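(* Let $\sigma_0>0$ and let the reward be purely rank-dependent, i.e. $R(x,r)=R(r)$ does not depend on $x$, where $R:[0,1]\to\mathbb{R}$ is bounded, continuous and non-decreasing. Assume there exist constants $L>0$ and $\alpha\in(0,1]$ such that $|R(r_1)-R(r_2)|\le L|r_1-r_2|^\alpha$ for all $r_1,r_2\in[0,1]$. Let $\bar\mu\in\mathcal{P}(\mathbb{R})$ be an equilibrium measure of the mean field game without common noise (i.e. $\Phi(\bar\mu)=\bar\mu$, with $\Phi$ as in the context). For $i=1,\dots,N$ let $X_i^\circ$ be the solution of $$dX^\circ_{i,t}=\frac{v_x(t,X^\circ_{i,t};\bar\mu)}{2c}\,dt+\sigma\,dB_{i,t},\qquad X^\circ_{i,0}=0,$$ and let $\bar a_{i,t}:=(2c)^{-1}v_x(t,X^\circ_{i,t};\bar\mu)$. Then $(\bar a_1,\dots,\bar a_N)$ is an $O(N^{-\alpha/2})$-Nash equilibrium, as $N\to\infty$, of the $N$-player game with common noise; that is, there exist constants $M>0$ and $N_0$, independent of $N$, such that for all $N\ge N_0$ it is an $\epsilon_N$-Nash equilibrium of that game with $\epsilon_N= M N^{-\alpha/2}$.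
   Context: Fix constants $T>0$, $c>0$, $\sigma>0$. $\mathcal{P}(\mathbb{R})$ is the set of Borel probability measures on $\mathbb{R}$; for $\mu\in\mathcal{P}(\mathbb{R})$, $F_\mu(x)=\mu(-\infty,x]$ and $R_\mu(x):=R(F_\mu(x))$. Mean field game without common noise. For $\mu\in\mathcal{P}(\mathbb{R})$ let $$v(t,x;\mu):=\sup_a \mathbb{E}_{t,x}\Big[R_\mu(X_T)-\int_t^T c\,a_s^2\,ds\Big],\qquad dX_s=a_s\,ds+\sigma\,dB_s,\ X_t=x,$$ where $B$ is a Brownian motion and $a$ ranges over progressively measurable processes with $\mathbb{E}\int_0^T|a_s|ds<\infty$. Explicitly, $v=2c\sigma^2\log u$ with $u(t,x;\mu)=\mathbb{E}\big[\exp\big(\tfrac{1}{2c\sigma^2}R_\mu(x+\sigma\sqrt{T-t}\,Z)\big)\big]$, $Z$ standard normal; $v$ is smooth in $x$ for $t<T$, and $v_x$ is its $x$-derivative. Let $X^\mu$ be the strong solution of $dX_t=\frac{v_x(t,X_t;\mu)}{2c}dt+\sigma dB_t$, $X_0=0$, on $[0,T)$, extended to $t=T$ by its (existing) limit, and let $\Phi(\mu):=\mathcal{L}(X^\mu_T)$ be the law of $X^\mu_T$. An equilibrium measure of the mean field game without common noise is a fixed point of $\Phi$. $N$-player game with common noise. $B_1,\dots,B_N,W$ are independent standard Brownian motions on a filtered probability space $(\Omega,\mathcal{F},\{\mathcal{F}_t\}_{t\in[0,T]},\mathbb{P})$ (Brownian with respect to the filtration). If player $i$ uses control process $a_i$,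 her state is $X^{a_i}_{i,t}=\int_0^t a_{i,s}ds+\sigma B_{i,t}+\sigma_0 W_t$. For $\mathbf a=(a_1,\dots,a_N)$ let $\bar\mu^{N,\mathbf a}=\frac1N\sum_{j=1}^N\delta_{X^{a_j}_{j,T}}$. A progressively measurable vector $\mathbf a=(a_1,\dots,a_N)$ is an $\epsilon$-Nash equilibrium if (i) $\mathbb{E}\int_0^T|a_{i,t}|dt<\infty$ for all $i$; and (ii) for every $i$ and every progressively measurable $\beta$ with $\mathbb{E}\int_0^T|\beta_t|dt<\infty$, $$\mathbb{E}\Big[R_{\bar\mu^{N,\mathbf a}}(X^{a_i}_{i,T})-\int_0^T c\,a_{i,t}^2dt\Big]+\epsilon\ \ge\ \mathbb{E}\Big[R_{\bar\mu^{N,\mathbf a^i_\beta}}(X^{\beta}_{i,T})-\int_0^T c\,\beta_t^2dt\Big],$$ where $\mathbf a^i_\beta=(a_1,\dots,a_{i-1},\beta,a_{i+1},\dots,a_N)$ and $X^\beta_{i,T}=\int_0^T\beta_t\,dt+\sigma B_{i,T}+\sigma_0W_T$. *)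

theory Defs
  imports "HOL-Probability.Probability"
begin

section \<open>Filtered probability spaces and Brownian motion on a finite horizon\<close>

definition filtered_prob_space :: "'a measure \<Rightarrow> (real \<Rightarrow> 'a measure) \<Rightarrow> real \<Rightarrow> bool" where
  "filtered_prob_space M F T \<longleftrightarrow>
     prob_space M \<and> (\<forall>t\<in>{0..T}. subalgebra M (F t)) \<and>
     (\<forall>s t. 0 \<le> s \<and> s \<le> t \<and> t \<le> T \<longrightarrow> sets (F s) \<subseteq> sets (F t))"

definition progressively_measurable ::
    "(real \<Rightarrow> 'a measure) \<Rightarrow> real \<Rightarrow> (real \<Rightarrow> 'a \<Rightarrow> real) \<Rightarrow> bool" where
  "progressively_measurable F T a \<longleftrightarrow>
     (\<forall>t\<in>{0..T}. (\<lambda>(s, \<omega>). a s \<omega>) \<in> borel_measurable (restrict_space borel {0..t} \<Otimes>\<^sub>M F t))"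

definition brownian_motion ::
    "'a measure \<Rightarrow> (real \<Rightarrow> 'a measure) \<Rightarrow> real \<Rightarrow> (real \<Rightarrow> 'a \<Rightarrow> real) \<Rightarrow> bool" where
  "brownian_motion M F T B \<longleftrightarrow>
     (\<forall>t\<in>{0..T}. B t \<in> borel_measurable (F t)) \<and>
     (AE \<omega> in M. B 0 \<omega> = 0 \<and> continuous_on {0..T} (\<lambda>t. B t \<omega>)) \<and>
     (\<forall>s t. 0 \<le> s \<and> s < t \<and> t \<le> T \<longrightarrow>
        distributed M lborel (\<lambda>\<omega>. B t \<omega> - B s \<omega>) (normal_density 0 (sqrt (t - s))) \<and>
        prob_space.indep_set M (sets (F s))
          {(\<lambda>\<omega>. B t \<omega> - B s \<omega>) -` A \<inter> space M | A. A \<in> sets borel})"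

text \<open>
  Admissible controls: progressively measurable with finite expected integral of the absolute value.
\<close>

definition admissible ::
    "'a measure \<Rightarrow> (real \<Rightarrow> 'a measure) \<Rightarrow> real \<Rightarrow> (real \<Rightarrow> 'a \<Rightarrow> real) \<Rightarrow> bool" where
  "admissible M F T a \<longleftrightarrow>
     progressively_measurable F T a \<and>
     (\<integral>\<^sup>+\<omega>. (\<integral>\<^sup>+s\<in>{0..T}. ennreal \<bar>a s \<omega>\<bar> \<partial>lborel) \<partial>M) < \<infinity>"

text \<open>
  Strong solutions of dX = b(t,X) dt + \<sigma> dB, X(0) = 0, on [0,T), extended to time T by the limit:
  the equation is imposed for t < T only, and continuity on the closed interval says that
  X(T) is the limit of X(t). The solution lives on the given filtered space with the given
  Brownian motion.
\<close>

definition sde_solution ::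
    "'a measure \<Rightarrow> (real \<Rightarrow> 'a measure) \<Rightarrow> real \<Rightarrow> real \<Rightarrow> (real \<Rightarrow> real \<Rightarrow> real) \<Rightarrow>
     (real \<Rightarrow> 'a \<Rightarrow> real) \<Rightarrow> (real \<Rightarrow> 'a \<Rightarrow> real) \<Rightarrow> bool" where
  "sde_solution M F T \<sigma> b B X \<longleftrightarrow>
     progressively_measurable F T X \<and>
     (AE \<omega> in M. X 0 \<omega> = 0 \<and> continuous_on {0..T} (\<lambda>t. X t \<omega>) \<and>
        (\<forall>t\<in>{0..<T}. set_integrable lborel {0..t} (\<lambda>s. b s (X s \<omega>)) \<and>
           X t \<omega> = (LBINT s:{0..t}. b s (X s \<omega>)) + \<sigma> * B t \<omega>))"

section \<open>Expected payoffs\<close>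

text \<open>
  Controls need not be square integrable, so a payoff may be minus infinity on a set of positive
  probability or in expectation. Payoffs are therefore extended reals, with expectation
  E[Y] = E[Y+] - E[Y-]; note that e2ennreal truncates negative values to 0.
  All payoffs below are bounded above, so E[Y+] is finite and the difference is well defined.
\<close>

definition ereal_expectation :: "'a measure \<Rightarrow> ('a \<Rightarrow> ereal) \<Rightarrow> ereal" where
  "ereal_expectation M Y =
     enn2ereal (\<integral>\<^sup>+\<omega>. e2ennreal (Y \<omega>) \<partial>M) - enn2ereal (\<integral>\<^sup>+\<omega>. e2ennreal (- Y \<omega>) \<partial>M)"

definition running_cost ::
    "real \<Rightarrow> (real \<Rightarrow> 'a \<Rightarrow> real) \<Rightarrow> real \<Rightarrow> real \<Rightarrow> 'a \<Rightarrow> ereal" where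
  "running_cost c a t T \<omega> = enn2ereal (\<integral>\<^sup>+s\<in>{t..T}. ennreal (c * (a s \<omega>)\<^sup>2) \<partial>lborel)"

definition rank_reward :: "(real \<Rightarrow> real) \<Rightarrow> real measure \<Rightarrow> real \<Rightarrow> real" where
  "rank_reward R \<mu> x = R (cdf \<mu> x)"

section \<open>The mean field game without common noise\<close>

text \<open>
  The sample space of the single-player problem is left unspecified in the mathematics, since neither
  the value nor the law of the optimally controlled state depends on it. We let the
  filtered probability space range over all those on the type of real paths, which is large enough
  to carry the joint path of any pair of processes.
\<close>

type_synonym path = "real \<Rightarrow> real"

definition mfg_value ::
    "real \<Rightarrow> real \<Rightarrow> real \<Rightarrow> (real \<Rightarrow> real) \<Rightarrow> real measure \<Rightarrow> real \<Rightarrow> real \<Rightarrow> real" where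
  "mfg_value T c \<sigma> R \<mu> t x = real_of_ereal (Sup
     {ereal_expectation P (\<lambda>\<omega>.
        ereal (rank_reward R \<mu> (x + (LBINT s:{t..T}. a s \<omega>) + \<sigma> * (B T \<omega> - B t \<omega>)))
        - running_cost c a t T \<omega>)
      | (P :: path measure) F B a.
        filtered_prob_space P F T \<and> brownian_motion P F T B \<and> admissible P F T a})"

definition mfg_drift ::
    "real \<Rightarrow> real \<Rightarrow> real \<Rightarrow> (real \<Rightarrow> real) \<Rightarrow> real measure \<Rightarrow> real \<Rightarrow> real \<Rightarrow> real" where
  "mfg_drift T c \<sigma> R \<mu> t x = deriv (\<lambda>y. mfg_value T c \<sigma> R \<mu> t y) x / (2 * c)"

text \<open>
  The graph of the best-response map \<Phi>: the law of the state at time T driven by the optimal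
  feedback against \<mu> is \<nu>.
\<close>

definition mfg_Phi_graph ::
    "real \<Rightarrow> real \<Rightarrow> real \<Rightarrow> (real \<Rightarrow> real) \<Rightarrow> real measure \<Rightarrow> real measure \<Rightarrow> bool" where
  "mfg_Phi_graph T c \<sigma> R \<mu> \<nu> \<longleftrightarrow>
     (\<exists>(P :: path measure) F B X.
        filtered_prob_space P F T \<and> brownian_motion P F T B \<and>
        sde_solution P F T \<sigma> (mfg_drift T c \<sigma> R \<mu>) B X \<and>
        \<nu> = distr P borel (X T))"

definition mfg_equilibrium ::
    "real \<Rightarrow> real \<Rightarrow> real \<Rightarrow> (real \<Rightarrow> real) \<Rightarrow> real measure \<Rightarrow> bool" where
  "mfg_equilibrium T c \<sigma> R \<mu> \<longleftrightarrow> real_distribution \<mu> \<and> mfg_Phi_graph T c \<sigma> R \<mu> \<mu>"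

section \<open>The N-player game with common noise\<close>

text \<open>Players are indexed by 1..N; index 0 of the joint noise family is the common noise W.\<close>

definition common_noise_space ::
    "'a measure \<Rightarrow> (real \<Rightarrow> 'a measure) \<Rightarrow> real \<Rightarrow> nat \<Rightarrow>
     (nat \<Rightarrow> real \<Rightarrow> 'a \<Rightarrow> real) \<Rightarrow> (real \<Rightarrow> 'a \<Rightarrow> real) \<Rightarrow> bool" where
  "common_noise_space M F T N B W \<longleftrightarrow>
     filtered_prob_space M F T \<and>
     (\<forall>i\<in>{1..N}. brownian_motion M F T (B i)) \<and> brownian_motion M F T W \<and>
     prob_space.indep_vars M (\<lambda>_. PiM {0..T} (\<lambda>_. borel))
       (\<lambda>k \<omega>. \<lambda>t\<in>{0..T}. (if k = 0 then W else B k) t \<omega>) {0..N}"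

definition player_state ::
    "real \<Rightarrow> real \<Rightarrow> (real \<Rightarrow> 'a \<Rightarrow> real) \<Rightarrow> (real \<Rightarrow> 'a \<Rightarrow> real) \<Rightarrow> (real \<Rightarrow> 'a \<Rightarrow> real) \<Rightarrow>
     real \<Rightarrow> 'a \<Rightarrow> real" where
  "player_state \<sigma> \<sigma>0 B W a t \<omega> = (LBINT s:{0..t}. a s \<omega>) + \<sigma> * B t \<omega> + \<sigma>0 * W t \<omega>"

definition empirical_measure :: "nat \<Rightarrow> (nat \<Rightarrow> real) \<Rightarrow> real measure" where
  "empirical_measure N x = distr (uniform_count_measure {1..N}) borel x"

definition player_payoff ::
    "'a measure \<Rightarrow> real \<Rightarrow> real \<Rightarrow> real \<Rightarrow> real \<Rightarrow> (real \<Rightarrow> real) \<Rightarrow> nat \<Rightarrow>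
     (nat \<Rightarrow> real \<Rightarrow> 'a \<Rightarrow> real) \<Rightarrow> (real \<Rightarrow> 'a \<Rightarrow> real) \<Rightarrow>
     (nat \<Rightarrow> real \<Rightarrow> 'a \<Rightarrow> real) \<Rightarrow> nat \<Rightarrow> ereal" where
  "player_payoff M T c \<sigma> \<sigma>0 R N B W a i = ereal_expectation M (\<lambda>\<omega>.
     ereal (rank_reward R
       (empirical_measure N (\<lambda>j. player_state \<sigma> \<sigma>0 (B j) W (a j) T \<omega>))
       (player_state \<sigma> \<sigma>0 (B i) W (a i) T \<omega>))
     - running_cost c (a i) 0 T \<omega>)"

definition eps_nash_equilibrium ::
    "'a measure \<Rightarrow> (real \<Rightarrow> 'a measure) \<Rightarrow> real \<Rightarrow> real \<Rightarrow> real \<Rightarrow> real \<Rightarrow> (real \<Rightarrow> real) \<Rightarrow> nat \<Rightarrow>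
     (nat \<Rightarrow> real \<Rightarrow> 'a \<Rightarrow> real) \<Rightarrow> (real \<Rightarrow> 'a \<Rightarrow> real) \<Rightarrow> real \<Rightarrow>
     (nat \<Rightarrow> real \<Rightarrow> 'a \<Rightarrow> real) \<Rightarrow> bool" where
  "eps_nash_equilibrium M F T c \<sigma> \<sigma>0 R N B W \<epsilon> a \<longleftrightarrow>
     (\<forall>i\<in>{1..N}. admissible M F T (a i)) \<and>
     (\<forall>i\<in>{1..N}. \<forall>\<beta>. admissible M F T \<beta> \<longrightarrow>
        player_payoff M T c \<sigma> \<sigma>0 R N B W a i + ereal \<epsilon>
          \<ge> player_payoff M T c \<sigma> \<sigma>0 R N B W (a(i := \<beta>)) i)"

text \<open>
  The feedback control along a state process. Since the derivative of the value exists only for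
  t < T, the control is set to 0 at the single time T, which affects neither states nor payoffs.
\<close>

definition feedback_control ::
    "real \<Rightarrow> real \<Rightarrow> real \<Rightarrow> (real \<Rightarrow> real) \<Rightarrow> real measure \<Rightarrow>
     (real \<Rightarrow> 'a \<Rightarrow> real) \<Rightarrow> real \<Rightarrow> 'a \<Rightarrow> real" where
  "feedback_control T c \<sigma> R \<mu> X t \<omega> = (if t < T then mfg_drift T c \<sigma> R \<mu> t (X t \<omega>) else 0)"

end

theory Submission
  imports Defs
begin

text \<open>
  The value of the mean field game is V = 2 c \<sigma>^2 log u with u a Gaussian smoothing of
  exp (R_\<mu> / (2 c \<sigma>^2)). Instead of Ito's formula, the verification uses the entropy inequality
  for a shifted Gaussian on each step of a time grid: it gives the upper bound exactly for delayed
  averages of any control, and the Euler scheme of the optimal feedback attains it up to O(h^2) per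
  step. The drift is Lipschitz before the terminal time, so the optimal states are limits of Euler
  schemes, hence functionals of the driving Brownian motions: they are independent with law \<mu>.

  In the game the common noise shifts all states equally and cancels in the ranks, so a deviating
  player faces the empirical distribution function of an i.i.d. sample. Her state may depend on the
  whole sample, but the martingale (F_N - F) / (1 - F) and Doob's inequality give
  E |F_N - F|^2 \<le> 8 / N at any random point. By the Hoelder bound on R each payoff therefore differs
  by O(N^(-\<alpha>/2)) from a payoff of the control problem against \<mu>.
\<close>

section \<open>The standard Gaussian measure\<close>

text \<open>The difficulty is that the terminal reward is known only to be bounded, monotone and
  right continuous, since atoms of the law are not excluded. So V is smooth only at positive
  remaining duration, where the available bounds on its drift grow like the inverse square root of
  that duration and those on the Lipschitz constant like its inverse. Estimates are made up to times
  before T; the passage to T pays for possible jumps with a small shift of the argument.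
  Monotonicity turns closeness of states into an inequality of rewards, and the shift is removed by
  continuity of V for arbitrary controls and by right continuity of the reward for the optimal
  state. A second point is that the drift in the statement is the derivative of a supremum over
  filtered spaces. That supremum must be identified with V before the feedback can be used, hence
  the near-optimal controls; the equilibrium itself provides a space that makes it run over a
  nonempty set. The final constant is 38 = 2 * 19, one error of 19 L N^(-\<alpha>/2) for each of the
  two payoffs compared.\<close>

definition std_gauss :: "real measure" where
  "std_gauss = density lborel (\<lambda>x. ennreal (std_normal_density x))"

lemma sets_std_gauss [measurable_cong, simp]: "sets std_gauss = sets borel"
  by (simp add: std_gauss_def)

lemma space_std_gauss [simp]: "space std_gauss = UNIV"
  by (simp add: std_gauss_def)

interpretation std_gauss: prob_space std_gauss
  unfolding std_gauss_def by (rule prob_space_normal_density) simp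

lemma integral_std_gauss:
  fixes f :: "real \<Rightarrow> real"
  assumes "f \<in> borel_measurable borel"
  shows "(\<integral>z. f z \<partial>std_gauss) = (\<integral>z. std_normal_density z * f z \<partial>lborel)"
  unfolding std_gauss_def using assms by (subst integral_density) auto

lemma integrable_std_gauss:
  fixes f :: "real \<Rightarrow> real"
  assumes "f \<in> borel_measurable borel"
  shows "integrable std_gauss f \<longleftrightarrow> integrable lborel (\<lambda>z. std_normal_density z * f z)"
  unfolding std_gauss_def using assms by (subst integrable_density) auto

lemma std_normal_density_shift:
  "std_normal_density (z - m) = std_normal_density z * exp (z * m - m\<^sup>2 / 2)"
  unfolding std_normal_density_def
  by (simp add: mult.assoc flip: exp_add) (simp add: power2_eq_square field_simps)

text \<open>The one-step Girsanov formula, by the substitution \<open>z + m\<close> in the Lebesgue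
  integral. Integrability is stated as an equivalence because the exponential factor is unbounded
  and the transfer is used in both directions.\<close>

lemma std_gauss_shift:
  fixes f :: "real \<Rightarrow> real"
  assumes [measurable]: "f \<in> borel_measurable borel"
  shows "(\<integral>z. f (z + m) \<partial>std_gauss) = (\<integral>z. f z * exp (z * m - m\<^sup>2 / 2) \<partial>std_gauss)"
    and "integrable std_gauss (\<lambda>z. f (z + m)) \<longleftrightarrow>
      integrable std_gauss (\<lambda>z. f z * exp (z * m - m\<^sup>2 / 2))"
proof -
  let ?F = "\<lambda>z. std_normal_density z * (f z * exp (z * m - m\<^sup>2 / 2))"
  have eq: "?F (m + 1 * z) = std_normal_density z * f (z + m)" for z
    using std_normal_density_shift[of "z + m" m] by (simp add: add.commute)
  show "(\<integral>z. f (z + m) \<partial>std_gauss) = (\<integral>z. f z * exp (z * m - m\<^sup>2 / 2) \<partial>std_gauss)"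
    using lborel_integral_real_affine[of 1 ?F m] eq by (simp add: integral_std_gauss)
  show "integrable std_gauss (\<lambda>z. f (z + m)) \<longleftrightarrow>
      integrable std_gauss (\<lambda>z. f z * exp (z * m - m\<^sup>2 / 2))"
    using lborel_integrable_real_affine_iff[of 1 ?F m] eq by (simp add: integrable_std_gauss)
qed

lemma integrable_std_gauss_bounded:
  fixes f :: "real \<Rightarrow> real"
  assumes [measurable]: "f \<in> borel_measurable borel" and "\<And>z. \<bar>f z\<bar> \<le> K"
  shows "integrable std_gauss f"
  by (rule std_gauss.integrable_const_bound[of _ K]) (use assms in auto)

lemma integrable_std_gauss_exp: "integrable std_gauss (\<lambda>z. exp (a * z))"
proof -
  have "integrable std_gauss (\<lambda>z. 1 * exp (z * a - a\<^sup>2 / 2))"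
    using std_gauss_shift(2)[of "\<lambda>_. 1" a] by simp
  then have "integrable std_gauss (\<lambda>z. exp (a\<^sup>2 / 2) * (1 * exp (z * a - a\<^sup>2 / 2)))"
    by (rule integrable_mult_right)
  then show ?thesis
    by (simp add: mult.commute flip: exp_add)
qed

lemma integrable_std_gauss_exp_abs: "integrable std_gauss (\<lambda>z. exp (a * \<bar>z\<bar>))"
proof (rule Bochner_Integration.integrable_bound)
  show "integrable std_gauss (\<lambda>z. exp (a * z) + exp ((- a) * z))"
    by (intro Bochner_Integration.integrable_add integrable_std_gauss_exp)
  have "exp (a * \<bar>z\<bar>) \<le> exp (a * z) + exp ((- a) * z)" for z
    by (cases "z \<ge> 0") (simp_all add: add_increasing add_increasing2)
  then show "AE z in std_gauss. norm (exp (a * \<bar>z\<bar>)) \<le> norm (exp (a * z) + exp ((- a) * z))"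
    by (simp add: add_pos_pos less_imp_le abs_of_pos)
qed auto

lemma power_le_fact_exp: "0 \<le> (x::real) \<Longrightarrow> x ^ n \<le> fact n * exp x"
proof -
  assume x: "0 \<le> x"
  have "(\<lambda>n. x ^ n /\<^sub>R fact n) sums exp x"
    by (rule exp_converges)
  then have s: "summable (\<lambda>n. x ^ n /\<^sub>R fact n)" "exp x = (\<Sum>n. x ^ n /\<^sub>R fact n)"
    by (simp_all add: sums_iff)
  have "(\<Sum>k\<in>{n}. x ^ k /\<^sub>R fact k) \<le> (\<Sum>n. x ^ n /\<^sub>R fact n)"
    by (rule sum_le_suminf[OF s(1)]) (use x in auto)
  then show ?thesis
    by (simp add: s(2) field_simps)
qed

text \<open>The common shape of the dominating functions for remainders of exponentials:
  \<open>n = 2\<close> serves \<open>U_quadratic\<close>, \<open>n = 4\<close> serves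
  \<open>V_step_ge\<close>. The power is traded for one more exponential, and a Gaussian integrates
  every exponent linear in \<open>\<bar>z\<bar>\<close>.\<close>

lemma integrable_std_gauss_power_exp:
  "integrable std_gauss (\<lambda>z. (a * \<bar>z\<bar> + b) ^ n * exp (d * (a * \<bar>z\<bar> + b)))" if "0 \<le> a" "0 \<le> b"
proof (rule Bochner_Integration.integrable_bound)
  show "integrable std_gauss (\<lambda>z. (fact n * exp ((1 + d) * b)) * exp (((1 + d) * a) * \<bar>z\<bar>))"
    by (intro integrable_mult_right integrable_std_gauss_exp_abs)
  have "(a * \<bar>z\<bar> + b) ^ n * exp (d * (a * \<bar>z\<bar> + b))
      \<le> (fact n * exp ((1 + d) * b)) * exp (((1 + d) * a) * \<bar>z\<bar>)" for z
  proof -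
    have "(a * \<bar>z\<bar> + b) ^ n * exp (d * (a * \<bar>z\<bar> + b))
        \<le> fact n * exp (a * \<bar>z\<bar> + b) * exp (d * (a * \<bar>z\<bar> + b))"
      by (intro mult_right_mono power_le_fact_exp) (use that in auto)
    also have "\<dots> = (fact n * exp ((1 + d) * b)) * exp (((1 + d) * a) * \<bar>z\<bar>)"
      by (simp add: mult.assoc flip: exp_add) (simp add: algebra_simps)
    finally show ?thesis .
  qed
  then show "AE z in std_gauss. norm ((a * \<bar>z\<bar> + b) ^ n * exp (d * (a * \<bar>z\<bar> + b)))
      \<le> norm ((fact n * exp ((1 + d) * b)) * exp (((1 + d) * a) * \<bar>z\<bar>))"
    using that by (simp add: abs_mult)
qed auto

lemma std_gauss_moments:
  shows "integrable std_gauss (\<lambda>z. z ^ n)" "integrable std_gauss (\<lambda>z. \<bar>z\<bar> ^ n)"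
    and "(\<integral>z. z \<partial>std_gauss) = 0" and "(\<integral>z. z\<^sup>2 \<partial>std_gauss) = 1"
proof -
  show "integrable std_gauss (\<lambda>z. z ^ n)" "integrable std_gauss (\<lambda>z. \<bar>z\<bar> ^ n)"
    using integrable_std_normal_moment[of n] integrable_std_normal_moment_abs[of n]
    by (simp_all add: integrable_std_gauss)
  show "(\<integral>z. z \<partial>std_gauss) = 0" "(\<integral>z. z\<^sup>2 \<partial>std_gauss) = 1"
    using integral_std_normal_moment_odd[of 0] integral_std_normal_moment_even[of 1]
    by (simp_all add: integral_std_gauss)
qed

lemma integrable_std_gauss_id [simp]: "integrable std_gauss (\<lambda>z. z)" "integrable std_gauss (\<lambda>z. \<bar>z\<bar>)"
  using std_gauss_moments(1,2)[of 1] by simp_all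

lemma std_gauss_abs_le_1: "(\<integral>z. \<bar>z\<bar> \<partial>std_gauss) \<le> 1"
proof -
  have "(\<integral>z. \<bar>z\<bar> \<partial>std_gauss) \<le> (\<integral>z. (1 + z\<^sup>2) / 2 \<partial>std_gauss)"
  proof (rule integral_mono)
    show "\<bar>z\<bar> \<le> (1 + z\<^sup>2) / 2" for z :: real
      using zero_le_power2[of "\<bar>z\<bar> - 1"] by (simp add: power2_diff)
  qed (use std_gauss_moments(1)[of 2] in auto)
  also have "\<dots> = 1"
    using std_gauss_moments std_gauss_moments(1)[of 2] std_gauss.prob_space by simp
  finally show ?thesis .
qed

text \<open>The relative entropy of the standard Gaussian shifted by m with respect to the
  unshifted one is m^2/2.\<close>

lemma std_gauss_entropy_bound:
  fixes f :: "real \<Rightarrow> real"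
  assumes [measurable]: "f \<in> borel_measurable borel" and bnd: "\<And>z. \<bar>f z\<bar> \<le> K"
  shows "(\<integral>z. f (z + m) \<partial>std_gauss) - m\<^sup>2 / 2 \<le> ln (\<integral>z. exp (f z) \<partial>std_gauss)"
proof -
  \<comment> \<open>\<open>\<phi> z\<close> is \<open>f\<close> minus the log-density of the shifted
    Gaussian, both taken at \<open>z + m\<close>. Hence \<open>exp (\<phi> z)\<close> and
    \<open>exp (f z)\<close> have the same integral, and the mean of \<open>\<phi>\<close> is the
    left-hand side of the claim.\<close>
  define \<phi> where "\<phi> z = f (z + m) - z * m - m\<^sup>2 / 2" for z
  have [measurable]: "\<phi> \<in> borel_measurable borel"
    unfolding \<phi>_def by measurable
  define e where "e = (\<integral>z. f (z + m) \<partial>std_gauss) - m\<^sup>2 / 2"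
  have fi: "integrable std_gauss (\<lambda>z. f (z + m))"
    by (rule integrable_std_gauss_bounded[of _ K]) (use bnd in auto)
  have \<phi>i: "integrable std_gauss \<phi>" "(\<integral>z. \<phi> z \<partial>std_gauss) = e"
    using fi std_gauss_moments(3) std_gauss.prob_space unfolding \<phi>_def e_def by simp_all
  \<comment> \<open>Jensen's inequality by hand: \<open>exp\<close> lies above its tangent at the
    mean \<open>e\<close> of \<open>\<phi>\<close>.\<close>
  have ge: "exp e * (1 + (\<phi> z - e)) \<le> exp (\<phi> z)" for z
  proof -
    have "exp e * (1 + (\<phi> z - e)) \<le> exp e * exp (\<phi> z - e)"
      by (intro mult_left_mono exp_ge_add_one_self) auto
    then show ?thesis by (simp flip: exp_add)
  qed
  have eq: "exp (\<phi> z) = exp (f (z + m) - (z + m) * m + m\<^sup>2 / 2)" for z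
    unfolding \<phi>_def by (simp add: algebra_simps power2_eq_square)
  have ei: "integrable std_gauss (\<lambda>z. exp (f z))"
    by (rule integrable_std_gauss_bounded[of _ "exp K"]) (use bnd in \<open>auto simp: abs_le_iff\<close>)
  have simp1: "exp (f z - z * m + m\<^sup>2 / 2) * exp (z * m - m\<^sup>2 / 2) = exp (f z)" for z
    by (simp flip: exp_add)
  have int: "integrable std_gauss (\<lambda>z. exp (\<phi> z))"
    "(\<integral>z. exp (\<phi> z) \<partial>std_gauss) = (\<integral>z. exp (f z) \<partial>std_gauss)"
    unfolding eq using std_gauss_shift[of "\<lambda>z. exp (f z - z * m + m\<^sup>2 / 2)" m] ei
    by (simp_all add: simp1)
  have "(\<integral>z. exp e * (1 + (\<phi> z - e)) \<partial>std_gauss) \<le> (\<integral>z. exp (\<phi> z) \<partial>std_gauss)"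
    by (rule integral_mono) (use \<phi>i int ge in auto)
  then have "exp e \<le> (\<integral>z. exp (f z) \<partial>std_gauss)"
    using \<phi>i int std_gauss.prob_space by simp
  then show ?thesis
    unfolding e_def[symmetric] using ln_mono[of "exp e"] by fastforce
qed

lemma distributed_std_gauss_scale:
  assumes "0 < u"
  shows "distributed std_gauss lborel (\<lambda>z. u * z) (normal_density 0 u)"
proof -
  have "distributed std_gauss lborel (\<lambda>z. z) std_normal_density"
    unfolding distributed_def
    by (auto simp: std_gauss_def distr_id2 cong: distr_cong)
  then show ?thesis
    using std_gauss.normal_density_affine[of "\<lambda>z. z" 0 1 u 0] assms by simp
qed

text \<open>Independent centred Gaussians add their variances. The two variables are realised as
  coordinates of a product measure so that the addition theorem for normal densities applies; a zero
  deviation has no density and is treated apart.\<close>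

lemma std_gauss_convolution:
  fixes f :: "real \<Rightarrow> real"
  assumes [measurable]: "f \<in> borel_measurable borel" and bnd: "\<And>z. \<bar>f z\<bar> \<le> K"
    and ab: "0 \<le> a" "0 \<le> b"
  shows "(\<integral>z. (\<integral>w. f (x + a * z + b * w) \<partial>std_gauss) \<partial>std_gauss) =
    (\<integral>z. f (x + sqrt (a\<^sup>2 + b\<^sup>2) * z) \<partial>std_gauss)"
proof (cases "a = 0 \<or> b = 0")
  case True
  then show ?thesis using ab std_gauss.prob_space by auto
next
  case False
  then have ab: "0 < a" "0 < b" using ab by auto
  interpret P: pair_prob_space std_gauss std_gauss ..
  let ?P = "std_gauss \<Otimes>\<^sub>M std_gauss"
  note aff = distributed_std_gauss_scale
  have fst_eq: "distr ?P std_gauss fst = std_gauss"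
    by (rule std_gauss.distr_pair_fst)
  have "distr ?P std_gauss snd = distr (distr ?P ?P (\<lambda>(x, y). (y, x))) std_gauss snd"
    by (simp flip: P.distr_pair_swap)
  also have "\<dots> = distr ?P std_gauss fst"
    by (subst distr_distr) (auto simp: comp_def case_prod_beta)
  finally have snd_eq: "distr ?P std_gauss snd = std_gauss"
    by (simp add: fst_eq)
  have d1: "distr ?P borel (\<lambda>p. a * fst p) = distr std_gauss borel (\<lambda>z. a * z)"
    using distr_distr[of "\<lambda>z. a * z" std_gauss borel fst ?P] fst_eq by (simp add: comp_def)
  have d2: "distr ?P borel (\<lambda>p. b * snd p) = distr std_gauss borel (\<lambda>z. b * z)"
    using distr_distr[of "\<lambda>z. b * z" std_gauss borel snd ?P] snd_eq
    by (simp add: comp_def)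
  have D1: "distributed ?P lborel (\<lambda>p. a * fst p) (normal_density 0 a)"
    using aff[OF ab(1)] d1 unfolding distributed_def by (simp cong: distr_cong)
  have D2: "distributed ?P lborel (\<lambda>p. b * snd p) (normal_density 0 b)"
    using aff[OF ab(2)] d2 unfolding distributed_def by (simp cong: distr_cong)
  have ind: "P.P.indep_var borel (\<lambda>p. a * fst p) borel (\<lambda>p. b * snd p)"
  proof (subst P.P.indep_var_distribution_eq, intro conjI)
    interpret Q: pair_sigma_finite "distr std_gauss borel (\<lambda>z. a * z)" "distr std_gauss borel (\<lambda>z. b * z)"
      by (intro pair_sigma_finite.intro prob_space_imp_sigma_finite std_gauss.prob_space_distr) auto
    show "distr ?P borel (\<lambda>p. a * fst p) \<Otimes>\<^sub>M distr ?P borel (\<lambda>p. b * snd p) =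
      distr ?P (borel \<Otimes>\<^sub>M borel) (\<lambda>p. (a * fst p, b * snd p))"
      unfolding d1 d2 
      by (subst pair_measure_distr)
        (simp_all add: case_prod_unfold prob_space_imp_sigma_finite std_gauss.prob_space_distr)
  qed auto
  have S: "distributed ?P lborel (\<lambda>p. a * fst p + b * snd p) (normal_density 0 (sqrt (a\<^sup>2 + b\<^sup>2)))"
    using P.P.add_indep_normal[OF ind ab D1 D2] by simp
  have s0: "0 < sqrt (a\<^sup>2 + b\<^sup>2)" using ab by (simp add: sum_power2_gt_zero_iff)
  have "(\<integral>z. (\<integral>w. f (x + a * z + b * w) \<partial>std_gauss) \<partial>std_gauss)
    = (\<integral>p. f (x + a * fst p + b * snd p) \<partial>?P)"
    by (subst P.integral_fst'[symmetric]) (auto intro!: P.P.integrable_const_bound[of _ K] bnd)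
  also have "\<dots> = (\<integral>p. f (x + (a * fst p + b * snd p)) \<partial>?P)"
    by (simp add: add.assoc)
  also have "\<dots> = (\<integral>y. normal_density 0 (sqrt (a\<^sup>2 + b\<^sup>2)) y * f (x + y) \<partial>lborel)"
    by (subst distributed_integral[OF S, of "\<lambda>y. f (x + y)", symmetric]) auto
  also have "\<dots> = (\<integral>z. f (x + sqrt (a\<^sup>2 + b\<^sup>2) * z) \<partial>std_gauss)"
    by (subst distributed_integral[OF aff[OF s0], of "\<lambda>y. f (x + y)", symmetric]) auto
  finally show ?thesis .
qed

section \<open>The Gaussian semigroup and its logarithmic transform\<close>

lemma exp_remainder_le:
  fixes t :: real
  shows "\<bar>exp t - 1 - t\<bar> \<le> t\<^sup>2 * exp \<bar>t\<bar>"
proof -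
  obtain u where u: "\<bar>u\<bar> \<le> \<bar>t\<bar>" "exp t = (\<Sum>m<2. t ^ m / fact m) + exp u / fact 2 * t ^ 2"
    using Maclaurin_exp_le by blast
  then have "\<bar>exp t - 1 - t\<bar> = exp u / 2 * t\<^sup>2"
    by (simp add: numeral_2_eq_2)
  also have "\<dots> \<le> exp \<bar>t\<bar> * t\<^sup>2"
  proof (rule mult_right_mono)
    have "exp u \<le> exp \<bar>t\<bar>" using u(1) by simp
    then show "exp u / 2 \<le> exp \<bar>t\<bar>" using exp_gt_zero[of u] by linarith
  qed simp
  finally show ?thesis by (simp add: mult.commute)
qed

text \<open>Replaces differentiation under the integral sign: a quadratic remainder bound identifies
  the derivative, and such a bound, when uniform, survives averaging against a Gaussian.\<close>

lemma has_real_derivative_quadraticI: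
  fixes f :: "real \<Rightarrow> real"
  assumes "0 < r" and q: "\<And>y. \<bar>y\<bar> \<le> r \<Longrightarrow> \<bar>f (x + y) - f x - D * y\<bar> \<le> C * y\<^sup>2"
  shows "(f has_real_derivative D) (at x)"
proof -
  have "((\<lambda>h. (f (x + h) - f x) / h - D) \<longlongrightarrow> 0) (at 0)"
  proof (rule Lim_null_comparison)
    have "eventually (\<lambda>h::real. h \<in> {-r<..<r}) (at 0)"
      using \<open>0 < r\<close> by (intro eventually_at_in_open') auto
    moreover have "eventually (\<lambda>h::real. h \<noteq> 0) (at 0)"
      by (rule eventually_neq_at_within)
    ultimately show "eventually (\<lambda>h. norm ((f (x + h) - f x) / h - D) \<le> C * \<bar>h\<bar>) (at 0)"
    proof eventually_elim
      case (elim h)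
      have "norm ((f (x + h) - f x) / h - D) = \<bar>f (x + h) - f x - D * h\<bar> / \<bar>h\<bar>"
        using elim by (simp add: field_simps flip: abs_divide)
      also have "\<dots> \<le> C * h\<^sup>2 / \<bar>h\<bar>"
        using q[of h] elim by (intro divide_right_mono) auto
      also have "\<dots> = C * \<bar>h\<bar>"
        using elim by (simp add: power2_eq_square field_simps)
      finally show ?case .
    qed
    show "((\<lambda>h. C * \<bar>h\<bar>) \<longlongrightarrow> 0) (at 0)"
      by (auto intro!: tendsto_eq_intros)
  qed
  then show ?thesis
    unfolding DERIV_def by (simp add: LIM_zero_iff)
qed

lemma abs_integral_mono:
  fixes f h :: "'a \<Rightarrow> real"
  assumes "integrable M f" "integrable M h" "\<And>x. \<bar>f x\<bar> \<le> h x"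
  shows "\<bar>\<integral>x. f x \<partial>M\<bar> \<le> (\<integral>x. h x \<partial>M)"
proof -
  have "\<bar>\<integral>x. f x \<partial>M\<bar> \<le> (\<integral>x. \<bar>f x\<bar> \<partial>M)"
    by (rule integral_abs_bound)
  also have "\<dots> \<le> (\<integral>x. h x \<partial>M)"
    using assms by (intro integral_mono) auto
  finally show ?thesis .
qed

lemma mvt_lipschitz:
  fixes f f' :: "real \<Rightarrow> real"
  assumes d: "\<And>x. (f has_real_derivative f' x) (at x)" and "\<And>x. \<bar>f' x\<bar> \<le> K"
  shows "\<bar>f y - f x\<bar> \<le> K * \<bar>y - x\<bar>"
proof -
  have "norm (f y - f x) \<le> K * norm (y - x)"
    by (rule field_differentiable_bound[of UNIV f f'])
      (use assms in \<open>auto intro: has_field_derivative_at_within\<close>)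
  then show ?thesis by simp
qed

lemma ln_lipschitz:
  fixes a b m :: real
  assumes "0 < m" "m \<le> a" "m \<le> b"
  shows "\<bar>ln a - ln b\<bar> \<le> \<bar>a - b\<bar> / m"
proof -
  have *: "ln a - ln b \<le> \<bar>a - b\<bar> / m" if "0 < m" "m \<le> a" "m \<le> b" for a b
  proof -
    have "ln a - ln b \<le> (a - b) / b"
      using ln_diff_le[of a b] that by simp
    also have "\<dots> \<le> \<bar>a - b\<bar> / m"
      using that by (intro frac_le) auto
    finally show ?thesis .
  qed
  show ?thesis
    using *[OF assms] *[of b a] assms by (auto simp: abs_le_iff abs_minus_commute)
qed

text \<open>\<open>g\<close> is the reward as a function of the terminal position, later
  \<open>rank_reward R \<mu>\<close>. It may jump at atoms of \<open>\<mu>\<close>, so it is fixed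
  here by monotonicity and a bound; right continuity enters as a hypothesis about the optimal
  state.\<close>

locale quadratic_control =
  fixes c \<sigma> Gb :: real and g :: "real \<Rightarrow> real"
  assumes c_pos: "0 < c" and \<sigma>_pos: "0 < \<sigma>" and mono_g: "mono g" and g_bound: "\<bar>g x\<bar> \<le> Gb"
begin

text \<open>In what follows \<open>s\<close> is the remaining duration T - t. \<open>U\<close> is
  the heat flow of \<open>G\<close> and \<open>V\<close> its Cole-Hopf transform. \<open>dU\<close>
  is the x-derivative of \<open>U\<close> as Gaussian integration by parts gives it, with no
  derivative falling on the possibly discontinuous \<open>G\<close>; \<open>drift\<close> is then
  V_x / (2 c).\<close>

definition \<kappa> :: real where "\<kappa> = 2 * c * \<sigma>\<^sup>2"
definition G :: "real \<Rightarrow> real" where "G x = exp (g x / \<kappa>)"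
definition Glo :: real where "Glo = exp (- Gb / \<kappa>)"
definition Ghi :: real where "Ghi = exp (Gb / \<kappa>)"
definition U :: "real \<Rightarrow> real \<Rightarrow> real" where
  "U s x = (\<integral>z. G (x + \<sigma> * sqrt s * z) \<partial>std_gauss)"
definition dU :: "real \<Rightarrow> real \<Rightarrow> real" where
  "dU s x = (\<integral>z. G (x + \<sigma> * sqrt s * z) * z \<partial>std_gauss) / (\<sigma> * sqrt s)"
definition V :: "real \<Rightarrow> real \<Rightarrow> real" where "V s x = \<kappa> * ln (U s x)"
definition drift :: "real \<Rightarrow> real \<Rightarrow> real" where "drift s x = \<sigma>\<^sup>2 * dU s x / U s x"

lemma \<kappa>_pos: "0 < \<kappa>"
  using c_pos \<sigma>_pos by (simp add: \<kappa>_def)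

lemma measurable_g [measurable]: "g \<in> borel_measurable borel"
  by (rule borel_measurable_mono[OF mono_g])

lemma measurable_G [measurable]: "G \<in> borel_measurable borel"
  unfolding G_def by measurable

lemma Glo_pos: "0 < Glo" and Ghi_pos: "0 < Ghi"
  by (simp_all add: Glo_def Ghi_def)

lemma G_bounds: "Glo \<le> G x" "G x \<le> Ghi" "0 < G x" "\<bar>G x\<bar> \<le> Ghi"
  using g_bound[of x] \<kappa>_pos divide_right_mono[of "- Gb" "g x" \<kappa>] unfolding Glo_def Ghi_def G_def
  by (auto simp: abs_le_iff divide_right_mono)

lemma G_mono: "x \<le> y \<Longrightarrow> G x \<le> G y"
  using \<kappa>_pos by (simp add: G_def divide_right_mono monoD[OF mono_g])

lemma integrable_G [simp]: "integrable std_gauss (\<lambda>z. G (x + a * z))"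
  by (rule integrable_std_gauss_bounded[of _ Ghi]) (auto intro: G_bounds)

lemma integrable_G_id [simp]: "integrable std_gauss (\<lambda>z. G (x + a * z) * z)"
proof (rule Bochner_Integration.integrable_bound)
  show "integrable std_gauss (\<lambda>z. Ghi * \<bar>z\<bar>)" by simp
  show "AE z in std_gauss. norm (G (x + a * z) * z) \<le> norm (Ghi * \<bar>z\<bar>)"
    using G_bounds Ghi_pos by (auto simp: abs_mult intro!: mult_right_mono)
qed measurable

lemma measurable_U [measurable]: "(\<lambda>p. U (fst p) (snd p)) \<in> borel_measurable (borel \<Otimes>\<^sub>M borel)"
  unfolding U_def by measurable

lemma measurable_dU [measurable]: "(\<lambda>p. dU (fst p) (snd p)) \<in> borel_measurable (borel \<Otimes>\<^sub>M borel)"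
  unfolding dU_def by measurable

lemma measurable_U_x [measurable]: "U s \<in> borel_measurable borel"
  unfolding U_def by measurable

lemma measurable_dU_x [measurable]: "dU s \<in> borel_measurable borel"
  unfolding dU_def by measurable

lemma measurable_V_x [measurable]: "V s \<in> borel_measurable borel"
  unfolding V_def by measurable

lemma measurable_drift_x [measurable]: "drift s \<in> borel_measurable borel"
  unfolding drift_def by measurable

lemma measurable_drift: "(\<lambda>p. drift (fst p) (snd p)) \<in> borel_measurable (borel \<Otimes>\<^sub>M borel)"
  unfolding drift_def by measurable

lemma U_bounds: "Glo \<le> U s x" "U s x \<le> Ghi" "0 < U s x" "\<bar>U s x\<bar> \<le> Ghi"
proof -
  show 1: "Glo \<le> U s x"
    unfolding U_def by (rule std_gauss.integral_ge_const) (auto intro: G_bounds)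
  show 2: "U s x \<le> Ghi"
    unfolding U_def by (rule std_gauss.integral_le_const) (auto intro: G_bounds)
  show "0 < U s x" "\<bar>U s x\<bar> \<le> Ghi"
    using 1 2 Glo_pos by auto
qed

lemma V_bound: "\<bar>V s x\<bar> \<le> Gb"
proof -
  have "ln Glo \<le> ln (U s x)" "ln (U s x) \<le> ln Ghi"
    using U_bounds[of s x] Glo_pos Ghi_pos by simp_all
  then have "- (Gb / \<kappa>) \<le> ln (U s x)" "ln (U s x) \<le> Gb / \<kappa>"
    by (simp_all add: Glo_def Ghi_def)
  then show ?thesis
    using \<kappa>_pos unfolding V_def by (auto simp: abs_le_iff field_simps)
qed

lemma exp_V: "exp (V s x / \<kappa>) = U s x"
  using \<kappa>_pos U_bounds[of s x] by (simp add: V_def)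

lemma V_0: "V 0 x = g x"
  using \<kappa>_pos std_gauss.prob_space by (simp add: V_def U_def G_def)

lemma integrable_V: "integrable std_gauss (\<lambda>z. V s (x + a * z))"
  by (rule integrable_std_gauss_bounded[of _ Gb]) (auto intro: V_bound)

lemma U_semigroup:
  assumes "0 \<le> s" "0 \<le> h"
  shows "U (s + h) x = (\<integral>z. U s (x + \<sigma> * sqrt h * z) \<partial>std_gauss)"
proof -
  have "sqrt ((\<sigma> * sqrt h)\<^sup>2 + (\<sigma> * sqrt s)\<^sup>2) = \<sigma> * sqrt (s + h)"
    using assms \<sigma>_pos
    by (simp add: power_mult_distrib real_sqrt_mult add.commute flip: distrib_left)
  then show ?thesis
    unfolding U_def
    using std_gauss_convolution[of G Ghi "\<sigma> * sqrt h" "\<sigma> * sqrt s" x] assms \<sigma>_pos G_bounds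
    by simp
qed

text \<open>The increment a h of the controlled state costs c a^2 h, which is \<kappa> times the relative
  entropy of the shifted Gaussian increment.\<close>

lemma V_step_le:
  assumes "0 \<le> s" "0 < h"
  shows "(\<integral>z. V s (x + a * h + \<sigma> * sqrt h * z) \<partial>std_gauss) - c * h * a\<^sup>2 \<le> V (s + h) x"
proof -
  \<comment> \<open>The shift of the standard normal increment that produces the displacement
    \<open>a * h\<close>.\<close>
  define m where "m = a * sqrt h / \<sigma>"
  define f where "f z = V s (x + \<sigma> * sqrt h * z) / \<kappa>" for z
  have m: "\<sigma> * sqrt h * m = a * h" "\<kappa> * (m\<^sup>2 / 2) = c * h * a\<^sup>2"
    using \<sigma>_pos assms
    by (simp_all add: m_def \<kappa>_def power2_eq_square field_simps)
  have "(\<integral>z. f (z + m) \<partial>std_gauss) - m\<^sup>2 / 2 \<le> ln (\<integral>z. exp (f z) \<partial>std_gauss)"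
    by (rule std_gauss_entropy_bound[of _ "Gb / \<kappa>"])
      (use \<kappa>_pos V_bound in \<open>auto simp: f_def divide_right_mono\<close>)
  moreover have "ln (\<integral>z. exp (f z) \<partial>std_gauss) = V (s + h) x / \<kappa>"
    unfolding f_def exp_V using U_semigroup[of s h x] assms \<kappa>_pos by (simp add: V_def)
  moreover have "f (z + m) = V s (x + a * h + \<sigma> * sqrt h * z) / \<kappa>" for z
    unfolding f_def m(1)[symmetric] by (simp add: algebra_simps)
  ultimately have "(\<integral>z. V s (x + a * h + \<sigma> * sqrt h * z) \<partial>std_gauss) / \<kappa> - m\<^sup>2 / 2 \<le> V (s + h) x / \<kappa>"
    by simp
  then have "\<kappa> * ((\<integral>z. V s (x + a * h + \<sigma> * sqrt h * z) \<partial>std_gauss) / \<kappa> - m\<^sup>2 / 2)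
      \<le> \<kappa> * (V (s + h) x / \<kappa>)"
    using \<kappa>_pos by (intro mult_left_mono) auto
  then show ?thesis
    using \<kappa>_pos m(2) by (simp add: right_diff_distrib)
qed

text \<open>The Gaussian mean of the remainder in \<open>U_quadratic\<close>. The factors 1 keep the
  integrand in the literal form of \<open>integrable_std_gauss_power_exp\<close>.\<close>

definition Kq :: real where
  "Kq = (\<integral>z. (1 * \<bar>z\<bar> + 1) ^ 2 * exp (1 * (1 * \<bar>z\<bar> + 1)) + 1 \<partial>std_gauss)"

lemma Kq_nonneg: "0 \<le> Kq"
  unfolding Kq_def by (intro integral_nonneg_AE) auto

text \<open>By the Gaussian shift a translation of x turns into an exponential factor, which is
  smooth although G is not.\<close>

lemma U_quadratic:
  assumes "0 < s" and y: "\<bar>y\<bar> \<le> \<sigma> * sqrt s"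
  shows "\<bar>U s (x + y) - U s x - dU s x * y\<bar> \<le> Ghi * Kq / (\<sigma>\<^sup>2 * s) * y\<^sup>2"
proof -
  define \<theta> where "\<theta> = \<sigma> * sqrt s"
  have \<theta>: "0 < \<theta>" using assms \<sigma>_pos by (simp add: \<theta>_def)
  \<comment> \<open>The displacement in units of the standard deviation. The assumption on
    \<open>y\<close> bounds it by 1, which keeps the exponent \<open>t\<close> below within
    \<open>\<bar>z\<bar> + 1\<close> and the dominating function free of \<open>s\<close>.\<close>
  define \<eta> where "\<eta> = y / \<theta>"
  have \<eta>: "\<bar>\<eta>\<bar> \<le> 1" "\<theta> * \<eta> = y" using y \<theta> by (auto simp: \<eta>_def \<theta>_def[symmetric])
  have "U s (x + y) = (\<integral>z. G (x + \<theta> * (z + \<eta>)) \<partial>std_gauss)"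
    unfolding U_def \<theta>_def[symmetric] \<eta>(2)[symmetric] by (simp add: algebra_simps)
  also have "\<dots> = (\<integral>z. G (x + \<theta> * z) * exp (z * \<eta> - \<eta>\<^sup>2 / 2) \<partial>std_gauss)"
    by (rule std_gauss_shift(1)[of "\<lambda>z. G (x + \<theta> * z)"]) simp
  finally have Uy: "U s (x + y) = (\<integral>z. G (x + \<theta> * z) * exp (z * \<eta> - \<eta>\<^sup>2 / 2) \<partial>std_gauss)" .
  have int: "integrable std_gauss (\<lambda>z. G (x + \<theta> * z) * exp (z * \<eta> - \<eta>\<^sup>2 / 2))"
    using integrable_G[of "x + \<theta> * \<eta>" \<theta>] std_gauss_shift(2)[of "\<lambda>z. G (x + \<theta> * z)" \<eta>]
    by (simp add: algebra_simps)
  have dUy: "dU s x * y = (\<integral>z. G (x + \<theta> * z) * z * \<eta> \<partial>std_gauss)"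
    unfolding dU_def \<theta>_def[symmetric] using \<theta> by (simp add: \<eta>_def)
  have "U s (x + y) - U s x - dU s x * y = (\<integral>z. G (x + \<theta> * z) * exp (z * \<eta> - \<eta>\<^sup>2 / 2)
      - G (x + \<theta> * z) - G (x + \<theta> * z) * z * \<eta> \<partial>std_gauss)"
    unfolding Uy dUy unfolding U_def \<theta>_def[symmetric] using int by simp
  also have "\<dots> = (\<integral>z. G (x + \<theta> * z) * (exp (z * \<eta> - \<eta>\<^sup>2 / 2) - 1 - z * \<eta>) \<partial>std_gauss)"
    by (simp add: algebra_simps)
  finally have "\<bar>U s (x + y) - U s x - dU s x * y\<bar> =
      \<bar>\<integral>z. G (x + \<theta> * z) * (exp (z * \<eta> - \<eta>\<^sup>2 / 2) - 1 - z * \<eta>) \<partial>std_gauss\<bar>"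
    by (rule arg_cong)
  also have "\<dots> \<le> (\<integral>z. Ghi * \<eta>\<^sup>2 * ((1 * \<bar>z\<bar> + 1) ^ 2 * exp (1 * (1 * \<bar>z\<bar> + 1)) + 1) \<partial>std_gauss)"
  proof (rule abs_integral_mono)
    show "integrable std_gauss (\<lambda>z. G (x + \<theta> * z) * (exp (z * \<eta> - \<eta>\<^sup>2 / 2) - 1 - z * \<eta>))"
      using int integrable_G[of x \<theta>] integrable_G_id[of x \<theta>]
      by (simp add: right_diff_distrib flip: mult.assoc)
    show "integrable std_gauss (\<lambda>z. Ghi * \<eta>\<^sup>2 * ((1 * \<bar>z\<bar> + 1) ^ 2 * exp (1 * (1 * \<bar>z\<bar> + 1)) + 1))"
      by (intro integrable_mult_right Bochner_Integration.integrable_add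
          integrable_std_gauss_power_exp) auto
    fix z :: real
    define t where "t = z * \<eta> - \<eta>\<^sup>2 / 2"
    have \<eta>2: "\<eta>\<^sup>2 \<le> \<bar>\<eta>\<bar>"
      using \<eta>(1) mult_left_mono[of "\<bar>\<eta>\<bar>" 1 "\<bar>\<eta>\<bar>"] by (simp add: power2_eq_square abs_mult_self_eq)
    have "\<bar>t\<bar> \<le> \<bar>z * \<eta>\<bar> + \<eta>\<^sup>2 / 2"
      unfolding t_def using zero_le_power2[of \<eta>] by linarith
    also have "\<dots> \<le> \<bar>\<eta>\<bar> * (\<bar>z\<bar> + 1)"
      using \<eta>2 by (simp add: abs_mult algebra_simps)
    finally have t: "\<bar>t\<bar> \<le> \<bar>\<eta>\<bar> * (\<bar>z\<bar> + 1)" .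
    have "\<bar>\<eta>\<bar> * (\<bar>z\<bar> + 1) \<le> 1 * (\<bar>z\<bar> + 1)"
      using \<eta>(1) by (intro mult_right_mono) auto
    with t have t1: "\<bar>t\<bar> \<le> \<bar>z\<bar> + 1" by simp
    have "t\<^sup>2 \<le> (\<bar>\<eta>\<bar> * (\<bar>z\<bar> + 1))\<^sup>2"
      using power_mono[OF t abs_ge_zero, of 2] by simp
    then have t2: "t\<^sup>2 \<le> \<eta>\<^sup>2 * (\<bar>z\<bar> + 1)\<^sup>2"
      by (simp add: power_mult_distrib)
    \<comment> \<open>The linear term is \<open>z * \<eta>\<close>, not \<open>t\<close>. The
      correction \<open>\<eta>\<^sup>2 / 2\<close> has the order of the remainder and accounts for
      the \<open>+ 1\<close> in \<open>Kq\<close>.\<close>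
    have "\<bar>exp t - 1 - z * \<eta>\<bar> \<le> \<bar>exp t - 1 - t\<bar> + \<eta>\<^sup>2 / 2"
      using zero_le_power2[of \<eta>] unfolding t_def by linarith
    also have "\<dots> \<le> t\<^sup>2 * exp \<bar>t\<bar> + \<eta>\<^sup>2"
      using exp_remainder_le[of t] zero_le_power2[of \<eta>] by linarith
    also have "\<dots> \<le> \<eta>\<^sup>2 * (\<bar>z\<bar> + 1)\<^sup>2 * exp (\<bar>z\<bar> + 1) + \<eta>\<^sup>2"
      using t1 t2 by (intro add_right_mono mult_mono) auto
    finally have "\<bar>exp t - 1 - z * \<eta>\<bar> \<le> \<eta>\<^sup>2 * ((1 * \<bar>z\<bar> + 1) ^ 2 * exp (1 * (1 * \<bar>z\<bar> + 1)) + 1)"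
      by (simp add: algebra_simps)
    then show "\<bar>G (x + \<theta> * z) * (exp (z * \<eta> - \<eta>\<^sup>2 / 2) - 1 - z * \<eta>)\<bar>
      \<le> Ghi * \<eta>\<^sup>2 * ((1 * \<bar>z\<bar> + 1) ^ 2 * exp (1 * (1 * \<bar>z\<bar> + 1)) + 1)"
      unfolding t_def[symmetric] abs_mult mult.assoc
      by (intro mult_mono G_bounds(4)) (auto simp: Ghi_pos less_imp_le)
  qed
  also have "\<dots> = Ghi * Kq / (\<sigma>\<^sup>2 * s) * y\<^sup>2"
    unfolding integral_mult_right_zero Kq_def[symmetric] \<eta>_def \<theta>_def
    using assms \<sigma>_pos by (simp add: field_simps power_mult_distrib)
  finally show ?thesis .
qed

lemma U_deriv:
  assumes "0 < s"
  shows "(U s has_real_derivative dU s x) (at x)"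
  using assms \<sigma>_pos by (intro has_real_derivative_quadraticI[OF _ U_quadratic]) auto

lemma dU_bound:
  assumes "0 < s"
  shows "\<bar>dU s x\<bar> \<le> Ghi / (\<sigma> * sqrt s)"
proof -
  have "\<bar>\<integral>z. G (x + \<sigma> * sqrt s * z) * z \<partial>std_gauss\<bar> \<le> (\<integral>z. Ghi * \<bar>z\<bar> \<partial>std_gauss)"
  proof (rule abs_integral_mono)
    show "\<bar>G (x + \<sigma> * sqrt s * z) * z\<bar> \<le> Ghi * \<bar>z\<bar>" for z
      using G_bounds Ghi_pos by (auto simp: abs_mult intro!: mult_right_mono)
  qed auto
  also have "\<dots> \<le> Ghi"
    using std_gauss_abs_le_1 Ghi_pos by (simp add: mult_left_le)
  finally show ?thesis
    using assms \<sigma>_pos unfolding dU_def by (simp add: abs_mult divide_right_mono)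
qed

text \<open>\<open>2 * Kq\<close> is the constant for displacements within one standard deviation, 2
  the one for larger displacements; their sum serves both cases of
  \<open>dU_lipschitz\<close>.\<close>

definition Lip :: "real \<Rightarrow> real" where
  "Lip s = Ghi * (2 * Kq + 2) / (\<sigma>\<^sup>2 * s)"

lemma Lip_nonneg: "0 < s \<Longrightarrow> 0 \<le> Lip s"
  using Ghi_pos Kq_nonneg by (simp add: Lip_def)

lemma Lip_antimono: "0 < s0 \<Longrightarrow> s0 \<le> s \<Longrightarrow> Lip s \<le> Lip s0"
  using Ghi_pos Kq_nonneg \<sigma>_pos unfolding Lip_def
  by (intro divide_left_mono) auto

text \<open>No second derivative is formed. For small \<open>y\<close>, \<open>U_quadratic\<close>
  is applied at \<open>x\<close> with displacement \<open>y\<close> and at \<open>x + y\<close> with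
  \<open>- y\<close>; adding the two cancels \<open>U\<close> and leaves the difference of the
  slopes times \<open>y\<close>. For large \<open>y\<close> the bound on \<open>dU\<close> itself is
  enough.\<close>

lemma dU_lipschitz:
  assumes "0 < s"
  shows "\<bar>dU s (x + y) - dU s x\<bar> \<le> Lip s * \<bar>y\<bar>"
proof (cases "\<bar>y\<bar> \<le> \<sigma> * sqrt s")
  case True
  show ?thesis
  proof (cases "y = 0")
    case False
    let ?C = "Ghi * Kq / (\<sigma>\<^sup>2 * s)"
    have 1: "\<bar>U s (x + y) - U s x - dU s x * y\<bar> \<le> ?C * y\<^sup>2"
      by (rule U_quadratic) (use assms True in auto)
    have 2: "\<bar>U s x - U s (x + y) + dU s (x + y) * y\<bar> \<le> ?C * y\<^sup>2"
      using U_quadratic[of s "- y" "x + y"] assms True by simp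
    have "\<bar>dU s (x + y) - dU s x\<bar> * \<bar>y\<bar> = \<bar>(dU s (x + y) - dU s x) * y\<bar>"
      by (simp add: abs_mult)
    also have "\<dots> \<le> 2 * ?C * y\<^sup>2"
      using 1 2 unfolding left_diff_distrib by linarith
    also have "\<dots> \<le> Lip s * y\<^sup>2"
      using Ghi_pos Kq_nonneg assms \<sigma>_pos unfolding Lip_def
      by (intro mult_right_mono) (auto simp: field_simps)
    finally have "\<bar>dU s (x + y) - dU s x\<bar> * \<bar>y\<bar> \<le> (Lip s * \<bar>y\<bar>) * \<bar>y\<bar>"
      by (simp add: power2_eq_square mult.assoc)
    then show ?thesis using False by simp
  qed (use Lip_nonneg[OF assms] in simp)
next
  case False
  let ?\<theta> = "\<sigma> * sqrt s"
  have \<theta>: "0 < ?\<theta>" using assms \<sigma>_pos by simp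
  have "\<bar>dU s (x + y) - dU s x\<bar> \<le> 2 * Ghi / ?\<theta>"
    using dU_bound[OF assms, of x] dU_bound[OF assms, of "x + y"] by linarith
  also have "\<dots> = 2 * Ghi / ?\<theta>\<^sup>2 * ?\<theta>"
    using \<theta> by (simp add: power2_eq_square)
  also have "\<dots> \<le> 2 * Ghi / ?\<theta>\<^sup>2 * \<bar>y\<bar>"
    using False Ghi_pos by (intro mult_left_mono) auto
  also have "\<dots> \<le> Lip s * \<bar>y\<bar>"
    using Ghi_pos Kq_nonneg assms \<sigma>_pos unfolding Lip_def
    by (intro mult_right_mono) (auto simp: field_simps power_mult_distrib)
  finally show ?thesis .
qed

lemma integrable_dU: "0 < s \<Longrightarrow> integrable std_gauss (\<lambda>z. dU s (x + a * z))"
  by (rule integrable_std_gauss_bounded[of _ "Ghi / (\<sigma> * sqrt s)"]) (auto intro: dU_bound)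

lemma integrable_U: "integrable std_gauss (\<lambda>z. U s (x + a * z))"
  by (rule integrable_std_gauss_bounded[of _ Ghi]) (auto intro: U_bounds)

text \<open>Integrating \<open>U_quadratic\<close> at duration \<open>s\<close> shows that the
  averaged slope also satisfies a quadratic remainder bound for \<open>U (s + h)\<close>, so
  uniqueness of the derivative identifies it.\<close>

lemma dU_semigroup:
  assumes "0 < s" "0 \<le> h"
  shows "dU (s + h) x = (\<integral>z. dU s (x + \<sigma> * sqrt h * z) \<partial>std_gauss)"
proof (rule DERIV_unique)
  show "(U (s + h) has_real_derivative dU (s + h) x) (at x)"
    using assms by (intro U_deriv) auto
  let ?a = "\<sigma> * sqrt h" and ?C = "Ghi * Kq / (\<sigma>\<^sup>2 * s)"
  show "(U (s + h) has_real_derivative (\<integral>z. dU s (x + ?a * z) \<partial>std_gauss)) (at x)"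
  proof (rule has_real_derivative_quadraticI[of "\<sigma> * sqrt s" _ _ _ ?C])
    fix y assume y: "\<bar>y\<bar> \<le> \<sigma> * sqrt s"
    have i: "integrable std_gauss (\<lambda>z. U s (x + ?a * z + y))"
      using integrable_U[of s "x + y" ?a] by (simp add: algebra_simps)
    have Uxy: "U (s + h) (x + y) = (\<integral>z. U s (x + ?a * z + y) \<partial>std_gauss)"
      using assms U_semigroup[of s h "x + y"] by (simp add: algebra_simps)
    have Ux: "U (s + h) x = (\<integral>z. U s (x + ?a * z) \<partial>std_gauss)"
      using assms by (simp add: U_semigroup)
    have eq: "U (s + h) (x + y) - U (s + h) x - (\<integral>z. dU s (x + ?a * z) \<partial>std_gauss) * y =
      (\<integral>z. U s (x + ?a * z + y) - U s (x + ?a * z) - dU s (x + ?a * z) * y \<partial>std_gauss)"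
      unfolding Uxy Ux using i integrable_U[of s x ?a] integrable_dU[OF assms(1), of x ?a]
      by simp
    have "\<bar>U (s + h) (x + y) - U (s + h) x - (\<integral>z. dU s (x + ?a * z) \<partial>std_gauss) * y\<bar>
        \<le> (\<integral>z. ?C * y\<^sup>2 \<partial>std_gauss)"
      unfolding eq using i integrable_U[of s x ?a] integrable_dU[OF assms(1), of x ?a]
      by (intro abs_integral_mono U_quadratic[OF assms(1) y]) simp_all
    also have "\<dots> = ?C * y\<^sup>2"
      using std_gauss.prob_space by simp
    finally show "\<bar>U (s + h) (x + y) - U (s + h) x - (\<integral>z. dU s (x + ?a * z) \<partial>std_gauss) * y\<bar> \<le> ?C * y\<^sup>2" .
  qed (use assms \<sigma>_pos in auto)
qed

text \<open>Converts a Lipschitz bound in space into a bound of order \<open>sqrt h\<close> in time: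
  advancing the duration by \<open>h\<close> is an average over a Gaussian of deviation
  \<open>\<sigma> * sqrt h\<close>, and a standard normal has absolute mean at most 1.\<close>

lemma gauss_avg_diff:
  fixes f :: "real \<Rightarrow> real"
  assumes i: "integrable std_gauss (\<lambda>z. f (x + a * z))" and "0 \<le> a" "0 \<le> K"
    and "\<And>y. \<bar>f (x + y) - f x\<bar> \<le> K * \<bar>y\<bar>"
  shows "\<bar>(\<integral>z. f (x + a * z) \<partial>std_gauss) - f x\<bar> \<le> K * a"
proof -
  have eq: "(\<integral>z. f (x + a * z) \<partial>std_gauss) - f x = (\<integral>z. f (x + a * z) - f x \<partial>std_gauss)"
    using i std_gauss.prob_space by simp
  have "\<bar>(\<integral>z. f (x + a * z) \<partial>std_gauss) - f x\<bar> \<le> (\<integral>z. K * a * \<bar>z\<bar> \<partial>std_gauss)"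
    unfolding eq
  proof (rule abs_integral_mono)
    show "\<bar>f (x + a * z) - f x\<bar> \<le> K * a * \<bar>z\<bar>" for z
      using assms(4)[of "a * z"] assms(2) by (simp add: abs_mult mult.assoc)
  qed (use i in auto)
  also have "\<dots> \<le> K * a"
    using std_gauss_abs_le_1 assms by (simp add: mult_left_le)
  finally show ?thesis .
qed

lemma dU_holder_time:
  assumes "0 < s0" "s0 \<le> s" "0 \<le> h"
  shows "\<bar>dU (s + h) x - dU s x\<bar> \<le> Lip s0 * \<sigma> * sqrt h"
proof -
  have "\<bar>dU s (x + y) - dU s x\<bar> \<le> Lip s0 * \<bar>y\<bar>" for y
    using dU_lipschitz[of s x y] Lip_antimono[of s0 s] assms
    by (meson abs_ge_zero mult_right_mono order_less_le_trans order_trans)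
  then have "\<bar>(\<integral>z. dU s (x + \<sigma> * sqrt h * z) \<partial>std_gauss) - dU s x\<bar> \<le> Lip s0 * (\<sigma> * sqrt h)"
    using assms \<sigma>_pos Lip_nonneg[of s0] by (intro gauss_avg_diff integrable_dU) auto
  then show ?thesis
    using assms by (simp add: dU_semigroup mult.assoc)
qed

definition LipU :: "real \<Rightarrow> real" where "LipU s = Ghi / (\<sigma> * sqrt s)"

lemma LipU_nonneg: "0 < s \<Longrightarrow> 0 \<le> LipU s"
  using Ghi_pos \<sigma>_pos by (simp add: LipU_def)

lemma LipU_antimono: "0 < s0 \<Longrightarrow> s0 \<le> s \<Longrightarrow> LipU s \<le> LipU s0"
  using Ghi_pos \<sigma>_pos unfolding LipU_def by (intro divide_left_mono) auto

lemma U_lipschitz: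
  assumes "0 < s0" "s0 \<le> s"
  shows "\<bar>U s (x + y) - U s x\<bar> \<le> LipU s0 * \<bar>y\<bar>"
proof -
  have "\<bar>U s (x + y) - U s x\<bar> \<le> LipU s0 * \<bar>(x + y) - x\<bar>"
  proof (rule mvt_lipschitz)
    show "(U s has_real_derivative dU s z) (at z)" for z
      using assms by (intro U_deriv) auto
    show "\<bar>dU s z\<bar> \<le> LipU s0" for z
      using dU_bound[of s z] LipU_antimono[of s0 s] assms unfolding LipU_def by linarith
  qed
  then show ?thesis by simp
qed

lemma U_holder_time:
  assumes "0 < s0" "s0 \<le> s" "0 \<le> h"
  shows "\<bar>U (s + h) x - U s x\<bar> \<le> LipU s0 * \<sigma> * sqrt h"
proof -
  have "\<bar>(\<integral>z. U s (x + \<sigma> * sqrt h * z) \<partial>std_gauss) - U s x\<bar> \<le> LipU s0 * (\<sigma> * sqrt h)"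
    using assms \<sigma>_pos LipU_nonneg[of s0] U_lipschitz[OF assms(1,2)]
    by (intro gauss_avg_diff integrable_U) auto
  then show ?thesis
    using assms by (simp add: U_semigroup mult.assoc)
qed

text \<open>It tends to infinity as the duration vanishes, which is why later bounds are uniform
  only over durations at least some positive \<open>s0\<close>.\<close>

definition Bd :: "real \<Rightarrow> real" where "Bd s = \<sigma> * Ghi / (Glo * sqrt s)"

lemma drift_bound:
  assumes "0 < s"
  shows "\<bar>drift s x\<bar> \<le> Bd s"
proof -
  have "\<bar>drift s x\<bar> = \<sigma>\<^sup>2 * \<bar>dU s x\<bar> / U s x"
    using U_bounds[of s x] by (simp add: drift_def abs_mult)
  also have "\<dots> \<le> \<sigma>\<^sup>2 * (Ghi / (\<sigma> * sqrt s)) / Glo"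
    using U_bounds[of s x] dU_bound[OF assms, of x] Glo_pos Ghi_pos \<sigma>_pos assms
    by (intro frac_le mult_left_mono) auto
  also have "\<dots> = Bd s"
    using \<sigma>_pos by (simp add: Bd_def power2_eq_square field_simps)
  finally show ?thesis .
qed

lemma Bd_nonneg: "0 \<le> s \<Longrightarrow> 0 \<le> Bd s"
  using Ghi_pos Glo_pos \<sigma>_pos by (simp add: Bd_def)

lemma Bd_antimono: "0 < s0 \<Longrightarrow> s0 \<le> s \<Longrightarrow> Bd s \<le> Bd s0"
  using Ghi_pos Glo_pos \<sigma>_pos unfolding Bd_def by (intro divide_left_mono mult_left_mono) auto

lemma drift_bound': "0 < s0 \<Longrightarrow> s0 \<le> s \<Longrightarrow> \<bar>drift s x\<bar> \<le> Bd s0"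
  using drift_bound[of s x] Bd_antimono[of s0 s] by linarith

text \<open>The two summands follow the difference of two quotients \<open>dU / U\<close>: the
  change of the numerator, and the change of the denominator with the numerator bounded by
  \<open>LipU\<close>. The factor \<open>1 + \<sigma>\<close> absorbs the \<open>\<sigma>\<close>
  that accompanies the square root of the time difference.\<close>

definition Kd :: "real \<Rightarrow> real" where
  "Kd s = (\<sigma>\<^sup>2 * Lip s / Glo + \<sigma>\<^sup>2 * LipU s * LipU s / Glo\<^sup>2) * (1 + \<sigma>)"

lemma Kd_nonneg: "0 < s \<Longrightarrow> 0 \<le> Kd s"
  using Lip_nonneg LipU_nonneg Glo_pos \<sigma>_pos unfolding Kd_def
  by (intro mult_nonneg_nonneg add_nonneg_nonneg divide_nonneg_nonneg) auto

text \<open>Parabolic scaling: Lipschitz in space and of order 1/2 in time, because the time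
  regularity comes from the semigroup through \<open>gauss_avg_diff\<close>. The order 1/2 suffices
  for the Euler scheme to converge.\<close>

lemma drift_continuity:
  assumes s0: "0 < s0" "s0 \<le> s" "s0 \<le> s'"
  shows "\<bar>drift s x - drift s' x'\<bar> \<le> Kd s0 * (\<bar>x - x'\<bar> + sqrt \<bar>s - s'\<bar>)"
proof -
  define \<delta> where "\<delta> = (1 + \<sigma>) * (\<bar>x - x'\<bar> + sqrt \<bar>s - s'\<bar>)"
  \<comment> \<open>Combines a spatial and a temporal modulus; used once for \<open>dU\<close> and
    once for \<open>U\<close>.\<close>
  have gen: "\<bar>f s x - f s' x'\<bar> \<le> K * \<delta>"
    if K: "0 \<le> K" and xl: "\<And>s x y. s0 \<le> s \<Longrightarrow> \<bar>f s (x + y) - f s x\<bar> \<le> K * \<bar>y\<bar>"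
      and tl: "\<And>s x h. s0 \<le> s \<Longrightarrow> 0 \<le> h \<Longrightarrow> \<bar>f (s + h) x - f s x\<bar> \<le> K * \<sigma> * sqrt h"
    for f :: "real \<Rightarrow> real \<Rightarrow> real" and K
  proof -
    have 1: "\<bar>f s x - f s x'\<bar> \<le> K * \<bar>x - x'\<bar>"
      using xl[OF s0(2), of x' "x - x'"] by simp
    have 2: "\<bar>f s x' - f s' x'\<bar> \<le> K * \<sigma> * sqrt \<bar>s - s'\<bar>"
    proof (cases "s \<le> s'")
      case True
      then show ?thesis using tl[OF s0(2), of "s' - s" x'] by (simp add: abs_minus_commute)
    next
      case False
      then show ?thesis using tl[OF s0(3), of "s - s'" x'] by simp
    qed
    have "\<bar>f s x - f s' x'\<bar> \<le> K * (\<bar>x - x'\<bar> + \<sigma> * sqrt \<bar>s - s'\<bar>)"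
      using 1 2 by (simp add: distrib_left mult.assoc)
    also have "\<dots> \<le> K * \<delta>"
      unfolding \<delta>_def using K \<sigma>_pos
      by (intro mult_left_mono) (auto simp: algebra_simps)
    finally show ?thesis .
  qed
  have dUd: "\<bar>dU s x - dU s' x'\<bar> \<le> Lip s0 * \<delta>"
  proof (rule gen)
    fix s x y assume "s0 \<le> s"
    then show "\<bar>dU s (x + y) - dU s x\<bar> \<le> Lip s0 * \<bar>y\<bar>"
      using dU_lipschitz[of s x y] Lip_antimono[of s0 s] s0
      by (meson abs_ge_zero mult_right_mono order_less_le_trans order_trans)
  qed (use s0 Lip_nonneg dU_holder_time in auto)
  have Ud: "\<bar>U s x - U s' x'\<bar> \<le> LipU s0 * \<delta>"
    by (rule gen) (use s0 LipU_nonneg U_holder_time U_lipschitz in auto)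
  have \<delta>0: "0 \<le> \<delta>" using \<sigma>_pos by (simp add: \<delta>_def)
  have dU': "\<bar>dU s' x'\<bar> \<le> LipU s0"
    using dU_bound[of s' x'] LipU_antimono[of s0 s'] s0 unfolding LipU_def by linarith
  have UU: "Glo \<le> U s x" "Glo \<le> U s' x'" by (simp_all add: U_bounds)
  have UP: "Glo\<^sup>2 \<le> U s x * U s' x'"
    using UU Glo_pos unfolding power2_eq_square by (intro mult_mono) auto
  have eq: "drift s x - drift s' x' =
    \<sigma>\<^sup>2 * (dU s x - dU s' x') / U s x + \<sigma>\<^sup>2 * dU s' x' * (U s' x' - U s x) / (U s x * U s' x')"
  proof -
    have quot: "S * p / u - S * q / v = S * (p - q) / u + S * q * (v - u) / (u * v)"
      if "0 < u" "0 < v" for S p q u v :: real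
    proof -
      have "S * q * (v - u) / (u * v) = S * q / u - S * q / v"
        using that by (simp add: diff_divide_distrib right_diff_distrib)
      then show ?thesis by (simp add: diff_divide_distrib right_diff_distrib)
    qed
    show ?thesis
      unfolding drift_def by (rule quot[OF U_bounds(3) U_bounds(3)])
  qed
  have "\<bar>drift s x - drift s' x'\<bar> \<le> \<bar>\<sigma>\<^sup>2 * (dU s x - dU s' x') / U s x\<bar>
      + \<bar>\<sigma>\<^sup>2 * dU s' x' * (U s' x' - U s x) / (U s x * U s' x')\<bar>"
    unfolding eq by (rule abs_triangle_ineq)
  also have "\<dots> = \<sigma>\<^sup>2 * \<bar>dU s x - dU s' x'\<bar> / U s x
      + \<sigma>\<^sup>2 * \<bar>dU s' x'\<bar> * \<bar>U s x - U s' x'\<bar> / (U s x * U s' x')"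
  proof -
    have "\<bar>\<sigma>\<^sup>2\<bar> = \<sigma>\<^sup>2" "\<bar>U s x\<bar> = U s x" "\<bar>U s' x'\<bar> = U s' x'"
      using U_bounds(3)[of s x] U_bounds(3)[of s' x'] by simp_all
    then show ?thesis
      by (simp only: abs_mult abs_divide abs_minus_commute[of "U s' x'" "U s x"])
  qed
  also have "\<dots> \<le> \<sigma>\<^sup>2 * (Lip s0 * \<delta>) / Glo + \<sigma>\<^sup>2 * LipU s0 * (LipU s0 * \<delta>) / Glo\<^sup>2"
  proof (rule add_mono)
    have n1: "\<sigma>\<^sup>2 * \<bar>dU s x - dU s' x'\<bar> \<le> \<sigma>\<^sup>2 * (Lip s0 * \<delta>)"
      using dUd by (rule mult_left_mono) simp
    have n0: "0 \<le> \<sigma>\<^sup>2 * (Lip s0 * \<delta>)"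
      using Lip_nonneg[OF s0(1)] \<delta>0 by simp
    show "\<sigma>\<^sup>2 * \<bar>dU s x - dU s' x'\<bar> / U s x \<le> \<sigma>\<^sup>2 * (Lip s0 * \<delta>) / Glo"
      by (rule frac_le[OF n0 n1 Glo_pos UU(1)])
    have m1: "\<sigma>\<^sup>2 * \<bar>dU s' x'\<bar> \<le> \<sigma>\<^sup>2 * LipU s0"
      using dU' by (rule mult_left_mono) simp
    have m0: "0 \<le> \<sigma>\<^sup>2 * LipU s0"
      using LipU_nonneg[OF s0(1)] by simp
    have m2: "\<sigma>\<^sup>2 * \<bar>dU s' x'\<bar> * \<bar>U s x - U s' x'\<bar> \<le> \<sigma>\<^sup>2 * LipU s0 * (LipU s0 * \<delta>)"
      by (rule mult_mono[OF m1 Ud m0]) simp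
    have m3: "0 \<le> \<sigma>\<^sup>2 * LipU s0 * (LipU s0 * \<delta>)"
      using m0 LipU_nonneg[OF s0(1)] \<delta>0 by simp
    have "0 < Glo\<^sup>2" using Glo_pos by simp
    from frac_le[OF m3 m2 this UP]
    show "\<sigma>\<^sup>2 * \<bar>dU s' x'\<bar> * \<bar>U s x - U s' x'\<bar> / (U s x * U s' x')
      \<le> \<sigma>\<^sup>2 * LipU s0 * (LipU s0 * \<delta>) / Glo\<^sup>2" .
  qed
  also have "\<dots> = Kd s0 * (\<bar>x - x'\<bar> + sqrt \<bar>s - s'\<bar>)"
    unfolding Kd_def \<delta>_def by (simp add: distrib_right mult.assoc)
  finally show ?thesis .
qed

lemma drift_lipschitz:
  assumes s0: "0 < s0" "s0 \<le> s"
  shows "\<bar>drift s x - drift s y\<bar> \<le> Kd s0 * \<bar>x - y\<bar>"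
  using drift_continuity[OF assms assms(2), of x y] by simp

section \<open>Expansion of V over a short step and near the terminal time\<close>

lemma V_deriv:
  assumes "0 < s"
  shows "(V s has_real_derivative 2 * c * drift s x) (at x)"
proof -
  have "((\<lambda>x. ln (U s x)) has_real_derivative 1 / U s x * dU s x) (at x)"
    by (rule DERIV_chain2[OF DERIV_ln_divide[OF U_bounds(3)] U_deriv[OF assms]])
  then have "((\<lambda>x. \<kappa> * ln (U s x)) has_real_derivative \<kappa> * (1 / U s x * dU s x)) (at x)"
    by (rule DERIV_cmult)
  then show ?thesis by (simp add: V_def[abs_def] drift_def \<kappa>_def mult.assoc)
qed

lemma V_lipschitz:
  assumes "0 < s0" "s0 \<le> s"
  shows "\<bar>V s y - V s x\<bar> \<le> 2 * c * Bd s0 * \<bar>y - x\<bar>"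
  by (rule mvt_lipschitz[OF V_deriv])
    (use drift_bound'[OF assms] assms c_pos in \<open>auto simp: abs_mult\<close>)

text \<open>Both bounds are needed in the exponent: the quadratic one gives the right order in the
  step length, but the exponential of a large multiple of \<open>y\<^sup>2\<close> need not be
  integrable under a Gaussian, so the linear one controls the exponential weight.\<close>

lemma V_remainder:
  assumes "0 < s0" "s0 \<le> s"
  shows "\<bar>V s (x + y) - V s x - 2 * c * drift s x * y\<bar> \<le> 2 * c * Kd s0 * y\<^sup>2"
    and "\<bar>V s (x + y) - V s x - 2 * c * drift s x * y\<bar> \<le> 4 * c * Bd s0 * \<bar>y\<bar>"
proof -
  have "\<exists>\<xi>. \<bar>\<xi> - x\<bar> \<le> \<bar>y\<bar> \<and> V s (x + y) - V s x = 2 * c * drift s \<xi> * y"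
  proof (cases "y = 0")
    case True
    then show ?thesis by (intro exI[of _ x]) auto
  next
    case False
    show ?thesis
    proof (cases "0 < y")
      case True
      then obtain z where "x < z" "z < x + y" "V s (x + y) - V s x = (x + y - x) * (2 * c * drift s z)"
        using MVT2[of x "x + y" "V s" "\<lambda>z. 2 * c * drift s z"] V_deriv assms by auto
      then show ?thesis by (intro exI[of _ z]) auto
    next
      case nonpos: False
      then obtain z where "x + y < z" "z < x" "V s x - V s (x + y) = (x - (x + y)) * (2 * c * drift s z)"
        using False MVT2[of "x + y" x "V s" "\<lambda>z. 2 * c * drift s z"] V_deriv assms by auto
      then show ?thesis by (intro exI[of _ z]) (auto simp: algebra_simps)
    qed
  qed
  then obtain \<xi> where \<xi>: "\<bar>\<xi> - x\<bar> \<le> \<bar>y\<bar>" "V s (x + y) - V s x = 2 * c * drift s \<xi> * y"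
    by blast
  then have eq: "\<bar>V s (x + y) - V s x - 2 * c * drift s x * y\<bar>
      = 2 * c * (\<bar>drift s \<xi> - drift s x\<bar> * \<bar>y\<bar>)"
    using c_pos by (simp add: abs_mult flip: left_diff_distrib right_diff_distrib)
  have "\<bar>drift s \<xi> - drift s x\<bar> \<le> Kd s0 * \<bar>y\<bar>"
    using drift_lipschitz[OF assms, of \<xi> x] \<xi>(1) Kd_nonneg[OF assms(1)]
    by (meson mult_left_mono order_trans)
  then have "\<bar>drift s \<xi> - drift s x\<bar> * \<bar>y\<bar> \<le> Kd s0 * \<bar>y\<bar> * \<bar>y\<bar>"
    by (intro mult_right_mono) auto
  then show "\<bar>V s (x + y) - V s x - 2 * c * drift s x * y\<bar> \<le> 2 * c * Kd s0 * y\<^sup>2"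
    unfolding eq using c_pos by (simp add: power2_eq_square mult.assoc)
  have "\<bar>drift s \<xi> - drift s x\<bar> \<le> 2 * Bd s0"
    using drift_bound'[OF assms, of \<xi>] drift_bound'[OF assms, of x] by linarith
  then have "\<bar>drift s \<xi> - drift s x\<bar> * \<bar>y\<bar> \<le> 2 * Bd s0 * \<bar>y\<bar>"
    by (intro mult_right_mono) auto
  then show "\<bar>V s (x + y) - V s x - 2 * c * drift s x * y\<bar> \<le> 4 * c * Bd s0 * \<bar>y\<bar>"
    unfolding eq using mult_left_mono[of _ _ "2 * c"] c_pos by fastforce
qed

lemma V_holder_time:
  assumes "0 < s0" "s0 \<le> s" "0 \<le> h"
  shows "\<bar>V (s + h) x - V s x\<bar> \<le> \<kappa> * (LipU s0 * \<sigma> * sqrt h) / Glo"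
proof -
  have "\<bar>V (s + h) x - V s x\<bar> = \<kappa> * \<bar>ln (U (s + h) x) - ln (U s x)\<bar>"
    using \<kappa>_pos by (simp add: V_def abs_mult flip: right_diff_distrib)
  also have "\<dots> \<le> \<kappa> * (\<bar>U (s + h) x - U s x\<bar> / Glo)"
    using \<kappa>_pos U_bounds Glo_pos by (intro mult_left_mono ln_lipschitz) auto
  also have "\<dots> \<le> \<kappa> * (LipU s0 * \<sigma> * sqrt h / Glo)"
    using \<kappa>_pos Glo_pos U_holder_time[OF assms] by (intro mult_left_mono divide_right_mono) auto
  finally show ?thesis by simp
qed

text \<open>The loss in the entropy bound when the feedback is frozen over a step of length h: since
  V is linear up to a quadratic remainder \<rho>, only E (exp \<rho> - 1 - \<rho>) = O(h^2) is lost.\<close>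

lemma V_step_ge:
  assumes s0: "0 < s0"
  shows "\<exists>C\<ge>0. \<forall>s\<ge>s0. \<forall>h x. 0 < h \<and> h \<le> 1 \<longrightarrow>
    V (s + h) x - C * h\<^sup>2 \<le>
    (\<integral>z. V s (x + drift s x * h + \<sigma> * sqrt h * z) \<partial>std_gauss) - c * h * (drift s x)\<^sup>2"
proof -
  define A where "A = 2 * c * Kd s0 / \<kappa>"
  define A' where "A' = 4 * c * Bd s0 / \<kappa>"
  have A: "0 \<le> A" "0 \<le> A'"
    using Kd_nonneg[OF s0] Bd_nonneg[of s0] s0 c_pos \<kappa>_pos by (auto simp: A_def A'_def)
  have B: "0 \<le> Bd s0" using Bd_nonneg[of s0] s0 by simp
  \<comment> \<open>For \<open>h\<close> at most 1 this dominates the displacement over one step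
    uniformly in \<open>s\<close>, \<open>x\<close> and \<open>h\<close>, so that the resulting
    constant depends on \<open>s0\<close> alone.\<close>
  let ?w = "\<lambda>z. \<sigma> * \<bar>z\<bar> + Bd s0"
  define E where "E = (\<integral>z. ?w z ^ 4 * exp (A' * ?w z) \<partial>std_gauss)"
  have Ei: "integrable std_gauss (\<lambda>z. ?w z ^ 4 * exp (A' * ?w z))"
    using \<sigma>_pos B by (intro integrable_std_gauss_power_exp) auto
  have E0: "0 \<le> E"
    unfolding E_def using \<sigma>_pos B by (intro integral_nonneg_AE) auto
  show ?thesis
  proof (intro exI[of _ "\<kappa> * (A\<^sup>2 * E)"] conjI allI impI)
    show "0 \<le> \<kappa> * (A\<^sup>2 * E)" using \<kappa>_pos E0 by simp
    fix s h x :: real assume s: "s0 \<le> s" and "0 < h \<and> h \<le> 1"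
    then have h: "0 < h" "h \<le> 1" by auto
    define a where "a = drift s x"
    have a: "\<bar>a\<bar> \<le> Bd s0" unfolding a_def by (rule drift_bound'[OF s0 s])
    define m where "m = a * sqrt h / \<sigma>"
    have m: "\<sigma> * sqrt h * m = a * h" "\<kappa> * (m\<^sup>2 / 2) = c * h * a\<^sup>2"
      using \<sigma>_pos h by (simp_all add: m_def \<kappa>_def power2_eq_square field_simps)
    define y where "y z = a * h + \<sigma> * sqrt h * z" for z
    define \<rho> where "\<rho> z = (V s (x + y z) - V s x - 2 * c * a * y z) / \<kappa>" for z
    have [measurable]: "y \<in> borel_measurable borel" "\<rho> \<in> borel_measurable borel"
      unfolding y_def \<rho>_def by measurable
    have rh: "h \<le> sqrt h"
      using h real_sqrt_le_mono[of "h\<^sup>2" h] by (simp add: power2_eq_square mult_left_le)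
    have y1: "\<bar>y z\<bar> \<le> sqrt h * ?w z" for z
    proof -
      have "\<bar>y z\<bar> \<le> \<bar>a\<bar> * h + \<sigma> * sqrt h * \<bar>z\<bar>"
        unfolding y_def using h \<sigma>_pos abs_triangle_ineq[of "a * h" "\<sigma> * sqrt h * z"]
        by (simp add: abs_mult)
      also have "\<dots> \<le> Bd s0 * sqrt h + \<sigma> * sqrt h * \<bar>z\<bar>"
        using a rh h B by (intro add_right_mono mult_mono) auto
      finally show ?thesis by (simp add: algebra_simps)
    qed
    have w0: "0 \<le> ?w z" for z using \<sigma>_pos B by simp
    have y2: "\<bar>y z\<bar> \<le> ?w z" for z
      using y1[of z] mult_right_mono[of "sqrt h" 1 "?w z"] h w0[of z] by simp
    have \<rho>1: "\<bar>\<rho> z\<bar> \<le> A * (y z)\<^sup>2" for z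
      using V_remainder(1)[OF s0 s, of x "y z"] \<kappa>_pos
      unfolding \<rho>_def A_def a_def by (simp add: divide_right_mono)
    have "\<bar>\<rho> z\<bar> \<le> A' * \<bar>y z\<bar>" for z
      using V_remainder(2)[OF s0 s, of x "y z"] \<kappa>_pos
      unfolding \<rho>_def A'_def a_def by (simp add: divide_right_mono)
    then have \<rho>2: "\<bar>\<rho> z\<bar> \<le> A' * ?w z" for z
      using mult_left_mono[OF y2[of z] A(2)] by (meson order_trans)
    have y4: "(y z)\<^sup>2 \<le> h * (?w z)\<^sup>2" for z
      using power_mono[OF y1[of z] abs_ge_zero, of 2] h by (simp add: power_mult_distrib)
    have rem: "\<bar>exp (\<rho> z) - 1 - \<rho> z\<bar> \<le> A\<^sup>2 * h\<^sup>2 * (?w z ^ 4 * exp (A' * ?w z))" for z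
    proof -
      have "\<bar>\<rho> z\<bar> \<le> A * (h * (?w z)\<^sup>2)"
        using \<rho>1[of z] mult_left_mono[OF y4[of z] A(1)] by linarith
      then have "(\<rho> z)\<^sup>2 \<le> (A * (h * (?w z)\<^sup>2))\<^sup>2"
        using power_mono[OF _ abs_ge_zero, of "\<rho> z" _ 2] by simp
      also have "\<dots> = A\<^sup>2 * h\<^sup>2 * ?w z ^ 4"
        by (simp add: power_mult_distrib flip: power_mult)
      finally have "(\<rho> z)\<^sup>2 * exp \<bar>\<rho> z\<bar> \<le> A\<^sup>2 * h\<^sup>2 * ?w z ^ 4 * exp (A' * ?w z)"
        using \<rho>2[of z] by (intro mult_mono) auto
      then show ?thesis
        using exp_remainder_le[of "\<rho> z"] by (simp add: mult.assoc)
    qed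
    have yi: "integrable std_gauss y" "(\<integral>z. y z \<partial>std_gauss) = a * h"
      unfolding y_def using std_gauss_moments(3) std_gauss.prob_space by auto
    have Vi: "integrable std_gauss (\<lambda>z. V s (x + y z))"
      by (rule integrable_std_gauss_bounded[of _ Gb]) (auto intro: V_bound)
    have \<rho>i: "integrable std_gauss \<rho>"
      unfolding \<rho>_def using Vi yi by simp
    have remi: "integrable std_gauss (\<lambda>z. exp (\<rho> z) - 1 - \<rho> z)"
    proof (rule Bochner_Integration.integrable_bound)
      show "integrable std_gauss (\<lambda>z. A\<^sup>2 * h\<^sup>2 * (?w z ^ 4 * exp (A' * ?w z)))"
        using Ei by (rule integrable_mult_right)
    qed (use rem w0 in \<open>auto simp: abs_mult\<close>)
    have ei: "integrable std_gauss (\<lambda>z. exp (\<rho> z))"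
      using Bochner_Integration.integrable_add[OF remi Bochner_Integration.integrable_add[OF \<rho>i
            std_gauss.integrable_const[of 1]]] by simp
    have "(\<integral>z. exp (\<rho> z) - 1 - \<rho> z \<partial>std_gauss) \<le> (\<integral>z. A\<^sup>2 * h\<^sup>2 * (?w z ^ 4 * exp (A' * ?w z)) \<partial>std_gauss)"
      by (rule integral_mono[OF remi integrable_mult_right[OF Ei]]) (use rem abs_ge_self order_trans in blast)
    then have Erem: "(\<integral>z. exp (\<rho> z) \<partial>std_gauss) - 1 \<le> (\<integral>z. \<rho> z \<partial>std_gauss) + A\<^sup>2 * h\<^sup>2 * E"
      using ei \<rho>i std_gauss.prob_space unfolding E_def by simp
    have V\<rho>: "V s (x + y z) = V s x + 2 * c * a * y z + \<kappa> * \<rho> z" for z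
      using \<kappa>_pos by (simp add: \<rho>_def)
    have EV: "(\<integral>z. V s (x + y z) \<partial>std_gauss) = V s x + 2 * c * a * (a * h) + \<kappa> * (\<integral>z. \<rho> z \<partial>std_gauss)"
      unfolding V\<rho> using yi \<rho>i std_gauss.prob_space by simp
    \<comment> \<open>The smoothed exponential times the inverse Girsanov density for the shift
      \<open>m\<close>. After the shift, the linear part of \<open>V\<close> cancels exactly against
      this density, because \<open>a\<close> is the drift at \<open>x\<close>; only a constant
      factor and \<open>exp (\<rho> z)\<close> remain.\<close>
    define f where "f z = U s (x + \<sigma> * sqrt h * z) * exp (- z * m + m\<^sup>2 / 2)" for z
    have fz: "f (z + m) = exp (V s x / \<kappa> + m\<^sup>2 / 2) * exp (\<rho> z)" for z
    proof -
      have "x + \<sigma> * sqrt h * (z + m) = x + y z"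
        unfolding y_def m(1)[symmetric] by (simp add: algebra_simps)
      then have "f (z + m) = exp (V s (x + y z) / \<kappa> - (z + m) * m + m\<^sup>2 / 2)"
        unfolding f_def by (simp add: exp_V[symmetric] algebra_simps flip: exp_add)
      also have "V s (x + y z) / \<kappa> = V s x / \<kappa> + 2 * c * a * y z / \<kappa> + \<rho> z"
        unfolding V\<rho> using \<kappa>_pos by (simp add: add_divide_distrib)
      also have "2 * c * a * y z / \<kappa> = z * m + m\<^sup>2"
        unfolding y_def m_def \<kappa>_def using c_pos \<sigma>_pos h
        by (simp add: field_simps power2_eq_square)
      finally show ?thesis
        by (simp add: algebra_simps power2_eq_square flip: exp_add)
    qed
    have "U (s + h) x = (\<integral>z. f z * exp (z * m - m\<^sup>2 / 2) \<partial>std_gauss)"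
      using U_semigroup[of s h x] s s0 h
      by (simp add: f_def mult.assoc flip: exp_add)
    also have "\<dots> = (\<integral>z. f (z + m) \<partial>std_gauss)"
      by (rule std_gauss_shift(1)[symmetric]) (simp add: f_def)
    also have "\<dots> = exp (V s x / \<kappa> + m\<^sup>2 / 2) * (\<integral>z. exp (\<rho> z) \<partial>std_gauss)"
      unfolding fz by simp
    finally have Ush: "U (s + h) x = exp (V s x / \<kappa> + m\<^sup>2 / 2) * (\<integral>z. exp (\<rho> z) \<partial>std_gauss)" .
    then have Epos: "0 < (\<integral>z. exp (\<rho> z) \<partial>std_gauss)"
      using U_bounds(3)[of "s + h" x] by (simp add: zero_less_mult_iff)
    have "V (s + h) x = V s x + c * h * a\<^sup>2 + \<kappa> * ln (\<integral>z. exp (\<rho> z) \<partial>std_gauss)"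
      unfolding V_def[of "s + h"] Ush using Epos \<kappa>_pos m(2)
      by (simp add: ln_mult_pos distrib_left)
    also have "\<dots> \<le> V s x + c * h * a\<^sup>2 + \<kappa> * ((\<integral>z. exp (\<rho> z) \<partial>std_gauss) - 1)"
      using ln_le_minus_one[OF Epos] \<kappa>_pos by simp
    also have "\<dots> \<le> V s x + c * h * a\<^sup>2 + \<kappa> * ((\<integral>z. \<rho> z \<partial>std_gauss) + A\<^sup>2 * h\<^sup>2 * E)"
      using Erem \<kappa>_pos by simp
    also have "\<dots> = (\<integral>z. V s (x + y z) \<partial>std_gauss) - c * h * a\<^sup>2 + \<kappa> * (A\<^sup>2 * E) * h\<^sup>2"
      unfolding EV by (simp add: algebra_simps power2_eq_square)
    finally show "V (s + h) x - \<kappa> * (A\<^sup>2 * E) * h\<^sup>2 \<le>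
      (\<integral>z. V s (x + drift s x * h + \<sigma> * sqrt h * z) \<partial>std_gauss) - c * h * (drift s x)\<^sup>2"
      unfolding y_def a_def[symmetric] by (simp add: add.assoc)
  qed
qed

text \<open>By Chebyshev's inequality the increment exceeds \<open>\<delta>\<close> with probability
  at most \<open>\<sigma>\<^sup>2 * s / \<delta>\<^sup>2\<close>, and otherwise monotonicity
  applies. The shift by \<open>\<delta>\<close> is the price for a reward that may jump just above
  \<open>x\<close>.\<close>

lemma V_terminal_le:
  assumes "0 < s" "0 < \<delta>"
  shows "V s x \<le> g (x + \<delta>) + \<kappa> * (Ghi / Glo) * (\<sigma>\<^sup>2 * s / \<delta>\<^sup>2)"
proof -
  define \<theta> where "\<theta> = \<sigma> * sqrt s"
  have pt: "G (x + \<theta> * z) \<le> G (x + \<delta>) + Ghi * (\<theta>\<^sup>2 / \<delta>\<^sup>2 * z\<^sup>2)" for z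
  proof (cases "\<theta> * z \<le> \<delta>")
    case True
    then have "G (x + \<theta> * z) \<le> G (x + \<delta>)" by (intro G_mono) auto
    moreover have "0 \<le> Ghi * (\<theta>\<^sup>2 / \<delta>\<^sup>2 * z\<^sup>2)" using Ghi_pos by simp
    ultimately show ?thesis by linarith
  next
    case False
    then have "\<delta>\<^sup>2 \<le> (\<theta> * z)\<^sup>2" using assms by (intro power_mono) auto
    then have "1 \<le> \<theta>\<^sup>2 / \<delta>\<^sup>2 * z\<^sup>2" using assms by (simp add: field_simps power_mult_distrib)
    then have "Ghi * 1 \<le> Ghi * (\<theta>\<^sup>2 / \<delta>\<^sup>2 * z\<^sup>2)"
      using Ghi_pos by (intro mult_left_mono) auto
    then show ?thesis using G_bounds(2)[of "x + \<theta> * z"] G_bounds(3)[of "x + \<delta>"] by linarith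
  qed
  have "U s x \<le> (\<integral>z. G (x + \<delta>) + Ghi * (\<theta>\<^sup>2 / \<delta>\<^sup>2 * z\<^sup>2) \<partial>std_gauss)"
    unfolding U_def \<theta>_def[symmetric]
    by (rule integral_mono) (use pt std_gauss_moments(1)[of 2] in auto)
  also have "\<dots> = G (x + \<delta>) + Ghi * (\<theta>\<^sup>2 / \<delta>\<^sup>2)"
    using std_gauss_moments(1)[of 2] std_gauss_moments(4) std_gauss.prob_space by simp
  finally have Ule: "U s x \<le> G (x + \<delta>) + Ghi * (\<theta>\<^sup>2 / \<delta>\<^sup>2)" .
  have "ln (U s x) \<le> ln (G (x + \<delta>)) + Ghi * (\<theta>\<^sup>2 / \<delta>\<^sup>2) / Glo"
  proof -
    have "ln (U s x) - ln (G (x + \<delta>)) \<le> (U s x - G (x + \<delta>)) / G (x + \<delta>)"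
      using U_bounds(3) G_bounds(3) by (intro ln_diff_le) auto
    also have "\<dots> \<le> Ghi * (\<theta>\<^sup>2 / \<delta>\<^sup>2) / G (x + \<delta>)"
      using Ule G_bounds(3)[of "x + \<delta>"] by (intro divide_right_mono) auto
    also have "\<dots> \<le> Ghi * (\<theta>\<^sup>2 / \<delta>\<^sup>2) / Glo"
      using G_bounds[of "x + \<delta>"] Glo_pos Ghi_pos by (intro divide_left_mono) auto
    finally show ?thesis by simp
  qed
  then have "\<kappa> * ln (U s x) \<le> \<kappa> * (ln (G (x + \<delta>)) + Ghi * (\<theta>\<^sup>2 / \<delta>\<^sup>2) / Glo)"
    using \<kappa>_pos by simp
  then show ?thesis
    unfolding V_def \<theta>_def using \<kappa>_pos assms
    by (simp add: G_def distrib_left power_mult_distrib mult_ac)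
qed

end

section \<open>Controlled Brownian states: the upper bound\<close>

text \<open>With a bounded reward the extended payoff is minus infinity exactly when the expected
  cost is infinite. This reduces each payoff comparison to a trivial case and one about real
  integrals.\<close>

lemma ereal_expectation_payoff:
  fixes r :: "'a \<Rightarrow> real" and C :: "'a \<Rightarrow> ennreal"
  assumes "prob_space M" and r [measurable]: "r \<in> borel_measurable M" and rK: "\<And>\<omega>. \<bar>r \<omega>\<bar> \<le> K"
    and C [measurable]: "C \<in> borel_measurable M"
  shows "(\<integral>\<^sup>+\<omega>. C \<omega> \<partial>M) = \<infinity> \<Longrightarrow>
      ereal_expectation M (\<lambda>\<omega>. ereal (r \<omega>) - enn2ereal (C \<omega>)) = - \<infinity>"
    and "(\<integral>\<^sup>+\<omega>. C \<omega> \<partial>M) < \<infinity> \<Longrightarrow>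
      ereal_expectation M (\<lambda>\<omega>. ereal (r \<omega>) - enn2ereal (C \<omega>)) =
        ereal ((\<integral>\<omega>. r \<omega> \<partial>M) - enn2real (\<integral>\<^sup>+\<omega>. C \<omega> \<partial>M))"
proof -
  interpret prob_space M by fact
  have K: "0 \<le> K" using rK[of undefined] by linarith
  assume inf: "(\<integral>\<^sup>+\<omega>. C \<omega> \<partial>M) = \<infinity>"
  have "(\<integral>\<^sup>+\<omega>. e2ennreal (ereal (r \<omega>) - enn2ereal (C \<omega>)) \<partial>M) \<le> (\<integral>\<^sup>+\<omega>. ennreal K \<partial>M)"
  proof (rule nn_integral_mono)
    fix \<omega>
    have "ereal (r \<omega>) - enn2ereal (C \<omega>) \<le> ereal K"
      using rK[of \<omega>] enn2ereal_nonneg[of "C \<omega>"]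
      by (cases "enn2ereal (C \<omega>)") auto
    then have "e2ennreal (ereal (r \<omega>) - enn2ereal (C \<omega>)) \<le> e2ennreal (ereal K)"
      by (rule e2ennreal_mono)
    then show "e2ennreal (ereal (r \<omega>) - enn2ereal (C \<omega>)) \<le> ennreal K"
      by simp
  qed
  then have fin: "(\<integral>\<^sup>+\<omega>. e2ennreal (ereal (r \<omega>) - enn2ereal (C \<omega>)) \<partial>M) < \<infinity>"
    by (auto simp: emeasure_space_1 intro: le_less_trans)
  have "(\<integral>\<^sup>+\<omega>. C \<omega> \<partial>M) \<le> (\<integral>\<^sup>+\<omega>. e2ennreal (- (ereal (r \<omega>) - enn2ereal (C \<omega>))) + ennreal K \<partial>M)"
  proof (rule nn_integral_mono)
    fix \<omega>
    show "C \<omega> \<le> e2ennreal (- (ereal (r \<omega>) - enn2ereal (C \<omega>))) + ennreal K"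
    proof (cases "C \<omega>")
      case (real x)
      then have "C \<omega> \<le> ennreal (x - r \<omega>) + ennreal K"
        using rK[of \<omega>] K by (cases "0 \<le> x - r \<omega>")
          (auto simp: ennreal_neg simp flip: ennreal_plus intro!: ennreal_leI)
      then show ?thesis using real by (simp add: enn2ereal_ennreal)
    qed (simp add: e2ennreal_infty)
  qed
  also have "\<dots> = (\<integral>\<^sup>+\<omega>. e2ennreal (- (ereal (r \<omega>) - enn2ereal (C \<omega>))) \<partial>M) + ennreal K"
    by (subst nn_integral_add) (auto simp: emeasure_space_1)
  finally have "(\<integral>\<^sup>+\<omega>. e2ennreal (- (ereal (r \<omega>) - enn2ereal (C \<omega>))) \<partial>M) = \<infinity>"
    using inf by (simp add: top_unique)
  then show "ereal_expectation M (\<lambda>\<omega>. ereal (r \<omega>) - enn2ereal (C \<omega>)) = - \<infinity>"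
    using fin unfolding ereal_expectation_def
    by (cases "\<integral>\<^sup>+\<omega>. e2ennreal (ereal (r \<omega>) - enn2ereal (C \<omega>)) \<partial>M") (auto simp: enn2ereal_ennreal)
next
  interpret prob_space M by fact
  assume fin: "(\<integral>\<^sup>+\<omega>. C \<omega> \<partial>M) < \<infinity>"
  then have Cfin: "AE \<omega> in M. C \<omega> \<noteq> \<infinity>"
    by (intro nn_integral_PInf_AE) auto
  define y where "y \<omega> = r \<omega> - enn2real (C \<omega>)" for \<omega>
  have ri: "integrable M r"
    by (rule integrable_const_bound[of _ K]) (use rK in auto)
  have Ceq: "(\<integral>\<^sup>+\<omega>. ennreal (enn2real (C \<omega>)) \<partial>M) = (\<integral>\<^sup>+\<omega>. C \<omega> \<partial>M)"
    by (rule nn_integral_cong_AE) (use Cfin in \<open>auto simp: less_top\<close>)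
  have Ci: "integrable M (\<lambda>\<omega>. enn2real (C \<omega>))"
    by (rule integrableI_nonneg) (use fin Ceq in auto)
  have Cint: "(\<integral>\<omega>. enn2real (C \<omega>) \<partial>M) = enn2real (\<integral>\<^sup>+\<omega>. C \<omega> \<partial>M)"
    by (subst integral_eq_nn_integral) (auto simp: Ceq)
  have yi: "integrable M y" unfolding y_def using ri Ci by simp
  have Y: "AE \<omega> in M. ereal (r \<omega>) - enn2ereal (C \<omega>) = ereal (y \<omega>)"
    using Cfin
  proof eventually_elim
    case (elim \<omega>)
    then show ?case unfolding y_def by (cases "C \<omega>") (auto simp: enn2ereal_ennreal)
  qed
  have 1: "(\<integral>\<^sup>+\<omega>. e2ennreal (ereal (r \<omega>) - enn2ereal (C \<omega>)) \<partial>M) = (\<integral>\<^sup>+\<omega>. ennreal (y \<omega>) \<partial>M)"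
    by (rule nn_integral_cong_AE) (use Y in eventually_elim, simp)
  have 2: "(\<integral>\<^sup>+\<omega>. e2ennreal (- (ereal (r \<omega>) - enn2ereal (C \<omega>))) \<partial>M) = (\<integral>\<^sup>+\<omega>. ennreal (- y \<omega>) \<partial>M)"
    by (rule nn_integral_cong_AE) (use Y in eventually_elim, simp)
  have f1: "(\<integral>\<^sup>+\<omega>. ennreal (y \<omega>) \<partial>M) \<noteq> \<infinity>" "(\<integral>\<^sup>+\<omega>. ennreal (- y \<omega>) \<partial>M) \<noteq> \<infinity>"
    using yi unfolding real_integrable_def by auto
  have "ereal_expectation M (\<lambda>\<omega>. ereal (r \<omega>) - enn2ereal (C \<omega>)) = ereal (\<integral>\<omega>. y \<omega> \<partial>M)"
    unfolding ereal_expectation_def 1 2 real_lebesgue_integral_def[OF yi]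
    using f1
    by (cases "\<integral>\<^sup>+\<omega>. ennreal (y \<omega>) \<partial>M"; cases "\<integral>\<^sup>+\<omega>. ennreal (- y \<omega>) \<partial>M")
      (auto simp: enn2ereal_ennreal)
  also have "(\<integral>\<omega>. y \<omega> \<partial>M) = (\<integral>\<omega>. r \<omega> \<partial>M) - enn2real (\<integral>\<^sup>+\<omega>. C \<omega> \<partial>M)"
    unfolding y_def using ri Ci Cint by simp
  finally show "ereal_expectation M (\<lambda>\<omega>. ereal (r \<omega>) - enn2ereal (C \<omega>)) =
      ereal ((\<integral>\<omega>. r \<omega> \<partial>M) - enn2real (\<integral>\<^sup>+\<omega>. C \<omega> \<partial>M))" .
qed

text \<open>Stated in \<open>ennreal\<close> because a control is integrable in time but its square
  may not be.\<close>

lemma set_integral_cauchy_schwarz: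
  fixes f :: "real \<Rightarrow> real"
  assumes i: "set_integrable lborel {p<..q} f" and "p \<le> q"
  shows "ennreal ((LBINT s:{p<..q}. f s)\<^sup>2) \<le> ennreal (q - p) * (\<integral>\<^sup>+s\<in>{p<..q}. ennreal ((f s)\<^sup>2) \<partial>lborel)"
proof (cases "p = q \<or> (\<integral>\<^sup>+s\<in>{p<..q}. ennreal ((f s)\<^sup>2) \<partial>lborel) = \<infinity>")
  case True
  then show ?thesis
  proof
    assume "p = q" then show ?thesis by (simp add: set_lebesgue_integral_def)
  next
    assume inf: "(\<integral>\<^sup>+s\<in>{p<..q}. ennreal ((f s)\<^sup>2) \<partial>lborel) = \<infinity>"
    show ?thesis
    proof (cases "p = q")
      case False
      then show ?thesis using inf \<open>p \<le> q\<close> by (simp add: ennreal_mult_top)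
    qed (simp add: set_lebesgue_integral_def)
  qed
next
  case False
  then have pq: "p < q" and fin: "(\<integral>\<^sup>+s\<in>{p<..q}. ennreal ((f s)\<^sup>2) \<partial>lborel) < \<infinity>"
    using assms by (auto simp: less_top)
  define u where "u s = indicator {p<..q} s * f s" for s
  have ui: "integrable lborel u" and uI: "(LBINT s:{p<..q}. f s) = (\<integral>s. u s \<partial>lborel)"
    using i unfolding set_integrable_def set_lebesgue_integral_def u_def by simp_all
  have um [measurable]: "u \<in> borel_measurable borel" using borel_measurable_integrable[OF ui] by simp
  have sq: "(\<integral>\<^sup>+s\<in>{p<..q}. ennreal ((f s)\<^sup>2) \<partial>lborel) = (\<integral>\<^sup>+s. ennreal ((u s)\<^sup>2) \<partial>lborel)"
    by (intro nn_integral_cong) (simp add: u_def indicator_def)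
  have u2i: "integrable lborel (\<lambda>s. (u s)\<^sup>2)"
    by (rule integrableI_nonneg) (use fin sq in auto)
  \<comment> \<open>The mean over the interval; nonnegativity of the variance about it is the
    inequality.\<close>
  define m where "m = (\<integral>s. u s \<partial>lborel) / (q - p)"
  have indi: "integrable lborel (\<lambda>s. indicator {p<..q} s :: real)" "(\<integral>s. indicator {p<..q} s \<partial>lborel) = q - p"
    using pq by simp_all
  have pt: "(u s - m * indicator {p<..q} s)\<^sup>2 = (u s)\<^sup>2 - 2 * m * u s + m\<^sup>2 * indicator {p<..q} s" for s
    by (auto simp: u_def indicator_def power2_diff)
  have "0 \<le> (\<integral>s. (u s - m * indicator {p<..q} s)\<^sup>2 \<partial>lborel)"
    by (intro integral_nonneg_AE) auto
  also have "\<dots> = (\<integral>s. (u s)\<^sup>2 \<partial>lborel) - 2 * m * (\<integral>s. u s \<partial>lborel) + m\<^sup>2 * (q - p)"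
    unfolding pt using u2i ui indi by simp
  also have "\<dots> = (\<integral>s. (u s)\<^sup>2 \<partial>lborel) - (\<integral>s. u s \<partial>lborel)\<^sup>2 / (q - p)"
  proof -
    have "2 * (S / d) * S = 2 * (S\<^sup>2 / d)" "(S / d)\<^sup>2 * d = S\<^sup>2 / d" if "0 < d" for S d :: real
      using that by (simp_all add: power2_eq_square)
    from this[of "q - p"] show ?thesis unfolding m_def using pq by simp
  qed
  finally have "(\<integral>s. u s \<partial>lborel)\<^sup>2 \<le> (q - p) * (\<integral>s. (u s)\<^sup>2 \<partial>lborel)"
    using pq by (simp add: field_simps)
  then have "ennreal ((\<integral>s. u s \<partial>lborel)\<^sup>2) \<le> ennreal ((q - p) * (\<integral>s. (u s)\<^sup>2 \<partial>lborel))"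
    by (rule ennreal_leI)
  also have "\<dots> = ennreal (q - p) * ennreal (\<integral>s. (u s)\<^sup>2 \<partial>lborel)"
    using pq by (intro ennreal_mult) auto
  also have "ennreal (\<integral>s. (u s)\<^sup>2 \<partial>lborel) = (\<integral>\<^sup>+s. ennreal ((u s)\<^sup>2) \<partial>lborel)"
    using u2i by (intro nn_integral_eq_integral[symmetric]) auto
  finally show ?thesis unfolding uI sq .
qed

lemma set_nn_integral_split:
  fixes f :: "real \<Rightarrow> ennreal"
  assumes [measurable]: "(\<lambda>s. f s * indicator {p<..r} s) \<in> borel_measurable borel" and "p \<le> q" "q \<le> r"
  shows "(\<integral>\<^sup>+s\<in>{p<..r}. f s \<partial>lborel) = (\<integral>\<^sup>+s\<in>{p<..q}. f s \<partial>lborel) + (\<integral>\<^sup>+s\<in>{q<..r}. f s \<partial>lborel)"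
proof -
  let ?f = "\<lambda>s. f s * indicator {p<..r} s"
  have "(\<integral>\<^sup>+s\<in>{p<..r}. f s \<partial>lborel) = (\<integral>\<^sup>+s. ?f s * indicator {p<..q} s + ?f s * indicator {q<..r} s \<partial>lborel)"
    using assms by (intro nn_integral_cong) (auto simp: indicator_def)
  also have "\<dots> = (\<integral>\<^sup>+s. ?f s * indicator {p<..q} s \<partial>lborel) + (\<integral>\<^sup>+s. ?f s * indicator {q<..r} s \<partial>lborel)"
    by (intro nn_integral_add) auto
  also have "(\<integral>\<^sup>+s. ?f s * indicator {p<..q} s \<partial>lborel) = (\<integral>\<^sup>+s\<in>{p<..q}. f s \<partial>lborel)"
    using assms by (intro nn_integral_cong) (auto simp: indicator_def)
  also have "(\<integral>\<^sup>+s. ?f s * indicator {q<..r} s \<partial>lborel) = (\<integral>\<^sup>+s\<in>{q<..r}. f s \<partial>lborel)"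
    using assms by (intro nn_integral_cong) (auto simp: indicator_def)
  finally show ?thesis .
qed

section \<open>Measurability and conditioning on a filtered space with a Brownian motion\<close>

locale brownian_space =
  fixes M :: "'a measure" and F :: "real \<Rightarrow> 'a measure" and T :: real and B :: "real \<Rightarrow> 'a \<Rightarrow> real"
  assumes filtered: "filtered_prob_space M F T" and brownian: "brownian_motion M F T B"
begin

sublocale prob_space M
  using filtered by (simp add: filtered_prob_space_def)

lemma space_F: "t \<in> {0..T} \<Longrightarrow> space (F t) = space M"
  using filtered by (auto simp: filtered_prob_space_def subalgebra_def)

lemma measurable_F_M: "f \<in> borel_measurable (F t) \<Longrightarrow> t \<in> {0..T} \<Longrightarrow> f \<in> borel_measurable M"
  for f :: "'a \<Rightarrow> 'c :: topological_space"
  using filtered by (auto simp: filtered_prob_space_def intro: measurable_from_subalg)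

lemma measurable_F_mono:
  fixes f :: "'a \<Rightarrow> 'c :: topological_space"
  assumes "f \<in> borel_measurable (F s)" "0 \<le> s" "s \<le> t" "t \<le> T"
  shows "f \<in> borel_measurable (F t)"
proof (rule measurable_from_subalg[OF _ assms(1)])
  show "subalgebra (F t) (F s)"
    using filtered assms unfolding filtered_prob_space_def subalgebra_def by auto
qed

lemma measurable_B_F: "0 \<le> s \<Longrightarrow> s \<le> t \<Longrightarrow> t \<le> T \<Longrightarrow> B s \<in> borel_measurable (F t)"
  using brownian by (intro measurable_F_mono[of "B s" s t]) (auto simp: brownian_motion_def)

lemma measurable_B [measurable]: "t \<in> {0..T} \<Longrightarrow> B t \<in> borel_measurable M"
  using measurable_B_F[of t t] by (intro measurable_F_M) auto

text \<open>Takes the place of conditional expectation given \<open>F s\<close>: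
  \<open>\<xi>\<close> is known at time \<open>s\<close>, so it is independent of the increment and
  the joint law is a product. The law and independence of increments enter the value estimates
  through this lemma.\<close>

lemma brownian_freeze:
  fixes f \<xi> :: "_ \<Rightarrow> real"
  assumes st: "0 \<le> s" "s < t" "t \<le> T" and \<xi>: "\<xi> \<in> borel_measurable (F s)"
    and f [measurable]: "f \<in> borel_measurable borel" and fK: "\<And>x. \<bar>f x\<bar> \<le> K"
  shows "(\<integral>\<omega>. f (\<xi> \<omega> + \<sigma> * (B t \<omega> - B s \<omega>)) \<partial>M) =
    (\<integral>\<omega>. (\<integral>z. f (\<xi> \<omega> + \<sigma> * sqrt (t - s) * z) \<partial>std_gauss) \<partial>M)"
proof -
  define D where "D \<omega> = B t \<omega> - B s \<omega>" for \<omega>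
  have \<xi>M [measurable]: "\<xi> \<in> borel_measurable M" using measurable_F_M[OF \<xi>] st by simp
  have DM [measurable]: "D \<in> borel_measurable M"
    unfolding D_def using st by simp
  have dist: "distributed M lborel D (normal_density 0 (sqrt (t - s)))"
    and ind: "indep_set (sets (F s)) {D -` A \<inter> space M | A. A \<in> sets borel}"
    using brownian st unfolding brownian_motion_def D_def by auto
  have iv: "indep_var borel \<xi> borel D"
    unfolding indep_var_eq
  proof (intro conjI indep_set_sigma_sets)
    have "\<xi> -` A \<inter> space M \<in> sets (F s)" if "A \<in> sets borel" for A
      using measurable_sets[OF \<xi> that] space_F[of s] st by simp
    then show "indep_set {\<xi> -` A \<inter> space M |A. A \<in> sets borel} {D -` A \<inter> space M |A. A \<in> sets borel}"
      using ind unfolding indep_set_def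
      by (elim indep_sets_mono_sets) (auto split: bool.split)
    show "Int_stable {\<xi> -` A \<inter> space M |A. A \<in> sets borel}"
    proof (rule Int_stableI, safe)
      fix A A' :: "real set" assume "A \<in> sets borel" "A' \<in> sets borel"
      then show "\<exists>C. \<xi> -` A \<inter> space M \<inter> (\<xi> -` A' \<inter> space M) = \<xi> -` C \<inter> space M \<and> C \<in> sets borel"
        by (intro exI[of _ "A \<inter> A'"]) auto
    qed
    show "Int_stable {D -` A \<inter> space M |A. A \<in> sets borel}"
    proof (rule Int_stableI, safe)
      fix A A' :: "real set" assume "A \<in> sets borel" "A' \<in> sets borel"
      then show "\<exists>C. D -` A \<inter> space M \<inter> (D -` A' \<inter> space M) = D -` C \<inter> space M \<and> C \<in> sets borel"
        by (intro exI[of _ "A \<inter> A'"]) auto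
    qed
  qed auto
  have law: "distr M borel D = distr std_gauss borel (\<lambda>z. sqrt (t - s) * z)"
  proof -
    have "distr M lborel D = distr std_gauss lborel (\<lambda>z. sqrt (t - s) * z)"
      using dist distributed_std_gauss_scale[of "sqrt (t - s)"] st unfolding distributed_def by simp
    then show ?thesis by (simp cong: distr_cong)
  qed
  interpret X: prob_space "distr M borel \<xi>" by (rule prob_space_distr) simp
  interpret D: prob_space "distr M borel D" by (rule prob_space_distr) simp
  interpret P: pair_prob_space "distr M borel \<xi>" "distr M borel D" ..
  have "(\<integral>\<omega>. f (\<xi> \<omega> + \<sigma> * D \<omega>) \<partial>M) =
      (\<integral>p. f (fst p + \<sigma> * snd p) \<partial>distr M (borel \<Otimes>\<^sub>M borel) (\<lambda>\<omega>. (\<xi> \<omega>, D \<omega>)))"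
    by (subst integral_distr) auto
  also have "\<dots> = (\<integral>p. f (fst p + \<sigma> * snd p) \<partial>(distr M borel \<xi> \<Otimes>\<^sub>M distr M borel D))"
    using iv by (simp add: indep_var_distribution_eq)
  also have "\<dots> = (\<integral>x. (\<integral>y. f (x + \<sigma> * y) \<partial>distr M borel D) \<partial>distr M borel \<xi>)"
    by (subst P.integral_fst'[symmetric]) (auto intro!: P.P.integrable_const_bound[of _ K] fK)
  also have "\<dots> = (\<integral>x. (\<integral>z. f (x + \<sigma> * sqrt (t - s) * z) \<partial>std_gauss) \<partial>distr M borel \<xi>)"
    unfolding law by (subst integral_distr) (auto simp: mult.assoc)
  also have "\<dots> = (\<integral>\<omega>. (\<integral>z. f (\<xi> \<omega> + \<sigma> * sqrt (t - s) * z) \<partial>std_gauss) \<partial>M)"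
    by (subst integral_distr) auto
  finally show ?thesis unfolding D_def .
qed

text \<open>Clamping the time coordinate to [0, q] extends the process to the whole real line, so
  that the plain Borel algebra can replace the restricted one in the later Fubini arguments.\<close>

lemma progressive_clamp:
  assumes "progressively_measurable F T \<beta>" "0 \<le> q" "q \<le> T"
  shows "(\<lambda>p. \<beta> (max 0 (min q (fst p))) (snd p)) \<in> borel_measurable (borel \<Otimes>\<^sub>M F q)"
proof -
  have *: "(\<lambda>p. (max 0 (min q (fst p)), snd p)) \<in> borel \<Otimes>\<^sub>M F q \<rightarrow>\<^sub>M restrict_space borel {0..q} \<Otimes>\<^sub>M F q"
    using assms by (intro measurable_Pair measurable_restrict_space2) auto
  have "(\<lambda>(s, \<omega>). \<beta> s \<omega>) \<in> borel_measurable (restrict_space borel {0..q} \<Otimes>\<^sub>M F q)"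
    using assms unfolding progressively_measurable_def by auto
  from measurable_compose[OF * this] show ?thesis by simp
qed

lemma progressive_slice:
  assumes "progressively_measurable F T \<beta>" "0 \<le> t" "t \<le> T"
  shows "\<beta> t \<in> borel_measurable (F t)"
  using measurable_compose[OF _ progressive_clamp[OF assms], of "\<lambda>\<omega>. (t, \<omega>)" "F t"] assms by simp

lemma progressive_indicator:
  assumes \<beta>: "progressively_measurable F T \<beta>" and pq: "0 \<le> p" "p \<le> q" "q \<le> T" and A: "A \<in> sets borel" "A \<subseteq> {p..q}"
  shows "(\<lambda>x. indicator A (fst x) * \<beta> (fst x) (snd x)) \<in> borel_measurable (borel \<Otimes>\<^sub>M F q)"
proof -
  note [measurable] = progressive_clamp[OF \<beta> order_trans[OF pq(1,2)] pq(3)] A(1)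
  have "(\<lambda>x. indicator A (fst x) * \<beta> (max 0 (min q (fst x))) (snd x)) \<in> borel_measurable (borel \<Otimes>\<^sub>M F q)"
    using pq by measurable
  also have "(\<lambda>x. indicator A (fst x) * \<beta> (max 0 (min q (fst x))) (snd x)) = (\<lambda>x. indicator A (fst x) * \<beta> (fst x) (snd x))"
    using A pq by (auto simp: fun_eq_iff indicator_def max_def min_def)
  finally show ?thesis .
qed

lemma progressive_path:
  assumes \<beta>: "progressively_measurable F T \<beta>" and pq: "0 \<le> p" "p \<le> q" "q \<le> T" and A: "A \<in> sets borel" "A \<subseteq> {p..q}"
    and \<omega>: "\<omega> \<in> space M"
  shows "(\<lambda>s. indicator A s * \<beta> s \<omega>) \<in> borel_measurable borel"
  using measurable_compose[OF _ progressive_indicator[OF \<beta> pq A], of "\<lambda>s. (s, \<omega>)" borel] \<omega> space_F[of q] pq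
  by simp

lemma measurable_set_integral:
  assumes \<beta>: "progressively_measurable F T \<beta>" and pq: "0 \<le> p" "p \<le> q" "q \<le> T" and A: "A \<in> sets borel" "A \<subseteq> {p..q}"
  shows "(\<lambda>\<omega>. LBINT s:A. \<beta> s \<omega>) \<in> borel_measurable (F q)"
proof -
  note [measurable] = progressive_indicator[OF assms]
  have "(\<lambda>x. indicator A (snd x) * \<beta> (snd x) (fst x)) \<in> borel_measurable (F q \<Otimes>\<^sub>M borel)"
    using measurable_compose[OF measurable_pair_swap' progressive_indicator[OF assms]]
    by (simp add: case_prod_unfold)
  then show ?thesis
    unfolding set_lebesgue_integral_def
    by (intro lborel.borel_measurable_lebesgue_integral) (simp add: case_prod_unfold)
qed

lemma measurable_set_nn_integral:
  fixes \<phi> :: "real \<Rightarrow> ennreal"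
  assumes \<beta>: "progressively_measurable F T \<beta>" and pq: "0 \<le> p" "p \<le> q" "q \<le> T" and A: "A \<in> sets borel" "A \<subseteq> {p..q}"
    and [measurable]: "\<phi> \<in> borel_measurable borel"
  shows "(\<lambda>\<omega>. \<integral>\<^sup>+s\<in>A. \<phi> (\<beta> s \<omega>) \<partial>lborel) \<in> borel_measurable (F q)"
proof -
  have [measurable]: "A \<in> sets borel" by fact
  have [measurable]: "(\<lambda>x. indicator A (snd x) * \<beta> (snd x) (fst x)) \<in> borel_measurable (F q \<Otimes>\<^sub>M borel)"
    using measurable_compose[OF measurable_pair_swap' progressive_indicator[OF \<beta> pq A]]
    by (simp add: case_prod_unfold)
  have "(\<lambda>x. \<phi> (indicator A (snd x) * \<beta> (snd x) (fst x)) * indicator A (snd x)) \<in> borel_measurable (F q \<Otimes>\<^sub>M borel)"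
    by measurable
  also have "(\<lambda>x. \<phi> (indicator A (snd x) * \<beta> (snd x) (fst x)) * indicator A (snd x)) =
      (\<lambda>x. \<phi> (\<beta> (snd x) (fst x)) * indicator A (snd x))"
    by (auto simp: fun_eq_iff indicator_def)
  finally show ?thesis
    by (intro lborel.borel_measurable_nn_integral) (simp add: case_prod_unfold)
qed

lemma set_integrable_if_nn_integral_finite:
  assumes \<beta>: "progressively_measurable F T \<beta>" and pq: "0 \<le> p" "p \<le> q" "q \<le> T" and \<omega>: "\<omega> \<in> space M"
    and abs: "(\<integral>\<^sup>+s\<in>{p..q}. ennreal \<bar>\<beta> s \<omega>\<bar> \<partial>lborel) < \<infinity>"
  shows "set_integrable lborel {p..q} (\<lambda>s. \<beta> s \<omega>)"
  unfolding set_integrable_def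
proof (rule integrableI_bounded)
  show "(\<lambda>s. indicator {p..q} s *\<^sub>R \<beta> s \<omega>) \<in> borel_measurable lborel"
    using progressive_path[OF \<beta> pq _ _ \<omega>, of "{p..q}"] by simp
  have "(\<integral>\<^sup>+s. ennreal (norm (indicator {p..q} s *\<^sub>R \<beta> s \<omega>)) \<partial>lborel) = (\<integral>\<^sup>+s\<in>{p..q}. ennreal \<bar>\<beta> s \<omega>\<bar> \<partial>lborel)"
    by (intro nn_integral_cong) (auto simp: indicator_def)
  then show "(\<integral>\<^sup>+s. ennreal (norm (indicator {p..q} s *\<^sub>R \<beta> s \<omega>)) \<partial>lborel) < \<infinity>"
    using abs by simp
qed

lemma admissible_integrable:
  assumes "admissible M F T \<beta>" and T: "0 \<le> T"
  shows "AE \<omega> in M. set_integrable lborel {0..T} (\<lambda>s. \<beta> s \<omega>)"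
proof -
  have \<beta>: "progressively_measurable F T \<beta>"
    and fin: "(\<integral>\<^sup>+\<omega>. (\<integral>\<^sup>+s\<in>{0..T}. ennreal \<bar>\<beta> s \<omega>\<bar> \<partial>lborel) \<partial>M) < \<infinity>"
    using assms by (auto simp: admissible_def)
  have "(\<lambda>\<omega>. \<integral>\<^sup>+s\<in>{0..T}. ennreal \<bar>\<beta> s \<omega>\<bar> \<partial>lborel) \<in> borel_measurable M"
    using measurable_F_M[OF measurable_set_nn_integral[OF \<beta>, of 0 T "{0..T}" "\<lambda>x. ennreal \<bar>x\<bar>"]] T by simp
  from nn_integral_PInf_AE[OF this] fin
  have "AE \<omega> in M. (\<integral>\<^sup>+s\<in>{0..T}. ennreal \<bar>\<beta> s \<omega>\<bar> \<partial>lborel) \<noteq> \<infinity>" by simp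
  with AE_space show ?thesis
  proof eventually_elim
    case (elim \<omega>)
    then show ?case using T by (intro set_integrable_if_nn_integral_finite[OF \<beta>]) (auto simp: less_top)
  qed
qed

end

locale controlled_brownian = quadratic_control + brownian_space +
  assumes T_pos: "0 < T"
begin

lemma integrable_bounded_comp:
  fixes f \<xi> :: "_ \<Rightarrow> real"
  assumes "f \<in> borel_measurable borel" "\<xi> \<in> borel_measurable M" "\<And>x. \<bar>f x\<bar> \<le> K"
  shows "integrable M (\<lambda>\<omega>. f (\<xi> \<omega>))"
  by (rule integrable_const_bound[of _ K]) (use assms in auto)

text \<open>Averaging the control over the previous time step makes it adapted and piecewise constant
  without increasing its cost, and changes the controlled state at time T only by the integral
  over the last step. V_step_le applies to each step.\<close>

lemma delayed_payoff_le:
  fixes \<beta> :: "real \<Rightarrow> 'a \<Rightarrow> real" and n :: nat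
  assumes \<beta>: "progressively_measurable F T \<beta>" and t: "0 \<le> t" "t < T" and n: "0 < n"
    and int: "AE \<omega> in M. set_integrable lborel {t..T} (\<lambda>s. \<beta> s \<omega>)"
    and fin: "(\<integral>\<^sup>+\<omega>. (\<integral>\<^sup>+s\<in>{t..T}. ennreal (c * (\<beta> s \<omega>)\<^sup>2) \<partial>lborel) \<partial>M) < \<infinity>"
  shows "(\<integral>\<omega>. g (x + (LBINT s:{t<..T - (T - t) / n}. \<beta> s \<omega>) + \<sigma> * (B T \<omega> - B t \<omega>)) \<partial>M) \<le>
    V (T - t) x + enn2real (\<integral>\<^sup>+\<omega>. (\<integral>\<^sup>+s\<in>{t..T}. ennreal (c * (\<beta> s \<omega>)\<^sup>2) \<partial>lborel) \<partial>M)"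
proof -
  define h where "h = (T - t) / n"
  have h: "0 < h" "real n * h = T - t" using t n by (auto simp: h_def)
  define A where "A u \<omega> = (LBINT s:{t<..u}. \<beta> s \<omega>)" for u \<omega>
  \<comment> \<open>Natural subtraction is intended: \<open>pr 0\<close> and \<open>pr 1\<close> are
    both \<open>t\<close>, so the first step is uncontrolled and each later step uses the control of
    the preceding interval.\<close>
  define pr where "pr k = t + real (k - 1) * h" for k :: nat
  define tk where "tk k = t + real k * h" for k :: nat
  define Y where "Y k \<omega> = x + A (pr k) \<omega> + \<sigma> * (B (tk k) \<omega> - B t \<omega>)" for k \<omega>
  \<comment> \<open>The displacement applied during the step after \<open>tk k\<close>. It uses the
    control up to \<open>tk k\<close> only, hence is observable when the step begins and can be
    frozen.\<close>
  define J where "J k \<omega> = A (tk k) \<omega> - A (pr k) \<omega>" for k \<omega>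
  define q where "q k = (\<integral>\<^sup>+\<omega>. (\<integral>\<^sup>+s\<in>{t<..pr k}. ennreal (c * (\<beta> s \<omega>)\<^sup>2) \<partial>lborel) \<partial>M)" for k
  define Q where "Q = (\<integral>\<^sup>+\<omega>. (\<integral>\<^sup>+s\<in>{t..T}. ennreal (c * (\<beta> s \<omega>)\<^sup>2) \<partial>lborel) \<partial>M)"
  have tk_le: "tk k \<le> T" if "k \<le> n" for k
    using mult_right_mono[of "real k" "real n" h] that h by (simp add: tk_def)
  have tk_ge: "t \<le> tk k" "t \<le> pr k" "pr k \<le> tk k" for k
    using h by (auto simp: tk_def pr_def)
  have pr_Suc: "pr (Suc k) = tk k" for k by (simp add: pr_def tk_def)
  have tk_Suc: "tk (Suc k) = tk k + h" for k by (simp add: tk_def algebra_simps)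
  have tk_pr: "tk k - pr k \<le> h" for k using h by (cases k) (auto simp: tk_def pr_def algebra_simps)
  have Ameas: "A u \<in> borel_measurable (F v)" if "t \<le> u" "u \<le> v" "v \<le> T" for u v
  proof (rule measurable_F_mono)
    show "A u \<in> borel_measurable (F u)"
      unfolding A_def using that t by (intro measurable_set_integral[OF \<beta>, of t]) auto
  qed (use that t in auto)
  have Bt: "B u \<in> borel_measurable (F v)" if "0 \<le> u" "u \<le> v" "v \<le> T" for u v
    using measurable_B_F that by simp
  have Ymeas: "(\<lambda>\<omega>. Y k \<omega> + J k \<omega>) \<in> borel_measurable (F (tk k))" "Y k \<in> borel_measurable (F (tk k))"
    "J k \<in> borel_measurable (F (tk k))" if "k \<le> n" for k
    unfolding Y_def J_def using Ameas[of _ "tk k"] Bt[of _ "tk k"] tk_le[OF that] tk_ge[of k] t that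
    by simp_all
  have q_le: "q k \<le> Q" if "k \<le> n" for k
    unfolding q_def Q_def using tk_ge[of k] tk_le[OF that]
    by (intro nn_integral_mono mult_left_mono) (auto simp: indicator_def)
  have cost_m: "(\<lambda>\<omega>. \<integral>\<^sup>+s\<in>{u<..v}. ennreal (c * (\<beta> s \<omega>)\<^sup>2) \<partial>lborel) \<in> borel_measurable M"
    if "0 \<le> u" "u \<le> v" "v \<le> T" for u v
    by (intro measurable_F_M[OF measurable_set_nn_integral[OF \<beta>, of u v "{u<..v}" "\<lambda>x. ennreal (c * x\<^sup>2)"]])
      (use that in auto)
  \<comment> \<open>By Cauchy-Schwarz the constant control \<open>J k \<omega> / h\<close> over the
    step after \<open>tk k\<close> costs no more than \<open>\<beta>\<close> between
    \<open>pr k\<close> and \<open>tk k\<close>. Successive intervals of this kind are disjoint, so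
    the charges add up to the true cost.\<close>
  have Jcost: "(\<integral>\<^sup>+\<omega>. ennreal (c * h * (J k \<omega> / h)\<^sup>2) \<partial>M) + q k \<le> q (Suc k)" if k: "k < n" for k
  proof -
    let ?e = "\<lambda>\<omega>. \<integral>\<^sup>+s\<in>{pr k<..tk k}. ennreal (c * (\<beta> s \<omega>)\<^sup>2) \<partial>lborel"
    have b: "pr k \<le> tk k" "tk k \<le> T" "t \<le> pr k" using tk_ge[of k] tk_le[of k] k by auto
    have "(\<integral>\<^sup>+\<omega>. ennreal (c * h * (J k \<omega> / h)\<^sup>2) \<partial>M) \<le> (\<integral>\<^sup>+\<omega>. ?e \<omega> \<partial>M)"
    proof (rule nn_integral_mono_AE)
      show "AE \<omega> in M. ennreal (c * h * (J k \<omega> / h)\<^sup>2) \<le> ?e \<omega>"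
        using int AE_space
      proof eventually_elim
        case (elim \<omega>)
        have i1: "set_integrable lborel {t<..tk k} (\<lambda>s. \<beta> s \<omega>)"
          and i2: "set_integrable lborel {t<..pr k} (\<lambda>s. \<beta> s \<omega>)"
          and i3: "set_integrable lborel {pr k<..tk k} (\<lambda>s. \<beta> s \<omega>)"
          using b by (auto intro!: set_integrable_subset[OF elim(1)])
        have "A (tk k) \<omega> = A (pr k) \<omega> + (LBINT s:{pr k<..tk k}. \<beta> s \<omega>)"
          unfolding A_def
          using set_integral_Un[OF _ i2 i3] b by (simp add: ivl_disj_un_two(6))
        then have J: "J k \<omega> = (LBINT s:{pr k<..tk k}. \<beta> s \<omega>)" by (simp add: J_def)
        have "c * h * (J k \<omega> / h)\<^sup>2 = c / h * (J k \<omega>)\<^sup>2"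
          using h by (simp add: power2_eq_square)
        then have "ennreal (c * h * (J k \<omega> / h)\<^sup>2) = ennreal (c / h * (J k \<omega>)\<^sup>2)"
          by (simp only:)
        also have "\<dots> = ennreal (c / h) * ennreal ((J k \<omega>)\<^sup>2)"
          using c_pos h by (intro ennreal_mult) auto
        also have "\<dots> \<le> ennreal (c / h) * (ennreal (tk k - pr k) * (\<integral>\<^sup>+s\<in>{pr k<..tk k}. ennreal ((\<beta> s \<omega>)\<^sup>2) \<partial>lborel))"
          unfolding J by (intro mult_left_mono set_integral_cauchy_schwarz i3 b) auto
        also have "\<dots> = ennreal (c / h * (tk k - pr k)) * (\<integral>\<^sup>+s\<in>{pr k<..tk k}. ennreal ((\<beta> s \<omega>)\<^sup>2) \<partial>lborel)"
        proof -
          have "ennreal (c / h * (tk k - pr k)) = ennreal (c / h) * ennreal (tk k - pr k)"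
            using c_pos h b by (intro ennreal_mult) auto
          then show ?thesis by (simp only: mult.assoc)
        qed
        also have "\<dots> \<le> ennreal c * (\<integral>\<^sup>+s\<in>{pr k<..tk k}. ennreal ((\<beta> s \<omega>)\<^sup>2) \<partial>lborel)"
        proof (intro mult_right_mono ennreal_leI)
          show "c / h * (tk k - pr k) \<le> c"
            using mult_left_mono[OF tk_pr[of k], of "c / h"] c_pos h by simp
        qed auto
        also have "\<dots> = (\<integral>\<^sup>+s. ennreal c * (ennreal ((indicator {pr k<..tk k} s * \<beta> s \<omega>)\<^sup>2) * indicator {pr k<..tk k} s) \<partial>lborel)"
        proof -
          have [measurable]: "(\<lambda>s. indicator {pr k<..tk k} s * \<beta> s \<omega>) \<in> borel_measurable borel"
            using b t elim by (intro progressive_path[OF \<beta>, of "pr k" "tk k"]) auto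
          have "(\<integral>\<^sup>+s\<in>{pr k<..tk k}. ennreal ((\<beta> s \<omega>)\<^sup>2) \<partial>lborel) =
            (\<integral>\<^sup>+s\<in>{pr k<..tk k}. ennreal ((indicator {pr k<..tk k} s * \<beta> s \<omega>)\<^sup>2) \<partial>lborel)"
            by (intro nn_integral_cong) (auto simp: indicator_def)
          then show ?thesis
            by (simp add: nn_integral_cmult)
        qed
        also have "\<dots> = ?e \<omega>"
          using c_pos by (intro nn_integral_cong) (auto simp: indicator_def ennreal_mult)
        finally show ?case .
      qed
    qed
    then have "(\<integral>\<^sup>+\<omega>. ennreal (c * h * (J k \<omega> / h)\<^sup>2) \<partial>M) + q k \<le> q k + (\<integral>\<^sup>+\<omega>. ?e \<omega> \<partial>M)"
      by (simp add: add.commute add_left_mono)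
    also have "\<dots> = q (Suc k)"
      unfolding q_def pr_Suc
    proof (subst nn_integral_add[symmetric])
      show "(\<integral>\<^sup>+\<omega>. (\<integral>\<^sup>+s\<in>{t<..pr k}. ennreal (c * (\<beta> s \<omega>)\<^sup>2) \<partial>lborel) + ?e \<omega> \<partial>M) =
        (\<integral>\<^sup>+\<omega>. (\<integral>\<^sup>+s\<in>{t<..tk k}. ennreal (c * (\<beta> s \<omega>)\<^sup>2) \<partial>lborel) \<partial>M)"
      proof (rule nn_integral_cong)
        fix \<omega> assume \<omega>: "\<omega> \<in> space M"
        have [measurable]: "(\<lambda>s. indicator {t<..tk k} s * \<beta> s \<omega>) \<in> borel_measurable borel"
          using b t \<omega> by (intro progressive_path[OF \<beta>, of t "tk k"]) auto
        have "(\<lambda>s. ennreal (c * (indicator {t<..tk k} s * \<beta> s \<omega>)\<^sup>2) * indicator {t<..tk k} s) \<in> borel_measurable borel"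
          by measurable
        also have "(\<lambda>s. ennreal (c * (indicator {t<..tk k} s * \<beta> s \<omega>)\<^sup>2) * indicator {t<..tk k} s) =
          (\<lambda>s. ennreal (c * (\<beta> s \<omega>)\<^sup>2) * indicator {t<..tk k} s)"
          by (auto simp: fun_eq_iff indicator_def)
        finally show "(\<integral>\<^sup>+s\<in>{t<..pr k}. ennreal (c * (\<beta> s \<omega>)\<^sup>2) \<partial>lborel) + ?e \<omega> =
            (\<integral>\<^sup>+s\<in>{t<..tk k}. ennreal (c * (\<beta> s \<omega>)\<^sup>2) \<partial>lborel)"
          using b by (intro set_nn_integral_split[symmetric]) auto
      qed
    qed (use cost_m b t in auto)
    finally show ?thesis .
  qed
  \<comment> \<open>Dynamic programming in expectation: the mean of V along \<open>Y\<close> grows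
    by at most the mean cost of the displacement, so starting from \<open>V (T - t) x\<close> it
    never exceeds this value plus the accumulated cost \<open>q k\<close>.\<close>
  have step: "(\<integral>\<omega>. V (T - tk k) (Y k \<omega>) \<partial>M) \<le> V (T - t) x + enn2real (q k)" if "k \<le> n" for k
    using that
  proof (induction k)
    case 0
    have "AE \<omega> in M. Y 0 \<omega> = x"
      by (simp add: Y_def A_def pr_def tk_def set_lebesgue_integral_def)
    then have "(\<integral>\<omega>. V (T - tk 0) (Y 0 \<omega>) \<partial>M) = (\<integral>\<omega>. V (T - t) x \<partial>M)"
      by (simp add: Y_def A_def pr_def tk_def set_lebesgue_integral_def)
    then show ?case by (simp add: prob_space)
  next
    case (Suc k)
    then have k: "k < n" by simp
    have YSuc: "Y (Suc k) \<omega> = (Y k \<omega> + J k \<omega>) + \<sigma> * (B (tk (Suc k)) \<omega> - B (tk k) \<omega>)" for \<omega>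
      by (simp add: Y_def J_def pr_Suc algebra_simps)
    have sT: "0 \<le> T - tk (Suc k)" using tk_le[of "Suc k"] Suc by simp
    have [measurable]: "(\<lambda>\<omega>. Y k \<omega> + J k \<omega>) \<in> borel_measurable M" "Y k \<in> borel_measurable M" "J k \<in> borel_measurable M"
      using Ymeas[of k, THEN measurable_F_M] k tk_ge[of k] tk_le[of k] t by simp_all
    have VYi: "integrable M (\<lambda>\<omega>. V (T - tk k) (Y k \<omega>))"
      by (rule integrable_bounded_comp[of "V (T - tk k)" "Y k" Gb]) (auto intro: V_bound)
    have cJ: "(\<integral>\<^sup>+\<omega>. ennreal (c * h * (J k \<omega> / h)\<^sup>2) \<partial>M) + q k \<le> q (Suc k)" by (rule Jcost[OF k])
    have qfin: "q (Suc k) < \<infinity>" using q_le[of "Suc k"] Suc fin unfolding Q_def by (auto intro: le_less_trans)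
    have Jfin: "(\<integral>\<^sup>+\<omega>. ennreal (c * h * (J k \<omega> / h)\<^sup>2) \<partial>M) < \<infinity>"
      using cJ qfin by (meson le_less_trans le_add_same_cancel1 order_trans zero_le add_increasing2 order_refl)
    have qkfin: "q k < \<infinity>"
      using cJ qfin by (meson le_less_trans order_trans zero_le add_increasing order_refl)
    have Ji: "integrable M (\<lambda>\<omega>. c * h * (J k \<omega> / h)\<^sup>2)"
      using Jfin c_pos h by (intro integrableI_nonneg) auto
    have Jint: "ennreal (\<integral>\<omega>. c * h * (J k \<omega> / h)\<^sup>2 \<partial>M) = (\<integral>\<^sup>+\<omega>. ennreal (c * h * (J k \<omega> / h)\<^sup>2) \<partial>M)"
      using c_pos h by (intro nn_integral_eq_integral[symmetric] Ji) auto
    have "(\<integral>\<omega>. V (T - tk (Suc k)) (Y (Suc k) \<omega>) \<partial>M) =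
      (\<integral>\<omega>. (\<integral>z. V (T - tk (Suc k)) (Y k \<omega> + J k \<omega> + \<sigma> * sqrt (tk (Suc k) - tk k) * z) \<partial>std_gauss) \<partial>M)"
      unfolding YSuc
      by (rule brownian_freeze[OF _ _ _ Ymeas(1)])
        (use tk_ge[of k] t h tk_le[of "Suc k"] Suc.prems k V_bound in \<open>auto simp: tk_Suc\<close>)
    also have "\<dots> \<le> (\<integral>\<omega>. V (T - tk k) (Y k \<omega>) + c * h * (J k \<omega> / h)\<^sup>2 \<partial>M)"
    proof (rule integral_mono)
      fix \<omega>
      have *: "T - tk k = (T - tk (Suc k)) + h" by (simp add: tk_Suc)
      show "(\<integral>z. V (T - tk (Suc k)) (Y k \<omega> + J k \<omega> + \<sigma> * sqrt (tk (Suc k) - tk k) * z) \<partial>std_gauss)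
        \<le> V (T - tk k) (Y k \<omega>) + c * h * (J k \<omega> / h)\<^sup>2"
        unfolding * using V_step_le[OF sT h(1), of "Y k \<omega>" "J k \<omega> / h"] h by (simp add: tk_Suc)
    next
      show "integrable M (\<lambda>\<omega>. \<integral>z. V (T - tk (Suc k)) (Y k \<omega> + J k \<omega> + \<sigma> * sqrt (tk (Suc k) - tk k) * z) \<partial>std_gauss)"
      proof (rule integrable_const_bound[of _ Gb])
        show "AE \<omega> in M. norm (\<integral>z. V (T - tk (Suc k)) (Y k \<omega> + J k \<omega> + \<sigma> * sqrt (tk (Suc k) - tk k) * z) \<partial>std_gauss) \<le> Gb"
        proof (rule AE_I2)
          fix \<omega>
          have "\<bar>\<integral>z. V (T - tk (Suc k)) (Y k \<omega> + J k \<omega> + \<sigma> * sqrt (tk (Suc k) - tk k) * z) \<partial>std_gauss\<bar> \<le> (\<integral>z. Gb \<partial>std_gauss)"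
            by (rule abs_integral_mono) (auto intro: V_bound integrable_V)
          then show "norm (\<integral>z. V (T - tk (Suc k)) (Y k \<omega> + J k \<omega> + \<sigma> * sqrt (tk (Suc k) - tk k) * z) \<partial>std_gauss) \<le> Gb"
            using std_gauss.prob_space by simp
        qed
      qed measurable
      show "integrable M (\<lambda>\<omega>. V (T - tk k) (Y k \<omega>) + c * h * (J k \<omega> / h)\<^sup>2)"
        using Ji VYi by (intro Bochner_Integration.integrable_add)
    qed
    also have "\<dots> = (\<integral>\<omega>. V (T - tk k) (Y k \<omega>) \<partial>M) + (\<integral>\<omega>. c * h * (J k \<omega> / h)\<^sup>2 \<partial>M)"
      using Ji VYi by (intro Bochner_Integration.integral_add)
    also have "\<dots> \<le> V (T - t) x + (enn2real (q k) + (\<integral>\<omega>. c * h * (J k \<omega> / h)\<^sup>2 \<partial>M))"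
      using Suc by simp
    also have "enn2real (q k) + (\<integral>\<omega>. c * h * (J k \<omega> / h)\<^sup>2 \<partial>M) \<le> enn2real (q (Suc k))"
    proof -
      have J0: "0 \<le> (\<integral>\<omega>. c * h * (J k \<omega> / h)\<^sup>2 \<partial>M)"
        using c_pos h by (intro integral_nonneg_AE) auto
      have "enn2real (q k + ennreal (\<integral>\<omega>. c * h * (J k \<omega> / h)\<^sup>2 \<partial>M)) \<le> enn2real (q (Suc k))"
        using cJ qfin unfolding Jint by (intro enn2real_mono) (auto simp: add.commute)
      then show ?thesis
        using qkfin J0 by (subst (asm) enn2real_plus) auto
    qed
    finally show ?case by simp
  qed
  have "tk n = T" "pr n = T - h"
    using h n by (auto simp: tk_def pr_def of_nat_diff algebra_simps)
  then have "(\<integral>\<omega>. g (x + (LBINT s:{t<..T - (T - t) / n}. \<beta> s \<omega>) + \<sigma> * (B T \<omega> - B t \<omega>)) \<partial>M) =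
      (\<integral>\<omega>. V (T - tk n) (Y n \<omega>) \<partial>M)"
    by (simp add: Y_def A_def V_0 h_def)
  also have "\<dots> \<le> V (T - t) x + enn2real (q n)" by (rule step) simp
  also have "\<dots> \<le> V (T - t) x + enn2real Q"
    using q_le[of n] fin unfolding Q_def by (intro add_left_mono enn2real_mono) auto
  finally show ?thesis unfolding Q_def .
qed

text \<open>The delayed displacements converge almost surely to the true one, but \<open>g\<close>
  may be discontinuous. Starting the delayed state higher by \<open>\<delta>\<close> makes it
  dominate the true state outside an event of vanishing probability, on which boundedness of
  \<open>g\<close> is used. Finally \<open>\<delta>\<close> tends to 0 in
  \<open>V (T - t) (x + \<delta>)\<close>, which is continuous because \<open>T - t\<close> is
  positive.\<close>

lemma payoff_le:
  fixes \<beta> :: "real \<Rightarrow> 'a \<Rightarrow> real"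
  assumes \<beta>: "progressively_measurable F T \<beta>" and t: "0 \<le> t" "t < T"
    and int: "AE \<omega> in M. set_integrable lborel {t..T} (\<lambda>s. \<beta> s \<omega>)"
    and fin: "(\<integral>\<^sup>+\<omega>. (\<integral>\<^sup>+s\<in>{t..T}. ennreal (c * (\<beta> s \<omega>)\<^sup>2) \<partial>lborel) \<partial>M) < \<infinity>"
  shows "(\<integral>\<omega>. g (x + (LBINT s:{t..T}. \<beta> s \<omega>) + \<sigma> * (B T \<omega> - B t \<omega>)) \<partial>M) \<le>
    V (T - t) x + enn2real (\<integral>\<^sup>+\<omega>. (\<integral>\<^sup>+s\<in>{t..T}. ennreal (c * (\<beta> s \<omega>)\<^sup>2) \<partial>lborel) \<partial>M)"
proof -
  define Q where "Q = enn2real (\<integral>\<^sup>+\<omega>. (\<integral>\<^sup>+s\<in>{t..T}. ennreal (c * (\<beta> s \<omega>)\<^sup>2) \<partial>lborel) \<partial>M)"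
  define I where "I \<omega> = (LBINT s:{t..T}. \<beta> s \<omega>)" for \<omega>
  define u where "u n = T - (T - t) / real (Suc n)" for n
  define In where "In n \<omega> = (LBINT s:{t<..u n}. \<beta> s \<omega>)" for n \<omega>
  define S where "S \<omega> = \<sigma> * (B T \<omega> - B t \<omega>)" for \<omega>
  have u: "t \<le> u n" "u n \<le> T" for n
  proof -
    have "(T - t) / real (Suc n) \<le> T - t" "0 \<le> (T - t) / real (Suc n)"
      using t by (auto simp: divide_le_eq mult_le_cancel_left)
    then show "t \<le> u n" "u n \<le> T" by (auto simp: u_def)
  qed
  have ulim: "u \<longlonglongrightarrow> T"
  proof -
    have "(\<lambda>n. T - (T - t) * inverse (real (Suc n))) \<longlonglongrightarrow> T - (T - t) * 0"
      by (intro tendsto_intros LIMSEQ_inverse_real_of_nat)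
    then show ?thesis by (simp add: u_def[abs_def] divide_inverse)
  qed
  have [measurable]: "S \<in> borel_measurable M" "I \<in> borel_measurable M" "In n \<in> borel_measurable M" for n
  proof -
    show "S \<in> borel_measurable M" unfolding S_def using t by simp
    show "I \<in> borel_measurable M"
      unfolding I_def using t by (intro measurable_F_M[OF measurable_set_integral[OF \<beta>, of t T]]) auto
    show "In n \<in> borel_measurable M"
      unfolding In_def using t u[of n] by (intro measurable_F_M[OF measurable_set_integral[OF \<beta>, of t "u n"]]) auto
  qed
  have lim: "AE \<omega> in M. (\<lambda>n. In n \<omega>) \<longlonglongrightarrow> I \<omega>"
    using int
  proof eventually_elim
    case (elim \<omega>)
    have "(\<lambda>n. LINT s|lborel. indicator {t<..u n} s *\<^sub>R \<beta> s \<omega>) \<longlonglongrightarrow> (LINT s|lborel. indicator {t..T} s *\<^sub>R \<beta> s \<omega>)"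
    proof (rule integral_dominated_convergence[where w = "\<lambda>s. \<bar>indicator {t..T} s *\<^sub>R \<beta> s \<omega>\<bar>"])
      show "(\<lambda>s. indicator {t..T} s *\<^sub>R \<beta> s \<omega>) \<in> borel_measurable lborel"
        using elim unfolding set_integrable_def by (rule borel_measurable_integrable)
      show "(\<lambda>s. indicator {t<..u n} s *\<^sub>R \<beta> s \<omega>) \<in> borel_measurable lborel" for n
      proof -
        have "{t<..u n} \<subseteq> {t..T}" using u[of n] by auto
        then have "set_integrable lborel {t<..u n} (\<lambda>s. \<beta> s \<omega>)"
          by (intro set_integrable_subset[OF elim]) auto
        then show ?thesis unfolding set_integrable_def by (rule borel_measurable_integrable)
      qed
      show "integrable lborel (\<lambda>s. \<bar>indicator {t..T} s *\<^sub>R \<beta> s \<omega>\<bar>)"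
        using elim unfolding set_integrable_def by (rule integrable_abs)
      have "AE s in lborel. s \<noteq> t \<and> s \<noteq> T"
        using AE_lborel_singleton[of t] AE_lborel_singleton[of T] by eventually_elim simp
      then show "AE s in lborel. (\<lambda>n. indicator {t<..u n} s *\<^sub>R \<beta> s \<omega>) \<longlonglongrightarrow> indicator {t..T} s *\<^sub>R \<beta> s \<omega>"
      proof eventually_elim
        case (elim s)
        have "eventually (\<lambda>n. indicator {t<..u n} s *\<^sub>R \<beta> s \<omega> = indicator {t..T} s *\<^sub>R \<beta> s \<omega>) sequentially"
        proof (cases "t < s \<and> s < T")
          case True
          then have "eventually (\<lambda>n. s < u n) sequentially"
            using order_tendstoD(1)[OF ulim] by simp
          then show ?thesis by eventually_elim (use True in \<open>auto simp: indicator_def\<close>)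
        next
          case False
          then have "s < t \<or> T < s" using elim by auto
          then have "s \<notin> {t..T}" "s \<notin> {t<..u n}" for n
            using u(2)[of n] by auto
          then show ?thesis by (intro always_eventually allI) (auto simp: indicator_def)
        qed
        then show ?case by (rule tendsto_eventually)
      qed
      show "AE s in lborel. norm (indicator {t<..u n} s *\<^sub>R \<beta> s \<omega>) \<le> \<bar>indicator {t..T} s *\<^sub>R \<beta> s \<omega>\<bar>" for n
        using u[of n] by (auto simp: indicator_def)
    qed
    then show ?case by (simp add: In_def I_def set_lebesgue_integral_def)
  qed
  have gi: "integrable M (\<lambda>\<omega>. g (\<xi> \<omega>))" if "\<xi> \<in> borel_measurable M" for \<xi>
    using that g_bound by (intro integrable_bounded_comp) auto
  have main: "(\<integral>\<omega>. g (x + I \<omega> + S \<omega>) \<partial>M) \<le> V (T - t) (x + \<delta>) + Q" if \<delta>: "0 < \<delta>" for \<delta>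
  proof -
    define Ib where "Ib n \<omega> = (if \<delta> + In n \<omega> < I \<omega> then 1 else 0 :: real)" for n \<omega>
    define P where "P n = (\<integral>\<omega>. Ib n \<omega> \<partial>M)" for n
    have [measurable]: "Ib n \<in> borel_measurable M" for n
      unfolding Ib_def by measurable
    have P0: "P \<longlonglongrightarrow> (\<integral>\<omega>. 0 \<partial>M)"
      unfolding P_def
    proof (rule integral_dominated_convergence[where w = "\<lambda>_. 1"])
      show "AE \<omega> in M. (\<lambda>n. Ib n \<omega>) \<longlonglongrightarrow> 0"
        using lim
      proof eventually_elim
        case (elim \<omega>)
        have "eventually (\<lambda>n. I \<omega> - \<delta> < In n \<omega>) sequentially"
          using \<delta> by (intro order_tendstoD(1)[OF elim]) simp
        then have "eventually (\<lambda>n. Ib n \<omega> = 0) sequentially"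
          by eventually_elim (simp add: Ib_def)
        then show ?case by (rule tendsto_eventually)
      qed
    qed (auto simp: Ib_def)
    have "(\<integral>\<omega>. g (x + I \<omega> + S \<omega>) \<partial>M) \<le> V (T - t) (x + \<delta>) + Q + 2 * Gb * P n" for n
    proof -
      have ii: "integrable M (\<lambda>\<omega>. Ib n \<omega>)"
        by (rule integrable_const_bound[of _ 1]) (auto simp: Ib_def)
      have "(\<integral>\<omega>. g (x + I \<omega> + S \<omega>) \<partial>M) \<le>
          (\<integral>\<omega>. g (x + \<delta> + In n \<omega> + S \<omega>) + 2 * Gb * Ib n \<omega> \<partial>M)"
      proof (rule integral_mono)
        show "g (x + I \<omega> + S \<omega>) \<le> g (x + \<delta> + In n \<omega> + S \<omega>) + 2 * Gb * Ib n \<omega>" for \<omega>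
          using g_bound[of "x + I \<omega> + S \<omega>"] g_bound[of "x + \<delta> + In n \<omega> + S \<omega>"]
            monoD[OF mono_g, of "x + I \<omega> + S \<omega>" "x + \<delta> + In n \<omega> + S \<omega>"]
          by (cases "\<delta> + In n \<omega> < I \<omega>") (auto simp: Ib_def)
      qed (use ii in \<open>auto intro!: gi\<close>)
      also have "\<dots> = (\<integral>\<omega>. g (x + \<delta> + In n \<omega> + S \<omega>) \<partial>M) + 2 * Gb * P n"
        unfolding P_def using ii by (subst Bochner_Integration.integral_add) (auto intro!: gi)
      also have "(\<integral>\<omega>. g (x + \<delta> + In n \<omega> + S \<omega>) \<partial>M) \<le> V (T - t) (x + \<delta>) + Q"
        using delayed_payoff_le[OF \<beta> t _ int fin, of "Suc n" "x + \<delta>"]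
        unfolding In_def S_def Q_def u_def by simp
      finally show ?thesis by simp
    qed
    moreover have "(\<lambda>n. V (T - t) (x + \<delta>) + Q + 2 * Gb * P n) \<longlonglongrightarrow> V (T - t) (x + \<delta>) + Q + 2 * Gb * 0"
      using P0 by (intro tendsto_intros) simp
    ultimately show ?thesis
      by (intro LIMSEQ_le_const) auto
  qed
  have "(\<lambda>n. V (T - t) (x + inverse (real (Suc n))) + Q) \<longlonglongrightarrow> V (T - t) (x + 0) + Q"
  proof (intro tendsto_intros isCont_tendsto_compose[OF DERIV_isCont[OF V_deriv]] LIMSEQ_inverse_real_of_nat)
  qed (use t in auto)
  then have "(\<integral>\<omega>. g (x + I \<omega> + S \<omega>) \<partial>M) \<le> V (T - t) x + Q"
    by (intro LIMSEQ_le_const[where X = "\<lambda>n. V (T - t) (x + inverse (real (Suc n))) + Q"]) (use main in auto)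
  then show ?thesis unfolding I_def S_def Q_def .
qed

end

section \<open>The Euler scheme of the optimal feedback\<close>

text \<open>S is the remaining duration at the initial time; the drift over a step is evaluated at the
  duration remaining at its end.\<close>

primrec euler :: "(real \<Rightarrow> real \<Rightarrow> real) \<Rightarrow> real \<Rightarrow> real \<Rightarrow> real \<Rightarrow> (nat \<Rightarrow> real) \<Rightarrow> nat \<Rightarrow> real" where
  "euler D S h x w 0 = x"
| "euler D S h x w (Suc k) =
     euler D S h x w k + D (S - real (Suc k) * h) (euler D S h x w k) * h + (w (Suc k) - w k)"

text \<open>The expectation of \<open>f\<close> at the end of an Euler scheme, written as iterated
  Gaussian integrals. It refers to no probability space and therefore allows laws on different
  spaces to be compared.\<close>

primrec euler_mean :: "(real \<Rightarrow> real \<Rightarrow> real) \<Rightarrow> real \<Rightarrow> real \<Rightarrow> real \<Rightarrow> real \<Rightarrow> nat \<Rightarrow> (real \<Rightarrow> real) \<Rightarrow> real" where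
  "euler_mean D \<sigma> S h x 0 f = f x"
| "euler_mean D \<sigma> S h x (Suc k) f =
     euler_mean D \<sigma> S h x k (\<lambda>y. \<integral>z. f (y + D (S - real (Suc k) * h) y * h + \<sigma> * sqrt h * z) \<partial>std_gauss)"

lemma set_integral_near_const:
  fixes \<phi> :: "real \<Rightarrow> real"
  assumes i: "set_integrable lborel {a<..b} \<phi>" and "a \<le> b"
    and C: "\<And>s. s \<in> {a<..b} \<Longrightarrow> \<bar>\<phi> s - m\<bar> \<le> C"
  shows "\<bar>(LBINT s:{a<..b}. \<phi> s) - m * (b - a)\<bar> \<le> C * (b - a)"
proof -
  have ind: "integrable lborel (\<lambda>s. indicator {a<..b} s :: real)" "(\<integral>s. indicator {a<..b} s \<partial>lborel) = b - a"
    using \<open>a \<le> b\<close> by simp_all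
  have eq: "(LBINT s:{a<..b}. \<phi> s) - m * (b - a) = (\<integral>s. indicator {a<..b} s * \<phi> s - m * indicator {a<..b} s \<partial>lborel)"
    using i ind unfolding set_integrable_def set_lebesgue_integral_def by simp
  have "\<bar>(LBINT s:{a<..b}. \<phi> s) - m * (b - a)\<bar> \<le> (\<integral>s. C * indicator {a<..b} s \<partial>lborel)"
    unfolding eq
  proof (rule abs_integral_mono)
    show "\<bar>indicator {a<..b} s * \<phi> s - m * indicator {a<..b} s\<bar> \<le> C * indicator {a<..b} s" for s
      using C[of s] by (auto simp: indicator_def)
  qed (use i ind in \<open>auto simp: set_integrable_def\<close>)
  then show ?thesis using ind by simp
qed

lemma set_integral_split:
  fixes \<phi> :: "real \<Rightarrow> real"
  assumes i: "set_integrable lborel {p..r} \<phi>" and "p \<le> q" "q \<le> r"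
  shows "(LBINT s:{p..r}. \<phi> s) = (LBINT s:{p..q}. \<phi> s) + (LBINT s:{q<..r}. \<phi> s)"
    and "set_integrable lborel {p..q} \<phi>" "set_integrable lborel {q<..r} \<phi>"
proof -
  have "{p..q} \<subseteq> {p..r}" "{q<..r} \<subseteq> {p..r}" using assms by auto
  then show *: "set_integrable lborel {p..q} \<phi>" "set_integrable lborel {q<..r} \<phi>"
    by (auto intro: set_integrable_subset[OF i])
  have "{p..r} = {p..q} \<union> {q<..r}" using assms by auto
  then show "(LBINT s:{p..r}. \<phi> s) = (LBINT s:{p..q}. \<phi> s) + (LBINT s:{q<..r}. \<phi> s)"
    using set_integral_Un[OF ivl_disj_int_two(8) *] by simp
qed

context quadratic_control
begin

text \<open>Discrete Gronwall argument for a single path.\<close>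

lemma euler_error:
  fixes X w :: "real \<Rightarrow> real" and n :: nat
  assumes \<tau>: "0 < \<tau>" "\<tau> < S" and n: "0 < n" and h: "h = \<tau> / n"
    and cont: "continuous_on {0..\<tau>} X"
    and X: "\<And>t. t \<in> {0..\<tau>} \<Longrightarrow> X t = (LBINT s:{0..t}. drift (S - s) (X s)) + w t" and X0: "X 0 = x"
    and osc: "\<And>s s'. s \<in> {0..\<tau>} \<Longrightarrow> s' \<in> {0..\<tau>} \<Longrightarrow> \<bar>s - s'\<bar> \<le> h \<Longrightarrow> \<bar>X s - X s'\<bar> \<le> \<epsilon>"
    and he: "sqrt h \<le> \<epsilon>"
  defines "K \<equiv> Kd (S - \<tau>)" and "y \<equiv> euler drift S h x (\<lambda>k. w (real k * h))"
  shows "\<bar>y n - X \<tau>\<bar> \<le> 2 * \<epsilon> * exp (K * \<tau>)"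
    and "\<bar>h * (\<Sum>k<n. (drift (S - real (Suc k) * h) (y k))\<^sup>2) - (LBINT s:{0..\<tau>}. (drift (S - s) (X s))\<^sup>2)\<bar>
      \<le> \<tau> * (2 * Bd (S - \<tau>) * (K * (2 * \<epsilon> + 2 * \<epsilon> * exp (K * \<tau>))))"
proof -
  define s0 where "s0 = S - \<tau>"
  have s0: "0 < s0" using \<tau> by (simp add: s0_def)
  have K: "0 \<le> K" unfolding K_def using s0 by (intro Kd_nonneg) (simp add: s0_def)
  have hn: "0 < h" "real n * h = \<tau>" using \<tau> n by (auto simp: h)
  have \<epsilon>: "0 \<le> \<epsilon>" using he hn by (meson order_trans real_sqrt_ge_zero less_imp_le)
  define tk where "tk k = real k * h" for k :: nat
  have tk_Suc: "tk (Suc k) = tk k + h" for k by (simp add: tk_def algebra_simps)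
  have tk: "0 \<le> tk k" "tk k \<le> \<tau>" if "k \<le> n" for k
    using mult_right_mono[of "real k" "real n" h] that hn by (auto simp: tk_def)
  define \<phi> where "\<phi> s = drift (S - s) (X s)" for s
  \<comment> \<open>Continuity of the drift along the path provides the integrability needed to
    split the time integrals at grid points.\<close>
  have \<phi>_cont: "continuous_on {0..\<tau>} \<phi>"
  proof (rule continuous_onI)
    fix s e :: real assume s: "s \<in> {0..\<tau>}" and e: "0 < e"
    define e' where "e' = e / (2 * (K + 1))"
    have e': "0 < e'" using e K by (simp add: e'_def)
    obtain d where d: "0 < d" "\<And>s'. s' \<in> {0..\<tau>} \<Longrightarrow> dist s' s < d \<Longrightarrow> dist (X s') (X s) < e'"
      using cont s e' unfolding continuous_on_iff by metis
    show "\<exists>d>0. \<forall>s'\<in>{0..\<tau>}. dist s' s < d \<longrightarrow> dist (\<phi> s') (\<phi> s) \<le> e"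
    proof (intro exI[of _ "min d (e'\<^sup>2)"] conjI ballI impI)
      show "0 < min d (e'\<^sup>2)" using d e' by simp
      fix s' assume s': "s' \<in> {0..\<tau>}" "dist s' s < min d (e'\<^sup>2)"
      have "sqrt \<bar>s' - s\<bar> \<le> e'"
        using s' e' by (intro real_le_lsqrt) (auto simp: dist_real_def)
      moreover have "\<bar>X s' - X s\<bar> \<le> e'"
        using d(2)[of s'] s' by (simp add: dist_real_def)
      moreover have "\<bar>\<phi> s' - \<phi> s\<bar> \<le> K * (\<bar>X s' - X s\<bar> + sqrt \<bar>s' - s\<bar>)"
        using drift_continuity[of s0 "S - s'" "S - s" "X s'" "X s"] s s' s0
        unfolding \<phi>_def K_def s0_def by (simp add: abs_minus_commute)
      ultimately have "\<bar>\<phi> s' - \<phi> s\<bar> \<le> K * (e' + e')"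
        using K by (meson add_mono mult_left_mono order_trans)
      also have "\<dots> \<le> (K + 1) * (2 * e')" using e' K by (simp add: algebra_simps)
      also have "\<dots> = e" using K by (simp add: e'_def field_simps)
      finally show "dist (\<phi> s') (\<phi> s) \<le> e" by (simp add: dist_real_def)
    qed
  qed
  have \<phi>i: "set_integrable lborel {0..t} \<phi>" and \<phi>2i: "set_integrable lborel {0..t} (\<lambda>s. (\<phi> s)\<^sup>2)" if "t \<le> \<tau>" for t
  proof -
    have c: "continuous_on {0..t} \<phi>" by (rule continuous_on_subset[OF \<phi>_cont]) (use that in auto)
    show "set_integrable lborel {0..t} \<phi>" "set_integrable lborel {0..t} (\<lambda>s. (\<phi> s)\<^sup>2)"
      using c by (auto intro!: borel_integrable_atLeastAtMost' continuous_intros)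
  qed
  define m where "m k = drift (S - tk (Suc k)) (y k)" for k
  have ySuc: "y (Suc k) = y k + m k * h + (w (tk (Suc k)) - w (tk k))" for k
    by (simp add: y_def m_def tk_def)
  \<comment> \<open>One \<open>\<epsilon>\<close> is the oscillation of \<open>X\<close> over a
    step; the other bounds \<open>sqrt h\<close>, the contribution of the order 1/2 regularity of
    the drift in time.\<close>
  have m_near: "\<bar>\<phi> s - m k\<bar> \<le> K * (2 * \<epsilon> + \<bar>y k - X (tk k)\<bar>)"
    if k: "k < n" and s: "s \<in> {tk k<..tk (Suc k)}" for k s
  proof -
    have sT: "s \<in> {0..\<tau>}" "tk k \<in> {0..\<tau>}" "tk (Suc k) \<in> {0..\<tau>}"
      using s tk[of k] tk[of "Suc k"] k by auto
    have "\<bar>\<phi> s - m k\<bar> \<le> K * (\<bar>X s - y k\<bar> + sqrt \<bar>(S - s) - (S - tk (Suc k))\<bar>)"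
      unfolding \<phi>_def m_def K_def using sT s0
      by (intro drift_continuity) (auto simp: s0_def)
    also have "\<dots> \<le> K * ((\<epsilon> + \<bar>y k - X (tk k)\<bar>) + \<epsilon>)"
    proof (intro mult_left_mono add_mono K)
      have "\<bar>X s - X (tk k)\<bar> \<le> \<epsilon>" using s sT by (intro osc) (auto simp: tk_Suc)
      then show "\<bar>X s - y k\<bar> \<le> \<epsilon> + \<bar>y k - X (tk k)\<bar>" by linarith
      have "sqrt \<bar>(S - s) - (S - tk (Suc k))\<bar> \<le> sqrt h" using s by (intro real_sqrt_le_mono) (auto simp: tk_Suc)
      then show "sqrt \<bar>(S - s) - (S - tk (Suc k))\<bar> \<le> \<epsilon>" using he by linarith
    qed
    finally show ?thesis by (simp add: algebra_simps)
  qed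
  \<comment> \<open>The bound solves the recursion e' = (1 + K h) e + 2 \<epsilon> K h with initial
    value 0.\<close>
  have err: "\<bar>y k - X (tk k)\<bar> \<le> 2 * \<epsilon> * ((1 + K * h) ^ k - 1)" if "k \<le> n" for k
    using that
  proof (induction k)
    case 0
    then show ?case by (simp add: y_def tk_def X0)
  next
    case (Suc k)
    then have k: "k < n" "k \<le> n" by auto
    let ?I = "LBINT s:{tk k<..tk (Suc k)}. \<phi> s"
    have le: "tk k \<le> tk (Suc k)" using hn by (simp add: tk_Suc)
    note split = set_integral_split[OF \<phi>i[OF tk(2)[OF Suc.prems]] tk(1)[OF k(2)] le]
    have XS: "X (tk (Suc k)) = X (tk k) + ?I + (w (tk (Suc k)) - w (tk k))"
      using X[of "tk (Suc k)"] X[of "tk k"] tk[OF Suc.prems] tk[OF k(2)] split(1)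
      unfolding \<phi>_def[symmetric] by simp
    have near: "\<bar>?I - m k * h\<bar> \<le> K * (2 * \<epsilon> + \<bar>y k - X (tk k)\<bar>) * h"
      using set_integral_near_const[OF split(3) le m_near[OF k(1)]] by (simp add: tk_Suc)
    have "\<bar>y (Suc k) - X (tk (Suc k))\<bar> \<le> \<bar>y k - X (tk k)\<bar> + \<bar>?I - m k * h\<bar>"
      unfolding XS ySuc by linarith
    also have "\<dots> \<le> \<bar>y k - X (tk k)\<bar> + K * (2 * \<epsilon> + \<bar>y k - X (tk k)\<bar>) * h"
      using near by simp
    also have "\<dots> = (1 + K * h) * \<bar>y k - X (tk k)\<bar> + 2 * \<epsilon> * K * h" by (simp add: algebra_simps)
    also have "\<dots> \<le> (1 + K * h) * (2 * \<epsilon> * ((1 + K * h) ^ k - 1)) + 2 * \<epsilon> * K * h"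
      using Suc.IH k K hn by (intro add_right_mono mult_left_mono) auto
    also have "\<dots> = 2 * \<epsilon> * ((1 + K * h) ^ Suc k - 1)" by (simp add: algebra_simps)
    finally show ?case .
  qed
  have err': "\<bar>y k - X (tk k)\<bar> \<le> 2 * \<epsilon> * exp (K * \<tau>)" if k: "k \<le> n" for k
  proof -
    have "(1 + K * h) ^ k \<le> (1 + K * h) ^ n"
      using K hn k by (intro power_increasing) auto
    also have "\<dots> \<le> exp (K * h) ^ n"
      using K hn exp_ge_add_one_self[of "K * h"] by (intro power_mono) auto
    also have "\<dots> = exp (K * \<tau>)"
      using hn by (simp add: mult.assoc mult.commute flip: exp_of_nat_mult)
    finally have "2 * \<epsilon> * ((1 + K * h) ^ k - 1) \<le> 2 * \<epsilon> * exp (K * \<tau>)"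
      using \<epsilon> by (intro mult_left_mono) auto
    then show ?thesis using err[OF k] by linarith
  qed
  show "\<bar>y n - X \<tau>\<bar> \<le> 2 * \<epsilon> * exp (K * \<tau>)"
    using err'[of n] hn by (simp add: tk_def)
  define B where "B = Bd s0"
  have B: "\<bar>drift s x\<bar> \<le> B" if "s0 \<le> s" for s x
    unfolding B_def using s0 that by (rule drift_bound')
  define C where "C = 2 * B * (K * (2 * \<epsilon> + 2 * \<epsilon> * exp (K * \<tau>)))"
  have m2_near: "\<bar>(\<phi> s)\<^sup>2 - (m k)\<^sup>2\<bar> \<le> C" if k: "k < n" and s: "s \<in> {tk k<..tk (Suc k)}" for k s
  proof -
    have sT: "s \<in> {0..\<tau>}" "tk (Suc k) \<in> {0..\<tau>}"
      using s tk[of k] tk[of "Suc k"] k by auto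
    have "\<bar>(\<phi> s)\<^sup>2 - (m k)\<^sup>2\<bar> = \<bar>\<phi> s + m k\<bar> * \<bar>\<phi> s - m k\<bar>"
      by (simp add: power2_eq_square algebra_simps flip: abs_mult)
    also have "\<dots> \<le> (2 * B) * (K * (2 * \<epsilon> + 2 * \<epsilon> * exp (K * \<tau>)))"
    proof (intro mult_mono)
      show "\<bar>\<phi> s + m k\<bar> \<le> 2 * B"
        using B[of "S - s" "X s"] B[of "S - tk (Suc k)" "y k"] sT unfolding \<phi>_def m_def s0_def by simp
      have "K * (2 * \<epsilon> + \<bar>y k - X (tk k)\<bar>) \<le> K * (2 * \<epsilon> + 2 * \<epsilon> * exp (K * \<tau>))"
        using K err'[of k] k by (intro mult_left_mono add_left_mono) auto
      then show "\<bar>\<phi> s - m k\<bar> \<le> K * (2 * \<epsilon> + 2 * \<epsilon> * exp (K * \<tau>))"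
        using m_near[OF k s] by linarith
      show "0 \<le> 2 * B" using Bd_nonneg[of s0] s0 by (simp add: B_def)
    qed auto
    finally show ?thesis by (simp add: C_def)
  qed
  have "\<bar>h * (\<Sum>j<k. (m j)\<^sup>2) - (LBINT s:{0..tk k}. (\<phi> s)\<^sup>2)\<bar> \<le> tk k * C" if "k \<le> n" for k
    using that
  proof (induction k)
    case 0
    have "(LBINT s:{0..0}. (\<phi> s)\<^sup>2) = 0"
      unfolding set_lebesgue_integral_def
    proof (rule integral_eq_zero_AE)
      show "AE s in lborel. indicator {0..0} s *\<^sub>R (\<phi> s)\<^sup>2 = 0"
        using AE_lborel_singleton[of "0::real"] by eventually_elim simp
    qed
    then show ?case by (simp add: tk_def)
  next
    case (Suc k)
    then have k: "k < n" "k \<le> n" by auto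
    let ?I = "LBINT s:{tk k<..tk (Suc k)}. (\<phi> s)\<^sup>2"
    have le: "tk k \<le> tk (Suc k)" using hn by (simp add: tk_Suc)
    note split = set_integral_split[OF \<phi>2i[OF tk(2)[OF Suc.prems]] tk(1)[OF k(2)] le]
    have near: "\<bar>?I - (m k)\<^sup>2 * h\<bar> \<le> C * h"
      using set_integral_near_const[OF split(3) le m2_near[OF k(1)]] by (simp add: tk_Suc)
    have "\<bar>h * (\<Sum>j<Suc k. (m j)\<^sup>2) - (LBINT s:{0..tk (Suc k)}. (\<phi> s)\<^sup>2)\<bar>
      \<le> \<bar>h * (\<Sum>j<k. (m j)\<^sup>2) - (LBINT s:{0..tk k}. (\<phi> s)\<^sup>2)\<bar> + \<bar>?I - (m k)\<^sup>2 * h\<bar>"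
      unfolding split(1) by (simp add: algebra_simps)
    also have "\<dots> \<le> tk (Suc k) * C"
      using Suc.IH k near by (simp add: tk_Suc algebra_simps)
    finally show ?case .
  qed
  from this[of n] show "\<bar>h * (\<Sum>k<n. (drift (S - real (Suc k) * h) (y k))\<^sup>2) - (LBINT s:{0..\<tau>}. (drift (S - s) (X s))\<^sup>2)\<bar>
      \<le> \<tau> * (2 * Bd (S - \<tau>) * (K * (2 * \<epsilon> + 2 * \<epsilon> * exp (K * \<tau>))))"
    using hn by (simp add: m_def tk_def C_def B_def s0_def \<phi>_def)
qed

text \<open>Uniform continuity of \<open>X\<close> makes the oscillation assumption of
  \<open>euler_error\<close> hold with any \<open>\<epsilon>\<close> for fine grids, while the
  constants at duration \<open>S - \<tau>\<close> stay fixed. The second limit is what transfers the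
  running cost from the scheme to the solution.\<close>

lemma euler_tendsto:
  fixes X w :: "real \<Rightarrow> real"
  assumes \<tau>: "0 < \<tau>" "\<tau> < S" and cont: "continuous_on {0..\<tau>} X"
    and X: "\<And>t. t \<in> {0..\<tau>} \<Longrightarrow> X t = (LBINT s:{0..t}. drift (S - s) (X s)) + w t" and X0: "X 0 = x"
  defines "h \<equiv> \<lambda>n. \<tau> / real (Suc n)"
  defines "y \<equiv> \<lambda>n. euler drift S (h n) x (\<lambda>k. w (real k * h n))"
  shows "(\<lambda>n. y n (Suc n)) \<longlonglongrightarrow> X \<tau>"
    and "(\<lambda>n. h n * (\<Sum>k<Suc n. (drift (S - real (Suc k) * h n) (y n k))\<^sup>2)) \<longlonglongrightarrow> (LBINT s:{0..\<tau>}. (drift (S - s) (X s))\<^sup>2)"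
proof -
  define K where "K = Kd (S - \<tau>)"
  have K: "0 \<le> K" using \<tau> unfolding K_def by (intro Kd_nonneg) simp
  have hlim: "h \<longlonglongrightarrow> 0"
  proof -
    have "(\<lambda>n. \<tau> * inverse (real (Suc n))) \<longlonglongrightarrow> \<tau> * 0"
      by (intro tendsto_intros LIMSEQ_inverse_real_of_nat)
    then show ?thesis by (simp add: h_def divide_inverse)
  qed
  have uc: "uniformly_continuous_on {0..\<tau>} X"
    using cont by (rule compact_uniformly_continuous) simp
  have ev: "eventually (\<lambda>n. (\<forall>s\<in>{0..\<tau>}. \<forall>s'\<in>{0..\<tau>}. \<bar>s - s'\<bar> \<le> h n \<longrightarrow> \<bar>X s - X s'\<bar> \<le> \<epsilon>) \<and> sqrt (h n) \<le> \<epsilon>) sequentially"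
    if \<epsilon>: "0 < \<epsilon>" for \<epsilon>
  proof -
    obtain d where d: "0 < d" "\<And>s s'. s \<in> {0..\<tau>} \<Longrightarrow> s' \<in> {0..\<tau>} \<Longrightarrow> dist s' s < d \<Longrightarrow> dist (X s') (X s) < \<epsilon>"
      using uc \<epsilon> unfolding uniformly_continuous_on_def by metis
    have "eventually (\<lambda>n. h n < min d (\<epsilon>\<^sup>2)) sequentially"
      using order_tendstoD(2)[OF hlim, of "min d (\<epsilon>\<^sup>2)"] d \<epsilon> by simp
    then show ?thesis
    proof eventually_elim
      case (elim n)
      have "0 \<le> h n" using \<tau> by (simp add: h_def)
      then have "sqrt (h n) \<le> \<epsilon>" using elim \<epsilon> by (intro real_le_lsqrt) auto
      moreover have "\<bar>X s - X s'\<bar> \<le> \<epsilon>" if "s \<in> {0..\<tau>}" "s' \<in> {0..\<tau>}" "\<bar>s - s'\<bar> \<le> h n" for s s'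
        using d(2)[of s' s] that elim by (simp add: dist_real_def)
      ultimately show ?case by blast
    qed
  qed
  have bnd: "eventually (\<lambda>n. \<bar>y n (Suc n) - X \<tau>\<bar> \<le> 2 * \<epsilon> * exp (K * \<tau>) \<and>
      \<bar>h n * (\<Sum>k<Suc n. (drift (S - real (Suc k) * h n) (y n k))\<^sup>2) - (LBINT s:{0..\<tau>}. (drift (S - s) (X s))\<^sup>2)\<bar>
      \<le> \<tau> * (2 * Bd (S - \<tau>) * (K * (2 * \<epsilon> + 2 * \<epsilon> * exp (K * \<tau>))))) sequentially"
    if \<epsilon>: "0 < \<epsilon>" for \<epsilon>
    using ev[OF \<epsilon>]
  proof eventually_elim
    case (elim n)
    have "h n = \<tau> / real (Suc n)" by (simp add: h_def)
    from euler_error[OF \<tau> zero_less_Suc this cont X X0, of \<epsilon>] elim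
    show ?case unfolding K_def y_def by blast
  qed
  have lim: "Z \<longlonglongrightarrow> z" if Z: "\<And>\<epsilon>. 0 < \<epsilon> \<Longrightarrow> eventually (\<lambda>n. \<bar>Z n - z\<bar> \<le> A * \<epsilon>) sequentially" and A: "0 \<le> A"
    for Z :: "nat \<Rightarrow> real" and z A
  proof (rule tendstoI)
    fix e :: real assume e: "0 < e"
    have "eventually (\<lambda>n. \<bar>Z n - z\<bar> \<le> A * (e / (A + 1))) sequentially"
      using e A by (intro Z) auto
    moreover have "A * (e / (A + 1)) < e"
      using e A by (simp add: field_simps)
    ultimately show "eventually (\<lambda>n. dist (Z n) z < e) sequentially"
      by (auto elim: eventually_mono simp: dist_real_def)
  qed
  show "(\<lambda>n. y n (Suc n)) \<longlonglongrightarrow> X \<tau>"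
  proof (rule lim[where A = "2 * exp (K * \<tau>)"])
    show "eventually (\<lambda>n. \<bar>y n (Suc n) - X \<tau>\<bar> \<le> 2 * exp (K * \<tau>) * \<epsilon>) sequentially" if "0 < \<epsilon>" for \<epsilon>
      using bnd[OF that] by (auto elim: eventually_mono simp: mult_ac)
  qed simp
  show "(\<lambda>n. h n * (\<Sum>k<Suc n. (drift (S - real (Suc k) * h n) (y n k))\<^sup>2)) \<longlonglongrightarrow> (LBINT s:{0..\<tau>}. (drift (S - s) (X s))\<^sup>2)"
  proof (rule lim[where A = "\<tau> * (2 * Bd (S - \<tau>) * (K * (2 + 2 * exp (K * \<tau>))))"])
    show "eventually (\<lambda>n. \<bar>h n * (\<Sum>k<Suc n. (drift (S - real (Suc k) * h n) (y n k))\<^sup>2) - (LBINT s:{0..\<tau>}. (drift (S - s) (X s))\<^sup>2)\<bar>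
      \<le> \<tau> * (2 * Bd (S - \<tau>) * (K * (2 + 2 * exp (K * \<tau>)))) * \<epsilon>) sequentially" if "0 < \<epsilon>" for \<epsilon>
    proof -
      have *: "\<tau> * (2 * Bd (S - \<tau>) * (K * (2 * \<epsilon> + 2 * \<epsilon> * exp (K * \<tau>)))) =
        \<tau> * (2 * Bd (S - \<tau>) * (K * (2 + 2 * exp (K * \<tau>)))) * \<epsilon>"
        by (simp add: algebra_simps)
      show ?thesis
        using bnd[OF that] unfolding * by (rule eventually_mono) blast
    qed
    show "0 \<le> \<tau> * (2 * Bd (S - \<tau>) * (K * (2 + 2 * exp (K * \<tau>))))"
      using \<tau> K Bd_nonneg[of "S - \<tau>"] by (intro mult_nonneg_nonneg) auto
  qed
qed

end

context controlled_brownian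
begin

lemma euler_measurable:
  assumes t: "0 \<le> t" and h: "0 \<le> h" and "t + real k * h \<le> T"
  shows "(\<lambda>\<omega>. euler drift S h x (\<lambda>j. \<sigma> * B (t + real j * h) \<omega>) k) \<in> borel_measurable (F (t + real k * h))"
  using assms(3)
proof (induction k)
  case 0
  then show ?case by simp
next
  case (Suc k)
  let ?u = "t + real k * h" and ?v = "t + real (Suc k) * h"
  have uv: "0 \<le> ?u" "?u \<le> ?v" "?v \<le> T" using assms(1,2) Suc.prems by (auto simp: algebra_simps)
  have [measurable]: "(\<lambda>\<omega>. euler drift S h x (\<lambda>j. \<sigma> * B (t + real j * h) \<omega>) k) \<in> borel_measurable (F ?v)"
    using Suc.IH uv by (intro measurable_F_mono[of _ ?u ?v]) auto
  have [measurable]: "B ?u \<in> borel_measurable (F ?v)" "B ?v \<in> borel_measurable (F ?v)"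
    using uv by (auto intro!: measurable_B_F)
  show ?case unfolding euler.simps by measurable
qed

lemma expectation_euler_step:
  fixes S x t h :: real and f :: "real \<Rightarrow> real"
  assumes t: "0 \<le> t" and h: "0 < h" and k: "t + real (Suc k) * h \<le> T"
    and f [measurable]: "f \<in> borel_measurable borel" and fK: "\<And>x. \<bar>f x\<bar> \<le> K"
  defines "Y \<equiv> \<lambda>k \<omega>. euler drift S h x (\<lambda>j. \<sigma> * B (t + real j * h) \<omega>) k"
  shows "(\<integral>\<omega>. f (Y (Suc k) \<omega>) \<partial>M) =
    (\<integral>\<omega>. (\<integral>z. f (Y k \<omega> + drift (S - real (Suc k) * h) (Y k \<omega>) * h + \<sigma> * sqrt h * z) \<partial>std_gauss) \<partial>M)"
proof -
  let ?u = "t + real k * h" and ?v = "t + real (Suc k) * h"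
  have uv: "0 \<le> ?u" "?u < ?v" "?v \<le> T" "?v - ?u = h" using assms(1,2) k by (auto simp: algebra_simps)
  have [measurable]: "Y k \<in> borel_measurable (F ?u)"
    unfolding Y_def using t h uv by (intro euler_measurable) auto
  have "(\<lambda>\<omega>. Y k \<omega> + drift (S - real (Suc k) * h) (Y k \<omega>) * h) \<in> borel_measurable (F ?u)"
    by measurable
  from brownian_freeze[OF uv(1-3) this f fK, of \<sigma>] uv(4)
  have "(\<integral>\<omega>. f (Y k \<omega> + drift (S - real (Suc k) * h) (Y k \<omega>) * h + \<sigma> * (B ?v \<omega> - B ?u \<omega>)) \<partial>M) =
    (\<integral>\<omega>. (\<integral>z. f (Y k \<omega> + drift (S - real (Suc k) * h) (Y k \<omega>) * h + \<sigma> * sqrt h * z) \<partial>std_gauss) \<partial>M)"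
    by simp
  then show ?thesis by (simp add: Y_def right_diff_distrib)
qed

text \<open>Averaging over the last increment replaces \<open>f\<close> by another bounded
  measurable function one step earlier, so the induction has to run over all such
  \<open>f\<close>.\<close>

lemma expectation_euler:
  fixes f :: "real \<Rightarrow> real"
  assumes t: "0 \<le> t" and h: "0 < h" and k: "t + real k * h \<le> T"
    and f: "f \<in> borel_measurable borel" and fK: "\<And>x. \<bar>f x\<bar> \<le> K"
  shows "(\<integral>\<omega>. f (euler drift S h x (\<lambda>j. \<sigma> * B (t + real j * h) \<omega>) k) \<partial>M) = euler_mean drift \<sigma> S h x k f"
  using k f fK
proof (induction k arbitrary: f)
  case 0
  then show ?case by (simp add: prob_space)
next
  case (Suc k)
  note f = Suc.prems(2) and fK = Suc.prems(3)
  have [measurable]: "f \<in> borel_measurable borel" by (rule f)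
  let ?f = "\<lambda>y. \<integral>z. f (y + drift (S - real (Suc k) * h) y * h + \<sigma> * sqrt h * z) \<partial>std_gauss"
  have "?f \<in> borel_measurable borel" by measurable
  moreover have "\<bar>?f y\<bar> \<le> K" for y
  proof -
    have "\<bar>?f y\<bar> \<le> (\<integral>z. K \<partial>std_gauss)"
      by (rule abs_integral_mono) (auto intro: fK integrable_std_gauss_bounded[of _ K])
    then show ?thesis using std_gauss.prob_space by simp
  qed
  moreover have "t + real k * h \<le> T" using Suc.prems(1) h by (simp add: algebra_simps)
  ultimately show ?case
    unfolding expectation_euler_step[OF t h Suc.prems] euler_mean.simps by (intro Suc.IH) auto
qed

text \<open>Sums \<open>V_step_ge\<close> along the scheme. The accumulated defect
  \<open>C * real n * h\<^sup>2\<close> is of the order of the step length times the total duration,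
  hence vanishes for fine grids. \<open>C\<close> depends on \<open>s0\<close> only, which leaves
  \<open>S\<close> free to exceed the horizon by a safety margin in
  \<open>near_optimal\<close>.\<close>

lemma euler_value:
  assumes s0: "0 < s0"
  shows "\<exists>C\<ge>0. \<forall>S h n x t. 0 < h \<and> h \<le> 1 \<and> 0 \<le> t \<and> t + real n * h \<le> T \<and> s0 \<le> S - real n * h \<longrightarrow>
    V S x - C * real n * h\<^sup>2 + c * h * (\<Sum>k<n. \<integral>\<omega>. (drift (S - real (Suc k) * h) (euler drift S h x (\<lambda>j. \<sigma> * B (t + real j * h) \<omega>) k))\<^sup>2 \<partial>M)
    \<le> (\<integral>\<omega>. V (S - real n * h) (euler drift S h x (\<lambda>j. \<sigma> * B (t + real j * h) \<omega>) n) \<partial>M)"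
proof -
  obtain C where C: "0 \<le> C" "\<And>s h x. s0 \<le> s \<Longrightarrow> 0 < h \<Longrightarrow> h \<le> 1 \<Longrightarrow> V (s + h) x - C * h\<^sup>2 \<le>
    (\<integral>z. V s (x + drift s x * h + \<sigma> * sqrt h * z) \<partial>std_gauss) - c * h * (drift s x)\<^sup>2"
    using V_step_ge[OF s0] by blast
  show ?thesis
  proof (intro exI[of _ C] conjI allI impI C(1))
    fix S h x t :: real and n :: nat
    assume "0 < h \<and> h \<le> 1 \<and> 0 \<le> t \<and> t + real n * h \<le> T \<and> s0 \<le> S - real n * h"
    then have h: "0 < h" "h \<le> 1" and t: "0 \<le> t" and T: "t + real n * h \<le> T" "s0 \<le> S - real n * h" by auto
    define Y where "Y k \<omega> = euler drift S h x (\<lambda>j. \<sigma> * B (t + real j * h) \<omega>) k" for k \<omega>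
    have "V S x - C * real k * h\<^sup>2 + c * h * (\<Sum>j<k. \<integral>\<omega>. (drift (S - real (Suc j) * h) (Y j \<omega>))\<^sup>2 \<partial>M)
      \<le> (\<integral>\<omega>. V (S - real k * h) (Y k \<omega>) \<partial>M)" if "k \<le> n" for k
      using that
    proof (induction k)
      case 0
      then show ?case by (simp add: Y_def prob_space)
    next
      case (Suc k)
      have nk: "real (Suc k) * h \<le> real n * h" using Suc.prems h by (intro mult_right_mono) auto
      let ?s = "S - real (Suc k) * h"
      have s: "s0 \<le> ?s" "S - real k * h = ?s + h" using T nk by (auto simp: algebra_simps)
      have Tk: "t + real (Suc k) * h \<le> T" using T nk by simp
      have Yk [measurable]: "Y k \<in> borel_measurable M"
      proof (rule measurable_F_M)
        show "Y k \<in> borel_measurable (F (t + real k * h))"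
          unfolding Y_def using t h Tk by (intro euler_measurable) (auto simp: algebra_simps)
        show "t + real k * h \<in> {0..T}" using t h Tk by (auto simp: algebra_simps)
      qed
      let ?a = "\<lambda>\<omega>. drift ?s (Y k \<omega>)"
      let ?E = "\<lambda>\<omega>. \<integral>z. V ?s (Y k \<omega> + ?a \<omega> * h + \<sigma> * sqrt h * z) \<partial>std_gauss"
      have i1: "integrable M (\<lambda>\<omega>. V (S - real k * h) (Y k \<omega>))"
        by (rule integrable_const_bound[of _ Gb]) (auto intro: V_bound)
      have i2: "integrable M (\<lambda>\<omega>. (?a \<omega>)\<^sup>2)"
      proof (rule integrable_const_bound[of _ "(Bd s0)\<^sup>2"])
        have "(?a \<omega>)\<^sup>2 \<le> (Bd s0)\<^sup>2" for \<omega>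
          using power_mono[OF drift_bound'[OF s0 s(1)] abs_ge_zero, of "Y k \<omega>" 2] by simp
        then show "AE \<omega> in M. norm ((?a \<omega>)\<^sup>2) \<le> (Bd s0)\<^sup>2" by simp
      qed measurable
      have i3: "integrable M ?E"
      proof (rule integrable_const_bound[of _ Gb])
        show "AE \<omega> in M. norm (?E \<omega>) \<le> Gb"
        proof (rule AE_I2)
          fix \<omega>
          have "\<bar>?E \<omega>\<bar> \<le> (\<integral>z. Gb \<partial>std_gauss)"
            by (rule abs_integral_mono) (auto intro: V_bound integrable_V)
          then show "norm (?E \<omega>) \<le> Gb" using std_gauss.prob_space by simp
        qed
      qed measurable
      have "(\<integral>\<omega>. V (S - real k * h) (Y k \<omega>) - C * h\<^sup>2 + c * h * (?a \<omega>)\<^sup>2 \<partial>M) \<le> (\<integral>\<omega>. ?E \<omega> \<partial>M)"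
      proof (rule integral_mono)
        show "V (S - real k * h) (Y k \<omega>) - C * h\<^sup>2 + c * h * (?a \<omega>)\<^sup>2 \<le> ?E \<omega>" for \<omega>
          using C(2)[OF s(1) h, of "Y k \<omega>"] unfolding s(2) by simp
      qed (use i1 i2 i3 in auto)
      then have "(\<integral>\<omega>. V (S - real k * h) (Y k \<omega>) \<partial>M) - C * h\<^sup>2 + c * h * (\<integral>\<omega>. (?a \<omega>)\<^sup>2 \<partial>M) \<le> (\<integral>\<omega>. ?E \<omega> \<partial>M)"
        using i1 i2 by (simp add: prob_space)
      also have "\<dots> = (\<integral>\<omega>. V ?s (Y (Suc k) \<omega>) \<partial>M)"
        unfolding Y_def by (rule expectation_euler_step[OF t h(1) Tk, of _ Gb, symmetric]) (auto intro: V_bound)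
      finally show ?case
        using Suc by (simp add: algebra_simps)
    qed
    from this[of n] show "V S x - C * real n * h\<^sup>2 + c * h * (\<Sum>k<n. \<integral>\<omega>. (drift (S - real (Suc k) * h) (euler drift S h x (\<lambda>j. \<sigma> * B (t + real j * h) \<omega>) k))\<^sup>2 \<partial>M)
      \<le> (\<integral>\<omega>. V (S - real n * h) (euler drift S h x (\<lambda>j. \<sigma> * B (t + real j * h) \<omega>) n) \<partial>M)"
      by (simp add: Y_def)
  qed
qed

end

section \<open>Optimality of the feedback\<close>

context brownian_space
begin

text \<open>The intervals are closed on the left: the value chosen at a grid time is used from that
  time on, which makes the control progressively measurable. All of them lie in [t, T), so the
  integrals over {t..T} capture the whole control.\<close>

lemma step_control:
  fixes \<alpha> :: "nat \<Rightarrow> 'a \<Rightarrow> real" and n :: nat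
  assumes t: "0 \<le> t" and h: "0 < h" and T: "t + real n * h = T" and c: "0 \<le> c"
    and \<alpha>: "\<And>k. k < n \<Longrightarrow> \<alpha> k \<in> borel_measurable (F (t + real k * h))"
    and bnd: "\<And>k \<omega>. k < n \<Longrightarrow> \<bar>\<alpha> k \<omega>\<bar> \<le> A"
  defines "a \<equiv> \<lambda>s \<omega>. \<Sum>k<n. indicator {t + real k * h..<t + real (Suc k) * h} s * \<alpha> k \<omega>"
  shows "admissible M F T a"
    and "(LBINT s:{t..T}. a s \<omega>) = h * (\<Sum>k<n. \<alpha> k \<omega>)"
    and "(\<integral>\<^sup>+s\<in>{t..T}. ennreal (c * (a s \<omega>)\<^sup>2) \<partial>lborel) = ennreal (c * h * (\<Sum>k<n. (\<alpha> k \<omega>)\<^sup>2))"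
proof -
  let ?I = "\<lambda>k. {t + real k * h..<t + real (Suc k) * h}"
  have sub: "?I k \<subseteq> {t..T}" if "k < n" for k
  proof -
    have "0 \<le> real k * h" "real (Suc k) * h \<le> real n * h"
      using h that by (auto intro: mult_right_mono)
    then show ?thesis using T by auto
  qed
  have len: "measure lborel (?I k) = h" "emeasure lborel (?I k) < \<infinity>" for k
    using h by (simp_all add: algebra_simps)
  have ii: "integrable lborel (\<lambda>s. indicator (?I k) s * x)" "(\<integral>s. indicator (?I k) s * x \<partial>lborel) = h * x" for k and x :: real
    using len[of k] by simp_all
  have sq: "(a s \<omega>)\<^sup>2 = (\<Sum>k<n. indicator (?I k) s * (\<alpha> k \<omega>)\<^sup>2)" for s \<omega>
  proof -
    \<comment> \<open>Squaring the sum termwise rests on disjointness of the intervals. The extra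
      conjunct, that the sum of the earlier terms vanishes from the next grid time on, is what the
      induction needs to exclude cross terms.\<close>
    have "(t + real n * h \<le> s \<longrightarrow> (\<Sum>k<n. indicator (?I k) s * \<alpha> k \<omega>) = 0) \<and>
      (\<Sum>k<n. indicator (?I k) s * \<alpha> k \<omega>)\<^sup>2 = (\<Sum>k<n. indicator (?I k) s * (\<alpha> k \<omega>)\<^sup>2)" for n
    proof (induction n)
      case (Suc n)
      show ?case
      proof (cases "t + real n * h \<le> s")
        case True
        then have "(\<Sum>k<n. indicator (?I k) s * \<alpha> k \<omega>) = 0"
          "(\<Sum>k<n. indicator (?I k) s * (\<alpha> k \<omega>)\<^sup>2) = 0" using Suc by auto
        then show ?thesis by (simp add: indicator_def)
      next
        case False
        then have "s \<notin> ?I n" "\<not> t + real (Suc n) * h \<le> s" using h by (auto simp: algebra_simps)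
        then show ?thesis using Suc by simp
      qed
    qed simp
    then show ?thesis by (simp add: a_def)
  qed
  have ind_T: "indicator {t..T} s * (indicator (?I k) s * x) = indicator (?I k) s * x" if "k < n" for s k and x :: real
    using sub[OF that] by (auto simp: indicator_def)
  show "(LBINT s:{t..T}. a s \<omega>) = h * (\<Sum>k<n. \<alpha> k \<omega>)"
  proof -
    have "(LBINT s:{t..T}. a s \<omega>) = (\<integral>s. (\<Sum>k<n. indicator (?I k) s * \<alpha> k \<omega>) \<partial>lborel)"
      unfolding set_lebesgue_integral_def a_def
    proof (rule Bochner_Integration.integral_cong[OF refl])
      show "indicator {t..T} s *\<^sub>R (\<Sum>k<n. indicator (?I k) s * \<alpha> k \<omega>) = (\<Sum>k<n. indicator (?I k) s * \<alpha> k \<omega>)" for s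
        unfolding real_scaleR_def sum_distrib_left by (rule sum.cong[OF refl], rule ind_T) simp
    qed
    also have "\<dots> = (\<Sum>k<n. h * \<alpha> k \<omega>)"
      by (simp only: Bochner_Integration.integral_sum[OF ii(1)] ii(2))
    finally show ?thesis by (simp add: sum_distrib_left)
  qed
  show cost: "(\<integral>\<^sup>+s\<in>{t..T}. ennreal (c * (a s \<omega>)\<^sup>2) \<partial>lborel) = ennreal (c * h * (\<Sum>k<n. (\<alpha> k \<omega>)\<^sup>2))" for \<omega>
  proof -
    have "(\<integral>\<^sup>+s\<in>{t..T}. ennreal (c * (a s \<omega>)\<^sup>2) \<partial>lborel) = (\<integral>\<^sup>+s. ennreal (\<Sum>k<n. indicator (?I k) s * (c * (\<alpha> k \<omega>)\<^sup>2)) \<partial>lborel)"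
    proof (rule nn_integral_cong)
      fix s
      have "indicator {t..T} s * (c * (a s \<omega>)\<^sup>2) = (\<Sum>k<n. indicator (?I k) s * (c * (\<alpha> k \<omega>)\<^sup>2))"
        unfolding sq sum_distrib_left by (intro sum.cong refl) (use ind_T in \<open>simp add: mult.left_commute\<close>)
      then show "ennreal (c * (a s \<omega>)\<^sup>2) * indicator {t..T} s = ennreal (\<Sum>k<n. indicator (?I k) s * (c * (\<alpha> k \<omega>)\<^sup>2))"
        by (cases "s \<in> {t..T}") simp_all
    qed
    also have "\<dots> = ennreal (\<integral>s. (\<Sum>k<n. indicator (?I k) s * (c * (\<alpha> k \<omega>)\<^sup>2)) \<partial>lborel)"
      using ii c by (intro nn_integral_eq_integral Bochner_Integration.integrable_sum) (auto intro!: sum_nonneg)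
    also have "(\<integral>s. (\<Sum>k<n. indicator (?I k) s * (c * (\<alpha> k \<omega>)\<^sup>2)) \<partial>lborel) = (\<Sum>k<n. h * (c * (\<alpha> k \<omega>)\<^sup>2))"
      by (simp only: Bochner_Integration.integral_sum[OF ii(1)] ii(2))
    also have "\<dots> = c * h * (\<Sum>k<n. (\<alpha> k \<omega>)\<^sup>2)"
      by (simp add: sum_distrib_left mult_ac)
    finally show ?thesis .
  qed
  have prog: "progressively_measurable F T a"
    unfolding progressively_measurable_def
  proof
    fix u assume u: "u \<in> {0..T}"
    let ?P = "restrict_space borel {0..u} \<Otimes>\<^sub>M F u"
    have fst_m: "fst \<in> ?P \<rightarrow>\<^sub>M (borel :: real measure)"
      by (rule measurable_compose[OF measurable_fst]) (auto intro: measurable_restrict_space1)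
    have "(\<lambda>p. indicator (?I k) (fst p) * \<alpha> k (snd p)) \<in> borel_measurable ?P" if k: "k < n" for k
    proof (cases "t + real k * h \<le> u")
      case True
      have "\<alpha> k \<in> borel_measurable (F u)"
        using True u t h by (intro measurable_F_mono[OF \<alpha>[OF k]]) auto
      then have "(\<lambda>p. \<alpha> k (snd p)) \<in> borel_measurable ?P"
        by (rule measurable_compose[OF measurable_snd])
      moreover have "(\<lambda>p. indicator (?I k) (fst p) :: real) \<in> borel_measurable ?P"
        by (rule measurable_compose[OF fst_m]) simp
      ultimately show ?thesis by (rule borel_measurable_times[rotated])
    next
      case False
      \<comment> \<open>An interval starting after \<open>u\<close> contributes nothing on [0, u],
        so \<open>\<alpha> k\<close>, which need not be observable at time \<open>u\<close>, drops
        out.\<close>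
      have "(\<lambda>p. indicator (?I k) (fst p) * \<alpha> k (snd p)) \<in> borel_measurable ?P \<longleftrightarrow> (\<lambda>p. 0 :: real) \<in> borel_measurable ?P"
        using False by (intro measurable_cong) (auto simp: space_pair_measure space_restrict_space indicator_def)
      then show ?thesis by simp
    qed
    then have "(\<lambda>p. \<Sum>k<n. indicator (?I k) (fst p) * \<alpha> k (snd p)) \<in> borel_measurable ?P"
      by (intro borel_measurable_sum) auto
    then show "(\<lambda>(s, \<omega>). a s \<omega>) \<in> borel_measurable ?P"
      by (simp add: a_def case_prod_unfold)
  qed
  have abs_a: "\<bar>a s \<omega>\<bar> \<le> real n * \<bar>A\<bar>" for s \<omega>
  proof -
    have "\<bar>a s \<omega>\<bar> \<le> (\<Sum>k<n. \<bar>indicator (?I k) s * \<alpha> k \<omega>\<bar>)"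
      unfolding a_def by (rule sum_abs)
    also have "\<dots> \<le> (\<Sum>k<n. \<bar>A\<bar>)"
    proof (rule sum_mono)
      fix k assume "k \<in> {..<n}"
      then have "\<bar>\<alpha> k \<omega>\<bar> \<le> A" by (intro bnd) simp
      then show "\<bar>indicator (?I k) s * \<alpha> k \<omega>\<bar> \<le> \<bar>A\<bar>" by (auto simp: indicator_def)
    qed
    finally show ?thesis by simp
  qed
  have "(\<integral>\<^sup>+\<omega>. (\<integral>\<^sup>+s\<in>{0..T}. ennreal \<bar>a s \<omega>\<bar> \<partial>lborel) \<partial>M) \<le> (\<integral>\<^sup>+\<omega>. (\<integral>\<^sup>+s\<in>{0..T}. ennreal (real n * \<bar>A\<bar>) \<partial>lborel) \<partial>M)"
    using abs_a by (intro nn_integral_mono mult_right_mono ennreal_leI) auto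
  also have "\<dots> = ennreal (real n * \<bar>A\<bar>) * emeasure lborel {0..T}"
    by (simp add: nn_integral_cmult_indicator emeasure_space_1)
  also have "\<dots> < \<infinity>" by (simp add: ennreal_mult_less_top emeasure_lborel_Icc_eq)
  finally show "admissible M F T a" using prog by (simp add: admissible_def)
qed

end

context controlled_brownian
begin

lemma measurable_cost:
  assumes "progressively_measurable F T \<beta>" "0 \<le> p" "p \<le> q" "q \<le> T"
  shows "(\<lambda>\<omega>. \<integral>\<^sup>+s\<in>{p..q}. ennreal (c * (\<beta> s \<omega>)\<^sup>2) \<partial>lborel) \<in> borel_measurable M"
  by (intro measurable_F_M[OF measurable_set_nn_integral[OF assms(1), of p q "{p..q}" "\<lambda>x. ennreal (c * x\<^sup>2)"]])
    (use assms in auto)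

lemma payoff_ereal_le:
  assumes \<beta>: "admissible M F T \<beta>" and t: "0 \<le> t" "t < T"
  shows "ereal_expectation M (\<lambda>\<omega>. ereal (g (x + (LBINT s:{t..T}. \<beta> s \<omega>) + \<sigma> * (B T \<omega> - B t \<omega>))) - running_cost c \<beta> t T \<omega>)
    \<le> ereal (V (T - t) x)"
proof -
  have prog: "progressively_measurable F T \<beta>" using \<beta> by (simp add: admissible_def)
  have [measurable]: "(\<lambda>\<omega>. \<integral>\<^sup>+s\<in>{t..T}. ennreal (c * (\<beta> s \<omega>)\<^sup>2) \<partial>lborel) \<in> borel_measurable M"
    using t by (intro measurable_cost[OF prog]) auto
  have [measurable]: "(\<lambda>\<omega>. LBINT s:{t..T}. \<beta> s \<omega>) \<in> borel_measurable M"
    using t by (intro measurable_F_M[OF measurable_set_integral[OF prog, of t T]]) auto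
  have [measurable]: "B T \<in> borel_measurable M" "B t \<in> borel_measurable M" using t by auto
  let ?r = "\<lambda>\<omega>. g (x + (LBINT s:{t..T}. \<beta> s \<omega>) + \<sigma> * (B T \<omega> - B t \<omega>))"
  have rm: "?r \<in> borel_measurable M" by measurable
  have rK: "\<bar>?r \<omega>\<bar> \<le> Gb" for \<omega> by (rule g_bound)
  let ?C = "\<lambda>\<omega>. \<integral>\<^sup>+s\<in>{t..T}. ennreal (c * (\<beta> s \<omega>)\<^sup>2) \<partial>lborel"
  have Cm: "?C \<in> borel_measurable M" by measurable
  have int: "AE \<omega> in M. set_integrable lborel {t..T} (\<lambda>s. \<beta> s \<omega>)"
    using admissible_integrable[OF \<beta>] t
    by (auto elim!: eventually_mono intro: set_integrable_subset)
  show ?thesis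
  proof (cases "(\<integral>\<^sup>+\<omega>. ?C \<omega> \<partial>M) = \<infinity>")
    case True
    then show ?thesis
      using ereal_expectation_payoff(1)[OF prob_space_axioms rm rK Cm] by (simp add: running_cost_def)
  next
    case False
    then have fin: "(\<integral>\<^sup>+\<omega>. ?C \<omega> \<partial>M) < \<infinity>" by (simp add: less_top)
    show ?thesis
      using ereal_expectation_payoff(2)[OF prob_space_axioms rm rK Cm fin] payoff_le[OF prog t int fin, of x]
      by (simp add: running_cost_def)
  qed
qed

text \<open>The policy is the Euler feedback for the value with duration s0 left at time T, shifted
  by r; with s0 = r^4 that value stays below g up to a small error.\<close>

lemma near_optimal:
  assumes t: "0 \<le> t" "t < T" and \<epsilon>: "0 < \<epsilon>"
  shows "\<exists>a. admissible M F T a \<and> ereal (V (T - t) x - \<epsilon>) \<le>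
    ereal_expectation M (\<lambda>\<omega>. ereal (g (x + (LBINT s:{t..T}. a s \<omega>) + \<sigma> * (B T \<omega> - B t \<omega>))) - running_cost c a t T \<omega>)"
proof -
  \<comment> \<open>The coefficients of the three errors, each then multiplied by \<open>r\<close>:
    adding \<open>s0\<close> to the duration, lowering the starting point by \<open>r\<close>, and
    comparing \<open>V s0\<close> with the reward at the end. \<open>r\<close> is chosen to keep
    their sum within \<open>\<epsilon> / 2\<close>.\<close>
  define D where "D = \<kappa> * (LipU (T - t) * \<sigma>) / Glo + 2 * c * Bd (T - t) + \<kappa> * (Ghi / Glo) * \<sigma>\<^sup>2"
  have Tt: "0 < T - t" using t by simp
  have D: "0 \<le> \<kappa> * (LipU (T - t) * \<sigma>) / Glo" "0 \<le> 2 * c * Bd (T - t)" "0 \<le> \<kappa> * (Ghi / Glo) * \<sigma>\<^sup>2"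
    using \<kappa>_pos LipU_nonneg[OF Tt] \<sigma>_pos Glo_pos Ghi_pos c_pos Bd_nonneg[of "T - t"] Tt by auto
  define r where "r = min 1 (\<epsilon> / (2 * (D + 1)))"
  have D0: "0 \<le> D" using D unfolding D_def by linarith
  have r: "0 < r" "r \<le> 1" using \<epsilon> D0 by (auto simp: r_def)
  have "D * r \<le> (D + 1) * (\<epsilon> / (2 * (D + 1)))"
    using D0 r by (intro mult_mono) (auto simp: r_def)
  moreover have "(D + 1) * (\<epsilon> / (2 * (D + 1))) = \<epsilon> / 2" using D0 by (simp add: field_simps)
  ultimately have Dr: "D * r \<le> \<epsilon> / 2" by (simp only:)
  define s0 where "s0 = r ^ 4"
  have s0: "0 < s0" "sqrt s0 = r\<^sup>2" "s0 / r\<^sup>2 = r\<^sup>2"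
  proof -
    show "0 < s0" using r by (simp add: s0_def)
    have "s0 = (r\<^sup>2)\<^sup>2" by (simp add: s0_def flip: power_mult)
    then show "sqrt s0 = r\<^sup>2" "s0 / r\<^sup>2 = r\<^sup>2" using r by (simp_all add: power2_eq_square)
  qed
  have r2: "r\<^sup>2 \<le> r" using r by (simp add: power2_eq_square mult_left_le)
  define S where "S = T - t + s0"
  have V1: "V (T - t) x - \<kappa> * (LipU (T - t) * \<sigma>) / Glo * r - 2 * c * Bd (T - t) * r \<le> V S (x - r)"
  proof -
    have "\<bar>V S x - V (T - t) x\<bar> \<le> \<kappa> * (LipU (T - t) * \<sigma>) / Glo * r\<^sup>2"
      using V_holder_time[OF Tt order_refl, of s0 x] s0 by (simp add: S_def mult_ac)
    also have "\<dots> \<le> \<kappa> * (LipU (T - t) * \<sigma>) / Glo * r"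
      using D(1) r2 by (intro mult_left_mono)
    finally have 1: "\<bar>V S x - V (T - t) x\<bar> \<le> \<kappa> * (LipU (T - t) * \<sigma>) / Glo * r" .
    have "\<bar>V S (x - r) - V S x\<bar> \<le> 2 * c * Bd (T - t) * r"
      using V_lipschitz[OF Tt, of S "x - r" x] s0 r by (simp add: S_def)
    with 1 show ?thesis by linarith
  qed
  have V2: "V s0 y \<le> g (y + r) + \<kappa> * (Ghi / Glo) * \<sigma>\<^sup>2 * r" for y
  proof -
    have "\<kappa> * (Ghi / Glo) * (\<sigma>\<^sup>2 * s0 / r\<^sup>2) = \<kappa> * (Ghi / Glo) * \<sigma>\<^sup>2 * r\<^sup>2"
      by (simp only: times_divide_eq_right[symmetric] s0(3) mult.assoc)
    also have "\<dots> \<le> \<kappa> * (Ghi / Glo) * \<sigma>\<^sup>2 * r"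
      using D(3) r2 by (intro mult_left_mono)
    finally show ?thesis using V_terminal_le[OF s0(1) r(1), of y] by linarith
  qed
  obtain C where C: "0 \<le> C" "\<And>S h n x t. 0 < h \<Longrightarrow> h \<le> 1 \<Longrightarrow> 0 \<le> t \<Longrightarrow> t + real n * h \<le> T \<Longrightarrow> s0 \<le> S - real n * h \<Longrightarrow>
    V S x - C * real n * h\<^sup>2 + c * h * (\<Sum>k<n. \<integral>\<omega>. (drift (S - real (Suc k) * h) (euler drift S h x (\<lambda>j. \<sigma> * B (t + real j * h) \<omega>) k))\<^sup>2 \<partial>M)
    \<le> (\<integral>\<omega>. V (S - real n * h) (euler drift S h x (\<lambda>j. \<sigma> * B (t + real j * h) \<omega>) n) \<partial>M)"
    using euler_value[OF s0(1)] by meson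
  \<comment> \<open>The first bound makes the step at most 1 as \<open>euler_value\<close> requires;
    the second makes the accumulated defect, which equals
    \<open>C * (T - t)\<^sup>2 / real n\<close>, at most \<open>\<epsilon> / 2\<close>.\<close>
  obtain n :: nat where n: "max (T - t) (2 * C * (T - t)\<^sup>2 / \<epsilon>) < real n" using reals_Archimedean2 by blast
  then have n0: "0 < real n" using Tt by linarith
  define h where "h = (T - t) / n"
  have h: "0 < h" "h \<le> 1" "real n * h = T - t" "C * real n * h\<^sup>2 \<le> \<epsilon> / 2"
  proof -
    show "0 < h" "h \<le> 1" "real n * h = T - t" using Tt n0 n by (auto simp: h_def)
    have "C * real n * h\<^sup>2 = C * (T - t)\<^sup>2 / real n"
      using n0 by (simp add: h_def power2_eq_square)
    also have "\<dots> \<le> \<epsilon> / 2"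
      using n n0 \<epsilon> by (simp add: field_simps)
    finally show "C * real n * h\<^sup>2 \<le> \<epsilon> / 2" .
  qed
  define Y where "Y k \<omega> = euler drift S h (x - r) (\<lambda>j. \<sigma> * B (t + real j * h) \<omega>) k" for k \<omega>
  define \<alpha> where "\<alpha> k \<omega> = drift (S - real (Suc k) * h) (Y k \<omega>)" for k \<omega>
  define a where "a s \<omega> = (\<Sum>k<n. indicator {t + real k * h..<t + real (Suc k) * h} s * \<alpha> k \<omega>)" for s \<omega>
  have kT: "real k * h \<le> T - t" if "k \<le> n" for k
    using mult_right_mono[of "real k" "real n" h] that h by simp
  have Ym: "Y k \<in> borel_measurable (F (t + real k * h))" if "k \<le> n" for k
    unfolding Y_def using t h kT[OF that] by (intro euler_measurable) auto
  have Tn: "t + real n * h = T" using h by simp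
  have \<alpha>m: "\<alpha> k \<in> borel_measurable (F (t + real k * h))" if "k < n" for k
  proof -
    have [measurable]: "Y k \<in> borel_measurable (F (t + real k * h))" using Ym[of k] that by simp
    show ?thesis unfolding \<alpha>_def by measurable
  qed
  have \<alpha>b: "\<bar>\<alpha> k \<omega>\<bar> \<le> Bd s0" if "k < n" for k \<omega>
    unfolding \<alpha>_def using s0(1) kT[of "Suc k"] that by (intro drift_bound') (auto simp: S_def)
  note step = step_control[OF t(1) h(1) Tn less_imp_le[OF c_pos] \<alpha>m \<alpha>b]
  have sc1: "admissible M F T a"
    unfolding a_def[abs_def] by (rule step(1))
  have sc2: "(LBINT s:{t..T}. a s \<omega>) = h * (\<Sum>k<n. \<alpha> k \<omega>)" for \<omega>
    unfolding a_def by (rule step(2))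
  have sc3: "(\<integral>\<^sup>+s\<in>{t..T}. ennreal (c * (a s \<omega>)\<^sup>2) \<partial>lborel) = ennreal (c * h * (\<Sum>k<n. (\<alpha> k \<omega>)\<^sup>2))" for \<omega>
    unfolding a_def by (rule step(3))
  note sc = sc1 sc2 sc3
  have YM [measurable]: "Y k \<in> borel_measurable M" if "k \<le> n" for k
    using Ym[OF that] kT[OF that] t h by (intro measurable_F_M[OF Ym[OF that]]) auto
  have aM [measurable]: "\<alpha> k \<in> borel_measurable M" if "k < n" for k
    using kT[of k] that t h by (intro measurable_F_M[OF \<alpha>m[OF that]]) auto
  have Yn: "Y k \<omega> = x - r + h * (\<Sum>j<k. \<alpha> j \<omega>) + \<sigma> * (B (t + real k * h) \<omega> - B t \<omega>)" for k \<omega>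
  proof (induction k)
    case (Suc k)
    have "Y (Suc k) \<omega> = Y k \<omega> + \<alpha> k \<omega> * h + (\<sigma> * B (t + real (Suc k) * h) \<omega> - \<sigma> * B (t + real k * h) \<omega>)"
      by (simp add: Y_def \<alpha>_def)
    then show ?case using Suc by (simp add: algebra_simps)
  qed (simp add: Y_def)
  \<comment> \<open>The scheme starts from \<open>x - r\<close> while the controlled state starts
    from \<open>x\<close>. The state thus ends at \<open>Y n \<omega> + r\<close>, exactly the
    argument at which \<open>V2\<close> evaluates the reward.\<close>
  have state: "x + (LBINT s:{t..T}. a s \<omega>) + \<sigma> * (B T \<omega> - B t \<omega>) = Y n \<omega> + r" for \<omega>
    unfolding sc(2) using Yn[of n \<omega>] Tn by simp
  have rm: "(\<lambda>\<omega>. g (Y n \<omega> + r)) \<in> borel_measurable M" by measurable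
  have \<alpha>2i: "integrable M (\<lambda>\<omega>. (\<alpha> k \<omega>)\<^sup>2)" if "k < n" for k
  proof (rule integrable_const_bound[of _ "(Bd s0)\<^sup>2"])
    have "(\<alpha> k \<omega>)\<^sup>2 \<le> (Bd s0)\<^sup>2" for \<omega>
      using power_mono[OF \<alpha>b[OF that] abs_ge_zero, of \<omega> 2] by simp
    then show "AE \<omega> in M. norm ((\<alpha> k \<omega>)\<^sup>2) \<le> (Bd s0)\<^sup>2" by simp
  qed (use aM[OF that] in measurable)
  have ci: "integrable M (\<lambda>\<omega>. c * h * (\<Sum>k<n. (\<alpha> k \<omega>)\<^sup>2))"
    using \<alpha>2i by (intro integrable_mult_right Bochner_Integration.integrable_sum) auto
  have cI: "(\<integral>\<omega>. c * h * (\<Sum>k<n. (\<alpha> k \<omega>)\<^sup>2) \<partial>M) = c * h * (\<Sum>k<n. \<integral>\<omega>. (\<alpha> k \<omega>)\<^sup>2 \<partial>M)"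
    using \<alpha>2i by (simp add: Bochner_Integration.integral_sum)
  have c0: "0 \<le> c * h * (\<Sum>k<n. (\<alpha> k \<omega>)\<^sup>2)" for \<omega>
    using c_pos h by (intro mult_nonneg_nonneg sum_nonneg) auto
  have cost: "(\<integral>\<^sup>+\<omega>. ennreal (c * h * (\<Sum>k<n. (\<alpha> k \<omega>)\<^sup>2)) \<partial>M) = ennreal (c * h * (\<Sum>k<n. \<integral>\<omega>. (\<alpha> k \<omega>)\<^sup>2 \<partial>M))"
  proof -
    have "(\<integral>\<^sup>+\<omega>. ennreal (c * h * (\<Sum>k<n. (\<alpha> k \<omega>)\<^sup>2)) \<partial>M) = ennreal (\<integral>\<omega>. c * h * (\<Sum>k<n. (\<alpha> k \<omega>)\<^sup>2) \<partial>M)"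
      by (rule nn_integral_eq_integral[OF ci]) (rule AE_I2, rule c0)
    then show ?thesis by (simp only: cI)
  qed
  have cost0: "0 \<le> c * h * (\<Sum>k<n. \<integral>\<omega>. (\<alpha> k \<omega>)\<^sup>2 \<partial>M)"
    unfolding cI[symmetric] using c0 by (intro integral_nonneg_AE) auto
  have pay: "ereal_expectation M (\<lambda>\<omega>. ereal (g (x + (LBINT s:{t..T}. a s \<omega>) + \<sigma> * (B T \<omega> - B t \<omega>))) - running_cost c a t T \<omega>)
    = ereal ((\<integral>\<omega>. g (Y n \<omega> + r) \<partial>M) - c * h * (\<Sum>k<n. \<integral>\<omega>. (\<alpha> k \<omega>)\<^sup>2 \<partial>M))"
    unfolding state running_cost_def sc(3)
    using ereal_expectation_payoff(2)[OF prob_space_axioms rm g_bound, of "\<lambda>\<omega>. ennreal (c * h * (\<Sum>k<n. (\<alpha> k \<omega>)\<^sup>2))"] cost cost0 ci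
    by (simp add: borel_measurable_integrable)
  have val: "V S (x - r) - C * real n * h\<^sup>2 + c * h * (\<Sum>k<n. \<integral>\<omega>. (\<alpha> k \<omega>)\<^sup>2 \<partial>M) \<le> (\<integral>\<omega>. V s0 (Y n \<omega>) \<partial>M)"
    using C(2)[OF h(1,2) t(1), of n S "x - r"] h(3) Tn unfolding \<alpha>_def Y_def by (simp add: S_def)
  have "(\<integral>\<omega>. V s0 (Y n \<omega>) \<partial>M) \<le> (\<integral>\<omega>. g (Y n \<omega> + r) + \<kappa> * (Ghi / Glo) * \<sigma>\<^sup>2 * r \<partial>M)"
  proof (rule integral_mono)
    show "integrable M (\<lambda>\<omega>. V s0 (Y n \<omega>))"
      by (rule integrable_bounded_comp[of "V s0" "Y n" Gb]) (auto intro: V_bound)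
    show "integrable M (\<lambda>\<omega>. g (Y n \<omega> + r) + \<kappa> * (Ghi / Glo) * \<sigma>\<^sup>2 * r)"
      using integrable_const_bound[OF _ rm, of Gb] g_bound by simp
  qed (rule V2)
  also have "\<dots> = (\<integral>\<omega>. g (Y n \<omega> + r) \<partial>M) + \<kappa> * (Ghi / Glo) * \<sigma>\<^sup>2 * r"
    using integrable_const_bound[OF _ rm, of Gb] g_bound by (simp add: prob_space)
  finally have terminal: "(\<integral>\<omega>. V s0 (Y n \<omega>) \<partial>M) \<le> (\<integral>\<omega>. g (Y n \<omega> + r) \<partial>M) + \<kappa> * (Ghi / Glo) * \<sigma>\<^sup>2 * r" .
  have "D * r = \<kappa> * (LipU (T - t) * \<sigma>) / Glo * r + 2 * c * Bd (T - t) * r + \<kappa> * (Ghi / Glo) * \<sigma>\<^sup>2 * r"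
    by (simp add: D_def distrib_right)
  then have "V (T - t) x - \<epsilon> \<le> (\<integral>\<omega>. g (Y n \<omega> + r) \<partial>M) - c * h * (\<Sum>k<n. \<integral>\<omega>. (\<alpha> k \<omega>)\<^sup>2 \<partial>M)"
    using V1 val terminal h(4) Dr by linarith
  then show ?thesis
    using sc(1) pay by (intro exI[of _ a]) simp
qed

end

section \<open>The terminal state as a measurable functional of the noise\<close>

lemma euler_cong:
  assumes "\<And>j. j \<le> k \<Longrightarrow> w j = w' j"
  shows "euler D S h x w k = euler D S h x w' k"
  using assms by (induction k) auto

text \<open>Horizons increasing to \<open>T\<close>. The double successor puts the first one at
  \<open>T / 2\<close>, strictly inside the interval.\<close>

definition tau :: "real \<Rightarrow> nat \<Rightarrow> real" where
  "tau T m = T - T * inverse (real (Suc (Suc m)))"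

lemma tau_bounds: "0 < T \<Longrightarrow> 0 < tau T m" "0 < T \<Longrightarrow> tau T m < T"
proof -
  have i: "0 < inverse (real (Suc (Suc m)))" "inverse (real (Suc (Suc m))) < 1"
    by (simp_all add: inverse_less_1_iff)
  assume "0 < T"
  with mult_strict_left_mono[OF i(2) this] i(1) show "0 < tau T m" "tau T m < T"
    unfolding tau_def by auto
qed

lemma tau_mono: "0 < T \<Longrightarrow> m \<le> m' \<Longrightarrow> tau T m \<le> tau T m'"
  unfolding tau_def by (intro diff_left_mono mult_left_mono le_imp_inverse_le) auto

lemma tau_tendsto: "tau T \<longlonglongrightarrow> T"
proof -
  have "(\<lambda>m. T - T * inverse (real (Suc (Suc m)))) \<longlonglongrightarrow> T - T * 0"
    by (intro tendsto_intros LIMSEQ_Suc[OF LIMSEQ_inverse_real_of_nat])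
  then show ?thesis by (simp add: tau_def[abs_def])
qed

context quadratic_control
begin

definition euler_end :: "real \<Rightarrow> nat \<Rightarrow> nat \<Rightarrow> (real \<Rightarrow> real) \<Rightarrow> real" where
  "euler_end T m n p = euler drift T (tau T m / real (Suc n)) 0 (\<lambda>k. \<sigma> * p (real k * (tau T m / real (Suc n)))) (Suc n)"

text \<open>The optimal state at time T as a functional of the Brownian path.\<close>

definition terminal_map :: "real \<Rightarrow> (real \<Rightarrow> real) \<Rightarrow> real" where
  "terminal_map T p = lim (\<lambda>m. lim (\<lambda>n. euler_end T m n p))"

lemma grid_bounds:
  assumes "0 < T" "k \<le> Suc n"
  shows "0 \<le> real k * (tau T m / real (Suc n))" "real k * (tau T m / real (Suc n)) \<le> tau T m"
proof -
  have h0: "0 \<le> tau T m / real (Suc n)" using tau_bounds(1)[OF assms(1), of m] by simp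
  show "0 \<le> real k * (tau T m / real (Suc n))"
    by (rule mult_nonneg_nonneg[OF of_nat_0_le_iff h0])
  have "real k \<le> real (Suc n)" using assms(2) by simp
  from mult_right_mono[OF this h0] show "real k * (tau T m / real (Suc n)) \<le> tau T m"
    by (simp del: of_nat_Suc)
qed

text \<open>The joint independence of the noises is formulated for paths restricted to {0..T}; the
  grid lies inside this interval, so the restriction changes nothing.\<close>

lemma euler_end_restrict:
  assumes "0 < T"
  shows "euler_end T m n (restrict p {0..T}) = euler_end T m n p"
  unfolding euler_end_def
proof (rule euler_cong)
  fix j assume "j \<le> Suc n"
  from grid_bounds[OF assms this, of m] tau_bounds(2)[OF assms, of m]
  show "\<sigma> * restrict p {0..T} (real j * (tau T m / real (Suc n))) = \<sigma> * p (real j * (tau T m / real (Suc n)))"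
    by simp
qed

lemma terminal_map_restrict: "0 < T \<Longrightarrow> terminal_map T (restrict p {0..T}) = terminal_map T p"
  by (simp add: terminal_map_def euler_end_restrict)

text \<open>Each Euler scheme reads finitely many coordinates of the path, so the product algebra is
  enough although it does not see continuity. The two limits keep measurability even at paths where
  they fail to exist.\<close>

lemma measurable_terminal_map:
  assumes T: "0 < T"
  shows "terminal_map T \<in> borel_measurable (PiM {0..T} (\<lambda>_. borel))"
proof -
  have end_m: "euler_end T m n \<in> borel_measurable (PiM {0..T} (\<lambda>_. borel))" for m n
  proof -
    let ?h = "tau T m / real (Suc n)"
    have "(\<lambda>p. euler drift T ?h 0 (\<lambda>k. \<sigma> * p (real k * ?h)) k) \<in> borel_measurable (PiM {0..T} (\<lambda>_. borel))"
      if "k \<le> Suc n" for k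
      using that
    proof (induction k)
      case (Suc k)
      have [measurable]: "(\<lambda>p. euler drift T ?h 0 (\<lambda>k. \<sigma> * p (real k * ?h)) k) \<in> borel_measurable (PiM {0..T} (\<lambda>_. borel))"
        using Suc by simp
      have component: "(\<lambda>p. p (real j * ?h)) \<in> borel_measurable (PiM {0..T} (\<lambda>_. borel))" if "j \<le> Suc n" for j
        using grid_bounds[OF T that, of m] tau_bounds(2)[OF T, of m]
        by (intro measurable_component_singleton) simp
      note [measurable] = component[OF Suc_leD[OF Suc.prems]] component[OF Suc.prems]
      show ?case unfolding euler.simps by measurable
    qed simp
    from this[of "Suc n"] show ?thesis unfolding euler_end_def by simp
  qed
  have "(\<lambda>p. lim (\<lambda>n. euler_end T m n p)) \<in> borel_measurable (PiM {0..T} (\<lambda>_. borel))" for m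
    by (rule borel_measurable_lim_metric) (rule end_m)
  then show ?thesis
    unfolding terminal_map_def[abs_def] by (rule borel_measurable_lim_metric)
qed

end

locale optimal_state = controlled_brownian +
  fixes X :: "real \<Rightarrow> 'a \<Rightarrow> real"
  assumes sol: "sde_solution M F T \<sigma> (\<lambda>t x. drift (T - t) x) B X"
begin

definition control :: "real \<Rightarrow> 'a \<Rightarrow> real" where
  "control t \<omega> = (if t < T then drift (T - t) (X t \<omega>) else 0)"

text \<open>The almost sure event on which the pathwise arguments run: the integral equation before
  time T together with continuity of state and noise up to T.\<close>

definition good :: "'a \<Rightarrow> bool" where
  "good \<omega> \<longleftrightarrow> X 0 \<omega> = 0 \<and> continuous_on {0..T} (\<lambda>t. X t \<omega>) \<and> continuous_on {0..T} (\<lambda>t. B t \<omega>) \<and>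
    (\<forall>t\<in>{0..<T}. X t \<omega> = (LBINT s:{0..t}. drift (T - s) (X s \<omega>)) + \<sigma> * B t \<omega>)"

lemma AE_good: "AE \<omega> in M. good \<omega>"
proof -
  have "AE \<omega> in M. X 0 \<omega> = 0 \<and> continuous_on {0..T} (\<lambda>t. X t \<omega>) \<and>
        (\<forall>t\<in>{0..<T}. set_integrable lborel {0..t} (\<lambda>s. drift (T - s) (X s \<omega>)) \<and>
           X t \<omega> = (LBINT s:{0..t}. drift (T - s) (X s \<omega>)) + \<sigma> * B t \<omega>)"
    using sol unfolding sde_solution_def by blast
  moreover have "AE \<omega> in M. B 0 \<omega> = 0 \<and> continuous_on {0..T} (\<lambda>t. B t \<omega>)"
    using brownian unfolding brownian_motion_def by blast
  ultimately show ?thesis by eventually_elim (auto simp: good_def)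
qed

lemma progressive_X: "progressively_measurable F T X"
  using sol by (simp add: sde_solution_def)

lemma measurable_X [measurable]: "t \<in> {0..T} \<Longrightarrow> X t \<in> borel_measurable M"
  using progressive_slice[OF progressive_X, of t] by (intro measurable_F_M[of _ t]) auto

lemma progressive_control: "progressively_measurable F T control"
  unfolding progressively_measurable_def
proof
  fix u assume u: "u \<in> {0..T}"
  let ?P = "restrict_space borel {0..u} \<Otimes>\<^sub>M F u"
  have [measurable]: "fst \<in> ?P \<rightarrow>\<^sub>M (borel :: real measure)"
    by (rule measurable_compose[OF measurable_fst]) (auto intro: measurable_restrict_space1)
  have [measurable]: "(\<lambda>p. X (fst p) (snd p)) \<in> borel_measurable ?P"
    using progressive_X u unfolding progressively_measurable_def by (auto simp: case_prod_unfold)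
  have "(\<lambda>p. (T - fst p, X (fst p) (snd p))) \<in> ?P \<rightarrow>\<^sub>M borel \<Otimes>\<^sub>M borel" by measurable
  from measurable_compose[OF this measurable_drift]
  have [measurable]: "(\<lambda>p. drift (T - fst p) (X (fst p) (snd p))) \<in> borel_measurable ?P" by simp
  have "(\<lambda>p. if fst p < T then drift (T - fst p) (X (fst p) (snd p)) else 0) \<in> borel_measurable ?P"
    by measurable
  then show "(\<lambda>(s, \<omega>). control s \<omega>) \<in> borel_measurable ?P"
    by (simp add: control_def case_prod_unfold)
qed

lemma progressive_control_sq: "progressively_measurable F T (\<lambda>s \<omega>. (control s \<omega>)\<^sup>2)"
  using progressive_control unfolding progressively_measurable_def
  by (auto simp: case_prod_unfold)

lemma euler_path:
  assumes "good \<omega>" and \<tau>: "0 < \<tau>" "\<tau> < T"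
  defines "h \<equiv> \<lambda>n. \<tau> / real (Suc n)"
  defines "y \<equiv> \<lambda>n. euler drift T (h n) 0 (\<lambda>k. \<sigma> * B (real k * h n) \<omega>)"
  shows "(\<lambda>n. y n (Suc n)) \<longlonglongrightarrow> X \<tau> \<omega>"
    and "(\<lambda>n. h n * (\<Sum>k<Suc n. (drift (T - real (Suc k) * h n) (y n k))\<^sup>2)) \<longlonglongrightarrow> (LBINT s:{0..\<tau>}. (drift (T - s) (X s \<omega>))\<^sup>2)"
proof -
  have "{0..\<tau>} \<subseteq> {0..T}" using \<tau> by auto
  then have cont: "continuous_on {0..\<tau>} (\<lambda>t. X t \<omega>)"
    using assms(1) unfolding good_def by (blast intro: continuous_on_subset)
  have eq: "X t \<omega> = (LBINT s:{0..t}. drift (T - s) (X s \<omega>)) + \<sigma> * B t \<omega>" if "t \<in> {0..\<tau>}" for t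
    using assms(1) that \<tau> unfolding good_def by auto
  have 0: "X 0 \<omega> = 0" using assms(1) by (simp add: good_def)
  show "(\<lambda>n. y n (Suc n)) \<longlonglongrightarrow> X \<tau> \<omega>"
    unfolding y_def h_def by (rule euler_tendsto(1)[OF \<tau> cont eq 0])
  show "(\<lambda>n. h n * (\<Sum>k<Suc n. (drift (T - real (Suc k) * h n) (y n k))\<^sup>2)) \<longlonglongrightarrow> (LBINT s:{0..\<tau>}. (drift (T - s) (X s \<omega>))\<^sup>2)"
    unfolding y_def h_def by (rule euler_tendsto(2)[OF \<tau> cont eq 0])
qed

lemma X_tau_tendsto:
  assumes "good \<omega>"
  shows "(\<lambda>m. X (tau T m) \<omega>) \<longlonglongrightarrow> X T \<omega>"
proof (rule continuous_on_tendsto_compose[OF _ tau_tendsto])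
  show "continuous_on {0..T} (\<lambda>t. X t \<omega>)" using assms by (simp add: good_def)
  show "T \<in> {0..T}" using T_pos by simp
  show "eventually (\<lambda>m. tau T m \<in> {0..T}) sequentially"
    using tau_bounds[OF T_pos] by (intro always_eventually allI) (simp add: less_imp_le)
qed

text \<open>The limits are nested: refine the grid at a horizon before T, where the drift is
  Lipschitz, and only then let the horizon tend to T by continuity of the state. The error constants
  of a scheme running up to T would not be under control.\<close>

lemma terminal_map_eq:
  assumes "good \<omega>"
  shows "terminal_map T (\<lambda>t\<in>{0..T}. B t \<omega>) = X T \<omega>"
proof -
  have "(\<lambda>n. euler_end T m n (\<lambda>t. B t \<omega>)) \<longlonglongrightarrow> X (tau T m) \<omega>" for m
    unfolding euler_end_def
    by (rule euler_path(1)[OF assms tau_bounds[OF T_pos]])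
  then have "lim (\<lambda>n. euler_end T m n (\<lambda>t. B t \<omega>)) = X (tau T m) \<omega>" for m
    by (rule limI)
  then show ?thesis
    using limI[OF X_tau_tendsto[OF assms]] T_pos by (simp add: terminal_map_restrict) (simp add: terminal_map_def)
qed

text \<open>The right-hand side depends on the drift and on \<open>f\<close> but not on the space,
  filtration or Brownian motion. Uniqueness in law rests on this.\<close>

lemma mean_terminal:
  fixes f :: "real \<Rightarrow> real"
  assumes cf: "continuous_on UNIV f" and fK: "\<And>x. \<bar>f x\<bar> \<le> K"
  shows "(\<integral>\<omega>. f (X T \<omega>) \<partial>M) = lim (\<lambda>m. lim (\<lambda>n. euler_mean drift \<sigma> T (tau T m / real (Suc n)) 0 (Suc n) f))"
proof -
  have [measurable]: "f \<in> borel_measurable borel" using cf by (rule borel_measurable_continuous_onI)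
  have XT [measurable]: "X T \<in> borel_measurable M" using T_pos by simp
  have fc: "(\<lambda>n. f (u n)) \<longlonglongrightarrow> f l" if "u \<longlonglongrightarrow> l" for u :: "nat \<Rightarrow> real" and l
    by (rule continuous_on_tendsto_compose[OF cf that]) auto
  have "lim (\<lambda>n. euler_mean drift \<sigma> T (tau T m / real (Suc n)) 0 (Suc n) f) = (\<integral>\<omega>. f (X (tau T m) \<omega>) \<partial>M)" for m
  proof (rule limI)
    let ?h = "\<lambda>n. tau T m / real (Suc n)"
    note \<tau> = tau_bounds[OF T_pos, of m]
    have hT: "0 + real (Suc n) * ?h n \<le> T" "0 < ?h n" for n using \<tau> by auto
    have [measurable]: "X (tau T m) \<in> borel_measurable M" using \<tau> by simp
    have Em [measurable]: "(\<lambda>\<omega>. euler drift T (?h n) 0 (\<lambda>j. \<sigma> * B (real j * ?h n) \<omega>) (Suc n)) \<in> borel_measurable M" for n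
    proof -
      have "(\<lambda>\<omega>. euler drift T (?h n) 0 (\<lambda>j. \<sigma> * B (0 + real j * ?h n) \<omega>) (Suc n)) \<in> borel_measurable (F (0 + real (Suc n) * ?h n))"
        using hT[of n] by (intro euler_measurable) auto
      moreover have "0 + real (Suc n) * ?h n \<in> {0..T}" using hT[of n] \<tau> by simp
      ultimately have "(\<lambda>\<omega>. euler drift T (?h n) 0 (\<lambda>j. \<sigma> * B (0 + real j * ?h n) \<omega>) (Suc n)) \<in> borel_measurable M"
        by (rule measurable_F_M)
      then show ?thesis by (simp only: add_0)
    qed
    have eq: "euler_mean drift \<sigma> T (?h n) 0 (Suc n) f =
      (\<integral>\<omega>. f (euler drift T (?h n) 0 (\<lambda>j. \<sigma> * B (real j * ?h n) \<omega>) (Suc n)) \<partial>M)" for n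
    proof -
      have "(\<integral>\<omega>. f (euler drift T (?h n) 0 (\<lambda>j. \<sigma> * B (0 + real j * ?h n) \<omega>) (Suc n)) \<partial>M) =
        euler_mean drift \<sigma> T (?h n) 0 (Suc n) f"
        by (rule expectation_euler[OF order_refl hT(2) hT(1) _ fK]) simp
      then show ?thesis by (simp only: add_0)
    qed
    show "(\<lambda>n. euler_mean drift \<sigma> T (?h n) 0 (Suc n) f) \<longlonglongrightarrow> (\<integral>\<omega>. f (X (tau T m) \<omega>) \<partial>M)"
      unfolding eq
    proof (rule integral_dominated_convergence[where w = "\<lambda>_. K"])
      show "AE \<omega> in M. (\<lambda>n. f (euler drift T (?h n) 0 (\<lambda>j. \<sigma> * B (real j * ?h n) \<omega>) (Suc n))) \<longlonglongrightarrow> f (X (tau T m) \<omega>)"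
        using AE_good by (rule eventually_mono) (rule fc[OF euler_path(1)[OF _ \<tau>]])
      show "(\<lambda>\<omega>. f (euler drift T (?h n) 0 (\<lambda>j. \<sigma> * B (real j * ?h n) \<omega>) (Suc n))) \<in> borel_measurable M" for n
        by (rule measurable_compose[OF Em]) simp
    qed (use fK in \<open>auto simp del: euler.simps\<close>)
  qed
  moreover have "(\<lambda>m. \<integral>\<omega>. f (X (tau T m) \<omega>) \<partial>M) \<longlonglongrightarrow> (\<integral>\<omega>. f (X T \<omega>) \<partial>M)"
  proof (rule integral_dominated_convergence[where w = "\<lambda>_. K"])
    show "AE \<omega> in M. (\<lambda>m. f (X (tau T m) \<omega>)) \<longlonglongrightarrow> f (X T \<omega>)"
      using AE_good by (rule eventually_mono) (rule fc[OF X_tau_tendsto])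
    show "(\<lambda>\<omega>. f (X (tau T m) \<omega>)) \<in> borel_measurable M" for m
    proof -
      have [measurable]: "X (tau T m) \<in> borel_measurable M"
        using tau_bounds[OF T_pos, of m] by simp
      show ?thesis by measurable
    qed
  qed (use fK in auto)
  ultimately show ?thesis by (simp add: limI)
qed

lemma control_sq:
  assumes \<tau>: "0 < \<tau>" "\<tau> < T" and \<omega>: "\<omega> \<in> space M"
  shows "set_integrable lborel {0..\<tau>} (\<lambda>s. (control s \<omega>)\<^sup>2)"
    and "(LBINT s:{0..\<tau>}. (control s \<omega>)\<^sup>2) = (LBINT s:{0..\<tau>}. (drift (T - s) (X s \<omega>))\<^sup>2)"
    and "(\<integral>\<^sup>+s\<in>{0..\<tau>}. ennreal (c * (control s \<omega>)\<^sup>2) \<partial>lborel) = ennreal (c * (LBINT s:{0..\<tau>}. (control s \<omega>)\<^sup>2))"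
    and "0 \<le> (LBINT s:{0..\<tau>}. (control s \<omega>)\<^sup>2)"
    and "(LBINT s:{0..\<tau>}. (control s \<omega>)\<^sup>2) \<le> \<tau> * (Bd (T - \<tau>))\<^sup>2"
proof -
  have pt: "indicator {0..\<tau>} s * (control s \<omega>)\<^sup>2 \<le> (Bd (T - \<tau>))\<^sup>2 * indicator {0..\<tau>} s" for s
    using power_mono[OF drift_bound'[of "T - \<tau>" "T - s" "X s \<omega>"] abs_ge_zero, of 2] \<tau>
    by (auto simp: indicator_def control_def)
  have ind: "integrable lborel (\<lambda>s. (Bd (T - \<tau>))\<^sup>2 * indicator {0..\<tau>} s)"
    "(\<integral>s. (Bd (T - \<tau>))\<^sup>2 * indicator {0..\<tau>} s \<partial>lborel) = \<tau> * (Bd (T - \<tau>))\<^sup>2"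
    using \<tau> by simp_all
  have m: "(\<lambda>s. indicator {0..\<tau>} s * (control s \<omega>)\<^sup>2) \<in> borel_measurable borel"
    using \<tau> \<omega> by (intro progressive_path[OF progressive_control_sq, of 0 \<tau>]) auto
  have i: "integrable lborel (\<lambda>s. indicator {0..\<tau>} s * (control s \<omega>)\<^sup>2)"
    by (rule Bochner_Integration.integrable_bound[OF ind(1)]) (use m pt in auto)
  then show "set_integrable lborel {0..\<tau>} (\<lambda>s. (control s \<omega>)\<^sup>2)" by (simp add: set_integrable_def)
  show "(LBINT s:{0..\<tau>}. (control s \<omega>)\<^sup>2) = (LBINT s:{0..\<tau>}. (drift (T - s) (X s \<omega>))\<^sup>2)"
    using \<tau> by (intro set_lebesgue_integral_cong) (auto simp: control_def)
  show "0 \<le> (LBINT s:{0..\<tau>}. (control s \<omega>)\<^sup>2)"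
    unfolding set_lebesgue_integral_def by (intro integral_nonneg_AE) auto
  have "(LBINT s:{0..\<tau>}. (control s \<omega>)\<^sup>2) \<le> (\<integral>s. (Bd (T - \<tau>))\<^sup>2 * indicator {0..\<tau>} s \<partial>lborel)"
    unfolding set_lebesgue_integral_def real_scaleR_def by (rule integral_mono[OF i ind(1) pt])
  then show "(LBINT s:{0..\<tau>}. (control s \<omega>)\<^sup>2) \<le> \<tau> * (Bd (T - \<tau>))\<^sup>2" unfolding ind(2) .
  have "(\<integral>\<^sup>+s\<in>{0..\<tau>}. ennreal (c * (control s \<omega>)\<^sup>2) \<partial>lborel) =
    (\<integral>\<^sup>+s. ennreal (c * (indicator {0..\<tau>} s * (control s \<omega>)\<^sup>2)) \<partial>lborel)"
    by (intro nn_integral_cong) (auto simp: indicator_def)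
  also have "\<dots> = ennreal (\<integral>s. c * (indicator {0..\<tau>} s * (control s \<omega>)\<^sup>2) \<partial>lborel)"
    using c_pos i by (intro nn_integral_eq_integral integrable_mult_right) auto
  finally show "(\<integral>\<^sup>+s\<in>{0..\<tau>}. ennreal (c * (control s \<omega>)\<^sup>2) \<partial>lborel) = ennreal (c * (LBINT s:{0..\<tau>}. (control s \<omega>)\<^sup>2))"
    by (simp add: set_lebesgue_integral_def)
qed

lemma measurable_control_sq:
  assumes "0 < \<tau>" "\<tau> < T"
  shows "(\<lambda>\<omega>. LBINT s:{0..\<tau>}. (control s \<omega>)\<^sup>2) \<in> borel_measurable M"
  by (intro measurable_F_M[OF measurable_set_integral[OF progressive_control_sq, of 0 \<tau>]])
    (use assms in auto)

lemma integrable_control_sq: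
  assumes "0 < \<tau>" "\<tau> < T"
  shows "integrable M (\<lambda>\<omega>. LBINT s:{0..\<tau>}. (control s \<omega>)\<^sup>2)"
  by (rule integrable_const_bound[of _ "\<tau> * (Bd (T - \<tau>))\<^sup>2"])
    (use control_sq(4,5)[OF assms] measurable_control_sq[OF assms] in auto)

text \<open>The limit of \<open>euler_value\<close> with \<open>S = T\<close> as the mesh tends to
  0. Before \<open>\<tau>\<close> the drift is bounded by \<open>Bd (T - \<tau>)\<close> and V by
  \<open>Gb\<close>, so dominated convergence handles cost and value alike.\<close>

lemma value_at:
  assumes \<tau>: "0 < \<tau>" "\<tau> < T"
  shows "V T 0 + c * (\<integral>\<omega>. (LBINT s:{0..\<tau>}. (control s \<omega>)\<^sup>2) \<partial>M) \<le> (\<integral>\<omega>. V (T - \<tau>) (X \<tau> \<omega>) \<partial>M)"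
proof -
  define h where "h n = \<tau> / real (Suc n)" for n
  define Y where "Y n k \<omega> = euler drift T (h n) 0 (\<lambda>j. \<sigma> * B (real j * h n) \<omega>) k" for n k \<omega>
  define \<alpha> where "\<alpha> n k \<omega> = drift (T - real (Suc k) * h n) (Y n k \<omega>)" for n k \<omega>
  have h: "0 < h n" "real (Suc n) * h n = \<tau>" for n using \<tau> by (auto simp: h_def)
  have hlim: "h \<longlonglongrightarrow> 0"
  proof -
    have "(\<lambda>n. \<tau> * inverse (real (Suc n))) \<longlonglongrightarrow> \<tau> * 0"
      by (intro tendsto_intros LIMSEQ_inverse_real_of_nat)
    then show ?thesis by (simp add: h_def[abs_def] divide_inverse)
  qed
  have kh: "real k * h n \<le> \<tau>" if "k \<le> Suc n" for k n
    using mult_right_mono[of "real k" "real (Suc n)" "h n"] that h[of n] by (simp del: of_nat_Suc)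
  have Ym [measurable]: "Y n k \<in> borel_measurable M" if "k \<le> Suc n" for n k
  proof -
    have "(\<lambda>\<omega>. euler drift T (h n) 0 (\<lambda>j. \<sigma> * B (0 + real j * h n) \<omega>) k) \<in> borel_measurable (F (0 + real k * h n))"
      using h(1)[of n] kh[OF that] \<tau> by (intro euler_measurable) auto
    from measurable_F_M[OF this] show ?thesis
      using h(1)[of n] kh[OF that] \<tau> unfolding Y_def by simp
  qed
  have \<alpha>m: "\<alpha> n k \<in> borel_measurable M" if "k < Suc n" for n k
  proof -
    have [measurable]: "Y n k \<in> borel_measurable M" using that by (intro Ym) simp
    show ?thesis unfolding \<alpha>_def by measurable
  qed
  have \<alpha>b: "(\<alpha> n k \<omega>)\<^sup>2 \<le> (Bd (T - \<tau>))\<^sup>2" if "k < Suc n" for n k \<omega>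
  proof -
    have "\<bar>\<alpha> n k \<omega>\<bar> \<le> Bd (T - \<tau>)"
      unfolding \<alpha>_def using \<tau> kh[of "Suc k" n] that by (intro drift_bound') auto
    from power_mono[OF this abs_ge_zero, of 2] show ?thesis by simp
  qed
  have \<alpha>i: "integrable M (\<lambda>\<omega>. (\<alpha> n k \<omega>)\<^sup>2)" if "k < Suc n" for n k
  proof (rule integrable_const_bound[of _ "(Bd (T - \<tau>))\<^sup>2"])
    show "AE \<omega> in M. norm ((\<alpha> n k \<omega>)\<^sup>2) \<le> (Bd (T - \<tau>))\<^sup>2" using \<alpha>b[OF that] by simp
    show "(\<lambda>\<omega>. (\<alpha> n k \<omega>)\<^sup>2) \<in> borel_measurable M" using \<alpha>m[OF that] by measurable
  qed
  have XM [measurable]: "X \<tau> \<in> borel_measurable M" using \<tau> by simp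
  have costlim: "(\<lambda>n. \<integral>\<omega>. h n * (\<Sum>k<Suc n. (\<alpha> n k \<omega>)\<^sup>2) \<partial>M) \<longlonglongrightarrow> (\<integral>\<omega>. (LBINT s:{0..\<tau>}. (control s \<omega>)\<^sup>2) \<partial>M)"
  proof (rule integral_dominated_convergence[where w = "\<lambda>_. \<tau> * (Bd (T - \<tau>))\<^sup>2"])
    show "(\<lambda>\<omega>. LBINT s:{0..\<tau>}. (control s \<omega>)\<^sup>2) \<in> borel_measurable M"
      by (rule measurable_control_sq[OF \<tau>])
    show "(\<lambda>\<omega>. h n * (\<Sum>k<Suc n. (\<alpha> n k \<omega>)\<^sup>2)) \<in> borel_measurable M" for n
      by (intro borel_measurable_times borel_measurable_sum borel_measurable_power \<alpha>m) auto
    show "AE \<omega> in M. (\<lambda>n. h n * (\<Sum>k<Suc n. (\<alpha> n k \<omega>)\<^sup>2)) \<longlonglongrightarrow> (LBINT s:{0..\<tau>}. (control s \<omega>)\<^sup>2)"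
      using AE_good AE_space
    proof eventually_elim
      case (elim \<omega>)
      show ?case
        unfolding control_sq(2)[OF \<tau> elim(2)] \<alpha>_def Y_def h_def by (rule euler_path(2)[OF elim(1) \<tau>])
    qed
    show "AE \<omega> in M. norm (h n * (\<Sum>k<Suc n. (\<alpha> n k \<omega>)\<^sup>2)) \<le> \<tau> * (Bd (T - \<tau>))\<^sup>2" for n
    proof (rule AE_I2)
      fix \<omega>
      have "(\<Sum>k<Suc n. (\<alpha> n k \<omega>)\<^sup>2) \<le> real (Suc n) * (Bd (T - \<tau>))\<^sup>2"
        using sum_mono[of "{..<Suc n}" "\<lambda>k. (\<alpha> n k \<omega>)\<^sup>2" "\<lambda>_. (Bd (T - \<tau>))\<^sup>2"] \<alpha>b by simp
      then have "h n * (\<Sum>k<Suc n. (\<alpha> n k \<omega>)\<^sup>2) \<le> h n * (real (Suc n) * (Bd (T - \<tau>))\<^sup>2)"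
        using h(1)[of n] by (intro mult_left_mono) auto
      also have "\<dots> = \<tau> * (Bd (T - \<tau>))\<^sup>2"
        unfolding h(2)[of n, symmetric] by simp
      finally show "norm (h n * (\<Sum>k<Suc n. (\<alpha> n k \<omega>)\<^sup>2)) \<le> \<tau> * (Bd (T - \<tau>))\<^sup>2"
        using h(1)[of n] by (simp add: abs_of_nonneg sum_nonneg del: sum.lessThan_Suc)
    qed
  qed simp
  have vallim: "(\<lambda>n. \<integral>\<omega>. V (T - \<tau>) (Y n (Suc n) \<omega>) \<partial>M) \<longlonglongrightarrow> (\<integral>\<omega>. V (T - \<tau>) (X \<tau> \<omega>) \<partial>M)"
  proof (rule integral_dominated_convergence[where w = "\<lambda>_. Gb"])
    show "AE \<omega> in M. (\<lambda>n. V (T - \<tau>) (Y n (Suc n) \<omega>)) \<longlonglongrightarrow> V (T - \<tau>) (X \<tau> \<omega>)"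
      using AE_good
    proof eventually_elim
      case (elim \<omega>)
      have "isCont (V (T - \<tau>)) (X \<tau> \<omega>)" using \<tau> by (intro DERIV_isCont[OF V_deriv]) simp
      then show ?case
        by (rule isCont_tendsto_compose) (use euler_path(1)[OF elim \<tau>] in \<open>simp add: Y_def h_def del: euler.simps\<close>)
    qed
  qed (auto simp: V_bound)
  have T\<tau>: "0 < T - \<tau>" using \<tau> by simp
  obtain C where C: "0 \<le> C" "\<And>S h n x t. 0 < h \<Longrightarrow> h \<le> 1 \<Longrightarrow> 0 \<le> t \<Longrightarrow> t + real n * h \<le> T \<Longrightarrow> T - \<tau> \<le> S - real n * h \<Longrightarrow>
    V S x - C * real n * h\<^sup>2 + c * h * (\<Sum>k<n. \<integral>\<omega>. (drift (S - real (Suc k) * h) (euler drift S h x (\<lambda>j. \<sigma> * B (t + real j * h) \<omega>) k))\<^sup>2 \<partial>M)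
    \<le> (\<integral>\<omega>. V (S - real n * h) (euler drift S h x (\<lambda>j. \<sigma> * B (t + real j * h) \<omega>) n) \<partial>M)"
    using euler_value[OF T\<tau>] by meson
  have "eventually (\<lambda>n. h n \<le> 1) sequentially"
    using order_tendstoD(2)[OF hlim, of 1] by (auto elim: eventually_mono)
  then have ev: "eventually (\<lambda>n. V T 0 - C * \<tau> * h n + c * (\<integral>\<omega>. h n * (\<Sum>k<Suc n. (\<alpha> n k \<omega>)\<^sup>2) \<partial>M)
    \<le> (\<integral>\<omega>. V (T - \<tau>) (Y n (Suc n) \<omega>) \<partial>M)) sequentially"
  proof eventually_elim
    case (elim n)
    have e1: "C * real (Suc n) * (h n)\<^sup>2 = C * \<tau> * h n"
      unfolding h(2)[of n, symmetric] by (simp add: power2_eq_square)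
    have e2: "(\<integral>\<omega>. h n * (\<Sum>k<Suc n. (\<alpha> n k \<omega>)\<^sup>2) \<partial>M) = h n * (\<Sum>k<Suc n. \<integral>\<omega>. (\<alpha> n k \<omega>)\<^sup>2 \<partial>M)"
      using \<alpha>i by (subst integral_mult_right_zero, subst Bochner_Integration.integral_sum) auto
    have "0 + real (Suc n) * h n \<le> T" "T - \<tau> \<le> T - real (Suc n) * h n" using \<tau> h(2)[of n] by simp_all
    note le = C(2)[OF h(1) elim order_refl this, of 0, unfolded e1 h(2)]
    show ?case unfolding e2 unfolding \<alpha>_def Y_def using le by (simp only: add_0 mult.assoc)
  qed
  have "(\<lambda>n. V T 0 - C * \<tau> * h n + c * (\<integral>\<omega>. h n * (\<Sum>k<Suc n. (\<alpha> n k \<omega>)\<^sup>2) \<partial>M)) \<longlonglongrightarrow>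
    V T 0 - C * \<tau> * 0 + c * (\<integral>\<omega>. (LBINT s:{0..\<tau>}. (control s \<omega>)\<^sup>2) \<partial>M)"
    by (intro tendsto_intros hlim costlim)
  from tendsto_le[OF sequentially_bot vallim this ev] show ?thesis by simp
qed

text \<open>The value at \<open>tau T m\<close> is compared with the reward at T in two shifts of
  \<open>\<delta>\<close>: one from \<open>V_terminal_le\<close>, one because the state at
  \<open>tau T m\<close> exceeds \<open>X T \<omega> + \<delta>\<close> with vanishing probability.
  The cost is kept up to the fixed \<open>m0\<close> while \<open>m\<close> grows; right continuity
  of \<open>g\<close> then removes the shift.\<close>

lemma cost_bound_at:
  assumes rc: "\<And>x. continuous (at_right x) g"
  shows "V T 0 + c * (\<integral>\<omega>. (LBINT s:{0..tau T m0}. (control s \<omega>)\<^sup>2) \<partial>M) \<le> (\<integral>\<omega>. g (X T \<omega>) \<partial>M)"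
proof -
  define d where "d m = c * (\<integral>\<omega>. (LBINT s:{0..tau T m}. (control s \<omega>)\<^sup>2) \<partial>M)" for m
  note tb = tau_bounds[OF T_pos]
  have XT [measurable]: "X T \<in> borel_measurable M" using T_pos by simp
  have Xt [measurable]: "X (tau T m) \<in> borel_measurable M" for m using tb[of m] by simp
  have gi: "integrable M (\<lambda>\<omega>. g (\<xi> \<omega>))" if "\<xi> \<in> borel_measurable M" for \<xi>
    using that g_bound by (intro integrable_bounded_comp[of g \<xi> Gb]) auto
  have dmono: "d m0 \<le> d m" if "m0 \<le> m" for m
    unfolding d_def
  proof (intro mult_left_mono integral_mono_AE integrable_control_sq tb)
    show "AE \<omega> in M. (LBINT s:{0..tau T m0}. (control s \<omega>)\<^sup>2) \<le> (LBINT s:{0..tau T m}. (control s \<omega>)\<^sup>2)"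
    proof (rule AE_I2)
      fix \<omega> assume \<omega>: "\<omega> \<in> space M"
      show "(LBINT s:{0..tau T m0}. (control s \<omega>)\<^sup>2) \<le> (LBINT s:{0..tau T m}. (control s \<omega>)\<^sup>2)"
        using control_sq(1)[OF tb \<omega>, of m0] control_sq(1)[OF tb \<omega>, of m] tau_mono[OF T_pos that]
        unfolding set_lebesgue_integral_def set_integrable_def
        by (intro integral_mono) (auto simp: indicator_def)
    qed
  qed (use c_pos in simp)
  have main: "V T 0 + d m0 \<le> (\<integral>\<omega>. g (X T \<omega> + 2 * \<delta>) \<partial>M)" if \<delta>: "0 < \<delta>" for \<delta>
  proof -
    define Ib where "Ib m \<omega> = (if X T \<omega> + \<delta> < X (tau T m) \<omega> then 1 else 0 :: real)" for m \<omega>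
    have [measurable]: "Ib m \<in> borel_measurable M" for m unfolding Ib_def by measurable
    have Ii: "integrable M (Ib m)" for m by (rule integrable_const_bound[of _ 1]) (auto simp: Ib_def)
    define K where "K = \<kappa> * (Ghi / Glo)"
    define e where "e m = K * (\<sigma>\<^sup>2 * (T - tau T m) / \<delta>\<^sup>2)" for m
    have I0: "(\<lambda>m. \<integral>\<omega>. Ib m \<omega> \<partial>M) \<longlonglongrightarrow> (\<integral>\<omega>. 0 \<partial>M)"
    proof (rule integral_dominated_convergence[where w = "\<lambda>_. 1"])
      show "AE \<omega> in M. (\<lambda>m. Ib m \<omega>) \<longlonglongrightarrow> 0"
        using AE_good
      proof eventually_elim
        case (elim \<omega>)
        have "eventually (\<lambda>m. X (tau T m) \<omega> < X T \<omega> + \<delta>) sequentially"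
          using \<delta> by (intro order_tendstoD(2)[OF X_tau_tendsto[OF elim]]) simp
        then have "eventually (\<lambda>m. Ib m \<omega> = 0) sequentially"
          by eventually_elim (simp add: Ib_def)
        then show ?case by (rule tendsto_eventually)
      qed
    qed (auto simp: Ib_def)
    have bound: "V T 0 + d m \<le> (\<integral>\<omega>. g (X T \<omega> + 2 * \<delta>) \<partial>M) + 2 * Gb * (\<integral>\<omega>. Ib m \<omega> \<partial>M) + e m" for m
    proof -
      have "V T 0 + d m \<le> (\<integral>\<omega>. V (T - tau T m) (X (tau T m) \<omega>) \<partial>M)"
        unfolding d_def by (rule value_at[OF tb])
      also have "\<dots> \<le> (\<integral>\<omega>. g (X T \<omega> + 2 * \<delta>) + 2 * Gb * Ib m \<omega> + e m \<partial>M)"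
      proof (rule integral_mono)
        show "integrable M (\<lambda>\<omega>. V (T - tau T m) (X (tau T m) \<omega>))"
          by (rule integrable_bounded_comp[of "V (T - tau T m)" "X (tau T m)" Gb]) (auto intro: V_bound)
        show "integrable M (\<lambda>\<omega>. g (X T \<omega> + 2 * \<delta>) + 2 * Gb * Ib m \<omega> + e m)"
          using gi[of "\<lambda>\<omega>. X T \<omega> + 2 * \<delta>"] Ii[of m] by simp
        show "V (T - tau T m) (X (tau T m) \<omega>) \<le> g (X T \<omega> + 2 * \<delta>) + 2 * Gb * Ib m \<omega> + e m" for \<omega>
          using V_terminal_le[of "T - tau T m" \<delta> "X (tau T m) \<omega>"] tb[of m] \<delta>
            g_bound[of "X (tau T m) \<omega> + \<delta>"] g_bound[of "X T \<omega> + 2 * \<delta>"]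
            monoD[OF mono_g, of "X (tau T m) \<omega> + \<delta>" "X T \<omega> + 2 * \<delta>"]
          unfolding e_def K_def by (cases "X T \<omega> + \<delta> < X (tau T m) \<omega>") (auto simp: Ib_def)
      qed
      also have "\<dots> = (\<integral>\<omega>. g (X T \<omega> + 2 * \<delta>) \<partial>M) + 2 * Gb * (\<integral>\<omega>. Ib m \<omega> \<partial>M) + e m"
        using gi[of "\<lambda>\<omega>. X T \<omega> + 2 * \<delta>"] Ii[of m] by (simp add: prob_space)
      finally show ?thesis .
    qed
    have e0: "e \<longlonglongrightarrow> K * (\<sigma>\<^sup>2 * (T - T) / \<delta>\<^sup>2)"
      unfolding e_def by (intro tendsto_intros tau_tendsto) (use \<delta> in simp)
    have "(\<lambda>m. (\<integral>\<omega>. g (X T \<omega> + 2 * \<delta>) \<partial>M) + 2 * Gb * (\<integral>\<omega>. Ib m \<omega> \<partial>M) + e m) \<longlonglongrightarrow>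
      (\<integral>\<omega>. g (X T \<omega> + 2 * \<delta>) \<partial>M) + 2 * Gb * (\<integral>\<omega>. 0 \<partial>M) + K * (\<sigma>\<^sup>2 * (T - T) / \<delta>\<^sup>2)"
      by (intro tendsto_intros I0 e0)
    then have "(\<lambda>m. (\<integral>\<omega>. g (X T \<omega> + 2 * \<delta>) \<partial>M) + 2 * Gb * (\<integral>\<omega>. Ib m \<omega> \<partial>M) + e m) \<longlonglongrightarrow>
      (\<integral>\<omega>. g (X T \<omega> + 2 * \<delta>) \<partial>M)" by simp
    moreover have "\<exists>N. \<forall>m\<ge>N. V T 0 + d m0 \<le> (\<integral>\<omega>. g (X T \<omega> + 2 * \<delta>) \<partial>M) + 2 * Gb * (\<integral>\<omega>. Ib m \<omega> \<partial>M) + e m"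
      using dmono bound by (intro exI[of _ m0]) (meson add_left_mono order_trans)
    ultimately show ?thesis by (rule LIMSEQ_le_const)
  qed
  have glim: "(\<lambda>k. g (x + 2 * inverse (real (Suc k)))) \<longlonglongrightarrow> g x" for x
  proof (rule filterlim_compose[of g "nhds (g x)" "at_right x"])
    show "(g \<longlongrightarrow> g x) (at_right x)" using rc[of x] by (simp add: continuous_within)
    show "LIM k sequentially. x + 2 * inverse (real (Suc k)) :> at_right x"
    proof (rule filterlim_at_withinI)
      have "(\<lambda>k. x + 2 * inverse (real (Suc k))) \<longlonglongrightarrow> x + 2 * 0"
        by (intro tendsto_intros LIMSEQ_inverse_real_of_nat)
      then show "(\<lambda>k. x + 2 * inverse (real (Suc k))) \<longlonglongrightarrow> x" by simp
    qed (auto intro!: always_eventually)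
  qed
  have "(\<lambda>k. \<integral>\<omega>. g (X T \<omega> + 2 * inverse (real (Suc k))) \<partial>M) \<longlonglongrightarrow> (\<integral>\<omega>. g (X T \<omega>) \<partial>M)"
  proof (rule integral_dominated_convergence[where w = "\<lambda>_. Gb"])
    show "AE \<omega> in M. (\<lambda>k. g (X T \<omega> + 2 * inverse (real (Suc k)))) \<longlonglongrightarrow> g (X T \<omega>)"
      by (rule AE_I2) (rule glim)
    show "(\<lambda>\<omega>. g (X T \<omega> + 2 * inverse (real (Suc k)))) \<in> borel_measurable M" for k by measurable
    show "AE \<omega> in M. norm (g (X T \<omega> + 2 * inverse (real (Suc k)))) \<le> Gb" for k
      by (rule AE_I2) (simp add: g_bound del: of_nat_Suc)
  qed auto
  then have "V T 0 + d m0 \<le> (\<integral>\<omega>. g (X T \<omega>) \<partial>M)"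
    by (rule LIMSEQ_le_const) (use main in auto)
  then show ?thesis by (simp add: d_def)
qed

text \<open>Monotone convergence extends the cost bound from the horizons \<open>tau T m\<close> to
  T, and in particular shows that the feedback has finite expected cost although its bound is
  unbounded near T. The second claim ensures that the difference inside \<open>ennreal\<close> is
  not truncated at 0.\<close>

lemma value_attained:
  assumes rc: "\<And>x. continuous (at_right x) g"
  shows "(\<integral>\<^sup>+\<omega>. (\<integral>\<^sup>+s\<in>{0..T}. ennreal (c * (control s \<omega>)\<^sup>2) \<partial>lborel) \<partial>M) \<le> ennreal ((\<integral>\<omega>. g (X T \<omega>) \<partial>M) - V T 0)"
    and "V T 0 \<le> (\<integral>\<omega>. g (X T \<omega>) \<partial>M)"
proof -
  note tb = tau_bounds[OF T_pos]
  let ?f = "\<lambda>\<omega> s. ennreal (c * (control s \<omega>)\<^sup>2)"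
  have q: "(\<integral>\<^sup>+\<omega>. (\<integral>\<^sup>+s\<in>{0..tau T m}. ?f \<omega> s \<partial>lborel) \<partial>M) \<le> ennreal ((\<integral>\<omega>. g (X T \<omega>) \<partial>M) - V T 0)" for m
  proof -
    have "(\<integral>\<^sup>+\<omega>. (\<integral>\<^sup>+s\<in>{0..tau T m}. ?f \<omega> s \<partial>lborel) \<partial>M) = (\<integral>\<^sup>+\<omega>. ennreal (c * (LBINT s:{0..tau T m}. (control s \<omega>)\<^sup>2)) \<partial>M)"
      by (rule nn_integral_cong) (rule control_sq(3)[OF tb])
    also have "\<dots> = ennreal (\<integral>\<omega>. c * (LBINT s:{0..tau T m}. (control s \<omega>)\<^sup>2) \<partial>M)"
      using control_sq(4)[OF tb] c_pos
      by (intro nn_integral_eq_integral integrable_mult_right integrable_control_sq tb) auto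
    also have "\<dots> \<le> ennreal ((\<integral>\<omega>. g (X T \<omega>) \<partial>M) - V T 0)"
      using cost_bound_at[OF rc, of m] by (intro ennreal_leI) simp
    finally show ?thesis .
  qed
  have sup: "(\<integral>\<^sup>+s\<in>{0..T}. ?f \<omega> s \<partial>lborel) = (SUP m. \<integral>\<^sup>+s\<in>{0..tau T m}. ?f \<omega> s \<partial>lborel)" if \<omega>: "\<omega> \<in> space M" for \<omega>
  proof -
    have "(\<integral>\<^sup>+s\<in>{0..T}. ?f \<omega> s \<partial>lborel) = (\<integral>\<^sup>+s. (SUP m. ?f \<omega> s * indicator {0..tau T m} s) \<partial>lborel)"
    proof (rule nn_integral_cong)
      fix s
      show "?f \<omega> s * indicator {0..T} s = (SUP m. ?f \<omega> s * indicator {0..tau T m} s)"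
      proof (cases "s \<in> {0..<T}")
        case True
        then have "eventually (\<lambda>m. s < tau T m) sequentially"
          using order_tendstoD(1)[OF tau_tendsto, of s T] by simp
        then obtain m where "s < tau T m" unfolding eventually_sequentially by blast
        then have "?f \<omega> s * indicator {0..T} s \<le> (SUP m. ?f \<omega> s * indicator {0..tau T m} s)"
          using True by (intro SUP_upper2[of m]) (auto simp: indicator_def)
        moreover have "(SUP m. ?f \<omega> s * indicator {0..tau T m} s) \<le> ?f \<omega> s * indicator {0..T} s"
          using True by (intro SUP_least) (auto simp: indicator_def)
        ultimately show ?thesis by (rule antisym)
      next
        case False
        \<comment> \<open>At time T the control is 0 by convention, so the intervals up to
          \<open>tau T m\<close> exhaust every point of {0..T} at which the integrand can differ
          from 0.\<close>
        then have z: "?f \<omega> s * indicator {0..T} s = 0" by (auto simp: indicator_def control_def)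
        have z': "?f \<omega> s * indicator {0..tau T m} s = 0" for m
          using False tb(2)[of m] by (auto simp: indicator_def control_def)
        show ?thesis unfolding z z' by simp
      qed
    qed
    also have "\<dots> = (SUP m. \<integral>\<^sup>+s. ?f \<omega> s * indicator {0..tau T m} s \<partial>lborel)"
    proof (rule nn_integral_monotone_convergence_SUP)
      show "incseq (\<lambda>m s. ?f \<omega> s * indicator {0..tau T m} s)"
        using tau_mono[OF T_pos] by (intro incseq_SucI le_funI mult_left_mono) (auto simp: indicator_def intro: order_trans)
      show "(\<lambda>s. ?f \<omega> s * indicator {0..tau T m} s) \<in> borel_measurable lborel" for m
      proof -
        have eq: "(\<lambda>s. ?f \<omega> s * indicator {0..tau T m} s) = (\<lambda>s. ennreal (c * (indicator {0..tau T m} s * (control s \<omega>)\<^sup>2)))"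
          by (auto simp: fun_eq_iff indicator_def)
        show ?thesis
          unfolding eq using progressive_path[OF progressive_control_sq, of 0 "tau T m" "{0..tau T m}" \<omega>] tb[of m] \<omega>
          by simp
      qed
    qed
    finally show ?thesis .
  qed
  have "(\<integral>\<^sup>+\<omega>. (\<integral>\<^sup>+s\<in>{0..T}. ?f \<omega> s \<partial>lborel) \<partial>M) = (\<integral>\<^sup>+\<omega>. (SUP m. \<integral>\<^sup>+s\<in>{0..tau T m}. ?f \<omega> s \<partial>lborel) \<partial>M)"
    by (rule nn_integral_cong) (rule sup)
  also have "\<dots> = (SUP m. \<integral>\<^sup>+\<omega>. (\<integral>\<^sup>+s\<in>{0..tau T m}. ?f \<omega> s \<partial>lborel) \<partial>M)"
  proof (rule nn_integral_monotone_convergence_SUP)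
    show "incseq (\<lambda>m \<omega>. \<integral>\<^sup>+s\<in>{0..tau T m}. ?f \<omega> s \<partial>lborel)"
      using tau_mono[OF T_pos]
      by (intro incseq_SucI le_funI nn_integral_mono mult_left_mono) (auto simp: indicator_def intro: order_trans)
    show "(\<lambda>\<omega>. \<integral>\<^sup>+s\<in>{0..tau T m}. ?f \<omega> s \<partial>lborel) \<in> borel_measurable M" for m
      using tb[of m] by (intro measurable_cost[OF progressive_control]) auto
  qed
  also have "\<dots> \<le> ennreal ((\<integral>\<omega>. g (X T \<omega>) \<partial>M) - V T 0)"
    by (rule SUP_least) (rule q)
  finally show "(\<integral>\<^sup>+\<omega>. (\<integral>\<^sup>+s\<in>{0..T}. ?f \<omega> s \<partial>lborel) \<partial>M) \<le> ennreal ((\<integral>\<omega>. g (X T \<omega>) \<partial>M) - V T 0)" .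
  have "0 \<le> c * (\<integral>\<omega>. (LBINT s:{0..tau T 0}. (control s \<omega>)\<^sup>2) \<partial>M)"
    using control_sq(4)[OF tb] c_pos by (intro mult_nonneg_nonneg integral_nonneg_AE AE_I2) auto
  then show "V T 0 \<le> (\<integral>\<omega>. g (X T \<omega>) \<partial>M)"
    using cost_bound_at[OF rc, of 0] by linarith
qed

text \<open>Finite quadratic cost implies the first-moment condition on a finite horizon, by
  \<open>\<bar>a\<bar> \<le> 1 + a\<^sup>2\<close>.\<close>

lemma admissible_control:
  assumes rc: "\<And>x. continuous (at_right x) g"
  shows "admissible M F T control"
  unfolding admissible_def
proof (intro conjI progressive_control)
  let ?Q = "\<integral>\<^sup>+\<omega>. (\<integral>\<^sup>+s\<in>{0..T}. ennreal (c * (control s \<omega>)\<^sup>2) \<partial>lborel) \<partial>M"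
  have Q: "?Q < \<infinity>" using value_attained(1)[OF rc] by (rule le_less_trans) simp
  have "(\<integral>\<^sup>+\<omega>. (\<integral>\<^sup>+s\<in>{0..T}. ennreal \<bar>control s \<omega>\<bar> \<partial>lborel) \<partial>M) \<le>
    (\<integral>\<^sup>+\<omega>. ennreal T + ennreal (1 / c) * (\<integral>\<^sup>+s\<in>{0..T}. ennreal (c * (control s \<omega>)\<^sup>2) \<partial>lborel) \<partial>M)"
  proof (rule nn_integral_mono)
    fix \<omega> assume \<omega>: "\<omega> \<in> space M"
    have "(\<lambda>s. indicator {0..T} s * (control s \<omega>)\<^sup>2) \<in> borel_measurable borel"
      using T_pos \<omega> by (intro progressive_path[OF progressive_control_sq, of 0 T]) auto
    moreover have eq: "(\<lambda>s. ennreal (c * (control s \<omega>)\<^sup>2) * indicator {0..T} s) = (\<lambda>s. ennreal (c * (indicator {0..T} s * (control s \<omega>)\<^sup>2)))"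
      by (auto simp: fun_eq_iff indicator_def)
    ultimately have [measurable]: "(\<lambda>s. ennreal (c * (control s \<omega>)\<^sup>2) * indicator {0..T} s) \<in> borel_measurable lborel"
      unfolding eq by simp
    have "(\<integral>\<^sup>+s\<in>{0..T}. ennreal \<bar>control s \<omega>\<bar> \<partial>lborel) \<le>
      (\<integral>\<^sup>+s. indicator {0..T} s + ennreal (1 / c) * (ennreal (c * (control s \<omega>)\<^sup>2) * indicator {0..T} s) \<partial>lborel)"
    proof (rule nn_integral_mono)
      fix s
      have "\<bar>control s \<omega>\<bar> \<le> 1 + (control s \<omega>)\<^sup>2"
        using zero_le_power2[of "\<bar>control s \<omega>\<bar> - 1"] by (simp add: power2_diff)
      then have "ennreal \<bar>control s \<omega>\<bar> \<le> ennreal (1 + (control s \<omega>)\<^sup>2)"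
        by (rule ennreal_leI)
      also have "\<dots> = ennreal 1 + ennreal ((control s \<omega>)\<^sup>2)"
        by (rule ennreal_plus) auto
      also have "ennreal ((control s \<omega>)\<^sup>2) = ennreal (1 / c) * ennreal (c * (control s \<omega>)\<^sup>2)"
        using c_pos by (simp flip: ennreal_mult)
      finally show "ennreal \<bar>control s \<omega>\<bar> * indicator {0..T} s \<le>
        indicator {0..T} s + ennreal (1 / c) * (ennreal (c * (control s \<omega>)\<^sup>2) * indicator {0..T} s)"
        by (auto simp: indicator_def)
    qed
    also have "\<dots> = ennreal T + ennreal (1 / c) * (\<integral>\<^sup>+s\<in>{0..T}. ennreal (c * (control s \<omega>)\<^sup>2) \<partial>lborel)"
      using T_pos by (subst nn_integral_add) (auto simp: nn_integral_cmult)
    finally show "(\<integral>\<^sup>+s\<in>{0..T}. ennreal \<bar>control s \<omega>\<bar> \<partial>lborel) \<le>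
      ennreal T + ennreal (1 / c) * (\<integral>\<^sup>+s\<in>{0..T}. ennreal (c * (control s \<omega>)\<^sup>2) \<partial>lborel)" .
  qed
  also have "\<dots> = ennreal T + ennreal (1 / c) * ?Q"
    using measurable_cost[OF progressive_control, of 0 T] T_pos
    by (subst nn_integral_add) (auto simp: nn_integral_cmult emeasure_space_1)
  also have "\<dots> < \<infinity>"
    using Q by (simp add: ennreal_mult_less_top)
  finally show "(\<integral>\<^sup>+\<omega>. (\<integral>\<^sup>+s\<in>{0..T}. ennreal \<bar>control s \<omega>\<bar> \<partial>lborel) \<partial>M) < \<infinity>" .
qed

text \<open>The integral equation is imposed before T only, while states in the game are integrals
  up to T. Integrability of the control and continuity of state and noise close the gap.\<close>

lemma terminal_state:
  assumes rc: "\<And>x. continuous (at_right x) g"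
  shows "AE \<omega> in M. (LBINT s:{0..T}. control s \<omega>) + \<sigma> * B T \<omega> = X T \<omega>"
  using AE_good admissible_integrable[OF admissible_control[OF rc] less_imp_le[OF T_pos]]
proof eventually_elim
  case (elim \<omega>)
  note tb = tau_bounds[OF T_pos]
  have sub: "set_integrable lborel {0..tau T m} (\<lambda>s. control s \<omega>)" for m
    by (rule set_integrable_subset[OF elim(2)]) (use tb[of m] in auto)
  have eq: "X (tau T m) \<omega> = (LBINT s:{0..tau T m}. control s \<omega>) + \<sigma> * B (tau T m) \<omega>" for m
  proof -
    have "(LBINT s:{0..tau T m}. control s \<omega>) = (LBINT s:{0..tau T m}. drift (T - s) (X s \<omega>))"
      using tb(2)[of m] by (intro set_lebesgue_integral_cong) (auto simp: control_def)
    then show ?thesis using elim(1) tb[of m] by (simp add: good_def)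
  qed
  have "(\<lambda>m. \<integral>s. indicator {0..tau T m} s *\<^sub>R control s \<omega> \<partial>lborel) \<longlonglongrightarrow> (\<integral>s. indicator {0..T} s *\<^sub>R control s \<omega> \<partial>lborel)"
  proof (rule integral_dominated_convergence[where w = "\<lambda>s. \<bar>indicator {0..T} s *\<^sub>R control s \<omega>\<bar>"])
    show "(\<lambda>s. indicator {0..T} s *\<^sub>R control s \<omega>) \<in> borel_measurable lborel"
      using elim(2) unfolding set_integrable_def by (rule borel_measurable_integrable)
    show "(\<lambda>s. indicator {0..tau T m} s *\<^sub>R control s \<omega>) \<in> borel_measurable lborel" for m
      using sub[of m] unfolding set_integrable_def by (rule borel_measurable_integrable)
    show "integrable lborel (\<lambda>s. \<bar>indicator {0..T} s *\<^sub>R control s \<omega>\<bar>)"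
      using elim(2) unfolding set_integrable_def by (rule integrable_abs)
    show "AE s in lborel. (\<lambda>m. indicator {0..tau T m} s *\<^sub>R control s \<omega>) \<longlonglongrightarrow> indicator {0..T} s *\<^sub>R control s \<omega>"
    proof (rule AE_I2)
      fix s
      have "eventually (\<lambda>m. indicator {0..tau T m} s *\<^sub>R control s \<omega> = indicator {0..T} s *\<^sub>R control s \<omega>) sequentially"
      proof (cases "s < T")
        case True
        then have "eventually (\<lambda>m. s < tau T m) sequentially"
          by (rule order_tendstoD(1)[OF tau_tendsto])
        then show ?thesis by eventually_elim (use True in \<open>auto simp: indicator_def\<close>)
      next
        case False
        then show ?thesis by (simp add: control_def)
      qed
      then show "(\<lambda>m. indicator {0..tau T m} s *\<^sub>R control s \<omega>) \<longlonglongrightarrow> indicator {0..T} s *\<^sub>R control s \<omega>"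
        by (rule tendsto_eventually)
    qed
    show "AE s in lborel. norm (indicator {0..tau T m} s *\<^sub>R control s \<omega>) \<le> \<bar>indicator {0..T} s *\<^sub>R control s \<omega>\<bar>" for m
      using tb[of m] by (auto simp: indicator_def)
  qed
  then have "(\<lambda>m. LBINT s:{0..tau T m}. control s \<omega>) \<longlonglongrightarrow> (LBINT s:{0..T}. control s \<omega>)"
    by (simp add: set_lebesgue_integral_def)
  moreover have "(\<lambda>m. B (tau T m) \<omega>) \<longlonglongrightarrow> B T \<omega>"
  proof (rule continuous_on_tendsto_compose[OF _ tau_tendsto])
    show "continuous_on {0..T} (\<lambda>t. B t \<omega>)" using elim(1) by (simp add: good_def)
    show "T \<in> {0..T}" using T_pos by simp
    show "eventually (\<lambda>m. tau T m \<in> {0..T}) sequentially"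
      using tb by (intro always_eventually allI) (simp add: less_imp_le)
  qed
  ultimately have "(\<lambda>m. X (tau T m) \<omega>) \<longlonglongrightarrow> (LBINT s:{0..T}. control s \<omega>) + \<sigma> * B T \<omega>"
    unfolding eq by (intro tendsto_intros)
  with X_tau_tendsto[OF elim(1)] show ?case by (rule LIMSEQ_unique[symmetric])
qed

end

text \<open>The real and imaginary parts of the characteristic function are means of bounded
  continuous functions, which \<open>mean_terminal\<close> computes identically on both
  spaces.\<close>

lemma optimal_law_unique:
  assumes "optimal_state c \<sigma> Gb g M F T B X" and "optimal_state c \<sigma> Gb g M' F' T B' X'"
  shows "distr M borel (X T) = distr M' borel (X' T)"
proof -
  interpret A: optimal_state c \<sigma> Gb g M F T B X by fact
  interpret A': optimal_state c \<sigma> Gb g M' F' T B' X' by fact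
  have [measurable]: "X T \<in> borel_measurable M" "X' T \<in> borel_measurable M'"
    using A.T_pos by auto
  have eq: "(\<integral>\<omega>. f (X T \<omega>) \<partial>M) = (\<integral>\<omega>. f (X' T \<omega>) \<partial>M')"
    if "continuous_on UNIV f" "\<And>x. \<bar>f x\<bar> \<le> 1" for f :: "real \<Rightarrow> real"
    using A.mean_terminal[OF that] A'.mean_terminal[OF that] by simp
  show ?thesis
  proof (rule Levy_uniqueness)
    show "real_distribution (distr M borel (X T))" by simp
    show "real_distribution (distr M' borel (X' T))" by simp
    have ch: "char (distr N borel Y) t = Complex (\<integral>\<omega>. cos (t * Y \<omega>) \<partial>N) (\<integral>\<omega>. sin (t * Y \<omega>) \<partial>N)"
      if "prob_space N" and [measurable]: "Y \<in> borel_measurable N" for N :: "'z measure" and Y t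
    proof -
      interpret N: prob_space N by fact
      have i: "integrable N (\<lambda>\<omega>. iexp (t * Y \<omega>))"
        by (rule N.integrable_const_bound[of _ 1]) (auto simp: norm_exp_i_times)
      have "char (distr N borel Y) t = (CLINT \<omega>|N. iexp (t * Y \<omega>))"
        unfolding char_def by (subst integral_distr) auto
      also have "\<dots> = Complex (\<integral>\<omega>. cos (t * Y \<omega>) \<partial>N) (\<integral>\<omega>. sin (t * Y \<omega>) \<partial>N)"
        using i by (intro complex_eqI) (simp_all add: Re_exp Im_exp flip: integral_Re integral_Im)
      finally show ?thesis .
    qed
    show "char (distr M borel (X T)) = char (distr M' borel (X' T))"
    proof
      fix t
      have "(\<integral>\<omega>. cos (t * X T \<omega>) \<partial>M) = (\<integral>\<omega>. cos (t * X' T \<omega>) \<partial>M')"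
        by (rule eq) (auto intro!: continuous_intros)
      moreover have "(\<integral>\<omega>. sin (t * X T \<omega>) \<partial>M) = (\<integral>\<omega>. sin (t * X' T \<omega>) \<partial>M')"
        by (rule eq) (auto intro!: continuous_intros)
      ultimately show "char (distr M borel (X T)) t = char (distr M' borel (X' T)) t"
        by (simp add: ch[OF A.prob_space_axioms] ch[OF A'.prob_space_axioms])
    qed
  qed
qed

section \<open>Empirical distribution functions\<close>

primrec runmax :: "(nat \<Rightarrow> real) \<Rightarrow> nat \<Rightarrow> real" where
  "runmax d 0 = \<bar>d 0\<bar>"
| "runmax d (Suc i) = max (runmax d i) \<bar>d (Suc i)\<bar>"

lemma runmax_nonneg: "0 \<le> runmax d i"
  by (induction i) auto

lemma runmax_ge: "i \<le> n \<Longrightarrow> \<bar>d i\<bar> \<le> runmax d n"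
  by (induction n) (auto simp: le_Suc_eq max_def)

lemma runmax_le: "(\<And>i. i \<le> n \<Longrightarrow> \<bar>d i\<bar> \<le> K) \<Longrightarrow> runmax d n \<le> K"
  by (induction n) auto

lemma runmax_cong: "(\<And>i. i \<le> n \<Longrightarrow> d i = d' i) \<Longrightarrow> runmax d n = runmax d' n"
  by (induction n) auto

lemma runmax_measurable:
  assumes "\<And>i. i \<le> n \<Longrightarrow> (\<lambda>x. d x i) \<in> borel_measurable N"
  shows "(\<lambda>x. runmax (d x) n) \<in> borel_measurable N"
  using assms by (induction n) auto

text \<open>Doob's L2 maximal inequality follows by taking expectations.\<close>

lemma runmax_pathwise:
  "(\<Sum>i<n. runmax d i * sgn (d i) * (d (Suc i) - d i)) \<le> runmax d n * \<bar>d n\<bar> - (runmax d n)\<^sup>2 / 2"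
proof (induction n)
  case 0
  show ?case by (simp add: power2_eq_square)
next
  case (Suc n)
  let ?b = "runmax d n" and ?b' = "runmax d (Suc n)"
  \<comment> \<open>\<open>sgn\<close> is a subgradient of the absolute value.\<close>
  have "sgn (d n) * (d (Suc n) - d n) \<le> \<bar>d (Suc n)\<bar> - \<bar>d n\<bar>"
    by (auto simp: sgn_real_def)
  from mult_left_mono[OF this runmax_nonneg[of d n]]
  have "?b * sgn (d n) * (d (Suc n) - d n) \<le> ?b * \<bar>d (Suc n)\<bar> - ?b * \<bar>d n\<bar>"
    by (simp add: algebra_simps)
  then have "(\<Sum>i<Suc n. runmax d i * sgn (d i) * (d (Suc i) - d i)) \<le> ?b * \<bar>d (Suc n)\<bar> - ?b\<^sup>2 / 2"
    using Suc by simp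
  also have "\<dots> \<le> ?b' * \<bar>d (Suc n)\<bar> - ?b'\<^sup>2 / 2"
  proof (cases "\<bar>d (Suc n)\<bar> \<le> ?b")
    case True
    then show ?thesis by simp
  next
    case False
    then have b': "?b' = \<bar>d (Suc n)\<bar>" by simp
    have "0 \<le> (\<bar>d (Suc n)\<bar> - ?b)\<^sup>2" by simp
    then show ?thesis unfolding b' by (simp add: power2_eq_square algebra_simps)
  qed
  finally show ?case .
qed

text \<open>The martingale property is asked only against the weight appearing in
  \<open>runmax_pathwise\<close>, which avoids conditional expectations. With R the running maximum,
  R \<bar>D\<bar> is at most R^2 / 4 + D^2; this leaves a quarter of R^2 and explains the factor
  4.\<close>

lemma (in prob_space) doob_L2:
  fixes D :: "nat \<Rightarrow> 'a \<Rightarrow> real"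
  assumes D [measurable]: "\<And>i. i \<le> n \<Longrightarrow> D i \<in> borel_measurable M"
    and bnd: "\<And>i \<omega>. i \<le> n \<Longrightarrow> \<bar>D i \<omega>\<bar> \<le> K"
    and mart: "\<And>i. i < n \<Longrightarrow> expectation (\<lambda>\<omega>. runmax (\<lambda>i. D i \<omega>) i * sgn (D i \<omega>) * (D (Suc i) \<omega> - D i \<omega>)) = 0"
  shows "expectation (\<lambda>\<omega>. (runmax (\<lambda>i. D i \<omega>) n)\<^sup>2) \<le> 4 * expectation (\<lambda>\<omega>. (D n \<omega>)\<^sup>2)"
proof -
  let ?R = "\<lambda>i \<omega>. runmax (\<lambda>i. D i \<omega>) i"
  have Rm: "?R i \<in> borel_measurable M" if "i \<le> n" for i
    using that by (intro runmax_measurable D) auto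
  have Rb: "0 \<le> ?R i \<omega>" "?R i \<omega> \<le> K" if "i \<le> n" for i \<omega>
    using that bnd by (auto intro!: runmax_nonneg runmax_le)
  have K: "0 \<le> K" using Rb[of 0 undefined] by simp
  have bi: "integrable M f" if "f \<in> borel_measurable M" "\<And>\<omega>. \<bar>f \<omega>\<bar> \<le> C" for f :: "'a \<Rightarrow> real" and C
    by (rule integrable_const_bound[of _ C]) (use that in auto)
  have Ri: "integrable M (\<lambda>\<omega>. (?R n \<omega>)\<^sup>2)"
    by (rule bi[of _ "K\<^sup>2"]) (use Rm[of n] Rb[of n] in \<open>auto intro!: power_mono\<close>)
  have D2i: "integrable M (\<lambda>\<omega>. (D n \<omega>)\<^sup>2)"
  proof (rule bi[of _ "K\<^sup>2"])
    show "\<bar>(D n \<omega>)\<^sup>2\<bar> \<le> K\<^sup>2" for \<omega>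
      using power_mono[OF bnd abs_ge_zero, of n \<omega> 2] by simp
  qed simp
  have si: "integrable M (\<lambda>\<omega>. ?R i \<omega> * sgn (D i \<omega>) * (D (Suc i) \<omega> - D i \<omega>))" if i: "i < n" for i
  proof (rule bi[of _ "K * 1 * (K + K)"])
    have [measurable]: "D i \<in> borel_measurable M" "D (Suc i) \<in> borel_measurable M" "?R i \<in> borel_measurable M"
      using i by (auto intro: Rm)
    show "(\<lambda>\<omega>. ?R i \<omega> * sgn (D i \<omega>) * (D (Suc i) \<omega> - D i \<omega>)) \<in> borel_measurable M" by measurable
    show "\<bar>?R i \<omega> * sgn (D i \<omega>) * (D (Suc i) \<omega> - D i \<omega>)\<bar> \<le> K * 1 * (K + K)" for \<omega>
      unfolding abs_mult
    proof (intro mult_mono)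
      show "\<bar>?R i \<omega>\<bar> \<le> K" using Rb[of i \<omega>] i by simp
      show "\<bar>sgn (D i \<omega>)\<bar> \<le> 1" by (simp add: sgn_real_def)
      show "\<bar>D (Suc i) \<omega> - D i \<omega>\<bar> \<le> K + K" using bnd[of i \<omega>] bnd[of "Suc i" \<omega>] i by simp
    qed (use K in auto)
  qed
  have "0 = expectation (\<lambda>\<omega>. \<Sum>i<n. ?R i \<omega> * sgn (D i \<omega>) * (D (Suc i) \<omega> - D i \<omega>))"
    using mart by (subst Bochner_Integration.integral_sum) (auto intro: si)
  also have "\<dots> \<le> expectation (\<lambda>\<omega>. (D n \<omega>)\<^sup>2 - (?R n \<omega>)\<^sup>2 / 4)"
  proof (rule integral_mono)
    show "integrable M (\<lambda>\<omega>. \<Sum>i<n. ?R i \<omega> * sgn (D i \<omega>) * (D (Suc i) \<omega> - D i \<omega>))"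
      by (intro Bochner_Integration.integrable_sum si) simp
    show "integrable M (\<lambda>\<omega>. (D n \<omega>)\<^sup>2 - (?R n \<omega>)\<^sup>2 / 4)" using Ri D2i by simp
    fix \<omega>
    have "0 \<le> (?R n \<omega> / 2 - \<bar>D n \<omega>\<bar>)\<^sup>2" by simp
    then have "?R n \<omega> * \<bar>D n \<omega>\<bar> \<le> (?R n \<omega>)\<^sup>2 / 4 + (D n \<omega>)\<^sup>2"
      by (simp add: power2_diff power_divide)
    then show "(\<Sum>i<n. ?R i \<omega> * sgn (D i \<omega>) * (D (Suc i) \<omega> - D i \<omega>)) \<le> (D n \<omega>)\<^sup>2 - (?R n \<omega>)\<^sup>2 / 4"
      using runmax_pathwise[of "\<lambda>i. D i \<omega>" n] by linarith
  qed
  also have "\<dots> = expectation (\<lambda>\<omega>. (D n \<omega>)\<^sup>2) - expectation (\<lambda>\<omega>. (?R n \<omega>)\<^sup>2) / 4"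
    using Ri D2i by simp
  finally show ?thesis by simp
qed

text \<open>Along an increasing family of sets A with probabilities p, the process (F_N - p) / (1 - p) is
  a martingale; it is written below as 1 minus a normalized count of the points outside A, which
  shows that an increment only involves the points outside the smaller set.\<close>

lemma (in prob_space) empirical_runmax:
  fixes Z :: "nat \<Rightarrow> 'a \<Rightarrow> real" and A :: "nat \<Rightarrow> real set"
  assumes ind: "indep_vars (\<lambda>_. borel) Z I" and I: "finite I" "I \<noteq> {}"
    and A [measurable]: "\<And>i. A i \<in> sets borel" and inc: "\<And>i. i < n \<Longrightarrow> A i \<subseteq> A (Suc i)"
    and p: "\<And>i j. i \<le> n \<Longrightarrow> j \<in> I \<Longrightarrow> prob {\<omega> \<in> space M. Z j \<omega> \<in> A i} = p i" and half: "\<And>i. i \<le> n \<Longrightarrow> p i \<le> 1 / 2"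
  defines "D \<equiv> \<lambda>i \<omega>. 1 - (\<Sum>j\<in>I. indicator (- A i) (Z j \<omega>) / (1 - p i)) / card I"
  shows "expectation (\<lambda>\<omega>. (runmax (\<lambda>i. D i \<omega>) n)\<^sup>2) \<le> 4 / card I"
    and "\<And>i \<omega>. i \<le> n \<Longrightarrow> \<bar>(\<Sum>j\<in>I. indicator (A i) (Z j \<omega>)) / card I - p i\<bar> \<le> runmax (\<lambda>i. D i \<omega>) n"
    and "integrable M (\<lambda>\<omega>. (runmax (\<lambda>i. D i \<omega>) n)\<^sup>2)"
proof -
  define N where "N = real (card I)"
  have N: "0 < N" using I by (simp add: N_def card_gt_0_iff)
  have Zm [measurable]: "Z j \<in> borel_measurable M" if "j \<in> I" for j
    using ind that unfolding indep_vars_def by blast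
  have p0: "0 \<le> p i" if "i \<le> n" for i
    using p[OF that] I by (metis all_not_in_conv measure_nonneg)
  have p1: "1 / 2 \<le> 1 - p i" "1 - p i \<le> 1" if "i \<le> n" for i
    using half[OF that] p0[OF that] by auto
  have Eind: "expectation (\<lambda>\<omega>. indicator (- A i) (Z j \<omega>)) = 1 - p i" if "i \<le> n" "j \<in> I" for i j
  proof -
    have "expectation (\<lambda>\<omega>. indicator (- A i) (Z j \<omega>)) = expectation (\<lambda>\<omega>. 1 - indicator {\<omega> \<in> space M. Z j \<omega> \<in> A i} \<omega>)"
      by (intro Bochner_Integration.integral_cong) (auto simp: indicator_def)
    also have "\<dots> = 1 - p i"
    proof -
      have [measurable]: "Z j \<in> borel_measurable M" by (rule Zm[OF that(2)])
      have "{\<omega> \<in> space M. Z j \<omega> \<in> A i} \<in> events" by measurable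
      then show ?thesis using p[OF that]
        by (subst Bochner_Integration.integral_diff) (simp_all add: prob_space emeasure_eq_measure)
    qed
    finally show ?thesis .
  qed
  have Dm: "D i \<in> borel_measurable M" for i
  proof -
    have "(\<lambda>\<omega>. indicator (- A i) (Z j \<omega>) / (1 - p i) :: real) \<in> borel_measurable M" if "j \<in> I" for j
      using Zm[OF that] by measurable
    then have "(\<lambda>\<omega>. \<Sum>j\<in>I. indicator (- A i) (Z j \<omega>) / (1 - p i) :: real) \<in> borel_measurable M"
      by (rule borel_measurable_sum)
    then show ?thesis unfolding D_def by simp
  qed
  \<comment> \<open>The bound 2, like the later bounds on \<open>\<xi>\<close> and
    \<open>\<eta>\<close>, comes from the probabilities being at most 1 / 2.\<close>
  have ratio: "0 \<le> indicator (- A i) x / (1 - p i)" "indicator (- A i) x / (1 - p i) \<le> (2::real)" if "i \<le> n" for i x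
    using p1[OF that] by (auto simp: indicator_def field_simps)
  have avg: "0 \<le> (\<Sum>j\<in>J. indicator (- A i) (x j) / (1 - p i)) / N"
    "(\<Sum>j\<in>J. indicator (- A i) (x j) / (1 - p i)) / N \<le> 2" if "i \<le> n" "J \<subseteq> I" for i x J
  proof -
    show "0 \<le> (\<Sum>j\<in>J. indicator (- A i) (x j) / (1 - p i)) / N"
      by (rule divide_nonneg_nonneg[OF sum_nonneg[OF ratio(1)[OF that(1)]]]) (use N in simp)
    have "(\<Sum>j\<in>J. indicator (- A i) (x j) / (1 - p i)) \<le> real (card J) * 2"
      using sum_mono[of J "\<lambda>j. indicator (- A i) (x j) / (1 - p i)" "\<lambda>_. 2"] ratio(2)[OF that(1)] by simp
    also have "\<dots> \<le> N * 2"
      using card_mono[OF I(1) that(2)] by (simp add: N_def)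
    finally show "(\<Sum>j\<in>J. indicator (- A i) (x j) / (1 - p i)) / N \<le> 2"
      using N by (simp add: field_simps)
  qed
  have Db: "\<bar>D i \<omega>\<bar> \<le> 2" if "i \<le> n" for i \<omega>
    using avg[OF that subset_refl, of "\<lambda>j. Z j \<omega>"] unfolding D_def N_def[symmetric] by linarith
  show "integrable M (\<lambda>\<omega>. (runmax (\<lambda>i. D i \<omega>) n)\<^sup>2)"
  proof (rule integrable_const_bound[of _ "2\<^sup>2"])
    have [measurable]: "(\<lambda>\<omega>. runmax (\<lambda>i. D i \<omega>) n) \<in> borel_measurable M"
      by (rule runmax_measurable) (rule Dm)
    show "(\<lambda>\<omega>. (runmax (\<lambda>i. D i \<omega>) n)\<^sup>2) \<in> borel_measurable M" by measurable
    have "(runmax (\<lambda>i. D i \<omega>) n)\<^sup>2 \<le> 2\<^sup>2" for \<omega>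
      by (intro power_mono runmax_le Db runmax_nonneg)
    then show "AE \<omega> in M. norm ((runmax (\<lambda>i. D i \<omega>) n)\<^sup>2) \<le> 2\<^sup>2" by simp
  qed
  show "\<bar>(\<Sum>j\<in>I. indicator (A i) (Z j \<omega>)) / card I - p i\<bar> \<le> runmax (\<lambda>i. D i \<omega>) n" if i: "i \<le> n" for i \<omega>
  proof -
    have "(\<Sum>j\<in>I. indicator (- A i) (Z j \<omega>) :: real) = (\<Sum>j\<in>I. 1 - indicator (A i) (Z j \<omega>))"
      by (intro sum.cong) (auto simp: indicator_def)
    then have "(\<Sum>j\<in>I. indicator (- A i) (Z j \<omega>) / (1 - p i)) = (N - (\<Sum>j\<in>I. indicator (A i) (Z j \<omega>))) / (1 - p i)"
      by (simp add: sum_subtractf N_def flip: sum_divide_distrib)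
    then have "(1 - p i) * D i \<omega> = (1 - p i) - (N - (\<Sum>j\<in>I. indicator (A i) (Z j \<omega>))) / N"
    proof -
      have gen: "q * (1 - u / q / N) = q - u / N" if "q \<noteq> 0" for q u :: real
        using that N by (simp add: field_simps)
      have "1 - p i \<noteq> 0" using p1[OF i] by simp
      from gen[OF this] show ?thesis
        unfolding D_def N_def[symmetric]
        using \<open>(\<Sum>j\<in>I. indicator (- A i) (Z j \<omega>) / (1 - p i)) = (N - (\<Sum>j\<in>I. indicator (A i) (Z j \<omega>))) / (1 - p i)\<close>
        by (simp only:)
    qed
    also have "\<dots> = (\<Sum>j\<in>I. indicator (A i) (Z j \<omega>)) / N - p i"
      using N by (simp add: diff_divide_distrib)
    finally have "\<bar>(\<Sum>j\<in>I. indicator (A i) (Z j \<omega>)) / N - p i\<bar> = \<bar>(1 - p i) * D i \<omega>\<bar>" by simp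
    also have "\<dots> \<le> 1 * \<bar>D i \<omega>\<bar>"
      using p1[OF i] unfolding abs_mult by (intro mult_right_mono) auto
    also have "\<dots> \<le> runmax (\<lambda>i. D i \<omega>) n"
      using runmax_ge[OF i, of "\<lambda>i. D i \<omega>"] by simp
    finally show ?thesis by (simp add: N_def)
  qed
  have prod0: "expectation (\<lambda>\<omega>. \<xi> (Z j \<omega>) * \<Psi> (\<lambda>k\<in>I - {j}. Z k \<omega>)) = 0"
    if j: "j \<in> I" and \<xi> [measurable]: "\<xi> \<in> borel_measurable borel" "\<And>x. \<bar>\<xi> x\<bar> \<le> K" "expectation (\<lambda>\<omega>. \<xi> (Z j \<omega>)) = 0"
      and \<Psi> [measurable]: "\<Psi> \<in> borel_measurable (PiM (I - {j}) (\<lambda>_. borel))" "\<And>x. \<bar>\<Psi> x\<bar> \<le> K'"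
    for j K K' and \<xi> :: "real \<Rightarrow> real" and \<Psi> :: "(nat \<Rightarrow> real) \<Rightarrow> real"
  proof -
    have "indep_var (PiM {j} (\<lambda>_. borel)) (\<lambda>\<omega>. restrict (\<lambda>i. Z i \<omega>) {j}) (PiM (I - {j}) (\<lambda>_. borel)) (\<lambda>\<omega>. restrict (\<lambda>i. Z i \<omega>) (I - {j}))"
      by (rule indep_var_restrict[OF ind]) (use j in auto)
    moreover have "(\<lambda>x. \<xi> (x j)) \<in> borel_measurable (PiM {j} (\<lambda>_. borel))" by measurable
    ultimately have iv: "indep_var borel ((\<lambda>x. \<xi> (x j)) \<circ> (\<lambda>\<omega>. restrict (\<lambda>i. Z i \<omega>) {j})) borel (\<Psi> \<circ> (\<lambda>\<omega>. restrict (\<lambda>i. Z i \<omega>) (I - {j})))"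
      by (rule indep_var_compose) (rule \<Psi>(1))
    then have iv': "indep_var borel (\<lambda>\<omega>. \<xi> (Z j \<omega>)) borel (\<lambda>\<omega>. \<Psi> (\<lambda>k\<in>I - {j}. Z k \<omega>))"
      by (simp add: comp_def)
    have i1: "integrable M (\<lambda>\<omega>. \<xi> (Z j \<omega>))"
      by (rule integrable_const_bound[of _ K]) (use \<xi> Zm[OF j] in auto)
    have "random_variable borel (\<lambda>\<omega>. \<Psi> (\<lambda>k\<in>I - {j}. Z k \<omega>))" using iv' by (rule indep_var_rv2)
    then have i2: "integrable M (\<lambda>\<omega>. \<Psi> (\<lambda>k\<in>I - {j}. Z k \<omega>))"
      by (intro integrable_const_bound[of _ K']) (use \<Psi>(2) in auto)
    show ?thesis using indep_var_lebesgue_integral[OF iv' i1 i2] \<xi>(3) by simp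
  qed
  have mart: "expectation (\<lambda>\<omega>. runmax (\<lambda>i. D i \<omega>) i * sgn (D i \<omega>) * (D (Suc i) \<omega> - D i \<omega>)) = 0" if i: "i < n" for i
  proof -
    define \<xi> where "\<xi> x = (indicator (- A i) x / (1 - p i) - indicator (- A (Suc i)) x / (1 - p (Suc i)) :: real)" for x
    \<comment> \<open>The value of \<open>D l\<close> when the point with index \<open>j\<close>
      lies outside \<open>A l\<close>: its contribution is then the constant
      \<open>1 / (1 - p l)\<close>, and the rest depends on the other points only.\<close>
    define d where "d j x l = 1 - (1 / (1 - p l) + (\<Sum>k\<in>I - {j}. indicator (- A l) (x k) / (1 - p l))) / N" for j :: nat and x :: "nat \<Rightarrow> real" and l :: nat
    define \<Psi> where "\<Psi> j x = runmax (d j x) i * sgn (d j x i)" for j x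
    have le: "i \<le> n" "Suc i \<le> n" using i by auto
    have \<xi>m [measurable]: "\<xi> \<in> borel_measurable borel" unfolding \<xi>_def by measurable
    have \<xi>b: "\<bar>\<xi> x\<bar> \<le> 4" for x
      using ratio[OF le(1), of x] ratio[OF le(2), of x] unfolding \<xi>_def by linarith
    have \<xi>0: "expectation (\<lambda>\<omega>. \<xi> (Z j \<omega>)) = 0" if j: "j \<in> I" for j
    proof -
      have ii: "integrable M (\<lambda>\<omega>. indicator (- A l) (Z j \<omega>) :: real)" for l
        by (rule integrable_const_bound[of _ 1]) (use Zm[OF j] in auto)
      show ?thesis
        unfolding \<xi>_def using ii Eind[OF le(1) j] Eind[OF le(2) j] p1[OF le(1)] p1[OF le(2)] by simp
    qed
    have mono_A: "A l \<subseteq> A i" if "l \<le> i" for l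
      using that i
    proof (induction i rule: dec_induct)
      case (step m)
      then show ?case using inc[of m] by auto
    qed simp
    have dm: "(\<lambda>x. d j x l) \<in> borel_measurable (PiM (I - {j}) (\<lambda>_. borel))" for j l
    proof -
      have m: "(\<lambda>y. indicator (- A l) y / (1 - p l) :: real) \<in> borel_measurable borel" by measurable
      have "(\<lambda>x. indicator (- A l) (x k) / (1 - p l) :: real) \<in> borel_measurable (PiM (I - {j}) (\<lambda>_. borel))"
        if "k \<in> I - {j}" for k
        by (rule measurable_compose[where f = "\<lambda>x. x k" and N = borel, OF _ m])
          (rule measurable_component_singleton[OF that])
      then have "(\<lambda>x. \<Sum>k\<in>I - {j}. indicator (- A l) (x k) / (1 - p l) :: real) \<in> borel_measurable (PiM (I - {j}) (\<lambda>_. borel))"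
        by (rule borel_measurable_sum)
      then show ?thesis unfolding d_def by simp
    qed
    have db: "\<bar>d j x l\<bar> \<le> 6" if l: "l \<le> i" for j x l
    proof -
      have l': "l \<le> n" using l i by simp
      have N1: "1 \<le> N" using I unfolding N_def by (simp add: card_gt_0_iff Suc_le_eq)
      define v where "v = 1 / (1 - p l)"
      have v: "0 \<le> v" "v \<le> 2" using p1[OF l'] by (auto simp: v_def field_simps)
      then have "v / N \<le> v" "0 \<le> v / N"
        using mult_left_mono[OF N1, of v] N by (auto simp: divide_le_eq)
      then show ?thesis
        using avg[OF l' Diff_subset[of I "{j}"], of x] v(2) unfolding d_def v_def[symmetric] add_divide_distrib
        by linarith
    qed
    have \<Psi>m: "\<Psi> j \<in> borel_measurable (PiM (I - {j}) (\<lambda>_. borel))" for j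
    proof -
      have [measurable]: "(\<lambda>x. runmax (d j x) i) \<in> borel_measurable (PiM (I - {j}) (\<lambda>_. borel))"
        "(\<lambda>x. d j x i) \<in> borel_measurable (PiM (I - {j}) (\<lambda>_. borel))"
        by (auto intro: runmax_measurable dm)
      show ?thesis unfolding \<Psi>_def[abs_def] by measurable
    qed
    have \<Psi>b: "\<bar>\<Psi> j x\<bar> \<le> 6 * 1" for j x
      unfolding \<Psi>_def abs_mult
    proof (rule mult_mono)
      show "\<bar>runmax (d j x) i\<bar> \<le> 6" using runmax_nonneg[of "d j x" i] runmax_le[of i "d j x" 6] db by simp
    qed (auto simp: sgn_real_def)
    \<comment> \<open>If the point lies in \<open>A i\<close>, it also lies in
      \<open>A (Suc i)\<close> and the increment \<open>\<xi>\<close> vanishes. Otherwise it lies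
      outside all earlier sets, so the weight equals \<open>\<Psi> j\<close>, a function of the
      remaining points. In both cases the product has independent factors, one of them
      centred.\<close>
    have key: "runmax (\<lambda>i. D i \<omega>) i * sgn (D i \<omega>) * \<xi> (Z j \<omega>) = \<xi> (Z j \<omega>) * \<Psi> j (\<lambda>k\<in>I - {j}. Z k \<omega>)" if j: "j \<in> I" for j \<omega>
    proof (cases "Z j \<omega> \<in> A i")
      case True
      then have "\<xi> (Z j \<omega>) = 0" using inc[OF i] by (auto simp: \<xi>_def indicator_def)
      then show ?thesis by simp
    next
      case False
      have "D l \<omega> = d j (\<lambda>k\<in>I - {j}. Z k \<omega>) l" if "l \<le> i" for l
      proof -
        have "Z j \<omega> \<notin> A l" using mono_A[OF that] False by auto
        then show ?thesis
          unfolding D_def d_def N_def[symmetric] by (subst sum.remove[OF I(1) j]) simp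
      qed
      then have "runmax (\<lambda>i. D i \<omega>) i * sgn (D i \<omega>) = \<Psi> j (\<lambda>k\<in>I - {j}. Z k \<omega>)"
        unfolding \<Psi>_def by (intro arg_cong2[where f = "(*)"] runmax_cong) auto
      then show ?thesis by simp
    qed
    have incr: "D (Suc i) \<omega> - D i \<omega> = (\<Sum>j\<in>I. \<xi> (Z j \<omega>)) / N" for \<omega>
      unfolding D_def \<xi>_def N_def[symmetric] by (simp add: sum_subtractf diff_divide_distrib)
    have "runmax (\<lambda>i. D i \<omega>) i * sgn (D i \<omega>) * (D (Suc i) \<omega> - D i \<omega>) =
      (\<Sum>j\<in>I. \<xi> (Z j \<omega>) * \<Psi> j (\<lambda>k\<in>I - {j}. Z k \<omega>)) / N" for \<omega>
      unfolding incr by (simp add: sum_distrib_left key cong: sum.cong)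
    then have "expectation (\<lambda>\<omega>. runmax (\<lambda>i. D i \<omega>) i * sgn (D i \<omega>) * (D (Suc i) \<omega> - D i \<omega>)) =
      expectation (\<lambda>\<omega>. \<Sum>j\<in>I. \<xi> (Z j \<omega>) * \<Psi> j (\<lambda>k\<in>I - {j}. Z k \<omega>)) / N"
      by simp
    also have "expectation (\<lambda>\<omega>. \<Sum>j\<in>I. \<xi> (Z j \<omega>) * \<Psi> j (\<lambda>k\<in>I - {j}. Z k \<omega>)) =
      (\<Sum>j\<in>I. expectation (\<lambda>\<omega>. \<xi> (Z j \<omega>) * \<Psi> j (\<lambda>k\<in>I - {j}. Z k \<omega>)))"
    proof (rule Bochner_Integration.integral_sum)
      fix j assume j: "j \<in> I"
      have "(\<lambda>\<omega>. \<lambda>k\<in>I - {j}. Z k \<omega>) \<in> M \<rightarrow>\<^sub>M PiM (I - {j}) (\<lambda>_. borel)"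
        by (rule measurable_restrict) (rule Zm, simp)
      from measurable_compose[OF this \<Psi>m]
      have [measurable]: "(\<lambda>\<omega>. \<Psi> j (\<lambda>k\<in>I - {j}. Z k \<omega>)) \<in> borel_measurable M" .
      have [measurable]: "Z j \<in> borel_measurable M" by (rule Zm[OF j])
      show "integrable M (\<lambda>\<omega>. \<xi> (Z j \<omega>) * \<Psi> j (\<lambda>k\<in>I - {j}. Z k \<omega>))"
      proof (rule integrable_const_bound[of _ "4 * (6 * 1)"])
        have "\<bar>\<xi> (Z j \<omega>) * \<Psi> j (\<lambda>k\<in>I - {j}. Z k \<omega>)\<bar> \<le> 4 * (6 * 1)" for \<omega>
          unfolding abs_mult by (intro mult_mono \<xi>b \<Psi>b) auto
        then show "AE \<omega> in M. norm (\<xi> (Z j \<omega>) * \<Psi> j (\<lambda>k\<in>I - {j}. Z k \<omega>)) \<le> 4 * (6 * 1)" by simp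
      qed measurable
    qed
    also have "\<dots> = 0"
      by (rule sum.neutral) (use prod0[OF _ \<xi>m \<xi>b \<xi>0 \<Psi>m \<Psi>b] in blast)
    finally show ?thesis by simp
  qed
  have "expectation (\<lambda>\<omega>. (D n \<omega>)\<^sup>2) \<le> 1 / N"
  proof -
    \<comment> \<open>The centred summands of the last \<open>D n\<close>. They are bounded by 1 and
      uncorrelated, so the second moment of their average is at most \<open>1 / N\<close>.\<close>
    define \<eta> where "\<eta> x = (1 - indicator (- A n) x / (1 - p n) :: real)" for x
    have \<eta>m [measurable]: "\<eta> \<in> borel_measurable borel" unfolding \<eta>_def by measurable
    have \<eta>b: "\<bar>\<eta> x\<bar> \<le> 1" for x
      using ratio[OF order_refl, of x] unfolding \<eta>_def by linarith
    have ii: "integrable M (\<lambda>\<omega>. \<eta> (Z j \<omega>))" if j: "j \<in> I" for j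
      by (rule integrable_const_bound[of _ 1]) (use \<eta>b Zm[OF j] in auto)
    have \<eta>0: "expectation (\<lambda>\<omega>. \<eta> (Z j \<omega>)) = 0" if j: "j \<in> I" for j
    proof -
      have ii: "integrable M (\<lambda>\<omega>. indicator (- A n) (Z j \<omega>) :: real)"
        by (rule integrable_const_bound[of _ 1]) (use Zm[OF j] in auto)
      show ?thesis
        unfolding \<eta>_def using ii Eind[OF order_refl j] p1[of n] by (simp add: prob_space)
    qed
    have pi2: "integrable M (\<lambda>\<omega>. \<eta> (Z j \<omega>) * \<eta> (Z k \<omega>))" if "j \<in> I" "k \<in> I" for j k
    proof (rule integrable_const_bound[of _ "1 * 1"])
      have [measurable]: "Z j \<in> borel_measurable M" "Z k \<in> borel_measurable M" using that by (auto intro: Zm)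
      have "\<bar>\<eta> (Z j \<omega>) * \<eta> (Z k \<omega>)\<bar> \<le> 1 * 1" for \<omega>
        unfolding abs_mult by (intro mult_mono \<eta>b) auto
      then show "AE \<omega> in M. norm (\<eta> (Z j \<omega>) * \<eta> (Z k \<omega>)) \<le> 1 * 1" by simp
      show "(\<lambda>\<omega>. \<eta> (Z j \<omega>) * \<eta> (Z k \<omega>)) \<in> borel_measurable M" by measurable
    qed
    have cross: "expectation (\<lambda>\<omega>. \<eta> (Z j \<omega>) * \<eta> (Z k \<omega>)) = 0" if "j \<in> I" "k \<in> I" "k \<noteq> j" for j k
    proof -
      have "(\<lambda>x. \<eta> (x k)) \<in> borel_measurable (PiM (I - {j}) (\<lambda>_. borel))"
        by (rule measurable_compose[where f = "\<lambda>x. x k" and N = borel, OF _ \<eta>m])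
          (rule measurable_component_singleton, use that in simp)
      from prod0[OF that(1) \<eta>m \<eta>b \<eta>0[OF that(1)] this \<eta>b] show ?thesis using that by simp
    qed
    have "D n \<omega> = (\<Sum>j\<in>I. \<eta> (Z j \<omega>)) / N" for \<omega>
      using N unfolding D_def \<eta>_def N_def[symmetric] by (simp add: sum_subtractf diff_divide_distrib N_def[symmetric])
    then have "(D n \<omega>)\<^sup>2 = (\<Sum>j\<in>I. \<Sum>k\<in>I. \<eta> (Z j \<omega>) * \<eta> (Z k \<omega>)) / N\<^sup>2" for \<omega>
      by (simp add: power_divide power2_eq_square sum_product)
    then have "expectation (\<lambda>\<omega>. (D n \<omega>)\<^sup>2) = (\<Sum>j\<in>I. \<Sum>k\<in>I. expectation (\<lambda>\<omega>. \<eta> (Z j \<omega>) * \<eta> (Z k \<omega>))) / N\<^sup>2"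
      using pi2 by (simp add: Bochner_Integration.integral_sum Bochner_Integration.integrable_sum)
    also have "(\<Sum>j\<in>I. \<Sum>k\<in>I. expectation (\<lambda>\<omega>. \<eta> (Z j \<omega>) * \<eta> (Z k \<omega>))) \<le> (\<Sum>j\<in>I. 1)"
    proof (rule sum_mono)
      fix j assume j: "j \<in> I"
      have "(\<Sum>k\<in>I. expectation (\<lambda>\<omega>. \<eta> (Z j \<omega>) * \<eta> (Z k \<omega>))) = expectation (\<lambda>\<omega>. \<eta> (Z j \<omega>) * \<eta> (Z j \<omega>))"
        using cross[OF j] by (subst sum.remove[OF I(1) j]) simp
      also have "\<dots> \<le> expectation (\<lambda>_. 1)"
      proof (rule integral_mono[OF pi2[OF j j]])
        show "\<eta> (Z j \<omega>) * \<eta> (Z j \<omega>) \<le> 1" for \<omega>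
          using power_mono[OF \<eta>b[of "Z j \<omega>"] abs_ge_zero, of 2] by (simp add: power2_eq_square)
      qed simp
      finally show "(\<Sum>k\<in>I. expectation (\<lambda>\<omega>. \<eta> (Z j \<omega>) * \<eta> (Z k \<omega>))) \<le> 1" by (simp add: prob_space)
    qed
    also have "(\<Sum>j\<in>I. 1) / N\<^sup>2 = 1 / N" using N by (simp add: N_def power2_eq_square)
    finally show ?thesis using N by (simp add: divide_right_mono)
  qed
  moreover have "expectation (\<lambda>\<omega>. (runmax (\<lambda>i. D i \<omega>) n)\<^sup>2) \<le> 4 * expectation (\<lambda>\<omega>. (D n \<omega>)\<^sup>2)"
    by (rule doob_L2[of n D 2]) (use Dm Db mart in auto)
  ultimately show "expectation (\<lambda>\<omega>. (runmax (\<lambda>i. D i \<omega>) n)\<^sup>2) \<le> 4 / card I"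
    by (simp add: N_def)
qed

text \<open>The factor 1 - F must stay away from 0. Levels with F at most 1/2 are therefore treated
  through half-lines {..q} in increasing order, the others through the complements {q<..}, which
  grow as \<open>q\<close> decreases. Each family contributes 4, giving 8. A single variable bounds
  all grid points at once, so a random choice among them is harmless.\<close>

lemma (in prob_space) empirical_cdf_grid:
  fixes Z :: "nat \<Rightarrow> 'a \<Rightarrow> real"
  assumes ind: "indep_vars (\<lambda>_. borel) Z I" and I: "finite I" "I \<noteq> {}" and S: "finite S"
    and \<mu>: "real_distribution \<mu>" and law: "\<And>j. j \<in> I \<Longrightarrow> distr M borel (Z j) = \<mu>"
  shows "\<exists>R. integrable M R \<and> expectation R \<le> 8 / card I \<and>
    (\<forall>q\<in>S. \<forall>\<omega>\<in>space M. ((\<Sum>j\<in>I. indicator {..q} (Z j \<omega>)) / card I - cdf \<mu> q)\<^sup>2 \<le> R \<omega>)"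
proof -
  interpret \<mu>: real_distribution \<mu> by fact
  have Zm [measurable]: "Z j \<in> borel_measurable M" if "j \<in> I" for j
    using ind that unfolding indep_vars_def by blast
  have pr: "prob {\<omega> \<in> space M. Z j \<omega> \<in> C} = measure \<mu> C" if "j \<in> I" "C \<in> sets borel" for j C
    using measure_distr[of "Z j" M borel C] Zm[OF that(1)] law[OF that(1)] that(2)
    by (simp add: vimage_def Int_def conj_commute)
  have N: "0 < real (card I)" using I by (simp add: card_gt_0_iff)
  have half: "\<exists>R. (\<forall>\<omega>. 0 \<le> R \<omega>) \<and> integrable M R \<and> expectation R \<le> 4 / card I \<and>
      (\<forall>q\<in>set xs. \<forall>\<omega>. ((\<Sum>j\<in>I. indicator (C q) (Z j \<omega>)) / card I - measure \<mu> (C q))\<^sup>2 \<le> R \<omega>)"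
    if C: "\<And>q. C q \<in> sets borel" and inc: "\<And>i. Suc i < length xs \<Longrightarrow> C (xs ! i) \<subseteq> C (xs ! Suc i)"
      and h: "\<And>q. q \<in> set xs \<Longrightarrow> measure \<mu> (C q) \<le> 1 / 2" for xs :: "real list" and C :: "real \<Rightarrow> real set"
  proof (cases "xs = []")
    case True
    then show ?thesis by (intro exI[of _ "\<lambda>_. 0"]) auto
  next
    case False
    define n where "n = length xs - 1"
    have n: "length xs = Suc n" using False by (simp add: n_def)
    define A where "A i = C (xs ! i)" for i
    define p where "p i = measure \<mu> (A i)" for i
    define D where "D i \<omega> = 1 - (\<Sum>j\<in>I. indicator (- A i) (Z j \<omega>) / (1 - p i)) / card I" for i \<omega>
    have Am: "A i \<in> sets borel" for i by (simp add: A_def C)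
    have Ainc: "A i \<subseteq> A (Suc i)" if "i < n" for i using inc[of i] that n by (simp add: A_def)
    have Ap: "prob {\<omega> \<in> space M. Z j \<omega> \<in> A i} = p i" if "i \<le> n" "j \<in> I" for i j
      unfolding p_def by (rule pr[OF that(2) Am])
    have Ah: "p i \<le> 1 / 2" if "i \<le> n" for i
      unfolding p_def A_def using n that nth_mem[of i xs] by (intro h) auto
    show ?thesis
    proof (intro exI[of _ "\<lambda>\<omega>. (runmax (\<lambda>i. D i \<omega>) n)\<^sup>2"] conjI ballI allI)
      show "0 \<le> (runmax (\<lambda>i. D i \<omega>) n)\<^sup>2" for \<omega> by simp
      show "integrable M (\<lambda>\<omega>. (runmax (\<lambda>i. D i \<omega>) n)\<^sup>2)"
        unfolding D_def by (rule empirical_runmax(3)[of Z I A n p, OF ind I Am Ainc Ap Ah])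
      show "expectation (\<lambda>\<omega>. (runmax (\<lambda>i. D i \<omega>) n)\<^sup>2) \<le> 4 / card I"
        unfolding D_def by (rule empirical_runmax(1)[of Z I A n p, OF ind I Am Ainc Ap Ah])
      fix q \<omega> assume "q \<in> set xs"
      then obtain i where i: "i \<le> n" "q = xs ! i"
        using n by (auto simp: in_set_conv_nth less_Suc_eq_le)
      have "\<bar>(\<Sum>j\<in>I. indicator (A i) (Z j \<omega>)) / card I - p i\<bar> \<le> runmax (\<lambda>i. D i \<omega>) n"
        unfolding D_def by (rule empirical_runmax(2)[of Z I A n p, OF ind I Am Ainc Ap Ah i(1)])
      from power_mono[OF this abs_ge_zero, of 2]
      show "((\<Sum>j\<in>I. indicator (C q) (Z j \<omega>)) / card I - measure \<mu> (C q))\<^sup>2 \<le> (runmax (\<lambda>i. D i \<omega>) n)\<^sup>2"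
        by (simp add: i(2) A_def p_def)
    qed
  qed
  define Slo where "Slo = {q\<in>S. cdf \<mu> q \<le> 1 / 2}"
  define Shi where "Shi = {q\<in>S. 1 / 2 < cdf \<mu> q}"
  have fin: "finite Slo" "finite Shi" using S by (auto simp: Slo_def Shi_def)
  have "\<exists>R. (\<forall>\<omega>. 0 \<le> R \<omega>) \<and> integrable M R \<and> expectation R \<le> 4 / card I \<and>
      (\<forall>q\<in>set (sorted_list_of_set Slo). \<forall>\<omega>. ((\<Sum>j\<in>I. indicator {..q} (Z j \<omega>)) / card I - measure \<mu> {..q})\<^sup>2 \<le> R \<omega>)"
  proof (rule half)
    show "{..sorted_list_of_set Slo ! i} \<subseteq> {..sorted_list_of_set Slo ! Suc i}"
      if "Suc i < length (sorted_list_of_set Slo)" for i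
      using sorted_nth_mono[OF sorted_sorted_list_of_set, of i "Suc i" Slo] that by simp
  qed (use fin in \<open>auto simp: Slo_def cdf_def\<close>)
  then obtain R1 where R1: "\<And>\<omega>. 0 \<le> R1 \<omega>" "integrable M R1" "expectation R1 \<le> 4 / card I"
    "\<And>q \<omega>. q \<in> Slo \<Longrightarrow> ((\<Sum>j\<in>I. indicator {..q} (Z j \<omega>)) / card I - measure \<mu> {..q})\<^sup>2 \<le> R1 \<omega>"
    using fin by auto
  have cmp: "measure \<mu> {q<..} = 1 - cdf \<mu> q" for q
  proof -
    have "{q<..} = space \<mu> - {..q}" by auto
    then show ?thesis using \<mu>.prob_compl[of "{..q}"] by (simp add: cdf_def)
  qed
  have "\<exists>R. (\<forall>\<omega>. 0 \<le> R \<omega>) \<and> integrable M R \<and> expectation R \<le> 4 / card I \<and>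
      (\<forall>q\<in>set (rev (sorted_list_of_set Shi)). \<forall>\<omega>. ((\<Sum>j\<in>I. indicator {q<..} (Z j \<omega>)) / card I - measure \<mu> {q<..})\<^sup>2 \<le> R \<omega>)"
  proof (rule half)
    show "{rev (sorted_list_of_set Shi) ! i<..} \<subseteq> {rev (sorted_list_of_set Shi) ! Suc i<..}"
      if "Suc i < length (rev (sorted_list_of_set Shi))" for i
      using sorted_rev_nth_mono[of "rev (sorted_list_of_set Shi)" i "Suc i"] that by auto
  qed (use fin in \<open>auto simp: Shi_def cmp\<close>)
  then obtain R2 where R2: "\<And>\<omega>. 0 \<le> R2 \<omega>" "integrable M R2" "expectation R2 \<le> 4 / card I"
    "\<And>q \<omega>. q \<in> Shi \<Longrightarrow> ((\<Sum>j\<in>I. indicator {q<..} (Z j \<omega>)) / card I - measure \<mu> {q<..})\<^sup>2 \<le> R2 \<omega>"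
    using fin by auto
  show ?thesis
  proof (intro exI[of _ "\<lambda>\<omega>. R1 \<omega> + R2 \<omega>"] conjI ballI)
    show "integrable M (\<lambda>\<omega>. R1 \<omega> + R2 \<omega>)" using R1 R2 by simp
    show "expectation (\<lambda>\<omega>. R1 \<omega> + R2 \<omega>) \<le> 8 / card I"
      using R1(2,3) R2(2,3) N by (simp add: add_divide_distrib[symmetric] field_simps)
    fix q \<omega> assume q: "q \<in> S" and "\<omega> \<in> space M"
    show "((\<Sum>j\<in>I. indicator {..q} (Z j \<omega>)) / card I - cdf \<mu> q)\<^sup>2 \<le> R1 \<omega> + R2 \<omega>"
    proof (cases "cdf \<mu> q \<le> 1 / 2")
      case True
      then show ?thesis using R1(4)[of q \<omega>] R2(1)[of \<omega>] q by (simp add: Slo_def cdf_def)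
    next
      case False
      have "(\<Sum>j\<in>I. indicator {q<..} (Z j \<omega>) :: real) = (\<Sum>j\<in>I. 1 - indicator {..q} (Z j \<omega>))"
        by (intro sum.cong) (auto simp: indicator_def)
      then have "(\<Sum>j\<in>I. indicator {q<..} (Z j \<omega>)) / card I - measure \<mu> {q<..} =
        - ((\<Sum>j\<in>I. indicator {..q} (Z j \<omega>)) / card I - cdf \<mu> q)"
        using N by (simp add: cmp sum_subtractf diff_divide_distrib)
      then show ?thesis using R2(4)[of q \<omega>] R1(1)[of \<omega>] q False
        by (simp add: Shi_def power2_commute[of "cdf \<mu> q"])
    qed
  qed
qed

text \<open>\<open>Y\<close> may depend on the entire sample. It is rounded upwards to finite dyadic
  grids, where the previous bound does not depend on the grid; both distribution functions are right
  continuous, so the bound passes to the limit.\<close>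

lemma (in prob_space) empirical_cdf_at:
  fixes Z :: "nat \<Rightarrow> 'a \<Rightarrow> real"
  assumes ind: "indep_vars (\<lambda>_. borel) Z I" and I: "finite I" "I \<noteq> {}"
    and \<mu>: "real_distribution \<mu>" and law: "\<And>j. j \<in> I \<Longrightarrow> distr M borel (Z j) = \<mu>"
    and Y [measurable]: "Y \<in> borel_measurable M"
  defines "G \<equiv> \<lambda>q \<omega>. (\<Sum>j\<in>I. indicator {..q} (Z j \<omega>)) / card I - cdf \<mu> q"
  shows "(\<lambda>\<omega>. G (Y \<omega>) \<omega>) \<in> borel_measurable M" and "\<And>q \<omega>. \<bar>G q \<omega>\<bar> \<le> 1"
    and "expectation (\<lambda>\<omega>. (G (Y \<omega>) \<omega>)\<^sup>2) \<le> 8 / card I"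
proof -
  interpret \<mu>: real_distribution \<mu> by fact
  have Zm: "Z j \<in> borel_measurable M" if "j \<in> I" for j
    using ind that unfolding indep_vars_def by blast
  have N: "0 < real (card I)" using I by (simp add: card_gt_0_iff)
  have cdf_m [measurable]: "cdf \<mu> \<in> borel_measurable borel"
    by (intro borel_measurable_mono monoI \<mu>.cdf_nondecreasing)
  have Gm: "(\<lambda>\<omega>. G (y \<omega>) \<omega>) \<in> borel_measurable M" if [measurable]: "y \<in> borel_measurable M" for y
  proof -
    have "(\<lambda>\<omega>. indicator {..y \<omega>} (Z j \<omega>) :: real) \<in> borel_measurable M" if "j \<in> I" for j
    proof -
      have [measurable]: "Z j \<in> borel_measurable M" by (rule Zm[OF that])
      have "(\<lambda>\<omega>. if Z j \<omega> \<le> y \<omega> then 1 else 0 :: real) \<in> borel_measurable M" by measurable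
      then show ?thesis by (simp add: indicator_def of_bool_def)
    qed
    then have [measurable]: "(\<lambda>\<omega>. \<Sum>j\<in>I. indicator {..y \<omega>} (Z j \<omega>) :: real) \<in> borel_measurable M"
      by (rule borel_measurable_sum)
    show ?thesis unfolding G_def by measurable
  qed
  show "(\<lambda>\<omega>. G (Y \<omega>) \<omega>) \<in> borel_measurable M" by (rule Gm[OF Y])
  show Gb: "\<bar>G q \<omega>\<bar> \<le> 1" for q \<omega>
  proof -
    have "(\<Sum>j\<in>I. indicator {..q} (Z j \<omega>) :: real) \<le> (\<Sum>j\<in>I. 1)"
      by (intro sum_mono) (simp add: indicator_def)
    then have "(\<Sum>j\<in>I. indicator {..q} (Z j \<omega>)) / card I \<le> (1::real)"
      using N by (simp add: divide_le_eq)
    moreover have "0 \<le> (\<Sum>j\<in>I. indicator {..q} (Z j \<omega>)) / (card I :: real)"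
      by (intro divide_nonneg_nonneg sum_nonneg) auto
    ultimately show ?thesis
      unfolding G_def using \<mu>.cdf_nonneg[of q] \<mu>.cdf_bounded_prob[of q] by linarith
  qed
  \<comment> \<open>Adding 1 to the floor puts the rounded point strictly to the right of
    \<open>Y \<omega>\<close>, as right continuity requires. Values out of range are sent to 0 in
    \<open>y\<close> to keep the grid finite; for a given \<open>\<omega>\<close> this stops
    happening once \<open>m\<close> is large.\<close>
  define r where "r m \<omega> = real_of_int (\<lfloor>2 ^ m * Y \<omega>\<rfloor> + 1)" for m \<omega>
  define y where "y m \<omega> = (if \<bar>r m \<omega>\<bar> \<le> real (m * 2 ^ m) then r m \<omega> / 2 ^ m else 0)" for m \<omega>
  have [measurable]: "r m \<in> borel_measurable M" for m
    unfolding r_def by measurable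
  have ym [measurable]: "y m \<in> borel_measurable M" for m
    unfolding y_def by measurable
  have grid: "expectation (\<lambda>\<omega>. (G (y m \<omega>) \<omega>)\<^sup>2) \<le> 8 / card I" for m
  proof -
    let ?S = "(\<lambda>k. real_of_int k / 2 ^ m) ` {- int (m * 2 ^ m)..int (m * 2 ^ m)}"
    have yS: "y m \<omega> \<in> ?S" for \<omega>
    proof (cases "\<bar>r m \<omega>\<bar> \<le> real (m * 2 ^ m)")
      case True
      let ?k = "\<lfloor>2 ^ m * Y \<omega>\<rfloor> + 1"
      have "real_of_int \<bar>?k\<bar> \<le> real_of_int (int (m * 2 ^ m))"
        using True unfolding r_def by simp
      then have "\<bar>?k\<bar> \<le> int (m * 2 ^ m)" by (simp only: of_int_le_iff)
      then have "?k \<in> {- int (m * 2 ^ m)..int (m * 2 ^ m)}" unfolding abs_le_iff atLeastAtMost_iff by simp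
      then show ?thesis using True unfolding y_def r_def by (intro image_eqI[of _ _ ?k]) auto
    next
      case False
      then show ?thesis unfolding y_def by (intro image_eqI[of _ _ 0]) auto
    qed
    have "finite ?S" by simp
    from empirical_cdf_grid[OF ind I this \<mu> law]
    obtain R where R: "integrable M R" "expectation R \<le> 8 / card I"
      "\<And>q \<omega>. q \<in> ?S \<Longrightarrow> \<omega> \<in> space M \<Longrightarrow> (G q \<omega>)\<^sup>2 \<le> R \<omega>"
      unfolding G_def by blast
    have "expectation (\<lambda>\<omega>. (G (y m \<omega>) \<omega>)\<^sup>2) \<le> expectation R"
    proof (rule integral_mono)
      have Gm': "(\<lambda>\<omega>. (G (y m \<omega>) \<omega>)\<^sup>2) \<in> borel_measurable M"
        by (rule borel_measurable_power[OF Gm[OF ym]])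
      show "integrable M (\<lambda>\<omega>. (G (y m \<omega>) \<omega>)\<^sup>2)"
        by (rule integrable_const_bound[of _ 1, OF _ Gm']) (use Gb in \<open>auto simp: abs_square_le_1\<close>)
    qed (use R yS in auto)
    then show ?thesis using R(2) by linarith
  qed
  have lim: "(\<lambda>m. G (y m \<omega>) \<omega>) \<longlonglongrightarrow> G (Y \<omega>) \<omega>" for \<omega>
  proof -
    obtain m0 :: nat where m0: "\<bar>Y \<omega>\<bar> + 1 \<le> real m0" using real_arch_simple by blast
    have ev: "Y \<omega> < y m \<omega> \<and> y m \<omega> \<le> Y \<omega> + inverse (2 ^ m)" if "m0 \<le> m" for m
    proof -
      have r1: "2 ^ m * Y \<omega> < r m \<omega>" "r m \<omega> \<le> 2 ^ m * Y \<omega> + 1" 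
        using of_int_floor_le[of "2 ^ m * Y \<omega>"] real_of_int_floor_add_one_gt[of "2 ^ m * Y \<omega>"]
        unfolding r_def by simp_all
      have "(1::real) \<le> 2 ^ m" by simp
      have "\<bar>r m \<omega>\<bar> \<le> \<bar>2 ^ m * Y \<omega>\<bar> + 1" using r1 by linarith
      also have "\<dots> \<le> 2 ^ m * \<bar>Y \<omega>\<bar> + 2 ^ m" by (simp add: abs_mult)
      also have "\<dots> = 2 ^ m * (\<bar>Y \<omega>\<bar> + 1)" by (simp add: distrib_left)
      also have "\<dots> \<le> 2 ^ m * real m" using m0 that by (intro mult_left_mono) auto
      finally have y: "y m \<omega> = r m \<omega> / 2 ^ m" by (simp add: y_def mult.commute)
      have "Y \<omega> < r m \<omega> / 2 ^ m" using r1(1) by (simp add: pos_less_divide_eq mult.commute)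
      moreover have "r m \<omega> / 2 ^ m \<le> Y \<omega> + inverse (2 ^ m)"
        using divide_right_mono[OF r1(2), of "2 ^ m"] by (simp add: add_divide_distrib inverse_eq_divide)
      ultimately show ?thesis unfolding y by simp
    qed
    have i0: "(\<lambda>m. Y \<omega> + inverse (2 ^ m)) \<longlonglongrightarrow> Y \<omega> + 0"
      using LIMSEQ_inverse_realpow_zero[of 2] by (intro tendsto_intros) auto
    have y_lim: "(\<lambda>m. y m \<omega>) \<longlonglongrightarrow> Y \<omega>"
    proof (rule tendsto_sandwich[OF _ _ tendsto_const])
      show "(\<lambda>m. Y \<omega> + inverse (2 ^ m)) \<longlonglongrightarrow> Y \<omega>" using i0 by simp
      show "eventually (\<lambda>m. Y \<omega> \<le> y m \<omega>) sequentially" "eventually (\<lambda>m. y m \<omega> \<le> Y \<omega> + inverse (2 ^ m)) sequentially"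
        using ev unfolding eventually_sequentially by (auto intro!: exI[of _ m0] simp: less_imp_le)
    qed
    have yr: "LIM m sequentially. y m \<omega> :> at_right (Y \<omega>)"
    proof (rule filterlim_at_withinI[OF y_lim])
      show "eventually (\<lambda>m. y m \<omega> \<in> {Y \<omega><..} - {Y \<omega>}) sequentially"
        using ev unfolding eventually_sequentially by (intro exI[of _ m0]) auto
    qed
    have "(\<lambda>m. cdf \<mu> (y m \<omega>)) \<longlonglongrightarrow> cdf \<mu> (Y \<omega>)"
      using \<mu>.cdf_is_right_cont[of "Y \<omega>"] by (intro filterlim_compose[OF _ yr]) (simp add: continuous_within)
    moreover have "(\<lambda>m. indicator {..y m \<omega>} (Z j \<omega>) :: real) \<longlonglongrightarrow> indicator {..Y \<omega>} (Z j \<omega>)" for j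
    proof (rule tendsto_eventually)
      show "eventually (\<lambda>m. indicator {..y m \<omega>} (Z j \<omega>) = (indicator {..Y \<omega>} (Z j \<omega>) :: real)) sequentially"
      proof (cases "Z j \<omega> \<le> Y \<omega>")
        case True
        then show ?thesis
          using ev unfolding eventually_sequentially by (intro exI[of _ m0]) (force simp: indicator_def)
      next
        case False
        then have "eventually (\<lambda>m. y m \<omega> < Z j \<omega>) sequentially"
          by (intro order_tendstoD(2)[OF y_lim]) simp
        then show ?thesis by eventually_elim (use False in \<open>auto simp: indicator_def\<close>)
      qed
    qed
    ultimately show ?thesis
      unfolding G_def using N by (intro tendsto_intros) auto
  qed
  have "(\<lambda>m. expectation (\<lambda>\<omega>. (G (y m \<omega>) \<omega>)\<^sup>2)) \<longlonglongrightarrow> expectation (\<lambda>\<omega>. (G (Y \<omega>) \<omega>)\<^sup>2)"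
  proof (rule integral_dominated_convergence[where w = "\<lambda>_. 1"])
    show "AE \<omega> in M. (\<lambda>m. (G (y m \<omega>) \<omega>)\<^sup>2) \<longlonglongrightarrow> (G (Y \<omega>) \<omega>)\<^sup>2"
      by (intro AE_I2 tendsto_power lim)
    show "AE \<omega> in M. norm ((G (y m \<omega>) \<omega>)\<^sup>2) \<le> 1" for m
      by (rule AE_I2) (use Gb in \<open>simp add: abs_square_le_1\<close>)
  qed (auto intro!: borel_measurable_power Gm)
  then show "expectation (\<lambda>\<omega>. (G (Y \<omega>) \<omega>)\<^sup>2) \<le> 8 / card I"
    by (rule LIMSEQ_le_const2) (use grid in auto)
qed

section \<open>The mean field game and the game with common noise\<close>

text \<open>Agreement of the drifts is required only before T, which is where the drift of the game
  is identified with \<open>drift\<close>.\<close>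

lemma sde_solution_cong:
  assumes "\<And>t x. 0 \<le> t \<Longrightarrow> t < T \<Longrightarrow> b t x = b' t x"
  shows "sde_solution M F T \<sigma> b B X = sde_solution M F T \<sigma> b' B X"
proof -
  have eq: "(\<lambda>s. indicator {0..t} s *\<^sub>R b s (X s \<omega>)) = (\<lambda>s. indicator {0..t} s *\<^sub>R b' s (X s \<omega>))"
    if "t \<in> {0..<T}" for t \<omega>
    using assms that by (auto simp: fun_eq_iff indicator_def)
  have ball: "(\<forall>t\<in>{0..<T}. set_integrable lborel {0..t} (\<lambda>s. b s (X s \<omega>)) \<and>
        X t \<omega> = (LBINT s:{0..t}. b s (X s \<omega>)) + \<sigma> * B t \<omega>) =
      (\<forall>t\<in>{0..<T}. set_integrable lborel {0..t} (\<lambda>s. b' s (X s \<omega>)) \<and>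
        X t \<omega> = (LBINT s:{0..t}. b' s (X s \<omega>)) + \<sigma> * B t \<omega>)" for \<omega>
    unfolding set_integrable_def set_lebesgue_integral_def by (intro ball_cong refl) (simp only: eq)
  show ?thesis unfolding sde_solution_def ball ..
qed

lemma progressively_measurable_cong:
  assumes "filtered_prob_space M F T" and eq: "\<And>s \<omega>. s \<in> {0..T} \<Longrightarrow> a s \<omega> = a' s \<omega>"
  shows "progressively_measurable F T a = progressively_measurable F T a'"
  unfolding progressively_measurable_def
proof (intro ball_cong refl)
  fix t assume "t \<in> {0..T}"
  then show "((\<lambda>(s, \<omega>). a s \<omega>) \<in> borel_measurable (restrict_space borel {0..t} \<Otimes>\<^sub>M F t)) =
      ((\<lambda>(s, \<omega>). a' s \<omega>) \<in> borel_measurable (restrict_space borel {0..t} \<Otimes>\<^sub>M F t))"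
    using eq by (intro measurable_cong) (auto simp: space_pair_measure space_restrict_space)
qed

lemma admissible_cong:
  assumes "filtered_prob_space M F T" and eq: "\<And>s \<omega>. s \<in> {0..T} \<Longrightarrow> a s \<omega> = a' s \<omega>"
  shows "admissible M F T a = admissible M F T a'"
proof -
  have "(\<integral>\<^sup>+s\<in>{0..T}. ennreal \<bar>a s \<omega>\<bar> \<partial>lborel) = (\<integral>\<^sup>+s\<in>{0..T}. ennreal \<bar>a' s \<omega>\<bar> \<partial>lborel)" for \<omega>
    using eq by (intro nn_integral_cong) (auto simp: indicator_def)
  then show ?thesis
    unfolding admissible_def using progressively_measurable_cong[OF assms] by simp
qed

lemma cdf_empirical_measure:
  assumes "0 < N"
  shows "cdf (empirical_measure N x) y = (\<Sum>j\<in>{1..N}. indicator {..y} (x j)) / real N"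
proof -
  have "x \<in> uniform_count_measure {1..N} \<rightarrow>\<^sub>M borel"
    by (simp add: uniform_count_measure_def measurable_def)
  then have "cdf (empirical_measure N x) y = measure (uniform_count_measure {1..N}) (x -` {..y} \<inter> {1..N})"
    unfolding cdf_def empirical_measure_def by (subst measure_distr) (auto simp: space_uniform_count_measure)
  also have "\<dots> = real (card (x -` {..y} \<inter> {1..N})) / real (card {1..N})"
    by (rule measure_uniform_count_measure) auto
  also have "real (card (x -` {..y} \<inter> {1..N})) = (\<Sum>j\<in>{1..N}. indicator {..y} (x j))"
    by (simp add: indicator_def vimage_def Int_commute)
  finally show ?thesis by simp
qed

text \<open>The powers z^\<alpha> are absorbed into second moments: w^\<alpha> \<le> 1 + w^2 with w = sqrt N z.\<close>

lemma powr_le_second_moment: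
  fixes z \<alpha> :: real
  assumes "0 \<le> z" "0 < \<alpha>" "\<alpha> \<le> 1" "0 < N"
  shows "z powr \<alpha> \<le> N powr (- \<alpha> / 2) * (1 + N * z\<^sup>2)"
proof -
  define w where "w = sqrt N * z"
  have w: "0 \<le> w" using assms by (simp add: w_def)
  have "w powr \<alpha> \<le> 1 + w\<^sup>2"
  proof (cases "w \<le> 1")
    case True
    then have "w powr \<alpha> \<le> 1 powr \<alpha>" using w assms by (intro powr_mono2) auto
    then have "w powr \<alpha> \<le> 1" by simp
    then show ?thesis using zero_le_power2[of w] by linarith
  next
    case False
    then have "w powr \<alpha> \<le> w powr 2" using assms by (intro powr_mono) auto
    then show ?thesis using False by simp
  qed
  moreover have "w powr \<alpha> = N powr (\<alpha> / 2) * z powr \<alpha>"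
    using assms by (simp add: w_def powr_mult powr_powr flip: powr_half_sqrt)
  moreover have "w\<^sup>2 = N * z\<^sup>2" using assms by (simp add: w_def power_mult_distrib)
  ultimately have "N powr (\<alpha> / 2) * z powr \<alpha> \<le> 1 + N * z\<^sup>2" by simp
  then have "N powr (- \<alpha> / 2) * (N powr (\<alpha> / 2) * z powr \<alpha>) \<le> N powr (- \<alpha> / 2) * (1 + N * z\<^sup>2)"
    by (intro mult_left_mono) auto
  moreover have "N powr (- \<alpha> / 2) * (N powr (\<alpha> / 2) * z powr \<alpha>) = z powr \<alpha>"
    using assms by (simp flip: mult.assoc powr_add)
  ultimately show ?thesis by (simp only:)
qed

text \<open>\<open>path_space\<close> keeps the supremum in \<open>mfg_value\<close> from running
  over the empty set; in the final theorem it is witnessed by the space of the equilibrium.\<close>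

locale rank_mfg = quadratic_control c \<sigma> Gb "rank_reward R \<mu>"
  for c \<sigma> Gb :: real and R :: "real \<Rightarrow> real" and \<mu> :: "real measure" +
  fixes T :: real
  assumes T_pos: "0 < T" and \<mu>: "real_distribution \<mu>"
    and R_mono: "mono_on {0..1} R" and R_cont: "continuous_on {0..1} R" and R_bound: "\<And>r. r \<in> {0..1} \<Longrightarrow> \<bar>R r\<bar> \<le> Gb"
    and path_space: "\<exists>(P :: path measure) F B. filtered_prob_space P F T \<and> brownian_motion P F T B"
begin

interpretation \<mu>: real_distribution \<mu> by (rule \<mu>)

lemma cdf_unit: "cdf \<mu> x \<in> {0..1}"
  using \<mu>.cdf_nonneg[of x] \<mu>.cdf_bounded_prob[of x] by simp

lemma reward_right_continuous: "continuous (at_right x) (rank_reward R \<mu>)"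
proof -
  have "((\<lambda>y. R (cdf \<mu> y)) \<longlongrightarrow> R (cdf \<mu> x)) (at_right x)"
  proof (rule continuous_on_tendsto_compose[OF R_cont])
    show "(cdf \<mu> \<longlongrightarrow> cdf \<mu> x) (at_right x)"
      using \<mu>.cdf_is_right_cont[of x] by (simp add: continuous_within)
    show "\<forall>\<^sub>F y in at_right x. cdf \<mu> y \<in> {0..1}"
      by (intro always_eventually allI cdf_unit)
  qed (rule cdf_unit)
  then show ?thesis by (simp add: continuous_within rank_reward_def[abs_def])
qed

lemma controlled_brownianI:
  "filtered_prob_space M F T \<Longrightarrow> brownian_motion M F T B \<Longrightarrow> controlled_brownian c \<sigma> Gb (rank_reward R \<mu>) M F T B"
  by (intro controlled_brownian.intro controlled_brownian_axioms.intro brownian_space.intro quadratic_control_axioms T_pos)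

text \<open>The upper bound holds on every admissible space with the same number
  \<open>V (T - t) x\<close>, whereas near-optimal controls on one single space already give the
  lower bound.\<close>

lemma mfg_value_eq:
  assumes t: "0 \<le> t" "t < T"
  shows "mfg_value T c \<sigma> R \<mu> t x = V (T - t) x"
proof -
  define S where "S = {ereal_expectation P (\<lambda>\<omega>.
        ereal (rank_reward R \<mu> (x + (LBINT s:{t..T}. a s \<omega>) + \<sigma> * (B T \<omega> - B t \<omega>)))
        - running_cost c a t T \<omega>)
      | (P :: path measure) F B a.
        filtered_prob_space P F T \<and> brownian_motion P F T B \<and> admissible P F T a}"
  have upper: "Sup S \<le> ereal (V (T - t) x)"
  proof (rule Sup_least)
    fix y assume "y \<in> S"
    then obtain P F B a where "filtered_prob_space (P :: path measure) F T" "brownian_motion P F T B"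
      and a: "admissible P F T a"
      and y: "y = ereal_expectation P (\<lambda>\<omega>. ereal (rank_reward R \<mu> (x + (LBINT s:{t..T}. a s \<omega>) + \<sigma> * (B T \<omega> - B t \<omega>)))
        - running_cost c a t T \<omega>)"
      unfolding S_def by blast
    then interpret C: controlled_brownian c \<sigma> Gb "rank_reward R \<mu>" P F T B
      by (intro controlled_brownianI)
    show "y \<le> ereal (V (T - t) x)" unfolding y by (rule C.payoff_ereal_le[OF a t])
  qed
  obtain P F B where PFB: "filtered_prob_space (P :: path measure) F T" "brownian_motion P F T B"
    using path_space by blast
  then interpret C: controlled_brownian c \<sigma> Gb "rank_reward R \<mu>" P F T B
    by (intro controlled_brownianI)
  have lower: "ereal (V (T - t) x) \<le> Sup S"
  proof (rule ereal_le_epsilon2)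
    fix e :: real assume e: "0 < e"
    obtain a where a: "admissible P F T a"
      and le: "ereal (V (T - t) x - e) \<le> ereal_expectation P (\<lambda>\<omega>. ereal (rank_reward R \<mu> (x + (LBINT s:{t..T}. a s \<omega>) + \<sigma> * (B T \<omega> - B t \<omega>)))
        - running_cost c a t T \<omega>)"
      using C.near_optimal[OF t e] by blast
    have "ereal (V (T - t) x - e) \<le> Sup S"
      by (rule order_trans[OF le Sup_upper]) (use a PFB in \<open>auto simp: S_def\<close>)
    then show "ereal (V (T - t) x) \<le> Sup S + ereal e"
      by (cases "Sup S") auto
  qed
  from upper lower have "Sup S = ereal (V (T - t) x)" by (rule antisym)
  then show ?thesis unfolding mfg_value_def S_def by simp
qed

lemma mfg_drift_eq:
  assumes t: "0 \<le> t" "t < T"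
  shows "mfg_drift T c \<sigma> R \<mu> t x = drift (T - t) x"
proof -
  have "(\<lambda>y. mfg_value T c \<sigma> R \<mu> t y) = V (T - t)" using mfg_value_eq[OF t] by auto
  moreover have "deriv (V (T - t)) x = 2 * c * drift (T - t) x"
    using t by (intro DERIV_imp_deriv V_deriv) simp
  ultimately show ?thesis using c_pos by (simp add: mfg_drift_def)
qed

lemma optimal_stateI:
  assumes "filtered_prob_space M F T" "brownian_motion M F T B"
    and "sde_solution M F T \<sigma> (mfg_drift T c \<sigma> R \<mu>) B X"
  shows "optimal_state c \<sigma> Gb (rank_reward R \<mu>) M F T B X"
proof -
  have "sde_solution M F T \<sigma> (\<lambda>t x. drift (T - t) x) B X"
    using assms(3) mfg_drift_eq by (subst sde_solution_cong[where b' = "mfg_drift T c \<sigma> R \<mu>"]) auto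
  then show ?thesis
    by (intro optimal_state.intro optimal_state_axioms.intro controlled_brownianI assms)
qed

end

text \<open>The equilibrium property enters through \<open>law\<close>: each player's optimal state
  has terminal law \<open>\<mu>\<close> on the space of the game. It is discharged later by
  uniqueness in law.\<close>

locale common_noise_game = rank_mfg +
  fixes L \<alpha> \<sigma>0 :: real and N :: nat and M :: "'w measure" and F :: "real \<Rightarrow> 'w measure"
    and B :: "nat \<Rightarrow> real \<Rightarrow> 'w \<Rightarrow> real" and W :: "real \<Rightarrow> 'w \<Rightarrow> real" and X :: "nat \<Rightarrow> real \<Rightarrow> 'w \<Rightarrow> real"
  assumes L: "0 < L" and \<alpha>: "0 < \<alpha>" "\<alpha> \<le> 1" and N: "0 < N"
    and R_holder: "\<And>r r'. r \<in> {0..1} \<Longrightarrow> r' \<in> {0..1} \<Longrightarrow> \<bar>R r - R r'\<bar> \<le> L * \<bar>r - r'\<bar> powr \<alpha>"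
    and noise: "common_noise_space M F T N B W"
    and sols: "\<And>i. i \<in> {1..N} \<Longrightarrow> sde_solution M F T \<sigma> (mfg_drift T c \<sigma> R \<mu>) (B i) (X i)"
    and law: "\<And>i. i \<in> {1..N} \<Longrightarrow> distr M borel (X i T) = \<mu>"
begin

lemma noise_facts:
  "filtered_prob_space M F T" "i \<in> {1..N} \<Longrightarrow> brownian_motion M F T (B i)" "brownian_motion M F T W"
  using noise by (auto simp: common_noise_space_def)

sublocale prob_space M
  using noise_facts(1) by (simp add: filtered_prob_space_def)

lemma state: "i \<in> {1..N} \<Longrightarrow> optimal_state c \<sigma> Gb (rank_reward R \<mu>) M F T (B i) (X i)"
  by (intro optimal_stateI noise_facts sols)

text \<open>A version of the terminal state \<open>X i T\<close> that is literally a function of the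
  noise of player \<open>i\<close>. It inherits independence across players from the noises, which
  the definition of a solution does not state for the \<open>X i\<close>.\<close>

definition Z :: "nat \<Rightarrow> 'w \<Rightarrow> real" where
  "Z i \<omega> = terminal_map T (\<lambda>t\<in>{0..T}. B i t \<omega>)"

lemma indep_Z: "indep_vars (\<lambda>_. borel) Z {1..N}"
proof -
  have "indep_vars (\<lambda>_. PiM {0..T} (\<lambda>_. borel)) (\<lambda>k \<omega>. \<lambda>t\<in>{0..T}. (if k = 0 then W else B k) t \<omega>) {0..N}"
    using noise by (simp add: common_noise_space_def)
  then have "indep_vars (\<lambda>_. PiM {0..T} (\<lambda>_. borel)) (\<lambda>k \<omega>. \<lambda>t\<in>{0..T}. (if k = 0 then W else B k) t \<omega>) {1..N}"
    by (rule indep_vars_subset) auto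
  then have "indep_vars (\<lambda>_. borel) (\<lambda>k \<omega>. terminal_map T (\<lambda>t\<in>{0..T}. (if k = 0 then W else B k) t \<omega>)) {1..N}"
    by (rule indep_vars_compose2) (rule measurable_terminal_map[OF T_pos])
  then show ?thesis
    by (rule indep_vars_cong[THEN iffD1, rotated 3]) (auto simp: Z_def fun_eq_iff)
qed

lemma measurable_Z: "i \<in> {1..N} \<Longrightarrow> Z i \<in> borel_measurable M"
  using indep_Z unfolding indep_vars_def by blast

lemma Z_eq:
  assumes "i \<in> {1..N}"
  shows "AE \<omega> in M. Z i \<omega> = X i T \<omega>"
proof -
  interpret S: optimal_state c \<sigma> Gb "rank_reward R \<mu>" M F T "B i" "X i" by (rule state[OF assms])
  show ?thesis using S.AE_good by eventually_elim (simp add: Z_def S.terminal_map_eq)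
qed

lemma law_Z:
  assumes "i \<in> {1..N}"
  shows "distr M borel (Z i) = \<mu>"
proof -
  interpret S: optimal_state c \<sigma> Gb "rank_reward R \<mu>" M F T "B i" "X i" by (rule state[OF assms])
  have "distr M borel (Z i) = distr M borel (X i T)"
    using Z_eq[OF assms] measurable_Z[OF assms] T_pos by (intro distr_cong_AE) auto
  then show ?thesis using law[OF assms] by simp
qed

abbreviation feedback :: "nat \<Rightarrow> real \<Rightarrow> 'w \<Rightarrow> real" where
  "feedback i \<equiv> feedback_control T c \<sigma> R \<mu> (X i)"

lemma feedback_eq:
  assumes "i \<in> {1..N}" "s \<in> {0..T}"
  shows "feedback i s \<omega> = optimal_state.control c \<sigma> (rank_reward R \<mu>) T (X i) s \<omega>"
proof -
  interpret S: optimal_state c \<sigma> Gb "rank_reward R \<mu>" M F T "B i" "X i" by (rule state[OF assms(1)])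
  show ?thesis using assms(2) by (simp add: feedback_control_def S.control_def mfg_drift_eq)
qed

lemma admissible_feedback:
  assumes "i \<in> {1..N}"
  shows "admissible M F T (feedback i)"
proof -
  interpret S: optimal_state c \<sigma> Gb "rank_reward R \<mu>" M F T "B i" "X i" by (rule state[OF assms])
  show ?thesis
    by (subst admissible_cong[OF noise_facts(1) feedback_eq[OF assms]])
      (auto intro: S.admissible_control reward_right_continuous)
qed

lemma feedback_terminal:
  assumes "i \<in> {1..N}"
  shows "AE \<omega> in M. (LBINT s:{0..T}. feedback i s \<omega>) + \<sigma> * B i T \<omega> = Z i \<omega>"
proof -
  interpret S: optimal_state c \<sigma> Gb "rank_reward R \<mu>" M F T "B i" "X i" by (rule state[OF assms])
  have eq: "(LBINT s:{0..T}. feedback i s \<omega>) = (LBINT s:{0..T}. S.control s \<omega>)" for \<omega>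
    using feedback_eq[OF assms] by (intro set_lebesgue_integral_cong) auto
  show ?thesis
    unfolding eq using S.terminal_state[OF reward_right_continuous] Z_eq[OF assms] by eventually_elim simp
qed

text \<open>The constant arises as 19 = 3 + 2 * 8: the 8 is the second moment bound for the
  empirical distribution function, and 3 collects the constant of
  \<open>powr_le_second_moment\<close> and the change of one term in the empirical average.\<close>

definition err :: real where "err = 19 * L * real N powr (- \<alpha> / 2)"

text \<open>All states carry the same common noise, which therefore cancels in the ranks; the law of the
  deviating state is irrelevant because the bound on the empirical distribution function
  holds at an arbitrary random point.\<close>

lemma deviation_reward:
  fixes \<beta> :: "real \<Rightarrow> 'w \<Rightarrow> real"
  assumes i: "i \<in> {1..N}" and \<beta>: "admissible M F T \<beta>"
  defines "a \<equiv> feedback(i := \<beta>)"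
  defines "r \<equiv> \<lambda>\<omega>. rank_reward R (empirical_measure N (\<lambda>j. player_state \<sigma> \<sigma>0 (B j) W (a j) T \<omega>))
       (player_state \<sigma> \<sigma>0 (B i) W (a i) T \<omega>)"
  defines "Y \<equiv> \<lambda>\<omega>. (LBINT s:{0..T}. \<beta> s \<omega>) + \<sigma> * B i T \<omega>"
  shows "r \<in> borel_measurable M" and "\<And>\<omega>. \<bar>r \<omega>\<bar> \<le> Gb" and "Y \<in> borel_measurable M"
    and "\<bar>expectation r - expectation (\<lambda>\<omega>. rank_reward R \<mu> (Y \<omega>))\<bar> \<le> err"
proof -
  have Bt: "B j T \<in> borel_measurable M" "W T \<in> borel_measurable M" if "j \<in> {1..N}" for j
  proof -
    interpret C: controlled_brownian c \<sigma> Gb "rank_reward R \<mu>" M F T "B j"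
      by (intro controlled_brownianI noise_facts that)
    interpret C': controlled_brownian c \<sigma> Gb "rank_reward R \<mu>" M F T W
      by (intro controlled_brownianI noise_facts)
    show "B j T \<in> borel_measurable M" "W T \<in> borel_measurable M" using T_pos by auto
  qed
  interpret C: controlled_brownian c \<sigma> Gb "rank_reward R \<mu>" M F T "B i"
    by (intro controlled_brownianI noise_facts i)
  have intm: "(\<lambda>\<omega>. LBINT s:{0..T}. b s \<omega>) \<in> borel_measurable M" if "admissible M F T b" for b
    using that T_pos unfolding admissible_def
    by (intro C.measurable_F_M[OF C.measurable_set_integral[of b 0 T]]) auto
  have adm: "admissible M F T (a j)" if "j \<in> {1..N}" for j
    using that \<beta> admissible_feedback by (simp add: a_def)
  define st where "st j \<omega> = player_state \<sigma> \<sigma>0 (B j) W (a j) T \<omega>" for j \<omega>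
  have stm: "st j \<in> borel_measurable M" if "j \<in> {1..N}" for j
    unfolding st_def player_state_def using intm[OF adm[OF that]] Bt[OF that] by simp
  show Ym: "Y \<in> borel_measurable M"
    unfolding Y_def using intm[OF \<beta>] Bt[OF i] by simp
  define Fh where "Fh \<omega> = (\<Sum>j\<in>{1..N}. indicator {..st i \<omega>} (st j \<omega>)) / real N" for \<omega>
  have rF: "r \<omega> = R (Fh \<omega>)" for \<omega>
    unfolding r_def rank_reward_def cdf_empirical_measure[OF N] Fh_def st_def ..
  have Fm [measurable]: "Fh \<in> borel_measurable M"
  proof -
    have "(\<lambda>\<omega>. indicator {..st i \<omega>} (st j \<omega>) :: real) \<in> borel_measurable M" if "j \<in> {1..N}" for j
    proof -
      have [measurable]: "st j \<in> borel_measurable M" "st i \<in> borel_measurable M" using stm that i by auto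
      have "(\<lambda>\<omega>. if st j \<omega> \<le> st i \<omega> then 1 else 0 :: real) \<in> borel_measurable M" by measurable
      then show ?thesis by (simp add: indicator_def of_bool_def)
    qed
    then have "(\<lambda>\<omega>. \<Sum>j\<in>{1..N}. indicator {..st i \<omega>} (st j \<omega>) :: real) \<in> borel_measurable M"
      by (rule borel_measurable_sum)
    then show ?thesis unfolding Fh_def[abs_def] by simp
  qed
  have F01: "Fh \<omega> \<in> {0..1}" for \<omega>
  proof -
    have "(\<Sum>j\<in>{1..N}. indicator {..st i \<omega>} (st j \<omega>) :: real) \<le> (\<Sum>j\<in>{1..N}. 1)"
      by (intro sum_mono) (simp add: indicator_def)
    moreover have "0 \<le> (\<Sum>j\<in>{1..N}. indicator {..st i \<omega>} (st j \<omega>) :: real)" by (intro sum_nonneg) auto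
    ultimately show ?thesis using N by (simp add: Fh_def divide_le_eq)
  qed
  show rb: "\<bar>r \<omega>\<bar> \<le> Gb" for \<omega> unfolding rF by (rule R_bound[OF F01])
  \<comment> \<open>\<open>R\<close> is monotone on the unit interval only; clamping its argument
    gives a function monotone on the whole line, hence Borel.\<close>
  define R' where "R' x = R (max 0 (min 1 x))" for x
  have "mono R'"
    unfolding R'_def by (intro monoI mono_onD[OF R_mono]) auto
  then have [measurable]: "R' \<in> borel_measurable borel" by (rule borel_measurable_mono)
  have "r \<omega> = R' (Fh \<omega>)" for \<omega> using F01[of \<omega>] by (simp add: rF R'_def)
  then have "r = (\<lambda>\<omega>. R' (Fh \<omega>))" by auto
  then show rm: "r \<in> borel_measurable M" by simp
  define G where "G q \<omega> = (\<Sum>j\<in>{1..N}. indicator {..q} (Z j \<omega>)) / card {1..N} - cdf \<mu> q" for q \<omega>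
  have ne: "{1..N} \<noteq> {}" using N by simp
  have Gm [measurable]: "(\<lambda>\<omega>. G (Y \<omega>) \<omega>) \<in> borel_measurable M"
    unfolding G_def by (rule empirical_cdf_at(1)[OF indep_Z _ ne \<mu> law_Z Ym]) auto
  have Gb1: "\<bar>G q \<omega>\<bar> \<le> 1" for q \<omega>
    unfolding G_def by (rule empirical_cdf_at(2)[OF indep_Z _ ne \<mu> law_Z Ym]) auto
  have G2: "expectation (\<lambda>\<omega>. (G (Y \<omega>) \<omega>)\<^sup>2) \<le> 8 / real N"
    using empirical_cdf_at(3)[OF indep_Z finite_atLeastAtMost ne \<mu> law_Z Ym] unfolding G_def by simp
  \<comment> \<open>The empirical average of the actual states and that of the \<open>Z j\<close>
    differ almost surely only in the term of the deviating player, hence by at most 1 / N.\<close>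
  define z where "z \<omega> = \<bar>G (Y \<omega>) \<omega>\<bar> + 1 / real N" for \<omega>
  have zm [measurable]: "z \<in> borel_measurable M" unfolding z_def by measurable
  have z0: "0 \<le> z \<omega>" for \<omega> by (simp add: z_def)
  have z2: "z \<omega> \<le> 2" for \<omega>
  proof -
    have "1 / real N \<le> 1" using N by simp
    then show ?thesis using Gb1[of "Y \<omega>" \<omega>] by (simp add: z_def)
  qed
  have diff: "AE \<omega> in M. \<bar>r \<omega> - rank_reward R \<mu> (Y \<omega>)\<bar> \<le> L * z \<omega> powr \<alpha>"
  proof -
    have "AE \<omega> in M. \<forall>j\<in>{1..N}. (LBINT s:{0..T}. feedback j s \<omega>) + \<sigma> * B j T \<omega> = Z j \<omega>"
      using feedback_terminal by (intro AE_finite_allI) auto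
    then show ?thesis
    proof eventually_elim
      case (elim \<omega>)
      have sti: "st i \<omega> = Y \<omega> + \<sigma>0 * W T \<omega>" by (simp add: st_def player_state_def a_def Y_def)
      have stj: "st j \<omega> = Z j \<omega> + \<sigma>0 * W T \<omega>" if "j \<in> {1..N}" "j \<noteq> i" for j
        using elim that by (simp add: st_def player_state_def a_def)
      have dist: "\<bar>(\<Sum>j\<in>{1..N}. indicator {..st i \<omega>} (st j \<omega>)) - (\<Sum>j\<in>{1..N}. indicator {..Y \<omega>} (Z j \<omega>))\<bar> \<le> (1::real)"
      proof -
        have rem: "(\<Sum>j\<in>{1..N}. f j) = f i + (\<Sum>j\<in>{1..N} - {i}. f j)" for f :: "nat \<Rightarrow> real"
          using i by (intro sum.remove) auto
        have rest: "(\<Sum>j\<in>{1..N} - {i}. indicator {..st i \<omega>} (st j \<omega>)) = (\<Sum>j\<in>{1..N} - {i}. indicator {..Y \<omega>} (Z j \<omega>) :: real)"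
          by (intro sum.cong) (auto simp: indicator_def sti stj)
        have "\<bar>indicator A x - indicator A' x'\<bar> \<le> (1::real)" for A A' and x x' :: real
          by (simp add: indicator_def)
        then show ?thesis unfolding rem rest by simp
      qed
      have "Fh \<omega> - cdf \<mu> (Y \<omega>) = G (Y \<omega>) \<omega> + ((\<Sum>j\<in>{1..N}. indicator {..st i \<omega>} (st j \<omega>)) - (\<Sum>j\<in>{1..N}. indicator {..Y \<omega>} (Z j \<omega>))) / real N"
        by (simp add: Fh_def G_def diff_divide_distrib)
      moreover have "\<bar>((\<Sum>j\<in>{1..N}. indicator {..st i \<omega>} (st j \<omega>)) - (\<Sum>j\<in>{1..N}. indicator {..Y \<omega>} (Z j \<omega>))) / real N\<bar> \<le> 1 / real N"
        unfolding abs_divide using dist by (simp add: divide_right_mono)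
      ultimately have le: "\<bar>Fh \<omega> - cdf \<mu> (Y \<omega>)\<bar> \<le> z \<omega>" unfolding z_def by linarith
      have "\<bar>r \<omega> - rank_reward R \<mu> (Y \<omega>)\<bar> \<le> L * \<bar>Fh \<omega> - cdf \<mu> (Y \<omega>)\<bar> powr \<alpha>"
        unfolding rF rank_reward_def by (rule R_holder[OF F01 cdf_unit])
      also have "\<dots> \<le> L * z \<omega> powr \<alpha>"
        using le L \<alpha> by (intro mult_left_mono powr_mono2) auto
      finally show ?case .
    qed
  qed
  have G2i: "integrable M (\<lambda>\<omega>. (G (Y \<omega>) \<omega>)\<^sup>2)"
    by (rule integrable_const_bound[of _ 1]) (use Gb1 in \<open>auto simp: abs_square_le_1\<close>)
  have zpi: "integrable M (\<lambda>\<omega>. z \<omega> powr \<alpha>)"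
  proof (rule integrable_const_bound[of _ "2 powr \<alpha>"])
    show "AE \<omega> in M. norm (z \<omega> powr \<alpha>) \<le> 2 powr \<alpha>"
      using z0 z2 \<alpha> by (intro AE_I2) (simp add: powr_mono2)
  qed measurable
  have Ez: "expectation (\<lambda>\<omega>. z \<omega> powr \<alpha>) \<le> 19 * real N powr (- \<alpha> / 2)"
  proof -
    let ?p = "real N powr (- \<alpha> / 2)"
    have N1: "1 \<le> real N" using N by simp
    have pt: "z \<omega> powr \<alpha> \<le> ?p * (3 + 2 * real N * (G (Y \<omega>) \<omega>)\<^sup>2)" for \<omega>
    proof -
      \<comment> \<open>This gives (u + v)^2 \<le> 2 u^2 + 2 v^2. Multiplied by N, the part from 1 /
        N is at most 2, and with the 1 from \<open>powr_le_second_moment\<close> it makes 3.\<close>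
      have "0 \<le> (\<bar>G (Y \<omega>) \<omega>\<bar> - 1 / real N)\<^sup>2" by simp
      then have "(z \<omega>)\<^sup>2 \<le> 2 * (G (Y \<omega>) \<omega>)\<^sup>2 + 2 * (1 / real N)\<^sup>2"
        unfolding z_def by (simp add: power2_sum power2_diff)
      then have "real N * (z \<omega>)\<^sup>2 \<le> real N * (2 * (G (Y \<omega>) \<omega>)\<^sup>2 + 2 * (1 / real N)\<^sup>2)"
        by (intro mult_left_mono) auto
      also have "\<dots> = 2 * real N * (G (Y \<omega>) \<omega>)\<^sup>2 + 2 / real N"
        using N by (simp add: distrib_left power2_eq_square)
      also have "\<dots> \<le> 2 * real N * (G (Y \<omega>) \<omega>)\<^sup>2 + 2"
        using N1 by (simp add: divide_le_eq)
      finally have "real N * (z \<omega>)\<^sup>2 \<le> 2 * real N * (G (Y \<omega>) \<omega>)\<^sup>2 + 2" .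
      then have le: "?p * (1 + real N * (z \<omega>)\<^sup>2) \<le> ?p * (3 + 2 * real N * (G (Y \<omega>) \<omega>)\<^sup>2)"
        by (intro mult_left_mono) auto
      have "z \<omega> powr \<alpha> \<le> ?p * (1 + real N * (z \<omega>)\<^sup>2)"
        using N by (intro powr_le_second_moment z0 \<alpha>) simp
      from this le show ?thesis by (rule order_trans)
    qed
    have "expectation (\<lambda>\<omega>. z \<omega> powr \<alpha>) \<le> expectation (\<lambda>\<omega>. ?p * (3 + 2 * real N * (G (Y \<omega>) \<omega>)\<^sup>2))"
      by (rule integral_mono[OF zpi _ pt]) (use G2i in simp)
    also have "\<dots> = ?p * (3 + 2 * real N * expectation (\<lambda>\<omega>. (G (Y \<omega>) \<omega>)\<^sup>2))"
      using G2i by (simp add: prob_space)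
    also have "\<dots> \<le> ?p * (3 + 2 * real N * (8 / real N))"
      using G2 by (intro mult_left_mono add_left_mono) auto
    also have "\<dots> = 19 * ?p" using N by simp
    finally show ?thesis .
  qed
  have ri: "integrable M r" by (rule integrable_const_bound[of _ Gb]) (use rm rb in auto)
  have gi: "integrable M (\<lambda>\<omega>. rank_reward R \<mu> (Y \<omega>))"
    using Ym g_bound by (intro C.integrable_bounded_comp[of "rank_reward R \<mu>" Y Gb]) auto
  have "\<bar>expectation r - expectation (\<lambda>\<omega>. rank_reward R \<mu> (Y \<omega>))\<bar> = \<bar>expectation (\<lambda>\<omega>. r \<omega> - rank_reward R \<mu> (Y \<omega>))\<bar>"
    using ri gi by simp
  also have "\<dots> \<le> expectation (\<lambda>\<omega>. \<bar>r \<omega> - rank_reward R \<mu> (Y \<omega>)\<bar>)" by (rule integral_abs_bound)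
  also have "\<dots> \<le> expectation (\<lambda>\<omega>. L * z \<omega> powr \<alpha>)"
    using diff ri gi zpi by (intro integral_mono_AE) auto
  also have "\<dots> \<le> err"
    using Ez L zpi by (simp add: err_def mult.assoc)
  finally show "\<bar>expectation r - expectation (\<lambda>\<omega>. rank_reward R \<mu> (Y \<omega>))\<bar> \<le> err" .
qed

lemma deviation_payoff_le:
  assumes i: "i \<in> {1..N}" and \<beta>: "admissible M F T \<beta>"
  shows "player_payoff M T c \<sigma> \<sigma>0 R N B W (feedback(i := \<beta>)) i \<le> ereal (V T 0 + err)"
proof -
  interpret C: controlled_brownian c \<sigma> Gb "rank_reward R \<mu>" M F T "B i"
    by (intro controlled_brownianI noise_facts i)
  have prog: "progressively_measurable F T \<beta>" using \<beta> by (simp add: admissible_def)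
  let ?C = "\<lambda>\<omega>. \<integral>\<^sup>+s\<in>{0..T}. ennreal (c * (\<beta> s \<omega>)\<^sup>2) \<partial>lborel"
  have Cm: "?C \<in> borel_measurable M" using T_pos by (intro C.measurable_cost[OF prog]) auto
  note dr = deviation_reward[OF i \<beta>]
  note ee = ereal_expectation_payoff[OF prob_space_axioms dr(1,2) Cm]
  show ?thesis
  proof (cases "(\<integral>\<^sup>+\<omega>. ?C \<omega> \<partial>M) = \<infinity>")
    case True
    then show ?thesis using ee(1) by (simp add: player_payoff_def running_cost_def)
  next
    case False
    then have fin: "(\<integral>\<^sup>+\<omega>. ?C \<omega> \<partial>M) < \<infinity>" by (simp add: less_top)
    have B0: "AE \<omega> in M. B i 0 \<omega> = 0"
      using noise_facts(2)[OF i] unfolding brownian_motion_def by (auto elim: eventually_mono)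
    have m1: "(\<lambda>\<omega>. rank_reward R \<mu> (0 + (LBINT s:{0..T}. \<beta> s \<omega>) + \<sigma> * (B i T \<omega> - B i 0 \<omega>))) \<in> borel_measurable M"
    proof -
      have [measurable]: "(\<lambda>\<omega>. LBINT s:{0..T}. \<beta> s \<omega>) \<in> borel_measurable M" "B i T \<in> borel_measurable M" "B i 0 \<in> borel_measurable M"
        using T_pos by (auto intro!: C.measurable_F_M[OF C.measurable_set_integral[OF prog, of 0 T]])
      show ?thesis by measurable
    qed
    have m2: "(\<lambda>\<omega>. rank_reward R \<mu> ((LBINT s:{0..T}. \<beta> s \<omega>) + \<sigma> * B i T \<omega>)) \<in> borel_measurable M"
      using measurable_compose[OF dr(3) measurable_g] .
    have "expectation (\<lambda>\<omega>. rank_reward R \<mu> ((LBINT s:{0..T}. \<beta> s \<omega>) + \<sigma> * B i T \<omega>)) =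
      expectation (\<lambda>\<omega>. rank_reward R \<mu> (0 + (LBINT s:{0..T}. \<beta> s \<omega>) + \<sigma> * (B i T \<omega> - B i 0 \<omega>)))"
      using B0 m1 m2 by (intro integral_cong_AE) (auto elim: eventually_mono)
    also have "\<dots> \<le> V T 0 + enn2real (\<integral>\<^sup>+\<omega>. ?C \<omega> \<partial>M)"
      using C.payoff_le[OF prog order_refl T_pos C.admissible_integrable[OF \<beta> less_imp_le[OF T_pos]] fin, of 0] by simp
    finally show ?thesis
      using ee(2)[OF fin] dr(4) by (simp add: player_payoff_def running_cost_def)
  qed
qed

text \<open>The feedback profile is the deviation in which the player keeps the own feedback, so
  \<open>deviation_reward\<close> applies again; the matching cost bound comes from
  \<open>value_attained\<close>.\<close>

lemma feedback_payoff_ge: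
  assumes i: "i \<in> {1..N}"
  shows "ereal (V T 0 - err) \<le> player_payoff M T c \<sigma> \<sigma>0 R N B W feedback i"
proof -
  interpret S: optimal_state c \<sigma> Gb "rank_reward R \<mu>" M F T "B i" "X i" by (rule state[OF i])
  let ?C = "\<lambda>\<omega>. \<integral>\<^sup>+s\<in>{0..T}. ennreal (c * (feedback i s \<omega>)\<^sup>2) \<partial>lborel"
  have Ceq: "?C = (\<lambda>\<omega>. \<integral>\<^sup>+s\<in>{0..T}. ennreal (c * (S.control s \<omega>)\<^sup>2) \<partial>lborel)"
    using feedback_eq[OF i] by (intro ext nn_integral_cong) (auto simp: indicator_def)
  have Cm: "?C \<in> borel_measurable M"
    unfolding Ceq using T_pos by (intro S.measurable_cost[OF S.progressive_control]) auto
  note va = S.value_attained[OF reward_right_continuous]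
  have fin: "(\<integral>\<^sup>+\<omega>. ?C \<omega> \<partial>M) < \<infinity>"
    unfolding Ceq using va(1) by (rule le_less_trans) simp
  have Q: "enn2real (\<integral>\<^sup>+\<omega>. ?C \<omega> \<partial>M) \<le> expectation (\<lambda>\<omega>. rank_reward R \<mu> (X i T \<omega>)) - V T 0"
    unfolding Ceq using va by (intro enn2real_leI) auto
  note dr = deviation_reward[OF i admissible_feedback[OF i]]
  note ee = ereal_expectation_payoff(2)[OF prob_space_axioms dr(1,2) Cm fin]
  have "expectation (\<lambda>\<omega>. rank_reward R \<mu> ((LBINT s:{0..T}. feedback i s \<omega>) + \<sigma> * B i T \<omega>)) =
    expectation (\<lambda>\<omega>. rank_reward R \<mu> (X i T \<omega>))"
  proof (rule integral_cong_AE)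
    show "(\<lambda>\<omega>. rank_reward R \<mu> ((LBINT s:{0..T}. feedback i s \<omega>) + \<sigma> * B i T \<omega>)) \<in> borel_measurable M"
      using measurable_compose[OF dr(3) measurable_g] .
    show "(\<lambda>\<omega>. rank_reward R \<mu> (X i T \<omega>)) \<in> borel_measurable M"
      using T_pos by (intro measurable_compose[OF S.measurable_X measurable_g]) auto
    show "AE \<omega> in M. rank_reward R \<mu> ((LBINT s:{0..T}. feedback i s \<omega>) + \<sigma> * B i T \<omega>) = rank_reward R \<mu> (X i T \<omega>)"
      using feedback_terminal[OF i] Z_eq[OF i] by eventually_elim simp
  qed
  moreover have "(if j = i then feedback i else feedback j) = feedback j" for j
    by simp
  ultimately show ?thesis
    using ee dr(4) Q by (simp add: player_payoff_def running_cost_def)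
qed

text \<open>Both payoffs are compared with the same number \<open>V T 0\<close>, each with loss
  \<open>err\<close>.\<close>

lemma eps_nash: "eps_nash_equilibrium M F T c \<sigma> \<sigma>0 R N B W (38 * L * real N powr (- \<alpha> / 2)) feedback"
  unfolding eps_nash_equilibrium_def
proof (intro conjI ballI allI impI admissible_feedback)
  fix i \<beta> assume i: "i \<in> {1..N}" and \<beta>: "admissible M F T \<beta>"
  have "player_payoff M T c \<sigma> \<sigma>0 R N B W (feedback(i := \<beta>)) i \<le> ereal (V T 0 - err) + ereal (38 * L * real N powr (- \<alpha> / 2))"
    using deviation_payoff_le[OF i \<beta>] by (simp add: err_def algebra_simps)
  also have "\<dots> \<le> player_payoff M T c \<sigma> \<sigma>0 R N B W feedback i + ereal (38 * L * real N powr (- \<alpha> / 2))"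
    by (intro add_right_mono feedback_payoff_ge i)
  finally show "player_payoff M T c \<sigma> \<sigma>0 R N B W (feedback(i := \<beta>)) i
    \<le> player_payoff M T c \<sigma> \<sigma>0 R N B W feedback i + ereal (38 * L * real N powr (- \<alpha> / 2))" .
qed

end

theorem theorem4p3:
  fixes T c \<sigma> \<sigma>0 L \<alpha> :: real and R :: "real \<Rightarrow> real" and \<mu> :: "real measure"
  assumes "T > 0" and "c > 0" and "\<sigma> > 0" and "\<sigma>0 > 0"
    and "bounded (R ` {0..1})" and "continuous_on {0..1} R" and "mono_on {0..1} R"
    and "L > 0" and "0 < \<alpha>" and "\<alpha> \<le> 1"
    and "\<forall>r\<^sub>1\<in>{0..1}. \<forall>r\<^sub>2\<in>{0..1}. \<bar>R r\<^sub>1 - R r\<^sub>2\<bar> \<le> L * \<bar>r\<^sub>1 - r\<^sub>2\<bar> powr \<alpha>"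
    and "mfg_equilibrium T c \<sigma> R \<mu>"
  shows "\<exists>K>0. \<exists>N\<^sub>0::nat. \<forall>N\<ge>N\<^sub>0.
    \<forall>(M :: 'w measure) F B W X.
      common_noise_space M F T N B W \<and>
      (\<forall>i\<in>{1..N}. sde_solution M F T \<sigma> (mfg_drift T c \<sigma> R \<mu>) (B i) (X i)) \<longrightarrow>
      eps_nash_equilibrium M F T c \<sigma> \<sigma>0 R N B W (K * real N powr (- \<alpha> / 2))
        (\<lambda>i. feedback_control T c \<sigma> R \<mu> (X i))"
proof -
  have \<mu>: "real_distribution \<mu>" using assms(12) by (simp add: mfg_equilibrium_def)
  interpret \<mu>: real_distribution \<mu> by (rule \<mu>)
  \<comment> \<open>This space serves twice: as the witness for \<open>path_space\<close> and as the
    place where \<open>\<mu>\<close> is realised as the law of an optimal state.\<close>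
  obtain P F0 B0 X0 where P: "filtered_prob_space (P :: path measure) F0 T" "brownian_motion P F0 T B0"
    "sde_solution P F0 T \<sigma> (mfg_drift T c \<sigma> R \<mu>) B0 X0" and law0: "\<mu> = distr P borel (X0 T)"
    using assms(12) unfolding mfg_equilibrium_def mfg_Phi_graph_def by blast
  obtain Gb where "\<forall>y\<in>R ` {0..1}. norm y \<le> Gb"
    using assms(5) unfolding bounded_iff by blast
  then have Gb: "\<bar>R r\<bar> \<le> Gb" if "r \<in> {0..1}" for r
    using that by simp
  have unit: "cdf \<mu> x \<in> {0..1}" for x
    using \<mu>.cdf_nonneg[of x] \<mu>.cdf_bounded_prob[of x] by simp
  interpret rank_mfg c \<sigma> Gb R \<mu> T
  proof
    show "mono (rank_reward R \<mu>)"
      unfolding rank_reward_def by (intro monoI mono_onD[OF assms(7)] unit \<mu>.cdf_nondecreasing)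
    show "\<bar>rank_reward R \<mu> x\<bar> \<le> Gb" for x
      unfolding rank_reward_def by (rule Gb[OF unit])
    show "\<exists>(P :: path measure) F B. filtered_prob_space P F T \<and> brownian_motion P F T B"
      using P by blast
  qed (use assms \<mu> Gb in auto)
  show ?thesis
  \<comment> \<open>The estimate holds for every positive number of players, so the threshold is
    1.\<close>
  proof (intro exI[of _ "38 * L"] conjI exI[of _ "1::nat"] allI impI)
    show "0 < 38 * L" using assms(8) by simp
    fix N :: nat and M :: "'w measure" and F B W X
    assume N: "1 \<le> N" and H: "common_noise_space M F T N B W \<and>
      (\<forall>i\<in>{1..N}. sde_solution M F T \<sigma> (mfg_drift T c \<sigma> R \<mu>) (B i) (X i))"
    interpret common_noise_game c \<sigma> Gb R \<mu> T L \<alpha> \<sigma>0 N M F B W X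
    proof
      fix i assume i: "i \<in> {1..N}"
      have "filtered_prob_space M F T" "brownian_motion M F T (B i)"
        using H i by (auto simp: common_noise_space_def)
      \<comment> \<open>Uniqueness in law carries the fixed-point property from the equilibrium's
        own space to the space of the game.\<close>
      then show "distr M borel (X i T) = \<mu>"
        unfolding law0
        using H i P by (intro optimal_law_unique[OF optimal_stateI optimal_stateI]) auto
    qed (use assms H N in auto)
    show "eps_nash_equilibrium M F T c \<sigma> \<sigma>0 R N B W (38 * L * real N powr (- \<alpha> / 2))
        (\<lambda>i. feedback_control T c \<sigma> R \<mu> (X i))"
      by (rule eps_nash)
  qed
qed

end
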